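(* Let $\mathcal C$ be a category and $\Sigma$ a class of morphisms in $\mathcal C$. Let $\operatorname{Ab}(\operatorname{add}(\mathcal C))$ and $\operatorname{Ab}(\operatorname{add}(\mathcal C[\Sigma^{-1}]))$ denote the abelian hulls of the additive hulls of $\mathcal C$ and of the localisation $\mathcal C[\Sigma^{-1}]$. Then the localisation functor $\mathcal C\to\mathcal C[\Sigma^{-1}]$ induces an equivalence \[\operatorname{Ab}(\operatorname{add}(\mathcal C))/\mathcal S\xrightarrow{\ \sim\ }\operatorname{Ab}(\operatorname{add}(\mathcal C[\Sigma^{-1}])),\] where $\mathcal S$ denotes the Serre subcategory of $\operatorname{Ab}(\operatorname{add}(\mathcal C))$ generated by the kernels and cokernels of the morphisms in $\Sigma$, viewed as morphisms in $\operatorname{Ab}(\operatorname{add}(\mathcal C))$ via the canonical functor $\mathcal C\to\operatorname{Ab}(\operatorname{add}(\mathcal C))$.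
   Context: Size conventions: a Grothendieck universe $\mathfrak U$ containing the set of integers is fixed, and categories are assumed to be $\mathfrak U$-categories (for all objects $X,Y$ the set $\operatorname{Hom}(X,Y)$ belongs to $\mathfrak U$) unless they arise from localisations. The localisation $\mathcal C[\Sigma^{-1}]$, and hence the two categories in the equivalence, need not be $\mathfrak U$-categories; they are formed in a sufficiently large universe, and universal properties are understood there. Localisation: $\mathcal C\to\mathcal C[\Sigma^{-1}]$ is the universal functor inverting all morphisms in $\Sigma$ (Gabriel–Zisman). Additive hull: for a category $\mathcal C$, $\operatorname{add}(\mathcal C)$ is obtained by taking formal finite direct sums of the objects of the $\mathbb Z$-linearisation $\mathbb Z\mathcal C$ (same objects as $\mathcal C$, with $\operatorname{Hom}(X,Y)$ the free abelian group on $\operatorname{Hom}_{\mathcal C}(X,Y)$). For any additive category $\mathcal A$, restriction along $\mathcal C\to\operatorname{add}(\mathcal C)$ is an equivalence from additive functors $\operatorname{add}(\mathcal C)\to\mathcal A$ to functors $\mathcal C\to\mathcal A$. Abelian hull: for an additive category $\mathcal C$, let $\operatorname{mod}(\mathcal C)$ be its completion under finite colimits, obtained by adding formal cokernels of morphisms in $\mathcal C$; concretely, the category of coherent functors, i.e. additive functors $F\colon\mathcal C^{\mathrm{op}}\to\mathrm{Ab}$ admitting an exact presentation $\operatorname{Hom}(-,X)\to\operatorname{Hom}(-,Y)\to F\to 0$ with $X,Y\in\mathcal C$. The abelian hull of $\mathcal C$ is $\operatorname{Ab}(\mathcal C):=\operatorname{mod}\bigl((\operatorname{mod}(\mathcal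 C))^{\mathrm{op}}\bigr)^{\mathrm{op}}$, an abelian category. For any abelian category $\mathcal A$, restriction along the canonical inclusion $\mathcal C\to\operatorname{Ab}(\mathcal C)$ is an equivalence from exact functors $\operatorname{Ab}(\mathcal C)\to\mathcal A$ to additive functors $\mathcal C\to\mathcal A$. Induced functor: the composite $\mathcal C\to\mathcal C[\Sigma^{-1}]\to\operatorname{Ab}(\operatorname{add}(\mathcal C[\Sigma^{-1}]))$ extends, uniquely up to isomorphism, to an exact functor $\operatorname{Ab}(\operatorname{add}(\mathcal C))\to\operatorname{Ab}(\operatorname{add}(\mathcal C[\Sigma^{-1}]))$; the equivalence in the claim is the one induced by this functor on the quotient. Abelian quotient: for an abelian category $\mathcal A$ and a Serre subcategory $\mathcal S$ (full, closed under subobjects, quotients and extensions), $\mathcal A/\mathcal S$ is the localisation of $\mathcal A$ with respect to the class of morphisms whose kernel and cokernel both lie in $\mathcal S$. The Serre subcategory generated by a class of objects is the smallest Serre subcategory containing it. *)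

theory Defs
  imports "HOL-Algebra.Coset" "HOL-Algebra.FiniteProduct" "HOL-Library.Poly_Mapping"
begin

section \<open>Categories and functors\<close>

text \<open>Only the behaviour of the operations on \<open>Obj\<close> and \<open>Arr\<close> matters.
  \<open>Comp C g f\<close> is the composite \<open>g \<circ> f\<close>.\<close>

record ('o, 'm) cat =
  Obj :: "'o set"
  Arr :: "'m set"
  Dom :: "'m \<Rightarrow> 'o"
  Cod :: "'m \<Rightarrow> 'o"
  Id :: "'o \<Rightarrow> 'm"
  Comp :: "'m \<Rightarrow> 'm \<Rightarrow> 'm"

definition Hom :: "('o, 'm, 'z) cat_scheme \<Rightarrow> 'o \<Rightarrow> 'o \<Rightarrow> 'm set" where
  "Hom C X Y = {f \<in> Arr C. Dom C f = X \<and> Cod C f = Y}"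

locale category =
  fixes C :: "('o, 'm, 'z) cat_scheme"
  assumes Dom_Obj: "f \<in> Arr C \<Longrightarrow> Dom C f \<in> Obj C"
    and Cod_Obj: "f \<in> Arr C \<Longrightarrow> Cod C f \<in> Obj C"
    and Id_Hom: "X \<in> Obj C \<Longrightarrow> Id C X \<in> Hom C X X"
    and Comp_Hom: "f \<in> Hom C X Y \<Longrightarrow> g \<in> Hom C Y Z \<Longrightarrow> Comp C g f \<in> Hom C X Z"
    and Comp_Id_right: "f \<in> Hom C X Y \<Longrightarrow> Comp C f (Id C X) = f"
    and Comp_Id_left: "f \<in> Hom C X Y \<Longrightarrow> Comp C (Id C Y) f = f"
    and Comp_assoc: "f \<in> Hom C W X \<Longrightarrow> g \<in> Hom C X Y \<Longrightarrow> h \<in> Hom C Y Z \<Longrightarrow>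
      Comp C h (Comp C g f) = Comp C (Comp C h g) f"

definition isomorphism :: "('o, 'm, 'z) cat_scheme \<Rightarrow> 'm \<Rightarrow> bool" where
  "isomorphism C f \<longleftrightarrow> f \<in> Arr C \<and>
     (\<exists>g \<in> Hom C (Cod C f) (Dom C f).
        Comp C g f = Id C (Dom C f) \<and> Comp C f g = Id C (Cod C f))"

record ('o1, 'm1, 'o2, 'm2) func =
  on_obj :: "'o1 \<Rightarrow> 'o2"
  on_arr :: "'m1 \<Rightarrow> 'm2"

definition is_functor ::
  "('o1, 'm1, 'y) cat_scheme \<Rightarrow> ('o2, 'm2, 'z) cat_scheme \<Rightarrow> ('o1, 'm1, 'o2, 'm2) func \<Rightarrow> bool"
where
  "is_functor C D F \<longleftrightarrow>
     (\<forall>X \<in> Obj C. on_obj F X \<in> Obj D \<and> on_arr F (Id C X) = Id D (on_obj F X)) \<and>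
     (\<forall>f \<in> Arr C. on_arr F f \<in> Hom D (on_obj F (Dom C f)) (on_obj F (Cod C f))) \<and>
     (\<forall>f \<in> Arr C. \<forall>g \<in> Arr C. Dom C g = Cod C f \<longrightarrow>
        on_arr F (Comp C g f) = Comp D (on_arr F g) (on_arr F f))"

definition id_func :: "('o, 'm, 'o, 'm) func" where
  "id_func = \<lparr>on_obj = (\<lambda>X. X), on_arr = (\<lambda>f. f)\<rparr>"

definition comp_func ::
  "('o2, 'm2, 'o3, 'm3) func \<Rightarrow> ('o1, 'm1, 'o2, 'm2) func \<Rightarrow> ('o1, 'm1, 'o3, 'm3) func"
  (infixl "\<circ>\<^sub>F" 55)
where
  "G \<circ>\<^sub>F F = \<lparr>on_obj = on_obj G \<circ> on_obj F, on_arr = on_arr G \<circ> on_arr F\<rparr>"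

definition func_eq_on ::
  "('o1, 'm1, 'y) cat_scheme \<Rightarrow> ('o1, 'm1, 'o2, 'm2) func \<Rightarrow> ('o1, 'm1, 'o2, 'm2) func \<Rightarrow> bool"
where
  "func_eq_on C F G \<longleftrightarrow>
     (\<forall>X \<in> Obj C. on_obj F X = on_obj G X) \<and> (\<forall>f \<in> Arr C. on_arr F f = on_arr G f)"

definition nat_isomorphic ::
  "('o1, 'm1, 'y) cat_scheme \<Rightarrow> ('o2, 'm2, 'z) cat_scheme \<Rightarrow>
   ('o1, 'm1, 'o2, 'm2) func \<Rightarrow> ('o1, 'm1, 'o2, 'm2) func \<Rightarrow> bool"
where
  "nat_isomorphic C D F G \<longleftrightarrow>
     (\<exists>\<tau>. (\<forall>X \<in> Obj C. \<tau> X \<in> Hom D (on_obj F X) (on_obj G X) \<and> isomorphism D (\<tau> X)) \<and>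
          (\<forall>f \<in> Arr C. Comp D (on_arr G f) (\<tau> (Dom C f)) = Comp D (\<tau> (Cod C f)) (on_arr F f)))"

definition is_equivalence ::
  "('o1, 'm1, 'y) cat_scheme \<Rightarrow> ('o2, 'm2, 'z) cat_scheme \<Rightarrow> ('o1, 'm1, 'o2, 'm2) func \<Rightarrow> bool"
where
  "is_equivalence C D F \<longleftrightarrow> is_functor C D F \<and>
     (\<exists>G. is_functor D C G \<and> nat_isomorphic C C (G \<circ>\<^sub>F F) id_func \<and>
          nat_isomorphic D D (F \<circ>\<^sub>F G) id_func)"


section \<open>Localisation\<close>

text \<open>The Gabriel--Zisman construction: arrows of the localisation are zigzags, that is, paths
  in the graph with an edge \<open>Fwd f\<close> for every arrow \<open>f\<close> and a reversed edge \<open>Bwd s\<close> for every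
  \<open>s \<in> \<Sigma>\<close>, modulo the least congruence that identifies \<open>Fwd\<close> of identities and composites with
  empty and concatenated paths and makes \<open>Bwd s\<close> a two-sided inverse of \<open>Fwd s\<close>.
  Lists of steps are in order of travel, so concatenation \<open>ps @ qs\<close> is the composite \<open>qs \<circ> ps\<close>.\<close>

datatype 'm step = Fwd 'm | Bwd 'm

fun is_path :: "('o, 'm, 'z) cat_scheme \<Rightarrow> 'm set \<Rightarrow> 'o \<Rightarrow> 'm step list \<Rightarrow> 'o \<Rightarrow> bool" where
  "is_path C \<Sigma> X [] Y \<longleftrightarrow> X \<in> Obj C \<and> X = Y"
| "is_path C \<Sigma> X (Fwd f # ps) Y \<longleftrightarrow> f \<in> Arr C \<and> Dom C f = X \<and> is_path C \<Sigma> (Cod C f) ps Y"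
| "is_path C \<Sigma> X (Bwd s # ps) Y \<longleftrightarrow> s \<in> \<Sigma> \<and> Cod C s = X \<and> is_path C \<Sigma> (Dom C s) ps Y"

inductive path_equiv ::
  "('o, 'm, 'z) cat_scheme \<Rightarrow> 'm set \<Rightarrow> 'o \<Rightarrow> 'o \<Rightarrow> 'm step list \<Rightarrow> 'm step list \<Rightarrow> bool"
  for C :: "('o, 'm, 'z) cat_scheme" and \<Sigma> :: "'m set"
where
  refl: "is_path C \<Sigma> X ps Y \<Longrightarrow> path_equiv C \<Sigma> X Y ps ps"
| sym: "path_equiv C \<Sigma> X Y ps qs \<Longrightarrow> path_equiv C \<Sigma> X Y qs ps"
| trans: "path_equiv C \<Sigma> X Y ps qs \<Longrightarrow> path_equiv C \<Sigma> X Y qs rs \<Longrightarrow> path_equiv C \<Sigma> X Y ps rs"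
| append: "path_equiv C \<Sigma> X Y ps ps' \<Longrightarrow> path_equiv C \<Sigma> Y Z qs qs' \<Longrightarrow>
    path_equiv C \<Sigma> X Z (ps @ qs) (ps' @ qs')"
| ident: "X \<in> Obj C \<Longrightarrow> path_equiv C \<Sigma> X X [Fwd (Id C X)] []"
| comp: "f \<in> Hom C X Y \<Longrightarrow> g \<in> Hom C Y Z \<Longrightarrow>
    path_equiv C \<Sigma> X Z [Fwd f, Fwd g] [Fwd (Comp C g f)]"
| inv_right: "s \<in> \<Sigma> \<Longrightarrow> path_equiv C \<Sigma> (Dom C s) (Dom C s) [Fwd s, Bwd s] []"
| inv_left: "s \<in> \<Sigma> \<Longrightarrow> path_equiv C \<Sigma> (Cod C s) (Cod C s) [Bwd s, Fwd s] []"

datatype ('o, 'm) larr = LArr (lsrc: 'o) (ltgt: 'o) (paths: "'m step list set")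

definition path_class ::
  "('o, 'm, 'z) cat_scheme \<Rightarrow> 'm set \<Rightarrow> 'o \<Rightarrow> 'o \<Rightarrow> 'm step list \<Rightarrow> ('o, 'm) larr"
where
  "path_class C \<Sigma> X Y ps = LArr X Y {qs. path_equiv C \<Sigma> X Y ps qs}"

definition localisation ::
  "('o, 'm, 'z) cat_scheme \<Rightarrow> 'm set \<Rightarrow> ('o, ('o, 'm) larr) cat"
where
  "localisation C \<Sigma> =
     \<lparr>Obj = Obj C,
      Arr = {path_class C \<Sigma> X Y ps | X Y ps. is_path C \<Sigma> X ps Y},
      Dom = lsrc,
      Cod = ltgt,
      Id = (\<lambda>X. path_class C \<Sigma> X X []),
      Comp = (\<lambda>q p. LArr (lsrc p) (ltgt q)
        {rs. \<exists>ps \<in> paths p. \<exists>qs \<in> paths q.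
           path_equiv C \<Sigma> (lsrc p) (ltgt q) (ps @ qs) rs})\<rparr>"

definition loc_func :: "('o, 'm, 'z) cat_scheme \<Rightarrow> 'm set \<Rightarrow> ('o, 'm, 'o, ('o, 'm) larr) func" where
  "loc_func C \<Sigma> =
     \<lparr>on_obj = (\<lambda>X. X), on_arr = (\<lambda>f. path_class C \<Sigma> (Dom C f) (Cod C f) [Fwd f])\<rparr>"


section \<open>Preadditive categories\<close>

text \<open>\<open>Add C f g\<close> is the sum of parallel arrows and \<open>Zero C X Y\<close> the zero arrow from \<open>X\<close> to \<open>Y\<close>.\<close>

record ('o, 'm) addcat = "('o, 'm) cat" +
  Add :: "'m \<Rightarrow> 'm \<Rightarrow> 'm"
  Zero :: "'o \<Rightarrow> 'o \<Rightarrow> 'm"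

definition hom_group :: "('o, 'm, 'z) addcat_scheme \<Rightarrow> 'o \<Rightarrow> 'o \<Rightarrow> 'm monoid" where
  "hom_group C X Y = \<lparr>carrier = Hom C X Y, mult = Add C, one = Zero C X Y\<rparr>"

definition opcat :: "('o, 'm) addcat \<Rightarrow> ('o, 'm) addcat" where
  "opcat C =
     \<lparr>Obj = Obj C, Arr = Arr C, Dom = Cod C, Cod = Dom C, Id = Id C,
      Comp = (\<lambda>g f. Comp C f g), Add = Add C, Zero = (\<lambda>X Y. Zero C Y X)\<rparr>"

definition is_kernel :: "('o, 'm, 'z) addcat_scheme \<Rightarrow> 'm \<Rightarrow> 'm \<Rightarrow> bool" where
  "is_kernel A f k \<longleftrightarrow> f \<in> Arr A \<and> k \<in> Arr A \<and> Cod A k = Dom A f \<and>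
     Comp A f k = Zero A (Dom A k) (Cod A f) \<and>
     (\<forall>h \<in> Arr A. Cod A h = Dom A f \<and> Comp A f h = Zero A (Dom A h) (Cod A f) \<longrightarrow>
        (\<exists>!u. u \<in> Hom A (Dom A h) (Dom A k) \<and> Comp A k u = h))"

definition is_cokernel :: "('o, 'm, 'z) addcat_scheme \<Rightarrow> 'm \<Rightarrow> 'm \<Rightarrow> bool" where
  "is_cokernel A f c \<longleftrightarrow> f \<in> Arr A \<and> c \<in> Arr A \<and> Dom A c = Cod A f \<and>
     Comp A c f = Zero A (Dom A f) (Cod A c) \<and>
     (\<forall>h \<in> Arr A. Dom A h = Cod A f \<and> Comp A h f = Zero A (Dom A f) (Cod A h) \<longrightarrow>
        (\<exists>!u. u \<in> Hom A (Cod A c) (Cod A h) \<and> Comp A u c = h))"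

definition short_exact :: "('o, 'm, 'z) addcat_scheme \<Rightarrow> 'm \<Rightarrow> 'm \<Rightarrow> bool" where
  "short_exact A f g \<longleftrightarrow> is_kernel A g f \<and> is_cokernel A f g"

definition additive_functor ::
  "('o1, 'm1, 'y) addcat_scheme \<Rightarrow> ('o2, 'm2, 'z) addcat_scheme \<Rightarrow>
   ('o1, 'm1, 'o2, 'm2) func \<Rightarrow> bool"
where
  "additive_functor A B F \<longleftrightarrow> is_functor A B F \<and>
     (\<forall>X \<in> Obj A. \<forall>Y \<in> Obj A. \<forall>f \<in> Hom A X Y. \<forall>g \<in> Hom A X Y.
        on_arr F (Add A f g) = Add B (on_arr F f) (on_arr F g))"

definition exact_functor ::
  "('o1, 'm1, 'y) addcat_scheme \<Rightarrow> ('o2, 'm2, 'z) addcat_scheme \<Rightarrow>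
   ('o1, 'm1, 'o2, 'm2) func \<Rightarrow> bool"
where
  "exact_functor A B F \<longleftrightarrow> additive_functor A B F \<and>
     (\<forall>f g. short_exact A f g \<longrightarrow> short_exact B (on_arr F f) (on_arr F g))"


section \<open>The additive hull\<close>

text \<open>The linearisation: \<open>Hom\<close> is the free abelian group on \<open>Hom C X Y\<close>, realised as finitely
  supported integer-valued functions.\<close>

datatype ('o, 'm) zarr = ZArr (zsrc: 'o) (ztgt: 'o) (coeffs: "'m \<Rightarrow>\<^sub>0 int")

definition linearisation :: "('o, 'm, 'z) cat_scheme \<Rightarrow> ('o, ('o, 'm) zarr) addcat" where
  "linearisation C =
     \<lparr>Obj = Obj C,
      Arr = {ZArr X Y a | X Y a. X \<in> Obj C \<and> Y \<in> Obj C \<and> Poly_Mapping.keys a \<subseteq> Hom C X Y},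
      Dom = zsrc,
      Cod = ztgt,
      Id = (\<lambda>X. ZArr X X (frag_of (Id C X))),
      Comp = (\<lambda>b a. ZArr (zsrc a) (ztgt b)
        (frag_extend (\<lambda>g. frag_extend (\<lambda>f. frag_of (Comp C g f)) (coeffs a)) (coeffs b))),
      Add = (\<lambda>a b. ZArr (zsrc a) (ztgt a) (coeffs a + coeffs b)),
      Zero = (\<lambda>X Y. ZArr X Y 0)\<rparr>"

text \<open>Formal finite direct sums are lists of objects; an arrow \<open>Xs \<rightarrow> Ys\<close> is a matrix whose
  entry at \<open>(i, j)\<close> is an arrow \<open>Xs ! j \<rightarrow> Ys ! i\<close>. Matrices are undefined outside their index
  range, so that equality of arrows is equality of entries.\<close>

datatype ('o, 'm) marr =
  MArr (msrc: "'o list") (mtgt: "'o list") (entries: "nat \<times> nat \<Rightarrow> 'm")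

abbreviation mat_index :: "'o list \<Rightarrow> 'o list \<Rightarrow> (nat \<times> nat) set" where
  "mat_index Xs Ys \<equiv> {..<length Ys} \<times> {..<length Xs}"

definition matrix_cat :: "('o, 'm, 'z) addcat_scheme \<Rightarrow> ('o list, ('o, 'm) marr) addcat" where
  "matrix_cat C =
     \<lparr>Obj = lists (Obj C),
      Arr = {MArr Xs Ys M | Xs Ys M. Xs \<in> lists (Obj C) \<and> Ys \<in> lists (Obj C) \<and>
        M \<in> (\<Pi>\<^sub>E (i, j) \<in> mat_index Xs Ys. Hom C (Xs ! j) (Ys ! i))},
      Dom = msrc,
      Cod = mtgt,
      Id = (\<lambda>Xs. MArr Xs Xs (\<lambda>(i, j) \<in> mat_index Xs Xs.
        if i = j then Id C (Xs ! i) else Zero C (Xs ! j) (Xs ! i))),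
      Comp = (\<lambda>N M. MArr (msrc M) (mtgt N)
        (\<lambda>(i, k) \<in> mat_index (msrc M) (mtgt N).
          finprod (hom_group C (msrc M ! k) (mtgt N ! i))
            (\<lambda>j. Comp C (entries N (i, j)) (entries M (j, k))) {..<length (mtgt M)})),
      Add = (\<lambda>M N. MArr (msrc M) (mtgt M)
        (\<lambda>ij \<in> mat_index (msrc M) (mtgt M). Add C (entries M ij) (entries N ij))),
      Zero = (\<lambda>Xs Ys. MArr Xs Ys (\<lambda>(i, j) \<in> mat_index Xs Ys. Zero C (Xs ! j) (Ys ! i)))\<rparr>"

type_synonym ('o, 'm) add_arr = "('o, ('o, 'm) zarr) marr"

definition add_hull :: "('o, 'm, 'z) cat_scheme \<Rightarrow> ('o list, ('o, 'm) add_arr) addcat" where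
  "add_hull C = matrix_cat (linearisation C)"

definition add_embedding ::
  "('o, 'm, 'z) cat_scheme \<Rightarrow> ('o, 'm, 'o list, ('o, 'm) add_arr) func"
where
  "add_embedding C =
     \<lparr>on_obj = (\<lambda>X. [X]),
      on_arr = (\<lambda>f. MArr [Dom C f] [Cod C f]
        (\<lambda>ij \<in> {(0, 0)}. ZArr (Dom C f) (Cod C f) (frag_of f)))\<rparr>"


section \<open>Coherent functors and the abelian hull\<close>

text \<open>Additive functors from the opposite of \<open>C\<close> to abelian groups. The underlying sets of the
  groups are taken in the type \<open>'m\<close> of arrows of \<open>C\<close>. This loses no coherent functor up to
  isomorphism: the values of a coherent functor are quotients of groups \<open>Hom C U Y\<close>, and such a
  quotient can be carried by a set of representatives. \<open>res F f\<close> is the homomorphism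
  \<open>F (Cod f) \<rightarrow> F (Dom f)\<close>.\<close>

record ('o, 'm) presheaf =
  val :: "'o \<Rightarrow> 'm monoid"
  res :: "'m \<Rightarrow> 'm \<Rightarrow> 'm"

definition additive_presheaf :: "('o, 'm) addcat \<Rightarrow> ('o, 'm) presheaf \<Rightarrow> bool" where
  "additive_presheaf C F \<longleftrightarrow>
     (\<forall>X \<in> Obj C. comm_group (val F X)) \<and>
     (\<forall>f \<in> Arr C. res F f \<in> hom (val F (Cod C f)) (val F (Dom C f))) \<and>
     (\<forall>X \<in> Obj C. \<forall>x \<in> carrier (val F X). res F (Id C X) x = x) \<and>
     (\<forall>f \<in> Arr C. \<forall>g \<in> Arr C. Dom C g = Cod C f \<longrightarrow>
        (\<forall>x \<in> carrier (val F (Cod C g)). res F (Comp C g f) x = res F f (res F g x))) \<and>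
     (\<forall>X \<in> Obj C. \<forall>Y \<in> Obj C. \<forall>f \<in> Hom C X Y. \<forall>g \<in> Hom C X Y.
        \<forall>x \<in> carrier (val F Y). res F (Add C f g) x = res F f x \<otimes>\<^bsub>val F X\<^esub> res F g x)"

text \<open>Components of natural transformations are extensional, so that they are determined by
  their values.\<close>

definition nat_trans ::
  "('o, 'm) addcat \<Rightarrow> ('o, 'm) presheaf \<Rightarrow> ('o, 'm) presheaf \<Rightarrow> ('o \<Rightarrow> 'm \<Rightarrow> 'm) \<Rightarrow> bool"
where
  "nat_trans C F G \<eta> \<longleftrightarrow>
     \<eta> \<in> (\<Pi>\<^sub>E X \<in> Obj C. hom (val F X) (val G X) \<inter> extensional (carrier (val F X))) \<and>
     (\<forall>f \<in> Arr C. \<forall>x \<in> carrier (val F (Cod C f)).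
        \<eta> (Dom C f) (res F f x) = res G f (\<eta> (Cod C f) x))"

definition representable :: "('o, 'm) addcat \<Rightarrow> 'o \<Rightarrow> ('o, 'm) presheaf" where
  "representable C X = \<lparr>val = (\<lambda>U. hom_group C U X), res = (\<lambda>f g. Comp C g f)\<rparr>"

text \<open>Exactness of \<open>Hom(-, X) \<rightarrow> Hom(-, Y) \<rightarrow> F \<rightarrow> 0\<close> is pointwise.\<close>

definition coherent :: "('o, 'm) addcat \<Rightarrow> ('o, 'm) presheaf \<Rightarrow> bool" where
  "coherent C F \<longleftrightarrow> additive_presheaf C F \<and>
     (\<exists>X \<in> Obj C. \<exists>Y \<in> Obj C. \<exists>\<alpha> \<pi>.
        nat_trans C (representable C X) (representable C Y) \<alpha> \<and>
        nat_trans C (representable C Y) F \<pi> \<and>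
        (\<forall>U \<in> Obj C.
           \<alpha> U ` carrier (hom_group C U X) = kernel (hom_group C U Y) (val F U) (\<pi> U) \<and>
           \<pi> U ` carrier (hom_group C U Y) = carrier (val F U)))"

datatype ('o, 'm) coh_arr =
  CohArr (csrc: "('o, 'm) presheaf") (ctgt: "('o, 'm) presheaf") (comps: "'o \<Rightarrow> 'm \<Rightarrow> 'm")

definition coh :: "('o, 'm) addcat \<Rightarrow> (('o, 'm) presheaf, ('o, 'm) coh_arr) addcat" where
  "coh C =
     \<lparr>Obj = {F. coherent C F},
      Arr = {CohArr F G \<eta> | F G \<eta>. coherent C F \<and> coherent C G \<and> nat_trans C F G \<eta>},
      Dom = csrc,
      Cod = ctgt,
      Id = (\<lambda>F. CohArr F F (\<lambda>X \<in> Obj C. \<lambda>x \<in> carrier (val F X). x)),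
      Comp = (\<lambda>\<theta> \<eta>. CohArr (csrc \<eta>) (ctgt \<theta>)
        (\<lambda>X \<in> Obj C. \<lambda>x \<in> carrier (val (csrc \<eta>) X). comps \<theta> X (comps \<eta> X x))),
      Add = (\<lambda>\<eta> \<theta>. CohArr (csrc \<eta>) (ctgt \<eta>)
        (\<lambda>X \<in> Obj C. \<lambda>x \<in> carrier (val (csrc \<eta>) X).
           comps \<eta> X x \<otimes>\<^bsub>val (ctgt \<eta>) X\<^esub> comps \<theta> X x)),
      Zero = (\<lambda>F G. CohArr F G (\<lambda>X \<in> Obj C. \<lambda>x \<in> carrier (val F X). \<one>\<^bsub>val G X\<^esub>))\<rparr>"

definition yoneda ::
  "('o, 'm) addcat \<Rightarrow> ('o, 'm, ('o, 'm) presheaf, ('o, 'm) coh_arr) func"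
where
  "yoneda C =
     \<lparr>on_obj = representable C,
      on_arr = (\<lambda>f. CohArr (representable C (Dom C f)) (representable C (Cod C f))
        (\<lambda>U \<in> Obj C. \<lambda>g \<in> Hom C U (Dom C f). Comp C f g))\<rparr>"

type_synonym ('o, 'm) ab_obj = "(('o, 'm) presheaf, ('o, 'm) coh_arr) presheaf"
type_synonym ('o, 'm) ab_arr = "(('o, 'm) presheaf, ('o, 'm) coh_arr) coh_arr"

definition ab_hull :: "('o, 'm) addcat \<Rightarrow> (('o, 'm) ab_obj, ('o, 'm) ab_arr) addcat" where
  "ab_hull C = opcat (coh (opcat (coh C)))"

text \<open>A Yoneda functor \<open>opcat (coh C) \<rightarrow> coh (opcat (coh C))\<close> is, with the same data, a functor
  \<open>coh C \<rightarrow> ab_hull C\<close> between the opposite categories.\<close>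

definition ab_embedding ::
  "('o, 'm) addcat \<Rightarrow> ('o, 'm, ('o, 'm) ab_obj, ('o, 'm) ab_arr) func"
where
  "ab_embedding C = yoneda (opcat (coh C)) \<circ>\<^sub>F yoneda C"

definition hull_embedding ::
  "('o, 'm, 'z) cat_scheme \<Rightarrow>
   ('o, 'm, ('o list, ('o, 'm) add_arr) ab_obj, ('o list, ('o, 'm) add_arr) ab_arr) func"
where
  "hull_embedding C = ab_embedding (add_hull C) \<circ>\<^sub>F add_embedding C"


section \<open>Serre subcategories and quotients\<close>

definition monomorphism :: "('o, 'm, 'z) cat_scheme \<Rightarrow> 'm \<Rightarrow> bool" where
  "monomorphism A f \<longleftrightarrow> f \<in> Arr A \<and>
     (\<forall>W \<in> Obj A. \<forall>g \<in> Hom A W (Dom A f). \<forall>h \<in> Hom A W (Dom A f).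
        Comp A f g = Comp A f h \<longrightarrow> g = h)"

definition epimorphism :: "('o, 'm, 'z) cat_scheme \<Rightarrow> 'm \<Rightarrow> bool" where
  "epimorphism A f \<longleftrightarrow> f \<in> Arr A \<and>
     (\<forall>W \<in> Obj A. \<forall>g \<in> Hom A (Cod A f) W. \<forall>h \<in> Hom A (Cod A f) W.
        Comp A g f = Comp A h f \<longrightarrow> g = h)"

definition zero_object :: "('o, 'm, 'z) cat_scheme \<Rightarrow> 'o \<Rightarrow> bool" where
  "zero_object A Z \<longleftrightarrow> Z \<in> Obj A \<and>
     (\<forall>X \<in> Obj A. (\<exists>!f. f \<in> Hom A Z X) \<and> (\<exists>!f. f \<in> Hom A X Z))"

text \<open>A full subcategory is given by its objects. Serre subcategories contain the zero objects,
  that is, they are nonempty.\<close>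

definition serre :: "('o, 'm, 'z) addcat_scheme \<Rightarrow> 'o set \<Rightarrow> bool" where
  "serre A S \<longleftrightarrow> S \<subseteq> Obj A \<and>
     (\<forall>Z. zero_object A Z \<longrightarrow> Z \<in> S) \<and>
     (\<forall>f. monomorphism A f \<and> Cod A f \<in> S \<longrightarrow> Dom A f \<in> S) \<and>
     (\<forall>f. epimorphism A f \<and> Dom A f \<in> S \<longrightarrow> Cod A f \<in> S) \<and>
     (\<forall>f g. short_exact A f g \<and> Dom A f \<in> S \<and> Cod A g \<in> S \<longrightarrow> Cod A f \<in> S)"

definition serre_generated :: "('o, 'm, 'z) addcat_scheme \<Rightarrow> 'o set \<Rightarrow> 'o set" where
  "serre_generated A K = \<Inter>{S. serre A S \<and> K \<subseteq> S}"

definition kernels_cokernels :: "('o, 'm, 'z) addcat_scheme \<Rightarrow> 'm set \<Rightarrow> 'o set" where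
  "kernels_cokernels A \<Phi> =
     {Dom A k | f k. f \<in> \<Phi> \<and> is_kernel A f k} \<union> {Cod A c | f c. f \<in> \<Phi> \<and> is_cokernel A f c}"

definition serre_isos :: "('o, 'm, 'z) addcat_scheme \<Rightarrow> 'o set \<Rightarrow> 'm set" where
  "serre_isos A S =
     {f. \<exists>k c. is_kernel A f k \<and> Dom A k \<in> S \<and> is_cokernel A f c \<and> Cod A c \<in> S}"

definition quotient_cat ::
  "('o, 'm, 'z) addcat_scheme \<Rightarrow> 'o set \<Rightarrow> ('o, ('o, 'm) larr) cat"
where
  "quotient_cat A S = localisation A (serre_isos A S)"

definition quotient_func ::
  "('o, 'm, 'z) addcat_scheme \<Rightarrow> 'o set \<Rightarrow> ('o, 'm, 'o, ('o, 'm) larr) func"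
where
  "quotient_func A S = loc_func A (serre_isos A S)"

end

theory Submission
  imports Defs "HOL-Algebra.Free_Abelian_Groups"
begin

text \<open>Both categories have the same universal property. Exact functors on \<open>Ab(add(C))\<close> amount to
  functors on \<open>C\<close>, and such an exact functor kills \<open>S\<close> if and only if it inverts \<open>\<Sigma>\<close>, because an
  arrow of an abelian category is invertible if and only if its kernel and cokernel vanish. So
  exact functors on the quotient amount to functors on the localisation. In particular, the
  quotient being abelian, the functor from \<open>C\<close> to it induces an exact functor \<open>G\<close> on the hull of
  the localisation, and \<open>G \<circ> F\<close> and \<open>F \<circ> G\<close> are isomorphic to identities because they are so on
  the objects and arrows that come from \<open>C\<close>.

  The universal property of \<open>coh\<close> is that of formal cokernels: a functor is extended along
  presentations of the objects by representable ones.\<close>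

text \<open>A localisation made of zigzags comes with functors out of it, but with no test for
  equality of its arrows and no sums. For the Serre quotient a calculus of fractions supplies both:
  roofs give the equality test, common denominators give sums, kernels and cokernels. Only with
  these is the quotient known to be abelian and thus a possible target for functors on a hull.

  The hull applies \<open>coh\<close> twice with an opposite in between. Extending once along a
  Yoneda functor yields preservation of cokernels only. Seen from the opposite category this is
  preservation of kernels, which is what makes the second extension exact. Likewise
  \<open>coh\<close> of an additive category always has cokernels, so its opposite has kernels,
  which makes the second \<open>coh\<close> abelian.

  Localisations extend functors on the nose, hulls only up to isomorphism; strict equalities are
  therefore weakened by \<open>func_eq_nat_isomorphic\<close> before composites are compared. The
  intersection that defines \<open>S\<close> is over a nonempty family because the objects killed by
  an exact functor form a Serre subcategory.\<close>

no_notation times (infixl "*" 70)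
notation Comp (infixr "*\<index>" 70)
notation Add (infixl "\<boxplus>\<index>" 65)

abbreviation (input) Comp_in ("_ *\<^sub>_ _" [71, 1000, 70] 70)
  where "g *\<^sub>C f \<equiv> Comp C g f"

abbreviation (input) Add_in ("_ \<boxplus>\<^sub>_ _" [65, 1000, 66] 65)
  where "f \<boxplus>\<^sub>C g \<equiv> Add C f g"

section \<open>Categories\<close>

lemma Hom_iff: "f \<in> Hom C X Y \<longleftrightarrow> f \<in> Arr C \<and> Dom C f = X \<and> Cod C f = Y" by (simp add: Hom_def)

locale cat = category C for C :: "('o, 'm, 'z) cat_scheme" (structure)
begin

lemmas [simp] = Hom_iff Dom_Obj Cod_Obj

lemma Hom_Obj: "f \<in> Hom C X Y \<Longrightarrow> X \<in> Obj C \<and> Y \<in> Obj C" by auto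

lemma Id_simps [simp]:
  "X \<in> Obj C \<Longrightarrow> Id C X \<in> Arr C" "X \<in> Obj C \<Longrightarrow> Dom C (Id C X) = X"
  "X \<in> Obj C \<Longrightarrow> Cod C (Id C X) = X" using Id_Hom[of X] by (simp_all add: Hom_def)

lemma Comp_simps [simp]:
  assumes "f \<in> Arr C" "g \<in> Arr C" "Dom C g = Cod C f"
  shows "g * f \<in> Arr C" "Dom C (g * f) = Dom C f" "Cod C (g * f) = Cod C g"
  using assms Comp_Hom[of f "Dom C f" "Cod C f" g "Cod C g"] by (simp_all add: Hom_def)

lemma Id_right [simp]: "f \<in> Arr C \<Longrightarrow> Dom C f = X \<Longrightarrow> f * Id C X = f" using Comp_Id_right[of f X "Cod C f"] by simp

lemma Id_left [simp]: "f \<in> Arr C \<Longrightarrow> Cod C f = X \<Longrightarrow> Id C X * f = f" using Comp_Id_left[of f "Dom C f" X] by simp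

lemma assoc [simp]:
  assumes "f \<in> Arr C" "g \<in> Arr C" "h \<in> Arr C" "Dom C g = Cod C f" "Dom C h = Cod C g"
  shows "(h * g) * f = h * (g * f)"
  using assms Comp_assoc[of f "Dom C f" "Cod C f" g "Cod C g" h "Cod C h"] by simp

text \<open>The rule \<open>assoc\<close> brackets every composite to the right, so a known equation
  for \<open>g * f\<close> no longer matches inside a longer composite. With a trailing
  \<open>x\<close> it does.\<close>

lemma reduce:
  assumes "g * f = h" "f \<in> Arr C" "g \<in> Arr C" "Dom C g = Cod C f" "x \<in> Arr C" "Cod C x = Dom C f"
  shows "g * (f * x) = h * x" using assms by (simp add: assms(1)[symmetric])

lemma iso_iff:
  "isomorphism C f \<longleftrightarrow> f \<in> Arr C \<and> (\<exists>g\<in>Arr C. Dom C g = Cod C f \<and> Cod C g = Dom C f \<and>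
     g * f = Id C (Dom C f) \<and> f * g = Id C (Cod C f))" by (auto simp: isomorphism_def)

lemma isoI:
  assumes "f \<in> Hom C X Y" "g \<in> Hom C Y X" "g * f = Id C X" "f * g = Id C Y"
  shows "isomorphism C f" using assms by (auto simp: iso_iff)

lemma isoE:
  assumes "isomorphism C f"
  obtains g where "g \<in> Hom C (Cod C f) (Dom C f)" "g * f = Id C (Dom C f)"
    "f * g = Id C (Cod C f)" "isomorphism C g"
proof -
  from assms obtain g where "f \<in> Arr C" "g \<in> Hom C (Cod C f) (Dom C f)"
    "g * f = Id C (Dom C f)" "f * g = Id C (Cod C f)" by (auto simp: iso_iff)
  moreover from this have "isomorphism C g" by (intro isoI[of _ "Cod C f" "Dom C f" f]) auto
  ultimately show ?thesis using that by blast
qed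

lemma iso_Arr: "isomorphism C f \<Longrightarrow> f \<in> Arr C" by (simp add: isomorphism_def)

lemma iso_Id [simp]: "X \<in> Obj C \<Longrightarrow> isomorphism C (Id C X)" by (rule isoI[of _ X X "Id C X"]) auto

lemma iso_comp:
  assumes "isomorphism C f" "isomorphism C g" "Dom C g = Cod C f"
  shows "isomorphism C (g * f)"
proof -
  from assms(1) obtain f' where f': "f' \<in> Hom C (Cod C f) (Dom C f)" "f' * f = Id C (Dom C f)"
    "f * f' = Id C (Cod C f)" by (rule isoE)
  from assms(2) obtain g' where g': "g' \<in> Hom C (Cod C g) (Dom C g)" "g' * g = Id C (Dom C g)"
    "g * g' = Id C (Cod C g)" by (rule isoE)
  have "f \<in> Arr C" "g \<in> Arr C" using assms by (auto simp: isomorphism_def)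
  then show ?thesis using f' g' assms(3) by (intro isoI[of _ "Dom C f" "Cod C g" "f' * g'"])
      (auto simp: reduce[OF f'(2)] reduce[OF g'(2)] reduce[OF f'(3)] reduce[OF g'(3)])
qed

lemma iso_cancel_left:
  assumes "isomorphism C s" "f \<in> Arr C" "g \<in> Arr C" "Cod C f = Dom C s" "Cod C g = Dom C s"
    "s * f = s * g"
  shows "f = g"
proof -
  obtain t where t: "t \<in> Hom C (Cod C s) (Dom C s)" "t * s = Id C (Dom C s)" using assms(1) by (rule isoE)
  have s: "s \<in> Arr C" using assms(1) by (rule iso_Arr)
  have "t * (s * f) = t * (s * g)" using assms(6) by simp
  then show ?thesis using t s assms(2-5) by (simp add: reduce[OF t(2)])
qed

lemma iso_cancel_right:
  assumes "isomorphism C s" "f \<in> Arr C" "g \<in> Arr C" "Dom C f = Cod C s" "Dom C g = Cod C s"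
    "f * s = g * s"
  shows "f = g"
proof -
  obtain t where t: "t \<in> Hom C (Cod C s) (Dom C s)" "s * t = Id C (Cod C s)" using assms(1) by (rule isoE)
  have s: "s \<in> Arr C" using assms(1) by (rule iso_Arr)
  have "(f * s) * t = (g * s) * t" using assms(6) by simp
  then show ?thesis using t s assms(2-5) by simp
qed

lemma mono_cancel:
  assumes "monomorphism C f" "g \<in> Arr C" "h \<in> Arr C" "Dom C g = Dom C h" "Cod C g = Dom C f"
    "Cod C h = Dom C f" "f * g = f * h"
  shows "g = h" using assms unfolding monomorphism_def by (metis Dom_Obj Hom_iff)

lemma epi_cancel:
  assumes "epimorphism C f" "g \<in> Arr C" "h \<in> Arr C" "Cod C g = Cod C h" "Dom C g = Cod C f"
    "Dom C h = Cod C f" "g * f = h * f"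
  shows "g = h" using assms unfolding epimorphism_def by (metis Cod_Obj Hom_iff)

lemma mono_comp:
  assumes "monomorphism C f" "monomorphism C g" "Dom C g = Cod C f"
  shows "monomorphism C (g * f)"
proof -
  have "f \<in> Arr C" "g \<in> Arr C" using assms by (auto simp: monomorphism_def)
  with assms show ?thesis unfolding monomorphism_def[of C "g * f"] by auto (metis Comp_simps mono_cancel)
qed

lemma mono_left:
  assumes "monomorphism C (g * f)" "f \<in> Arr C" "g \<in> Arr C" "Dom C g = Cod C f"
  shows "monomorphism C f" unfolding monomorphism_def
proof (intro conjI ballI impI)
  fix W x y assume "W \<in> Obj C" "x \<in> Hom C W (Dom C f)" "y \<in> Hom C W (Dom C f)" "f * x = f * y"
  then show "x = y" using assms mono_cancel[OF assms(1), of x y] by simp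
qed fact

lemma iso_mono: "isomorphism C f \<Longrightarrow> monomorphism C f"
  unfolding monomorphism_def using iso_cancel_left[of f] by (auto simp: iso_Arr)

lemma iso_epi: "isomorphism C f \<Longrightarrow> epimorphism C f"
  unfolding epimorphism_def using iso_cancel_right[of f] by (auto simp: iso_Arr)

end

section \<open>Functors\<close>

lemma comp_func_simps [simp]:
  "on_obj (G \<circ>\<^sub>F F) X = on_obj G (on_obj F X)" "on_arr (G \<circ>\<^sub>F F) f = on_arr G (on_arr F f)"
  by (simp_all add: comp_func_def)

lemma id_func_simps [simp]: "on_obj id_func X = X" "on_arr id_func f = f" by (simp_all add: id_func_def)

locale fctr = S: cat C + T: cat D
  for C :: "('o, 'm, 'z) cat_scheme" and D :: "('p, 'n, 'y) cat_scheme" and F +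
  assumes is_functor: "is_functor C D F"
begin

lemma obj [simp]: "X \<in> Obj C \<Longrightarrow> on_obj F X \<in> Obj D" using is_functor by (auto simp: is_functor_def)

lemma ident [simp]: "X \<in> Obj C \<Longrightarrow> on_arr F (Id C X) = Id D (on_obj F X)"
  using is_functor by (auto simp: is_functor_def)

lemma arr [simp]:
  assumes "f \<in> Arr C"
  shows "on_arr F f \<in> Arr D" "Dom D (on_arr F f) = on_obj F (Dom C f)"
    "Cod D (on_arr F f) = on_obj F (Cod C f)" using is_functor assms by (auto simp: is_functor_def)

lemma comp:
  "f \<in> Arr C \<Longrightarrow> g \<in> Arr C \<Longrightarrow> Dom C g = Cod C f \<Longrightarrow>
    on_arr F (g *\<^sub>C f) = on_arr F g *\<^sub>D on_arr F f" using is_functor by (auto simp: is_functor_def)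

lemma Hom: "f \<in> Hom C X Y \<Longrightarrow> on_arr F f \<in> Hom D (on_obj F X) (on_obj F Y)" by auto

lemma iso: assumes "isomorphism C f" shows "isomorphism D (on_arr F f)"
proof -
  from assms obtain g where g: "g \<in> Hom C (Cod C f) (Dom C f)" "g *\<^sub>C f = Id C (Dom C f)"
    "f *\<^sub>C g = Id C (Cod C f)" by (rule S.isoE)
  have f: "f \<in> Arr C" using assms by (rule S.iso_Arr)
  show ?thesis by (rule T.isoI[of _ "on_obj F (Dom C f)" "on_obj F (Cod C f)" "on_arr F g"])
      (use f g in \<open>auto simp: comp[symmetric]\<close>)
qed

end

lemma fctrI: "cat C \<Longrightarrow> cat D \<Longrightarrow> is_functor C D F \<Longrightarrow> fctr C D F" by (simp add: fctr_def fctr_axioms_def)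

lemma is_functorI:
  assumes "\<And>X. X \<in> Obj C \<Longrightarrow> on_obj F X \<in> Obj D"
    and "\<And>X. X \<in> Obj C \<Longrightarrow> on_arr F (Id C X) = Id D (on_obj F X)"
    and "\<And>f X Y. f \<in> Hom C X Y \<Longrightarrow> on_arr F f \<in> Hom D (on_obj F X) (on_obj F Y)"
    and "\<And>f g X Y Z. f \<in> Hom C X Y \<Longrightarrow> g \<in> Hom C Y Z \<Longrightarrow>
      on_arr F (g *\<^sub>C f) = on_arr F g *\<^sub>D on_arr F f"
  shows "is_functor C D F" unfolding is_functor_def using assms by (simp add: Hom_iff)

lemma comp_functor:
  assumes "cat C" "is_functor C D F" "is_functor D E G"
  shows "is_functor C E (G \<circ>\<^sub>F F)" using assms unfolding is_functor_def by (auto simp: Hom_iff)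

lemma id_functor: "cat C \<Longrightarrow> is_functor C C id_func" by (simp add: is_functor_def Hom_iff)

lemma nat_isomorphicI:
  assumes "\<And>X. X \<in> Obj C \<Longrightarrow> \<tau> X \<in> Hom D (on_obj F X) (on_obj G X)"
    and "\<And>X. X \<in> Obj C \<Longrightarrow> isomorphism D (\<tau> X)"
    and "\<And>f X Y. f \<in> Hom C X Y \<Longrightarrow> on_arr G f *\<^sub>D \<tau> X = \<tau> Y *\<^sub>D on_arr F f"
  shows "nat_isomorphic C D F G" unfolding nat_isomorphic_def using assms by (auto simp: Hom_iff)

lemma nat_isomorphic_sym:
  assumes "cat C" "cat D" "is_functor C D F" "is_functor C D G" "nat_isomorphic C D F G"
  shows "nat_isomorphic C D G F"
proof -
  interpret F: fctr C D F using assms by (intro fctrI)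
  interpret G: fctr C D G using assms by (intro fctrI)
  from assms(5) obtain \<tau> where
    \<tau>: "\<And>X. X \<in> Obj C \<Longrightarrow> \<tau> X \<in> Hom D (on_obj F X) (on_obj G X) \<and> isomorphism D (\<tau> X)"
      "\<And>f. f \<in> Arr C \<Longrightarrow> on_arr G f *\<^sub>D \<tau> (Dom C f) = \<tau> (Cod C f) *\<^sub>D on_arr F f"
    unfolding nat_isomorphic_def by blast
  have "\<exists>\<sigma>. \<forall>X\<in>Obj C. \<sigma> X \<in> Hom D (on_obj G X) (on_obj F X) \<and> isomorphism D (\<sigma> X) \<and>
    \<sigma> X *\<^sub>D \<tau> X = Id D (on_obj F X) \<and> \<tau> X *\<^sub>D \<sigma> X = Id D (on_obj G X)"
    by (intro bchoice ballI) (metis \<tau>(1) F.T.isoE Hom_iff)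
  then obtain \<sigma> where \<sigma>: "\<And>X. X\<in>Obj C \<Longrightarrow> \<sigma> X \<in> Hom D (on_obj G X) (on_obj F X) \<and>
    isomorphism D (\<sigma> X) \<and>
    \<sigma> X *\<^sub>D \<tau> X = Id D (on_obj F X) \<and> \<tau> X *\<^sub>D \<sigma> X = Id D (on_obj G X)" by blast
  show ?thesis
  proof (rule nat_isomorphicI[where \<tau> = \<sigma>])
    fix f X Y assume f: "f \<in> Hom C X Y"
    then have X: "X \<in> Obj C" "Y \<in> Obj C" by auto
    have m: "monomorphism D (\<tau> Y)" using \<tau>(1)[OF X(2)] by (simp add: F.T.iso_mono)
    have n: "on_arr G f *\<^sub>D \<tau> X = \<tau> Y *\<^sub>D on_arr F f" using \<tau>(2)[of f] f by simp
    show "on_arr F f *\<^sub>D \<sigma> X = \<sigma> Y *\<^sub>D on_arr G f"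
    proof (rule F.T.mono_cancel[OF m])
      have a: "\<sigma> X \<in> Hom D (on_obj G X) (on_obj F X)" "\<sigma> Y \<in> Hom D (on_obj G Y) (on_obj F Y)"
        "\<tau> X \<in> Hom D (on_obj F X) (on_obj G X)" "\<tau> Y \<in> Hom D (on_obj F Y) (on_obj G Y)"
        using \<sigma>[OF X(1)] \<sigma>[OF X(2)] \<tau>(1)[OF X(1)] \<tau>(1)[OF X(2)] by auto
      have t: "\<tau> X *\<^sub>D \<sigma> X = Id D (on_obj G X)" "\<tau> Y *\<^sub>D \<sigma> Y = Id D (on_obj G Y)" using \<sigma> X by auto
      show "\<tau> Y *\<^sub>D (on_arr F f *\<^sub>D \<sigma> X) = \<tau> Y *\<^sub>D (\<sigma> Y *\<^sub>D on_arr G f)"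
        using a f by (simp add: F.T.reduce[OF n[symmetric]] F.T.reduce[OF t(2)] t(1))
    qed (use \<sigma>[OF X(1)] \<sigma>[OF X(2)] \<tau>(1)[OF X(1)] \<tau>(1)[OF X(2)] f in auto)
  qed (use \<sigma> in auto)
qed

lemma nat_isomorphic_trans:
  assumes "cat C" "cat D" "is_functor C D F" "is_functor C D G" "is_functor C D H"
    "nat_isomorphic C D F G" "nat_isomorphic C D G H"
  shows "nat_isomorphic C D F H"
proof -
  interpret F: fctr C D F using assms by (intro fctrI)
  interpret G: fctr C D G using assms by (intro fctrI)
  interpret H: fctr C D H using assms by (intro fctrI)
  from assms(6) obtain \<tau> where
    \<tau>: "\<And>X. X \<in> Obj C \<Longrightarrow> \<tau> X \<in> Hom D (on_obj F X) (on_obj G X)"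
       "\<And>X. X \<in> Obj C \<Longrightarrow> isomorphism D (\<tau> X)"
      "\<And>f. f \<in> Arr C \<Longrightarrow> on_arr G f *\<^sub>D \<tau> (Dom C f) = \<tau> (Cod C f) *\<^sub>D on_arr F f"
    unfolding nat_isomorphic_def by blast
  from assms(7) obtain \<sigma> where
    \<sigma>: "\<And>X. X \<in> Obj C \<Longrightarrow> \<sigma> X \<in> Hom D (on_obj G X) (on_obj H X)"
       "\<And>X. X \<in> Obj C \<Longrightarrow> isomorphism D (\<sigma> X)"
      "\<And>f. f \<in> Arr C \<Longrightarrow> on_arr H f *\<^sub>D \<sigma> (Dom C f) = \<sigma> (Cod C f) *\<^sub>D on_arr G f"
    unfolding nat_isomorphic_def by blast
  show ?thesis
  proof (rule nat_isomorphicI[where \<tau> = "\<lambda>X. \<sigma> X *\<^sub>D \<tau> X"])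
    fix X assume X: "X \<in> Obj C"
    with \<tau> \<sigma> show "\<sigma> X *\<^sub>D \<tau> X \<in> Hom D (on_obj F X) (on_obj H X)"
      "isomorphism D (\<sigma> X *\<^sub>D \<tau> X)" by (auto intro!: F.T.iso_comp)
  next
    fix f X Y assume f: "f \<in> Hom C X Y"
    then have X: "X \<in> Obj C" "Y \<in> Obj C" by auto
    have a: "on_arr G f *\<^sub>D \<tau> X = \<tau> Y *\<^sub>D on_arr F f"
      and b: "on_arr H f *\<^sub>D \<sigma> X = \<sigma> Y *\<^sub>D on_arr G f" using \<tau>(3)[of f] \<sigma>(3)[of f] f by auto
    show "on_arr H f *\<^sub>D (\<sigma> X *\<^sub>D \<tau> X) = (\<sigma> Y *\<^sub>D \<tau> Y) *\<^sub>D on_arr F f"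
      using \<tau>(1)[OF X(1)] \<sigma>(1)[OF X(1)] \<tau>(1)[OF X(2)] \<sigma>(1)[OF X(2)] f by (simp add: F.T.reduce[OF b] a)
  qed
qed

lemma nat_isomorphic_whisker_right:
  assumes "cat B" "cat C" "is_functor B C H" "nat_isomorphic C D F G"
  shows "nat_isomorphic B D (F \<circ>\<^sub>F H) (G \<circ>\<^sub>F H)"
proof -
  interpret H: fctr B C H using assms by (intro fctrI)
  from assms(4) obtain \<tau> where
    \<tau>: "\<And>X. X \<in> Obj C \<Longrightarrow> \<tau> X \<in> Hom D (on_obj F X) (on_obj G X)"
       "\<And>X. X \<in> Obj C \<Longrightarrow> isomorphism D (\<tau> X)"
      "\<And>f. f \<in> Arr C \<Longrightarrow> on_arr G f *\<^sub>D \<tau> (Dom C f) = \<tau> (Cod C f) *\<^sub>D on_arr F f"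
    unfolding nat_isomorphic_def by blast
  show ?thesis
  proof (rule nat_isomorphicI[where \<tau> = "\<lambda>X. \<tau> (on_obj H X)"])
    fix f X Y assume "f \<in> Hom B X Y"
    then show "on_arr (G \<circ>\<^sub>F H) f *\<^sub>D \<tau> (on_obj H X) = \<tau> (on_obj H Y) *\<^sub>D on_arr (F \<circ>\<^sub>F H) f"
      using \<tau>(3)[of "on_arr H f"] by auto
  qed (simp_all add: \<tau>(2), use \<tau>(1) in \<open>simp add: Hom_iff\<close>)
qed

lemma nat_isomorphic_whisker_left:
  assumes "cat C" "cat D" "cat E" "is_functor C D F" "is_functor C D G" "is_functor D E H"
    "nat_isomorphic C D F G"
  shows "nat_isomorphic C E (H \<circ>\<^sub>F F) (H \<circ>\<^sub>F G)"
proof -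
  interpret F: fctr C D F using assms by (intro fctrI)
  interpret G: fctr C D G using assms by (intro fctrI)
  interpret H: fctr D E H using assms by (intro fctrI)
  from assms(7) obtain \<tau> where
    \<tau>: "\<And>X. X \<in> Obj C \<Longrightarrow> \<tau> X \<in> Hom D (on_obj F X) (on_obj G X)"
       "\<And>X. X \<in> Obj C \<Longrightarrow> isomorphism D (\<tau> X)"
      "\<And>f. f \<in> Arr C \<Longrightarrow> on_arr G f *\<^sub>D \<tau> (Dom C f) = \<tau> (Cod C f) *\<^sub>D on_arr F f"
    unfolding nat_isomorphic_def by blast
  show ?thesis
  proof (rule nat_isomorphicI[where \<tau> = "\<lambda>X. on_arr H (\<tau> X)"])
    fix f X Y assume f: "f \<in> Hom C X Y"
    then have X: "X \<in> Obj C" "Y \<in> Obj C" by auto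
    show "on_arr (H \<circ>\<^sub>F G) f *\<^sub>E on_arr H (\<tau> X) = on_arr H (\<tau> Y) *\<^sub>E on_arr (H \<circ>\<^sub>F F) f"
      using f \<tau>(1)[OF X(1)] \<tau>(1)[OF X(2)] \<tau>(3)[of f] by (simp add: H.comp[symmetric])
  next
    fix X assume "X \<in> Obj C"
    then show "on_arr H (\<tau> X) \<in> Hom E (on_obj (H \<circ>\<^sub>F F) X) (on_obj (H \<circ>\<^sub>F G) X)" using \<tau>(1)[of X] by auto
  qed (use \<tau>(2) in \<open>auto intro: H.iso\<close>)
qed

section \<open>Preadditive categories\<close>

lemma opcat_simps [simp]:
  "Obj (opcat C) = Obj C" "Arr (opcat C) = Arr C" "Dom (opcat C) = Cod C" "Cod (opcat C) = Dom C"
  "Id (opcat C) = Id C" "Comp (opcat C) g f = Comp C f g" "Add (opcat C) = Add C"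
  "Zero (opcat C) X Y = Zero C Y X" "opcat (opcat C) = C" by (simp_all add: opcat_def)

lemma Hom_opcat [simp]: "Hom (opcat C) X Y = Hom C Y X" by (auto simp: Hom_def)

lemma hom_group_opcat [simp]: "hom_group (opcat C) X Y = hom_group C Y X" by (simp add: hom_group_def)

lemma is_kernel_opcat [simp]: "is_kernel (opcat C) = is_cokernel C"
  by (intro ext) (simp add: is_kernel_def is_cokernel_def)

lemma is_cokernel_opcat [simp]: "is_cokernel (opcat C) = is_kernel C"
  by (intro ext) (simp add: is_kernel_def is_cokernel_def)

lemma monomorphism_opcat [simp]: "monomorphism (opcat C) = epimorphism C"
  by (intro ext) (simp add: monomorphism_def epimorphism_def)

lemma epimorphism_opcat [simp]: "epimorphism (opcat C) = monomorphism C"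
  by (intro ext) (simp add: monomorphism_def epimorphism_def)

lemma isomorphism_opcat [simp]: "isomorphism (opcat C) = isomorphism C"
  by (intro ext) (auto simp: isomorphism_def Hom_iff)

lemma short_exact_opcat [simp]: "short_exact (opcat C) f g = short_exact C g f" by (auto simp: short_exact_def)

lemma cat_opcat:
  assumes "cat C" shows "cat (opcat C)"
proof -
  interpret cat C by fact
  show ?thesis by unfold_locales auto
qed

lemma is_functor_opcat: "is_functor (opcat C) (opcat D) F \<longleftrightarrow> is_functor C D F"
  unfolding is_functor_def by (auto simp: Hom_iff)

definition neg :: "('o, 'm, 'z) addcat_scheme \<Rightarrow> 'm \<Rightarrow> 'm" where
  "neg C f = inv\<^bsub>hom_group C (Dom C f) (Cod C f)\<^esub> f"

lemma neg_opcat [simp]: "neg (opcat C) f = neg C f" by (simp add: neg_def)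

text \<open>Instantiating a lemma at \<open>opcat C\<close> and unfolding with these rules produces
  its dual. Facts on epimorphisms and cokernels are obtained in this way from those on monomorphisms
  and kernels.\<close>

lemmas op_simps = opcat_simps Hom_opcat hom_group_opcat is_kernel_opcat is_cokernel_opcat
  monomorphism_opcat epimorphism_opcat isomorphism_opcat short_exact_opcat neg_opcat

locale preadditive = cat C for C :: "('o, 'm) addcat" (structure) +
  assumes hom_group: "X \<in> Obj C \<Longrightarrow> Y \<in> Obj C \<Longrightarrow> comm_group (hom_group C X Y)"
    and Comp_Add': "f \<in> Hom C X Y \<Longrightarrow> g \<in> Hom C X Y \<Longrightarrow> h \<in> Hom C Y Z \<Longrightarrow>
      h * (f \<boxplus> g) = (h * f) \<boxplus> (h * g)"
    and Add_Comp': "f \<in> Hom C X Y \<Longrightarrow> g \<in> Hom C X Y \<Longrightarrow> h \<in> Hom C W X \<Longrightarrow> (f \<boxplus> g) * h = (f * h) \<boxplus> (g * h)"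
begin

lemma Add_simps [simp]:
  assumes "f \<in> Arr C" "g \<in> Arr C" "Dom C g = Dom C f" "Cod C g = Cod C f"
  shows "f \<boxplus> g \<in> Arr C" "Dom C (f \<boxplus> g) = Dom C f" "Cod C (f \<boxplus> g) = Cod C f"
proof -
  interpret comm_group "hom_group C (Dom C f) (Cod C f)" using assms by (intro hom_group) auto
  from m_closed[of f g] assms
  show "f \<boxplus> g \<in> Arr C" "Dom C (f \<boxplus> g) = Dom C f" "Cod C (f \<boxplus> g) = Cod C f" by (simp_all add: hom_group_def)
qed

lemma Zero_simps [simp]:
  assumes "X \<in> Obj C" "Y \<in> Obj C"
  shows "Zero C X Y \<in> Arr C" "Dom C (Zero C X Y) = X" "Cod C (Zero C X Y) = Y"
proof -
  interpret comm_group "hom_group C X Y" using assms by (intro hom_group) auto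
  from one_closed
  show "Zero C X Y \<in> Arr C" "Dom C (Zero C X Y) = X" "Cod C (Zero C X Y) = Y" by (simp_all add: hom_group_def)
qed

lemma neg_simps [simp]:
  assumes "f \<in> Arr C"
  shows "neg C f \<in> Arr C" "Dom C (neg C f) = Dom C f" "Cod C (neg C f) = Cod C f"
proof -
  interpret comm_group "hom_group C (Dom C f) (Cod C f)" using assms by (intro hom_group) auto
  from inv_closed[of f] assms
  show "neg C f \<in> Arr C" "Dom C (neg C f) = Dom C f" "Cod C (neg C f) = Cod C f"
    by (simp_all add: hom_group_def neg_def)
qed

lemma Comp_Add [simp]:
  "f \<in> Arr C \<Longrightarrow> g \<in> Arr C \<Longrightarrow> Dom C g = Dom C f \<Longrightarrow> Cod C g = Cod C f \<Longrightarrow> h \<in> Arr C \<Longrightarrow>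
    Dom C h = Cod C f \<Longrightarrow> h * (f \<boxplus> g) = (h * f) \<boxplus> (h * g)" by (rule Comp_Add') auto

lemma Add_Comp [simp]:
  "f \<in> Arr C \<Longrightarrow> g \<in> Arr C \<Longrightarrow> Dom C g = Dom C f \<Longrightarrow> Cod C g = Cod C f \<Longrightarrow> h \<in> Arr C \<Longrightarrow>
    Cod C h = Dom C f \<Longrightarrow> (f \<boxplus> g) * h = (f * h) \<boxplus> (g * h)" by (rule Add_Comp') auto

lemma Add_group:
  assumes "f \<in> Hom C X Y" "g \<in> Hom C X Y"
  shows Add_commute': "f \<boxplus> g = g \<boxplus> f"
    and "h \<in> Hom C X Y \<Longrightarrow> (f \<boxplus> g) \<boxplus> h = f \<boxplus> (g \<boxplus> h)"
    and "Zero C X Y \<boxplus> f = f" and "f \<boxplus> Zero C X Y = f"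
    and "neg C f \<boxplus> f = Zero C X Y" and "f \<boxplus> neg C f = Zero C X Y"
    and "f \<boxplus> g = Zero C X Y \<Longrightarrow> f = neg C g"
    and "f \<boxplus> g = f \<Longrightarrow> g = Zero C X Y"
    and "neg C (neg C f) = f"
    and "neg C (Zero C X Y) = Zero C X Y"
    and "f \<boxplus> neg C g = Zero C X Y \<longleftrightarrow> f = g"
proof -
  have XY: "X \<in> Obj C" "Y \<in> Obj C" using assms by auto
  interpret comm_group "hom_group C X Y" using XY by (intro hom_group)
  have c: "carrier (hom_group C X Y) = Hom C X Y" "mult (hom_group C X Y) = Add C"
     "one (hom_group C X Y) = Zero C X Y" by (auto simp: hom_group_def)
  have n: "neg C x = inv\<^bsub>hom_group C X Y\<^esub> x" if "x \<in> Hom C X Y" for x using that by (simp add: neg_def)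
  have ih: "neg C x \<in> Hom C X Y" if "x \<in> Hom C X Y" for x using that by simp
  note [simp del] = Hom_iff
  show "f \<boxplus> g = g \<boxplus> f" using m_comm assms c by simp
  show "h \<in> Hom C X Y \<Longrightarrow> (f \<boxplus> g) \<boxplus> h = f \<boxplus> (g \<boxplus> h)" using m_assoc assms c by simp
  show "Zero C X Y \<boxplus> f = f" "f \<boxplus> Zero C X Y = f" using l_one[of f] r_one[of f] assms c by simp_all
  show "neg C f \<boxplus> f = Zero C X Y" "f \<boxplus> neg C f = Zero C X Y" using l_inv[of f] r_inv[of f] assms c n by simp_all
  show "f \<boxplus> g = Zero C X Y \<Longrightarrow> f = neg C g" using inv_equality[of f g] assms c n by simp
  show "f \<boxplus> g = f \<Longrightarrow> g = Zero C X Y"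
    using r_cancel_one[of f g] l_cancel_one[of f g] assms c by (simp add: r_cancel_one)
  show "neg C (neg C f) = f" using inv_inv[of f] assms c n ih by simp
  show "neg C (Zero C X Y) = Zero C X Y" using inv_one c n one_closed by simp
  show "f \<boxplus> neg C g = Zero C X Y \<longleftrightarrow> f = g"
    using inv_equality[of f "neg C g"] inv_inv[of g] r_inv[of g] assms c n ih by auto
qed

lemma Add_Zero [simp]:
  "f \<in> Arr C \<Longrightarrow> Dom C f = X \<Longrightarrow> Cod C f = Y \<Longrightarrow> f \<boxplus> Zero C X Y = f"
  "f \<in> Arr C \<Longrightarrow> Dom C f = X \<Longrightarrow> Cod C f = Y \<Longrightarrow> Zero C X Y \<boxplus> f = f" using Add_group(3,4)[of f X Y f] by auto

lemma Add_commute: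
  "f \<in> Arr C \<Longrightarrow> g \<in> Arr C \<Longrightarrow> Dom C g = Dom C f \<Longrightarrow> Cod C g = Cod C f \<Longrightarrow> f \<boxplus> g = g \<boxplus> f"
  using Add_group(1)[of f "Dom C f" "Cod C f" g] by auto

lemma Add_assoc:
  "f \<in> Arr C \<Longrightarrow> g \<in> Arr C \<Longrightarrow> h \<in> Arr C \<Longrightarrow> Dom C g = Dom C f \<Longrightarrow> Cod C g = Cod C f \<Longrightarrow>
   Dom C h = Dom C f \<Longrightarrow> Cod C h = Cod C f \<Longrightarrow> (f \<boxplus> g) \<boxplus> h = f \<boxplus> (g \<boxplus> h)"
  using Add_group(2)[of f "Dom C f" "Cod C f" g h] by auto

lemma diff_eq_Zero:
  "f \<in> Arr C \<Longrightarrow> g \<in> Arr C \<Longrightarrow> Dom C f = X \<Longrightarrow> Cod C f = Y \<Longrightarrow> Dom C g = X \<Longrightarrow> Cod C g = Y \<Longrightarrow>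
    f \<boxplus> neg C g = Zero C X Y \<longleftrightarrow> f = g" using Add_group(11)[of f X Y g] by auto

lemma Add_neg [simp]:
  "f \<in> Arr C \<Longrightarrow> f \<boxplus> neg C f = Zero C (Dom C f) (Cod C f)"
  "f \<in> Arr C \<Longrightarrow> neg C f \<boxplus> f = Zero C (Dom C f) (Cod C f)" using Add_group(5,6)[of f "Dom C f" "Cod C f" f] by auto

lemma Comp_Zero [simp]:
  assumes "h \<in> Arr C" "Dom C h = Y" "X \<in> Obj C"
  shows "h * Zero C X Y = Zero C X (Cod C h)"
proof -
  have Y: "Y \<in> Obj C" using assms by auto
  have "(h * Zero C X Y) \<boxplus> (h * Zero C X Y) = h * (Zero C X Y \<boxplus> Zero C X Y)" using assms Y by (subst Comp_Add) auto
  also have "\<dots> = h * Zero C X Y" using assms Y by simp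
  finally show ?thesis using Add_group(8)[of "h * Zero C X Y" X "Cod C h" "h * Zero C X Y"] assms Y by auto
qed

lemma Zero_Comp [simp]:
  assumes "h \<in> Arr C" "Cod C h = X" "Y \<in> Obj C"
  shows "Zero C X Y * h = Zero C (Dom C h) Y"
proof -
  have Y: "X \<in> Obj C" using assms by auto
  have "(Zero C X Y * h) \<boxplus> (Zero C X Y * h) = (Zero C X Y \<boxplus> Zero C X Y) * h" using assms Y by (subst Add_Comp) auto
  also have "\<dots> = Zero C X Y * h" using assms Y by simp
  finally show ?thesis using Add_group(8)[of "Zero C X Y * h" "Dom C h" Y "Zero C X Y * h"] assms Y by auto
qed

lemma Comp_neg [simp]:
  assumes "f \<in> Arr C" "h \<in> Arr C" "Dom C h = Cod C f"
  shows "h * neg C f = neg C (h * f)" using Add_group(7)[of "h * neg C f" "Dom C f" "Cod C h" "h * f"] assms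
  by (simp flip: Comp_Add)

lemma neg_Comp [simp]:
  assumes "f \<in> Arr C" "h \<in> Arr C" "Dom C h = Cod C f"
  shows "neg C h * f = neg C (h * f)" using Add_group(7)[of "neg C h * f" "Dom C f" "Cod C h" "h * f"] assms
  by (simp flip: Add_Comp)

lemma neg_Zero [simp]: "X \<in> Obj C \<Longrightarrow> Y \<in> Obj C \<Longrightarrow> neg C (Zero C X Y) = Zero C X Y"
  using Add_group(10)[of "Zero C X Y" X Y "Zero C X Y"] by auto

lemma preadditive_opcat: "preadditive (opcat C)"
proof -
  interpret op: cat "opcat C" by (rule cat_opcat) unfold_locales
  show ?thesis by (intro preadditive.intro preadditive_axioms.intro op.cat_axioms)
      (use hom_group in \<open>simp_all add: Hom_iff\<close>)
qed

lemma monoI: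
  assumes "f \<in> Hom C X Y"
    and "\<And>W h. h \<in> Hom C W X \<Longrightarrow> f * h = Zero C W Y \<Longrightarrow> h = Zero C W X"
  shows "monomorphism C f" unfolding monomorphism_def
proof (intro conjI ballI impI)
  show "f \<in> Arr C" using assms by auto
  fix W g h assume *: "W \<in> Obj C" "g \<in> Hom C W (Dom C f)" "h \<in> Hom C W (Dom C f)" "f * g = f * h"
  have "g \<boxplus> neg C h = Zero C W X" using * assms(1) by (intro assms(2)) auto
  then show "g = h" using * assms(1) by (simp add: diff_eq_Zero)
qed

lemma mono_Zero:
  assumes "monomorphism C f" "h \<in> Hom C W (Dom C f)" "f * h = Zero C W (Cod C f)"
  shows "h = Zero C W (Dom C f)"
proof -
  have "f \<in> Arr C" using assms by (auto simp: monomorphism_def)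
  show ?thesis by (rule mono_cancel[of f]) (use \<open>f \<in> Arr C\<close> assms in auto)
qed

lemmas epiI = preadditive.monoI[OF preadditive_opcat, unfolded op_simps]
  and epi_Zero = preadditive.mono_Zero[OF preadditive_opcat, unfolded op_simps]

lemma kernelD:
  assumes "is_kernel C f k"
  shows "f \<in> Arr C" "k \<in> Arr C" "Cod C k = Dom C f" "f * k = Zero C (Dom C k) (Cod C f)"
  using assms by (auto simp: is_kernel_def)

lemma kernel_mono:
  assumes "is_kernel C f k" shows "monomorphism C k" unfolding monomorphism_def
proof (intro conjI ballI impI)
  note k = kernelD[OF assms]
  show "k \<in> Arr C" by fact
  fix W g h assume *: "W \<in> Obj C" "g \<in> Hom C W (Dom C k)" "h \<in> Hom C W (Dom C k)" "k * g = k * h"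
  have "f * (k * h) = Zero C W (Cod C f)" using * k by (simp add: reduce[OF k(4)])
  moreover have "\<forall>h\<in>Arr C. Cod C h = Dom C f \<and> f * h = Zero C (Dom C h) (Cod C f) \<longrightarrow>
      (\<exists>!u. u \<in> Hom C (Dom C h) (Dom C k) \<and> k * u = h)" using assms unfolding is_kernel_def by blast
  note bspec[OF this, of "k * h"]
  ultimately have "\<exists>!u. u \<in> Hom C W (Dom C k) \<and> k * u = k * h" using * k by simp
  then show "g = h" using * by blast
qed

lemma kernel_factor:
  assumes "is_kernel C f k" "h \<in> Hom C W (Dom C f)" "f * h = Zero C W (Cod C f)"
  obtains u where "u \<in> Hom C W (Dom C k)" "k * u = h" using assms that unfolding is_kernel_def by (metis Hom_iff)

lemma kernelI:
  assumes "f \<in> Hom C X Y" "k \<in> Hom C K X" "f * k = Zero C K Y" "monomorphism C k"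
    and "\<And>W h. h \<in> Hom C W X \<Longrightarrow> f * h = Zero C W Y \<Longrightarrow> \<exists>u\<in>Hom C W K. k * u = h"
  shows "is_kernel C f k" unfolding is_kernel_def
proof (intro conjI ballI impI)
  show "f \<in> Arr C" "k \<in> Arr C" "Cod C k = Dom C f" "f * k = Zero C (Dom C k) (Cod C f)" using assms by auto
  fix h assume h: "h \<in> Arr C" "Cod C h = Dom C f \<and> f * h = Zero C (Dom C h) (Cod C f)"
  then obtain u where u: "u \<in> Hom C (Dom C h) K" "k * u = h" using assms(1) assms(5)[of h "Dom C h"] by auto
  show "\<exists>!u. u \<in> Hom C (Dom C h) (Dom C k) \<and> k * u = h"
  proof (rule ex1I[of _ u])
    show "u \<in> Hom C (Dom C h) (Dom C k) \<and> k * u = h" using u assms by auto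
    fix v assume v: "v \<in> Hom C (Dom C h) (Dom C k) \<and> k * v = h"
    show "v = u" by (rule mono_cancel[OF assms(4)]) (use u v assms(2) in auto)
  qed
qed

lemmas cokernelD = preadditive.kernelD[OF preadditive_opcat, unfolded op_simps]
  and cokernel_epi = preadditive.kernel_mono[OF preadditive_opcat, unfolded op_simps]
  and cokernel_factor = preadditive.kernel_factor[OF preadditive_opcat, unfolded op_simps]
  and cokernelI = preadditive.kernelI[OF preadditive_opcat, unfolded op_simps]

lemma kernel_unique:
  assumes "is_kernel C f k" "is_kernel C f l"
  obtains j where "j \<in> Hom C (Dom C k) (Dom C l)" "l * j = k" "isomorphism C j"
proof -
  note k = kernelD[OF assms(1)] and l = kernelD[OF assms(2)]
  obtain j where j: "j \<in> Hom C (Dom C k) (Dom C l)" "l * j = k"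
    using kernel_factor[OF assms(2), of k "Dom C k"] k by auto
  obtain i where i: "i \<in> Hom C (Dom C l) (Dom C k)" "k * i = l"
    using kernel_factor[OF assms(1), of l "Dom C l"] l by auto
  have "isomorphism C j"
  proof (rule isoI[OF j(1) i(1)])
    show "i * j = Id C (Dom C k)"
      by (rule mono_cancel[OF kernel_mono[OF assms(1)]]) (use j i k l in \<open>simp_all add: reduce[OF i(2)]\<close>)
    show "j * i = Id C (Dom C l)"
      by (rule mono_cancel[OF kernel_mono[OF assms(2)]]) (use j i k l in \<open>simp_all add: reduce[OF j(2)]\<close>)
  qed
  with j that show ?thesis by blast
qed

lemma kernel_iso:
  assumes "is_kernel C f k" "isomorphism C j" "Cod C j = Dom C k"
  shows "is_kernel C f (k * j)"
proof -
  note k = kernelD[OF assms(1)]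
  obtain i where i: "i \<in> Hom C (Cod C j) (Dom C j)" "j * i = Id C (Cod C j)" using assms(2) by (rule isoE)
  have j: "j \<in> Arr C" using assms(2) by (rule iso_Arr)
  show ?thesis
  proof (rule kernelI[of _ "Dom C f" "Cod C f" _ "Dom C j"])
    show "monomorphism C (k * j)" using assms j k by (intro mono_comp kernel_mono iso_mono) auto
    fix W h assume h: "h \<in> Hom C W (Dom C f)" "f * h = Zero C W (Cod C f)"
    obtain u where u: "u \<in> Hom C W (Dom C k)" "k * u = h" using kernel_factor[OF assms(1) h] by blast
    show "\<exists>u\<in>Hom C W (Dom C j). (k * j) * u = h"
      using u i j k assms(3) by (intro bexI[of _ "i * u"]) (auto simp: reduce[OF i(2)])
  qed (use j k assms in \<open>auto simp: reduce[OF k(4)]\<close>)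
qed

lemma kernel_mono_comp:
  assumes "monomorphism C m" "f \<in> Arr C" "Dom C m = Cod C f"
  shows "is_kernel C (m * f) k \<longleftrightarrow> is_kernel C f k"
proof -
  have m: "m \<in> Arr C" using assms by (auto simp: monomorphism_def)
  have *: "m * f * h = Zero C (Dom C h) (Cod C m) \<longleftrightarrow> f * h = Zero C (Dom C h) (Cod C f)"
    if "h \<in> Arr C" "Cod C h = Dom C f" for h
    using that assms m mono_Zero[OF assms(1), of "f * h" "Dom C h"] by auto
  show ?thesis unfolding is_kernel_def using * m assms by (auto cong: conj_cong)
qed

lemmas cokernel_unique = preadditive.kernel_unique[OF preadditive_opcat, unfolded op_simps]
  and cokernel_iso = preadditive.kernel_iso[OF preadditive_opcat, unfolded op_simps]
  and cokernel_epi_comp = preadditive.kernel_mono_comp[OF preadditive_opcat, unfolded op_simps]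

lemma kernel_of_mono:
  assumes "monomorphism C f" "is_kernel C f k"
  shows "k = Zero C (Dom C k) (Dom C f)" "Id C (Dom C k) = Zero C (Dom C k) (Dom C k)"
proof -
  note k = kernelD[OF assms(2)]
  show 1: "k = Zero C (Dom C k) (Dom C f)" by (rule mono_Zero[OF assms(1)]) (use k in auto)
  have "k * Id C (Dom C k) = k * Zero C (Dom C k) (Dom C k)" by (subst (1 2) 1) (use k in simp)
  then show "Id C (Dom C k) = Zero C (Dom C k) (Dom C k)"
    using k mono_cancel[OF kernel_mono[OF assms(2)], of "Id C (Dom C k)" "Zero C (Dom C k) (Dom C k)"] by simp
qed

text \<open>The equation between identity and zero arrow is preserved by every additive functor,
  which makes it the working form of being a zero object.\<close>

lemma zero_object_iff:
  "zero_object C Z \<longleftrightarrow> Z \<in> Obj C \<and> Id C Z = Zero C Z Z"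
proof
  assume "zero_object C Z"
  then have Z: "Z \<in> Obj C" and u: "\<exists>!f. f \<in> Hom C Z Z" by (auto simp: zero_object_def)
  have "Id C Z \<in> Hom C Z Z" "Zero C Z Z \<in> Hom C Z Z" using Z by auto
  with u Z show "Z \<in> Obj C \<and> Id C Z = Zero C Z Z" by blast
next
  assume *: "Z \<in> Obj C \<and> Id C Z = Zero C Z Z"
  have "f = Zero C Z X" if "f \<in> Hom C Z X" for f X using that * Id_right[of f Z] by auto
  moreover have "f = Zero C X Z" if "f \<in> Hom C X Z" for f X using that * Id_left[of f Z] by auto
  moreover have "Zero C Z X \<in> Hom C Z X" "Zero C X Z \<in> Hom C X Z" if "X \<in> Obj C" for X using that * by auto
  ultimately show "zero_object C Z" unfolding zero_object_def using * by blast
qed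

lemma zero_arrows:
  assumes "Id C Z = Zero C Z Z"
  shows "f \<in> Hom C Z X \<Longrightarrow> f = Zero C Z X" "f \<in> Hom C X Z \<Longrightarrow> f = Zero C X Z"
  using assms Id_right[of f Z] Id_left[of f Z] by auto


lemma kernel_Zero_iso:
  assumes "is_kernel C (Zero C X Y) k" "X \<in> Obj C" "Y \<in> Obj C"
  shows "isomorphism C k"
proof -
  note k = kernelD[OF assms(1)]
  obtain u where u: "u \<in> Hom C X (Dom C k)" "k * u = Id C X"
    using kernel_factor[OF assms(1), of "Id C X" X] assms by auto
  have "u * k = Id C (Dom C k)"
    by (rule mono_cancel[OF kernel_mono[OF assms(1)]]) (use u k assms in \<open>simp_all add: reduce[OF u(2)]\<close>)
  with u k assms show ?thesis by (intro isoI[of k "Dom C k" X u]) auto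
qed

text \<open>A direct sum described by equations instead of a universal property: in this form it is
  self-dual and carried along by additive functors.\<close>

definition biprod :: "'o \<Rightarrow> 'o \<Rightarrow> 'o \<Rightarrow> 'm \<Rightarrow> 'm \<Rightarrow> 'm \<Rightarrow> 'm \<Rightarrow> bool" where
  "biprod X Y B i j p q \<longleftrightarrow> i \<in> Hom C X B \<and> j \<in> Hom C Y B \<and> p \<in> Hom C B X \<and> q \<in> Hom C B Y \<and>
     p * i = Id C X \<and> q * j = Id C Y \<and> q * i = Zero C X Y \<and> p * j = Zero C Y X \<and> (i * p) \<boxplus> (j * q) = Id C B"

end

lemma biprod_opcat:
  "preadditive C \<Longrightarrow> preadditive.biprod (opcat C) X Y B i j p q \<longleftrightarrow> preadditive.biprod C X Y B p q i j"
  using preadditive.preadditive_opcat[of C] by (auto simp: preadditive.biprod_def)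

locale additive = preadditive +
  assumes zero_ex: "\<exists>Z\<in>Obj C. Id C Z = Zero C Z Z"
    and biprod_ex: "X \<in> Obj C \<Longrightarrow> Y \<in> Obj C \<Longrightarrow> \<exists>B i j p q. biprod X Y B i j p q"
begin

lemma additive_opcat: "additive (opcat C)"
proof -
  interpret op: preadditive "opcat C" by (rule preadditive_opcat)
  show ?thesis by unfold_locales (use zero_ex biprod_ex in \<open>simp_all add: biprod_opcat preadditive_axioms, blast\<close>)
qed

text \<open>The pullback is the kernel of \<open>f * p - g * q\<close> on a direct sum. The
  hypotheses are kept to kernels so that the lemma applies in \<open>opcat (coh C)\<close>, where
  kernels are available before anything abelian is; the last clause takes the abelian axiom that it
  uses as a premise.\<close>

lemma pullback_ex:
  assumes ker: "\<And>f. f \<in> Arr C \<Longrightarrow> \<exists>k. is_kernel C f k"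
    and f: "f \<in> Hom C X Z" and g: "g \<in> Hom C Y Z"
  obtains P p q where "p \<in> Hom C P X" "q \<in> Hom C P Y" "f * p = g * q"
    "\<And>W a b. a \<in> Hom C W X \<Longrightarrow> b \<in> Hom C W Y \<Longrightarrow> f * a = g * b \<Longrightarrow>
      \<exists>u\<in>Hom C W P. p * u = a \<and> q * u = b"
    "\<And>W u v. u \<in> Hom C W P \<Longrightarrow> v \<in> Hom C W P \<Longrightarrow> p * u = p * v \<Longrightarrow> q * u = q * v \<Longrightarrow> u = v"
    "epimorphism C f \<Longrightarrow> (\<And>h c. is_kernel C h c \<Longrightarrow> epimorphism C h \<Longrightarrow> is_cokernel C c h) \<Longrightarrow> epimorphism C q"
proof -
  have O: "X \<in> Obj C" "Y \<in> Obj C" "Z \<in> Obj C" using f g by auto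
  from biprod_ex[OF O(1,2)] obtain B i j p q where b: "biprod X Y B i j p q" by blast
  then have b1: "i \<in> Hom C X B" "j \<in> Hom C Y B" "p \<in> Hom C B X" "q \<in> Hom C B Y"
    and b2: "p * i = Id C X" "q * j = Id C Y" "q * i = Zero C X Y" "p * j = Zero C Y X"
    and b3: "(i * p) \<boxplus> (j * q) = Id C B" by (auto simp: biprod_def)
  define r where "r = (f * p) \<boxplus> neg C (g * q)"
  have r: "r \<in> Hom C B Z" using b1 f g by (auto simp: r_def)
  have ri: "r * i = f" using b1 b2 f g O by (simp add: r_def)
  obtain k where k: "is_kernel C r k" using ker[of r] r by auto
  note kD = kernelD[OF k]
  have rx: "r * x = (f * p * x) \<boxplus> neg C (g * q * x)" if "x \<in> Arr C" "Cod C x = B" for x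
    using that b1 f g by (simp add: r_def)
  have sq: "f * p * k = g * q * k"
  proof -
    have "(f * p * k) \<boxplus> neg C (g * q * k) = Zero C (Dom C k) Z" using kD(4) rx[of k] kD r by simp
    then show ?thesis using kD r b1 f g by (subst (asm) diff_eq_Zero) auto
  qed
  show ?thesis
  proof
    show "p * k \<in> Hom C (Dom C k) X" "q * k \<in> Hom C (Dom C k) Y" using b1 kD r by auto
    show "f * (p * k) = g * (q * k)" by (rule sq)
    fix W a b assume ab: "a \<in> Hom C W X" "b \<in> Hom C W Y" "f * a = g * b"
    let ?h = "(i * a) \<boxplus> (j * b)"
    have W: "W \<in> Obj C" using ab by auto
    have h: "?h \<in> Hom C W B" using b1 ab by auto
    have ph: "p * ?h = a" "q * ?h = b" using ab b1 W
      by (simp_all add: reduce[OF b2(1)] reduce[OF b2(2)] reduce[OF b2(3)] reduce[OF b2(4)] O)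
    have "r * ?h = Zero C W Z" using h ab b1 f g by (subst rx) (auto simp: ph simp del: Comp_Add)
    then obtain u where u: "u \<in> Hom C W (Dom C k)" "k * u = ?h" using kernel_factor[OF k, of ?h W] h r by auto
    show "\<exists>u\<in>Hom C W (Dom C k). (p * k) * u = a \<and> (q * k) * u = b"
      using u b1 kD r ph by (intro bexI[of _ u]) (auto simp del: Comp_Add)
  next
    fix W u v assume uv: "u \<in> Hom C W (Dom C k)" "v \<in> Hom C W (Dom C k)"
      "(p * k) * u = (p * k) * v" "(q * k) * u = (q * k) * v"
    have kx: "k * x = (i * (p * k) * x) \<boxplus> (j * (q * k) * x)"
      if "x \<in> Hom C W (Dom C k)" for x
    proof -
      have "k * x = Id C B * (k * x)" using that kD r by simp
      also have "\<dots> = (i * (p * k) * x) \<boxplus> (j * (q * k) * x)" unfolding b3[symmetric] using that kD r b1 by simp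
      finally show ?thesis .
    qed
    have "k * u = k * v" unfolding kx[OF uv(1)] kx[OF uv(2)] uv(3,4) ..
    with uv show "u = v" by (simp add: mono_cancel[OF kernel_mono[OF k]])
  next
    assume e: "epimorphism C f"
      and ab: "\<And>h c. is_kernel C h c \<Longrightarrow> epimorphism C h \<Longrightarrow> is_cokernel C c h"
    \<comment> \<open>Restricted along the injection \<open>i\<close>, the difference
      \<open>r\<close> is \<open>f\<close>, which is already an epimorphism.\<close>
    have "epimorphism C r"
    proof (rule epiI[of r B Z])
      fix W h assume h: "h \<in> Hom C Z W" "h * r = Zero C B W"
      have "(h * r) * i = h * f" using ri r h(1) b1 by simp
      then have "h * f = Zero C X W" unfolding h(2) using h b1 by auto
      then show "h = Zero C Z W" using epi_Zero[OF e, of h W] h f by auto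
    qed (use r in auto)
    then have c: "is_cokernel C k r" using ab k by blast
    show "epimorphism C (q * k)"
    proof (rule epiI[of _ "Dom C k" Y])
      show "q * k \<in> Hom C (Dom C k) Y" using b1 kD r by auto
      \<comment> \<open>Since \<open>r\<close> is the cokernel of \<open>k\<close>, the composite
        \<open>h * q\<close> factors as \<open>t * r\<close>. Restriction along \<open>i\<close>
        gives \<open>t * f = 0\<close>, so \<open>t\<close> vanishes, and restriction of
        \<open>h * q\<close> along \<open>j\<close> recovers \<open>h\<close>.\<close>
      fix W h assume h: "h \<in> Hom C Y W" "h * (q * k) = Zero C (Dom C k) W"
      then obtain t where t: "t \<in> Hom C Z W" "t * r = h * q"
        using cokernel_factor[OF c, of "h * q" W] b1 kD r by auto
      have "(t * r) * i = t * f" using t(1) r b1 ri by simp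
      moreover have "(h * q) * i = Zero C X W" using h(1) b1 b2 O by simp
      ultimately have "t = Zero C Z W" unfolding t(2) using epi_Zero[OF e, of t W] t f by auto
      then have hq: "h * q = Zero C B W" using t(2)[symmetric] r h(1) O by auto
      have "h = h * (q * j)" using h(1) b2 by simp
      also have "\<dots> = (h * q) * j" using h(1) b1 by simp
      also have "\<dots> = Zero C Y W" unfolding hq using h b1 by auto
      finally show "h = Zero C Y W" .
    qed
  qed
qed

end

section \<open>Abelian categories and exact functors\<close>

locale abelian = additive +
  assumes kernel_ex: "f \<in> Arr C \<Longrightarrow> \<exists>k. is_kernel C f k"
    and cokernel_ex: "f \<in> Arr C \<Longrightarrow> \<exists>c. is_cokernel C f c"
    and mono_kernel: "monomorphism C f \<Longrightarrow> is_cokernel C f c \<Longrightarrow> is_kernel C c f"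
    and epi_cokernel: "epimorphism C f \<Longrightarrow> is_kernel C f k \<Longrightarrow> is_cokernel C k f"
begin

lemma abelian_opcat: "abelian (opcat C)"
proof -
  interpret op: additive "opcat C" by (rule additive_opcat)
  show ?thesis by unfold_locales (use kernel_ex cokernel_ex mono_kernel epi_cokernel in simp_all)
qed

lemma pullback:
  assumes f: "f \<in> Hom C X Z" and g: "g \<in> Hom C Y Z"
  obtains P p q where "p \<in> Hom C P X" "q \<in> Hom C P Y" "f * p = g * q"
    "\<And>W a b. a \<in> Hom C W X \<Longrightarrow> b \<in> Hom C W Y \<Longrightarrow> f * a = g * b \<Longrightarrow>
      \<exists>u\<in>Hom C W P. p * u = a \<and> q * u = b"
    "\<And>W u v. u \<in> Hom C W P \<Longrightarrow> v \<in> Hom C W P \<Longrightarrow> p * u = p * v \<Longrightarrow> q * u = q * v \<Longrightarrow> u = v"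
    "epimorphism C f \<Longrightarrow> epimorphism C q"
  by (rule pullback_ex[OF kernel_ex f g], assumption) (use epi_cokernel in blast)

text \<open>The image is the kernel \<open>m\<close> of the cokernel of \<open>f\<close>. If
  \<open>h * e = 0\<close>, then \<open>e\<close> factors through the kernel \<open>k\<close> of
  \<open>h\<close>, and \<open>m * k\<close> is a monomorphism, hence the kernel of its cokernel
  \<open>d\<close>. As \<open>d\<close> kills \<open>f\<close> it kills \<open>m\<close>, so
  \<open>m\<close> factors through \<open>m * k\<close>; therefore \<open>k\<close> has a right
  inverse and \<open>h\<close> is zero.\<close>

lemma image_factor:
  assumes "f \<in> Hom C X Y"
  obtains I m e where "e \<in> Hom C X I" "m \<in> Hom C I Y" "m * e = f" "monomorphism C m" "epimorphism C e"
proof -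
  obtain c where c: "is_cokernel C f c" using cokernel_ex assms by auto
  note cD = cokernelD[OF c]
  obtain m where m: "is_kernel C c m" using kernel_ex cD by blast
  note mD = kernelD[OF m]
  obtain e where e: "e \<in> Hom C X (Dom C m)" "m * e = f" using kernel_factor[OF m, of f X] assms cD by auto
  have mm: "monomorphism C m" by (rule kernel_mono[OF m])
  have "epimorphism C e"
  proof (rule epiI[OF e(1)])
    fix W h assume h: "h \<in> Hom C (Dom C m) W" "h * e = Zero C X W"
    obtain k where k: "is_kernel C h k" using kernel_ex h by auto
    note kD = kernelD[OF k]
    obtain e' where e': "e' \<in> Hom C X (Dom C k)" "k * e' = e" using kernel_factor[OF k, of e X] e h by auto
    have mk: "monomorphism C (m * k)" using mm kernel_mono[OF k] kD mD h by (intro mono_comp) auto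
    obtain d where d: "is_cokernel C (m * k) d" using cokernel_ex[of "m * k"] kD mD h by auto
    note dD = cokernelD[OF d]
    have ker: "is_kernel C d (m * k)" by (rule mono_kernel[OF mk d])
    have df: "d * f = Zero C X (Cod C d)"
    proof -
      have "d * f = d * (m * (k * e'))" by (simp only: e(2) e'(2))
      also have "\<dots> = (d * (m * k)) * e'" using dD(1-3) e'(1) kD(1-3) mD(1-3) h(1) by simp
      also have "\<dots> = Zero C X (Cod C d)" unfolding dD(4) using dD e' kD mD h by simp
      finally show ?thesis .
    qed
    obtain d' where d': "d' \<in> Hom C (Cod C c) (Cod C d)" "d' * c = d"
      using cokernel_factor[OF c, of d "Cod C d"] df dD assms mD cD kD h by auto
    have "d * m = (d' * c) * m" by (simp only: d'(2))
    also have "\<dots> = Zero C (Dom C m) (Cod C d)" using d'(1) cD mD by simp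
    finally obtain t where t: "t \<in> Hom C (Dom C m) (Dom C (m * k))" "(m * k) * t = m"
      using kernel_factor[OF ker, of m "Dom C m"] dD mD kD h by auto
    have t1: "t \<in> Hom C (Dom C m) (Dom C k)" using t(1) kD mD h by auto
    have "m * (k * t) = m * Id C (Dom C m)" using t(2) t1 kD(1-3) mD(1-3) h(1) by simp
    then have kt: "k * t = Id C (Dom C m)" by (rule mono_cancel[OF mm, rotated -1]) (use t1 kD mD h in simp_all)
    have "h = h * (k * t)" using kt h(1) by simp
    also have "\<dots> = (h * k) * t" using kD(1-3) t1 h(1) by simp
    also have "\<dots> = Zero C (Dom C m) W" unfolding kD(4) using kD t1 h(1) by auto
    finally show "h = Zero C (Dom C m) W" .
  qed
  then show ?thesis using that[OF e(1) _ e(2) mm] mD cD assms by auto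
qed

text \<open>A monomorphism is the kernel of its cokernel, and the cokernel of an epimorphism is a
  zero arrow, whose kernels are invertible.\<close>

lemma mono_epi_iso:
  assumes "monomorphism C f" "epimorphism C f"
  shows "isomorphism C f"
proof -
  have f: "f \<in> Arr C" using assms by (auto simp: monomorphism_def)
  obtain c where c: "is_cokernel C f c" using cokernel_ex f by blast
  note cD = cokernelD[OF c]
  have "c = Zero C (Cod C f) (Cod C c)" using epi_Zero[OF assms(2), of c "Cod C c"] cD by auto
  then have "is_kernel C (Zero C (Cod C f) (Cod C c)) f" using mono_kernel[OF assms(1) c] by simp
  then show ?thesis by (rule kernel_Zero_iso) (use f cD in auto)
qed

text \<open>Epimorphisms \<open>e\<close> into the source serve as refinements of generalised elements.\<close>

lemma cokernel_cover:
  assumes c: "is_cokernel C a c" and b: "b \<in> Hom C W (Dom C c)" "c * b = Zero C W (Cod C c)"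
  obtains V e y where "e \<in> Hom C V W" "epimorphism C e" "y \<in> Hom C V (Dom C a)" "b * e = a * y"
proof -
  note cD = cokernelD[OF c]
  obtain I m e where f: "e \<in> Hom C (Dom C a) I" "m \<in> Hom C I (Cod C a)" "m * e = a"
    "monomorphism C m" "epimorphism C e" by (rule image_factor[of a "Dom C a" "Cod C a"]) (use cD in simp)
  have "is_cokernel C m c" using cokernel_epi_comp[OF f(5), of m c] f(1-3) c by auto
  then have k: "is_kernel C c m" by (rule mono_kernel[OF f(4)])
  obtain b' where b': "b' \<in> Hom C W I" "m * b' = b" using kernel_factor[OF k b] f by auto
  obtain P p q where P: "p \<in> Hom C P (Dom C a)" "q \<in> Hom C P W" "e * p = b' * q"
    "epimorphism C e \<Longrightarrow> epimorphism C q" by (rule pullback[OF f(1) b'(1)]) blast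
  have "b * q = (m * b') * q" by (simp only: b'(2))
  also have "\<dots> = m * (e * p)" using P b'(1) f(1,2) by simp
  also have "\<dots> = (m * e) * p" using P(1) f(1,2) by simp
  also have "\<dots> = a * p" by (simp only: f(3))
  finally show ?thesis using that P f by blast
qed

text \<open>A chase with generalised elements. An element \<open>h\<close> killed by
  \<open>w\<close> is lifted along \<open>d\<close> to \<open>y\<close>; then \<open>g * y\<close>
  dies in the cokernel of \<open>f\<close> and becomes some \<open>f * x\<close> after a refinement.
  By \<open>pb\<close> the refined \<open>y\<close> comes from \<open>P\<close>, where
  \<open>d * q\<close> is zero. Only a weak pullback is asked for, because it is applied to the
  image of a pullback under a functor.\<close>

lemma pullback_cokernel_mono:
  assumes f: "f \<in> Hom C X Z" and g: "g \<in> Hom C Y Z" and pq: "p \<in> Hom C P X" "q \<in> Hom C P Y"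
    and pb: "\<And>W a b. a \<in> Hom C W X \<Longrightarrow> b \<in> Hom C W Y \<Longrightarrow> f * a = g * b \<Longrightarrow>
      \<exists>u\<in>Hom C W P. p * u = a \<and> q * u = b"
    and c: "is_cokernel C f c" and d: "d \<in> Hom C Y Q" "epimorphism C d" "d * q = Zero C P Q"
    and w: "w \<in> Hom C Q (Cod C c)" "w * d = c * g"
  shows "monomorphism C w"
proof (rule monoI[OF w(1)])
  note cD = cokernelD[OF c]
  fix V h assume h: "h \<in> Hom C V Q" "w * h = Zero C V (Cod C c)"
  obtain V1 y e where e: "y \<in> Hom C V1 Y" "e \<in> Hom C V1 V" "d * y = h * e"
    "epimorphism C d \<Longrightarrow> epimorphism C e" by (rule pullback[OF d(1) h(1)]) blast
  have "c * (g * y) = (w * d) * y" unfolding w(2) using cD(1-3) f g e by simp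
  also have "\<dots> = (w * h) * e" using w(1) d(1) e(1-3) h(1) by simp
  also have "\<dots> = Zero C V1 (Cod C c)" unfolding h(2) using e cD by auto
  finally obtain V2 e' x where e': "e' \<in> Hom C V2 V1" "epimorphism C e'" "x \<in> Hom C V2 X"
    "(g * y) * e' = f * x" using cokernel_cover[OF c, of "g * y" V1] cD f g e by auto
  obtain u where u: "u \<in> Hom C V2 P" "q * u = y * e'" using pb[of x V2 "y * e'"] e' e g by auto
  have "h * (e * e') = (h * e) * e'" using h(1) e(2) e'(1) by simp
  also have "\<dots> = d * (q * u)" unfolding e(3)[symmetric] using u(2) d(1) e(1) e'(1) by simp
  also have "\<dots> = (d * q) * u" using d(1) pq u(1) by simp
  also have "\<dots> = Zero C V2 Q" unfolding d(3) using u d pq by auto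
  finally have "(h * e) * e' = Zero C V2 Q" using h(1) e(2) e'(1) by simp
  then have "h * e = Zero C V1 Q" using epi_Zero[OF e'(2), of "h * e" Q] h(1) e(2) e'(1) by auto
  then show "h = Zero C V Q" using epi_Zero[OF e(4)[OF d(2)], of h Q] h(1) e(2) by auto
qed

end

lemma additive_functor_opcat: "additive_functor (opcat A) (opcat B) F \<longleftrightarrow> additive_functor A B F"
  by (auto simp: additive_functor_def is_functor_opcat)

lemma exact_functor_opcat: "exact_functor (opcat A) (opcat B) F \<longleftrightarrow> exact_functor A B F"
  by (auto simp: exact_functor_def additive_functor_opcat)

locale addfun = S: preadditive A + T: preadditive B
  for A :: "('o, 'm) addcat" and B :: "('p, 'n) addcat" and F +
  assumes additive: "additive_functor A B F"
begin

sublocale fctr A B F using additive by unfold_locales (auto simp: additive_functor_def)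

lemma Add [simp]:
  assumes "f \<in> Arr A" "g \<in> Arr A" "Dom A g = Dom A f" "Cod A g = Cod A f"
  shows "on_arr F (f \<boxplus>\<^sub>A g) = on_arr F f \<boxplus>\<^sub>B on_arr F g" using additive assms unfolding additive_functor_def
  by (metis Hom_iff S.Dom_Obj S.Cod_Obj)

lemma Zero [simp]:
  assumes "X \<in> Obj A" "Y \<in> Obj A"
  shows "on_arr F (Zero A X Y) = Zero B (on_obj F X) (on_obj F Y)"
proof -
  let ?z = "on_arr F (Zero A X Y)"
  have "?z \<boxplus>\<^sub>B ?z = ?z" using assms by (subst Add[symmetric]) auto
  then show ?thesis using T.Add_group(8)[of ?z "on_obj F X" "on_obj F Y" ?z] assms by auto
qed

lemma neg [simp]:
  assumes "f \<in> Arr A"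
  shows "on_arr F (neg A f) = neg B (on_arr F f)"
proof -
  have "on_arr F (neg A f) \<boxplus>\<^sub>B on_arr F f = Zero B (on_obj F (Dom A f)) (on_obj F (Cod A f))"
    using assms by (subst Add[symmetric]) auto
  then show ?thesis using T.Add_group(7)[of "on_arr F (neg A f)" "on_obj F (Dom A f)" "on_obj F (Cod A f)"
      "on_arr F f"] assms by auto
qed

lemma comp_Zero:
  assumes "g *\<^sub>A f = Zero A X Z" "f \<in> Hom A X Y" "g \<in> Hom A Y Z"
  shows "on_arr F g *\<^sub>B on_arr F f = Zero B (on_obj F X) (on_obj F Z)" using assms comp[of f g] by auto

lemma biprod:
  assumes "S.biprod X Y P i j p q"
  shows "T.biprod (on_obj F X) (on_obj F Y) (on_obj F P) (on_arr F i) (on_arr F j) (on_arr F p) (on_arr F q)"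
proof -
  from assms have b: "i \<in> Hom A X P" "j \<in> Hom A Y P" "p \<in> Hom A P X" "q \<in> Hom A P Y"
     "p *\<^sub>A i = Id A X" "q *\<^sub>A j = Id A Y" "q *\<^sub>A i = Zero A X Y" "p *\<^sub>A j = Zero A Y X"
     "(i *\<^sub>A p) \<boxplus>\<^sub>A (j *\<^sub>A q) = Id A P" by (auto simp: S.biprod_def)
  then have O: "X \<in> Obj A" "Y \<in> Obj A" "P \<in> Obj A" by auto
  have "on_arr F ((i *\<^sub>A p) \<boxplus>\<^sub>A (j *\<^sub>A q)) = (on_arr F i *\<^sub>B on_arr F p) \<boxplus>\<^sub>B (on_arr F j *\<^sub>B on_arr F q)"
    using b(1-4) by (simp add: comp)
  then show ?thesis unfolding T.biprod_def using b O
    comp[of i p] comp[of j q] comp[of i q] comp[of j p] by simp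
qed

end

lemma additive_comp:
  assumes "preadditive A" "additive_functor A B F" "additive_functor B C G"
  shows "additive_functor A C (G \<circ>\<^sub>F F)"
proof -
  interpret preadditive A by fact
  have "is_functor A C (G \<circ>\<^sub>F F)" using assms comp_functor[OF cat_axioms] by (auto simp: additive_functor_def)
  moreover have "on_arr (G \<circ>\<^sub>F F) (f \<boxplus>\<^sub>A g) = on_arr (G \<circ>\<^sub>F F) f \<boxplus>\<^sub>C on_arr (G \<circ>\<^sub>F F) g"
    if "X \<in> Obj A" "Y \<in> Obj A" "f \<in> Hom A X Y" "g \<in> Hom A X Y" for f g X Y
  proof -
    have F: "is_functor A B F" using assms by (auto simp: additive_functor_def)
    then have "on_arr F f \<in> Hom B (on_obj F X) (on_obj F Y)" "on_arr F g \<in> Hom B (on_obj F X) (on_obj F Y)"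
      "on_obj F X \<in> Obj B" "on_obj F Y \<in> Obj B" using that by (auto simp: is_functor_def)
    then have "on_arr G (on_arr F f \<boxplus>\<^sub>B on_arr F g) = on_arr G (on_arr F f) \<boxplus>\<^sub>C on_arr G (on_arr F g)"
      using assms(3) unfolding additive_functor_def by blast
    moreover have "on_arr F (f \<boxplus>\<^sub>A g) = on_arr F f \<boxplus>\<^sub>B on_arr F g"
      using that assms(2) unfolding additive_functor_def by blast
    ultimately show ?thesis by simp
  qed
  ultimately show ?thesis unfolding additive_functor_def by blast
qed

lemma additive_id: "preadditive A \<Longrightarrow> additive_functor A A id_func"
  using id_functor[of A] by (simp add: additive_functor_def preadditive_def)

lemma exact_comp:
  assumes "preadditive A" "exact_functor A B F" "exact_functor B C G"
  shows "exact_functor A C (G \<circ>\<^sub>F F)" using assms additive_comp[of A B F C G] by (auto simp: exact_functor_def)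

lemma exact_id: "preadditive A \<Longrightarrow> exact_functor A A id_func" by (simp add: exact_functor_def additive_id)

locale exact_fun = S: abelian A + T: abelian B
  for A :: "('o, 'm) addcat" and B :: "('p, 'n) addcat" and F +
  assumes exact: "exact_functor A B F"
begin

sublocale addfun A B F using exact by unfold_locales (auto simp: exact_functor_def)

lemma short_exact: "short_exact A f g \<Longrightarrow> short_exact B (on_arr F f) (on_arr F g)"
  using exact by (auto simp: exact_functor_def)

lemma mono: assumes "monomorphism A f" shows "monomorphism B (on_arr F f)"
proof -
  have "f \<in> Arr A" using assms by (auto simp: monomorphism_def)
  then obtain c where c: "is_cokernel A f c" using S.cokernel_ex by blast
  with S.mono_kernel[OF assms c] short_exact[of f c] have "is_kernel B (on_arr F c) (on_arr F f)"
    by (auto simp: short_exact_def)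
  then show ?thesis by (rule T.kernel_mono)
qed

lemma exact_opcat: "exact_fun (opcat A) (opcat B) F" using exact S.abelian_opcat T.abelian_opcat
  by (simp add: exact_fun_def exact_fun_axioms_def exact_functor_opcat)

end

lemma (in exact_fun) epi: "epimorphism A f \<Longrightarrow> epimorphism B (on_arr F f)"
  using exact_fun.mono[OF exact_opcat] by simp

text \<open>Exactness is stated for short exact sequences. Writing \<open>f = m * e\<close> through
  its image replaces \<open>f\<close> by the monomorphism \<open>m\<close>, which has the same
  cokernel and begins a short exact sequence; \<open>F\<close> keeps \<open>e\<close> an
  epimorphism.\<close>

lemma (in exact_fun) cokernel:
  assumes "is_cokernel A f c" shows "is_cokernel B (on_arr F f) (on_arr F c)"
proof -
  note cD = S.cokernelD[OF assms]
  obtain I m e where f: "e \<in> Hom A (Dom A f) I" "m \<in> Hom A I (Cod A f)" "m *\<^sub>A e = f"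
    "monomorphism A m" "epimorphism A e" by (rule S.image_factor[of f "Dom A f" "Cod A f"]) (use cD in simp)
  have "is_cokernel A m c" using S.cokernel_epi_comp[OF f(5), of m c] f(1-3) assms by auto
  then have "short_exact A m c" using S.mono_kernel[OF f(4)] by (auto simp: short_exact_def)
  then have "is_cokernel B (on_arr F m) (on_arr F c)" using short_exact by (auto simp: short_exact_def)
  then show ?thesis
    using T.cokernel_epi_comp[OF epi[OF f(5)], of "on_arr F m" "on_arr F c"] f(1-3) comp[of e m] by auto
qed

lemma (in exact_fun) kernel:
  "is_kernel A f k \<Longrightarrow> is_kernel B (on_arr F f) (on_arr F k)" using exact_fun.cokernel[OF exact_opcat] by simp

lemma exact_funI: "abelian A \<Longrightarrow> abelian B \<Longrightarrow> exact_functor A B F \<Longrightarrow> exact_fun A B F"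
  by (simp add: exact_fun_def exact_fun_axioms_def)

lemma exact_functorI:
  assumes "additive_functor A B F"
    and "\<And>f k. is_kernel A f k \<Longrightarrow> is_kernel B (on_arr F f) (on_arr F k)"
    and "\<And>f c. is_cokernel A f c \<Longrightarrow> is_cokernel B (on_arr F f) (on_arr F c)"
  shows "exact_functor A B F" using assms by (auto simp: exact_functor_def short_exact_def)

text \<open>Subobjects and quotients are killed because \<open>F\<close> preserves monomorphisms and
  epimorphisms, and arrows to or from a zero object vanish. For an extension
  \<open>on_arr F g\<close> is zero, so the identity of the middle object lifts through the kernel
  \<open>on_arr F f\<close>, which is zero as well.\<close>

lemma (in exact_fun) serre_kernel:
  "serre A {X \<in> Obj A. Id B (on_obj F X) = Zero B (on_obj F X) (on_obj F X)}" (is "serre A ?K") unfolding serre_def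
proof (intro conjI allI impI)
  show "?K \<subseteq> Obj A" by blast
  fix Z assume "zero_object A Z"
  then have Z: "Z \<in> Obj A" "Id A Z = Zero A Z Z" by (auto simp: S.zero_object_iff)
  then show "Z \<in> ?K" using ident[of Z] Zero[of Z Z] by simp
next
  fix f assume f: "monomorphism A f \<and> Cod A f \<in> ?K"
  have fA: "f \<in> Arr A" using f by (auto simp: monomorphism_def)
  have "on_arr F f = Zero B (on_obj F (Dom A f)) (on_obj F (Cod A f))"
    using f fA T.zero_arrows(2)[of "on_obj F (Cod A f)" "on_arr F f" "on_obj F (Dom A f)"] by auto
  then have "Id B (on_obj F (Dom A f)) = Zero B (on_obj F (Dom A f)) (on_obj F (Dom A f))"
    using fA f T.mono_Zero[OF mono, of f "Id B (on_obj F (Dom A f))" "on_obj F (Dom A f)"] by simp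
  then show "Dom A f \<in> ?K" using fA by simp
next
  fix f assume f: "epimorphism A f \<and> Dom A f \<in> ?K"
  have fA: "f \<in> Arr A" using f by (auto simp: epimorphism_def)
  have "on_arr F f = Zero B (on_obj F (Dom A f)) (on_obj F (Cod A f))"
    using f fA T.zero_arrows(1)[of "on_obj F (Dom A f)" "on_arr F f" "on_obj F (Cod A f)"] by auto
  then have "Id B (on_obj F (Cod A f)) = Zero B (on_obj F (Cod A f)) (on_obj F (Cod A f))"
    using fA f T.epi_Zero[OF epi, of f "Id B (on_obj F (Cod A f))" "on_obj F (Cod A f)"] by simp
  then show "Cod A f \<in> ?K" using fA by simp
next
  fix f g assume *: "short_exact A f g \<and> Dom A f \<in> ?K \<and> Cod A g \<in> ?K"
  then have k: "is_kernel A g f" by (auto simp: short_exact_def)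
  note kD = S.kernelD[OF k]
  let ?Y = "on_obj F (Cod A f)"
  have g0: "on_arr F g = Zero B ?Y (on_obj F (Cod A g))"
    using * kD T.zero_arrows(2)[of "on_obj F (Cod A g)" "on_arr F g" ?Y] by auto
  have f0: "on_arr F f = Zero B (on_obj F (Dom A f)) ?Y"
    using * kD T.zero_arrows(1)[of "on_obj F (Dom A f)" "on_arr F f" ?Y] by auto
  have Y: "?Y \<in> Obj B" using kD by auto
  obtain u where u: "u \<in> Hom B ?Y (on_obj F (Dom A f))" "on_arr F f *\<^sub>B u = Id B ?Y"
    using T.kernel_factor[OF kernel[OF k], of "Id B ?Y" ?Y] kD g0 Y by auto
  have "Id B ?Y = Zero B ?Y ?Y" unfolding u(2)[symmetric] f0 using u(1) Y kD by simp
  then show "Cod A f \<in> ?K" using kD by simp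
qed

section \<open>Localisation\<close>

lemma func_eq_nat_isomorphic:
  assumes "cat C" "cat D" "is_functor C D F" "is_functor C D G" "func_eq_on C F G"
  shows "nat_isomorphic C D F G"
proof -
  interpret F: fctr C D F using assms by (intro fctrI)
  interpret G: fctr C D G using assms by (intro fctrI)
  have e: "\<And>X. X \<in> Obj C \<Longrightarrow> on_obj F X = on_obj G X" "\<And>f. f \<in> Arr C \<Longrightarrow> on_arr F f = on_arr G f"
    using assms(5) by (auto simp: func_eq_on_def)
  show ?thesis
  proof (rule nat_isomorphicI[where \<tau> = "\<lambda>X. Id D (on_obj F X)"])
    fix f X Y assume f: "f \<in> Hom C X Y"
    then have "X \<in> Obj C" "Y \<in> Obj C" by auto
    with f show "on_arr G f *\<^sub>D Id D (on_obj F X) = Id D (on_obj F Y) *\<^sub>D on_arr F f" using e by simp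
  qed (use e in simp_all)
qed

locale loc = cat C for C :: "('o, 'm, 'z) cat_scheme" (structure) +
  fixes \<Sigma> :: "'m set"
  assumes Sigma_Arr: "\<Sigma> \<subseteq> Arr C"
begin

abbreviation "L \<equiv> localisation C \<Sigma>"
abbreviation "Q \<equiv> loc_func C \<Sigma>"
abbreviation "cls \<equiv> path_class C \<Sigma>"

lemma Sigma [simp]: "s \<in> \<Sigma> \<Longrightarrow> s \<in> Arr C" using Sigma_Arr by blast

lemma path_Obj: "is_path C \<Sigma> X ps Y \<Longrightarrow> X \<in> Obj C \<and> Y \<in> Obj C"
proof (induction ps arbitrary: X)
  case (Cons p ps)
  then show ?case by (cases p) auto
qed simp

lemma path_append: "is_path C \<Sigma> X ps Y \<Longrightarrow> is_path C \<Sigma> Y qs Z \<Longrightarrow> is_path C \<Sigma> X (ps @ qs) Z"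
proof (induction ps arbitrary: X)
  case (Cons p ps)
  then show ?case by (cases p) auto
qed simp

lemma path_equiv_path: "path_equiv C \<Sigma> X Y ps qs \<Longrightarrow> is_path C \<Sigma> X ps Y \<and> is_path C \<Sigma> X qs Y"
  by (induction rule: path_equiv.induct) (auto intro: path_append)

lemma cls_eq_iff:
  assumes "is_path C \<Sigma> X ps Y" "is_path C \<Sigma> X qs Y"
  shows "cls X Y ps = cls X Y qs \<longleftrightarrow> path_equiv C \<Sigma> X Y ps qs"
proof
  assume "cls X Y ps = cls X Y qs"
  then have "qs \<in> {rs. path_equiv C \<Sigma> X Y ps rs}" using path_equiv.refl[OF assms(2)] by (auto simp: path_class_def)
  then show "path_equiv C \<Sigma> X Y ps qs" by blast
next
  assume "path_equiv C \<Sigma> X Y ps qs"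
  then show "cls X Y ps = cls X Y qs" by (auto simp: path_class_def intro: path_equiv.sym path_equiv.trans)
qed

lemma loc_simps [simp]:
  "Obj L = Obj C" "Id L X = cls X X []" "Dom L (cls X Y ps) = X" "Cod L (cls X Y ps) = Y"
  by (simp_all add: localisation_def path_class_def)

lemma cls_Arr [simp]: "is_path C \<Sigma> X ps Y \<Longrightarrow> cls X Y ps \<in> Arr L" by (auto simp: localisation_def)

lemma loc_cases:
  assumes "f \<in> Arr L"
  obtains X Y ps where "f = cls X Y ps" "is_path C \<Sigma> X ps Y" using assms by (auto simp: localisation_def)

lemma loc_comp:
  assumes "is_path C \<Sigma> X ps Y" "is_path C \<Sigma> Y qs Z"
  shows "cls Y Z qs *\<^sub>L cls X Y ps = cls X Z (ps @ qs)"
proof -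
  have "path_equiv C \<Sigma> X Z (ps @ qs) rs"
    if "path_equiv C \<Sigma> X Y ps ps'" "path_equiv C \<Sigma> Y Z qs qs'" "path_equiv C \<Sigma> X Z (ps' @ qs') rs"
    for ps' qs' rs using path_equiv.append[OF that(1,2)] that(3) by (rule path_equiv.trans)
  moreover have "path_equiv C \<Sigma> X Y ps ps" "path_equiv C \<Sigma> Y Z qs qs" using assms by (auto intro: path_equiv.refl)
  ultimately have "(\<exists>ps'. path_equiv C \<Sigma> X Y ps ps' \<and> (\<exists>qs'. path_equiv C \<Sigma> Y Z qs qs' \<and>
      path_equiv C \<Sigma> X Z (ps' @ qs') rs)) \<longleftrightarrow> path_equiv C \<Sigma> X Z (ps @ qs) rs" for rs by blast
  then show ?thesis by (simp add: localisation_def path_class_def)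
qed

lemma loc_cat: "cat L"
proof
  fix f assume "f \<in> Arr L"
  then show "Dom L f \<in> Obj L" "Cod L f \<in> Obj L" by (auto elim!: loc_cases dest: path_Obj)
next
  fix X assume "X \<in> Obj L" then show "Id L X \<in> Hom L X X" by (simp add: Hom_def)
next
  fix f g X Y Z assume "f \<in> Hom L X Y" "g \<in> Hom L Y Z"
  then show "g *\<^sub>L f \<in> Hom L X Z"
    by (auto simp: Hom_def elim!: loc_cases) (auto simp: loc_comp, metis cls_Arr path_append)
next
  fix f X Y assume "f \<in> Hom L X Y"
  then show "f *\<^sub>L Id L X = f" "Id L Y *\<^sub>L f = f"
    by (auto simp: Hom_def elim!: loc_cases) (auto simp: loc_comp path_Obj)
next
  fix f g h W X Y Z assume "f \<in> Hom L W X" "g \<in> Hom L X Y" "h \<in> Hom L Y Z"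
  then show "h *\<^sub>L g *\<^sub>L f = (h *\<^sub>L g) *\<^sub>L f"
    by (auto simp: Hom_def elim!: loc_cases) (auto simp: loc_comp path_append)
qed

lemma Q_simps [simp]: "on_obj Q X = X" "on_arr Q f = cls (Dom C f) (Cod C f) [Fwd f]"
  by (simp_all add: loc_func_def)

lemma Q_functor: "is_functor C L Q"
proof (rule is_functorI)
  fix X assume "X \<in> Obj C"
  then show "on_arr Q (Id C X) = Id L (on_obj Q X)" by (simp add: cls_eq_iff path_equiv.ident)
next
  fix f g X Y Z assume *: "f \<in> Hom C X Y" "g \<in> Hom C Y Z"
  then have "path_equiv C \<Sigma> X Z [Fwd (g * f)] [Fwd f, Fwd g]" by (intro path_equiv.sym[OF path_equiv.comp])
  then show "on_arr Q (g * f) = on_arr Q g *\<^sub>L on_arr Q f"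
    using * Hom_Obj[OF *(1)] Hom_Obj[OF *(2)] loc_comp[of X "[Fwd f]" Y "[Fwd g]" Z]
      cls_eq_iff[of X "[Fwd (g * f)]" Z "[Fwd f, Fwd g]"] by simp
qed (auto simp: Hom_def)

sublocale L: cat L by (rule loc_cat)
sublocale Q: fctr C L Q by unfold_locales (rule Q_functor)

lemma Q_inverse:
  assumes "s \<in> \<Sigma>"
  shows "cls (Cod C s) (Dom C s) [Bwd s] \<in> Hom L (Cod C s) (Dom C s)"
    "cls (Cod C s) (Dom C s) [Bwd s] *\<^sub>L on_arr Q s = Id L (Dom C s)"
    "on_arr Q s *\<^sub>L cls (Cod C s) (Dom C s) [Bwd s] = Id L (Cod C s)"
  using assms path_equiv.inv_right[OF assms, of C] path_equiv.inv_left[OF assms, of C]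
  by (simp_all add: loc_comp cls_eq_iff)

lemma Q_iso: "s \<in> \<Sigma> \<Longrightarrow> isomorphism L (on_arr Q s)" using Q_inverse by (intro L.isoI[of _ "Dom C s" "Cod C s"]) auto

text \<open>Induction removes the step travelled first. A backward step is presented merely as an
  arrow \<open>t\<close> inverse to \<open>on_arr Q s\<close>, so that later proofs can forget about
  paths.\<close>

lemma loc_induct [consumes 1, case_names ident fwd bwd]:
  assumes "p \<in> Arr L"
    and ident: "\<And>X. X \<in> Obj C \<Longrightarrow> P (Id L X)"
    and fwd: "\<And>f p. f \<in> Arr C \<Longrightarrow> p \<in> Arr L \<Longrightarrow> Dom L p = Cod C f \<Longrightarrow> P p \<Longrightarrow> P (p *\<^sub>L on_arr Q f)"
    and bwd: "\<And>s t p. s \<in> \<Sigma> \<Longrightarrow> t \<in> Hom L (Cod C s) (Dom C s) \<Longrightarrow> t *\<^sub>L on_arr Q s = Id L (Dom C s) \<Longrightarrow>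
      on_arr Q s *\<^sub>L t = Id L (Cod C s) \<Longrightarrow> p \<in> Arr L \<Longrightarrow> Dom L p = Dom C s \<Longrightarrow> P p \<Longrightarrow> P (p *\<^sub>L t)"
  shows "P p"
proof -
  obtain X Y ps where ps: "p = cls X Y ps" "is_path C \<Sigma> X ps Y" using assms(1) by (rule loc_cases)
  have "P (cls X Y ps)" using ps(2)
  proof (induction ps arbitrary: X)
    case Nil
    then show ?case using ident[of X] by auto
  next
    case (Cons a ps)
    show ?case
    proof (cases a)
      case (Fwd f)
      with Cons have "P (cls (Cod C f) Y ps)" "is_path C \<Sigma> (Cod C f) ps Y" "f \<in> Arr C" "X = Dom C f" by auto
      then show ?thesis using fwd[of f "cls (Cod C f) Y ps"] Fwd path_Obj by (simp add: loc_comp)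
    next
      case (Bwd s)
      with Cons have "P (cls (Dom C s) Y ps)" "is_path C \<Sigma> (Dom C s) ps Y" "s \<in> \<Sigma>" "X = Cod C s" by auto
      then show ?thesis using bwd[OF _ Q_inverse, of s "cls (Dom C s) Y ps"] Bwd path_Obj by (simp add: loc_comp)
    qed
  qed
  with ps show ?thesis by simp
qed

end

definition inv_arr :: "('o, 'm, 'z) cat_scheme \<Rightarrow> 'm \<Rightarrow> 'm" where
  "inv_arr C f = (SOME g. g \<in> Hom C (Cod C f) (Dom C f) \<and>
     Comp C g f = Id C (Dom C f) \<and> Comp C f g = Id C (Cod C f))"

lemma (in cat) inv_arr:
  assumes "isomorphism C f"
  shows "inv_arr C f \<in> Hom C (Cod C f) (Dom C f)" "inv_arr C f * f = Id C (Dom C f)"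
    "f * inv_arr C f = Id C (Cod C f)"
proof -
  have "\<exists>g. g \<in> Hom C (Cod C f) (Dom C f) \<and> g * f = Id C (Dom C f) \<and> f * g = Id C (Cod C f)"
    using assms unfolding isomorphism_def by blast
  from someI_ex[OF this] show "inv_arr C f \<in> Hom C (Cod C f) (Dom C f)"
    "inv_arr C f * f = Id C (Dom C f)" "f * inv_arr C f = Id C (Cod C f)" unfolding inv_arr_def by blast+
qed

fun path_eval :: "('o, 'm, 'z) cat_scheme \<Rightarrow> ('p, 'n, 'y) cat_scheme \<Rightarrow> ('o, 'm, 'p, 'n) func \<Rightarrow>
    'o \<Rightarrow> 'm step list \<Rightarrow> 'n" where
  "path_eval C E H X [] = Id E (on_obj H X)"
| "path_eval C E H X (Fwd f # ps) = path_eval C E H (Cod C f) ps *\<^sub>E on_arr H f"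
| "path_eval C E H X (Bwd s # ps) = path_eval C E H (Dom C s) ps *\<^sub>E inv_arr E (on_arr H s)"

text \<open>Zigzags are evaluated in \<open>E\<close> with a chosen inverse for every backward step,
  and each generator of the congruence holds there. The extension agrees with \<open>H\<close>
  strictly, not only up to isomorphism.\<close>

lemma (in loc) universal:
  assumes "cat E" "is_functor C E H" and inv: "\<And>s. s \<in> \<Sigma> \<Longrightarrow> isomorphism E (on_arr H s)"
  shows "\<exists>F. is_functor L E F \<and> func_eq_on C (F \<circ>\<^sub>F Q) H"
proof -
  interpret H: fctr C E H using assms cat_axioms by (intro fctrI)
  have hom: "path_eval C E H X ps \<in> Hom E (on_obj H X) (on_obj H Y)" if "is_path C \<Sigma> X ps Y" for X Y ps using that
  proof (induction ps arbitrary: X)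
    case (Cons a ps)
    then show ?case using H.T.inv_arr(1)[OF inv] by (cases a) auto
  qed simp
  have app: "path_eval C E H X (ps @ qs) = path_eval C E H Y qs *\<^sub>E path_eval C E H X ps"
    if "is_path C \<Sigma> X ps Y" "is_path C \<Sigma> Y qs Z" for X Y Z ps qs using that
  proof (induction ps arbitrary: X)
    case Nil
    then show ?case using hom[of Y qs Z] by auto
  next
    case (Cons a ps)
    show ?case
    proof (cases a)
      case (Fwd f)
      then show ?thesis using Cons hom[of "Cod C f" ps Y] hom[of Y qs Z] by auto
    next
      case (Bwd s)
      then show ?thesis using Cons hom[of "Dom C s" ps Y] hom[of Y qs Z] H.T.inv_arr(1)[OF inv, of s] by auto
    qed
  qed
  have equiv: "path_eval C E H X ps = path_eval C E H X qs" if "path_equiv C \<Sigma> X Y ps qs" for X Y ps qs using that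
  proof (induction rule: path_equiv.induct)
    case (append X Y ps ps' Z qs qs')
    have "is_path C \<Sigma> X ps Y" "is_path C \<Sigma> X ps' Y" "is_path C \<Sigma> Y qs Z" "is_path C \<Sigma> Y qs' Z"
      using append path_equiv_path by blast+
    then show ?case using append by (simp add: app)
  next
    case (comp f X Y g Z)
    then show ?case by (auto simp: H.comp)
  next
    case (inv_right s)
    then show ?case using H.T.inv_arr[OF inv, of s] by simp
  next
    case (inv_left s)
    then show ?case using H.T.inv_arr[OF inv, of s] by simp
  qed simp_all
  \<comment> \<open>By \<open>equiv\<close> all representatives of a class have the same value, so
    an arbitrary one may be evaluated.\<close>
  define F where "F = \<lparr>on_obj = on_obj H,
    on_arr = (\<lambda>p. path_eval C E H (lsrc p) (SOME ps. ps \<in> paths p))\<rparr>"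
  have F: "on_arr F (cls X Y ps) = path_eval C E H X ps" if "is_path C \<Sigma> X ps Y" for X Y ps
  proof -
    have "path_equiv C \<Sigma> X Y ps (SOME qs. qs \<in> {qs. path_equiv C \<Sigma> X Y ps qs})"
      using path_equiv.refl[OF that] by (metis mem_Collect_eq someI_ex)
    from equiv[OF this] show ?thesis by (simp add: F_def path_class_def)
  qed
  have "is_functor L E F"
  proof (rule is_functorI)
    fix X assume X: "X \<in> Obj L"
    then show "on_obj F X \<in> Obj E" by (simp add: F_def)
    show "on_arr F (Id L X) = Id E (on_obj F X)" using X by (simp add: F) (simp add: F_def)
  next
    fix f X Y assume f: "f \<in> Hom L X Y"
    then obtain ps where "f = cls X Y ps" "is_path C \<Sigma> X ps Y" by (auto elim!: loc_cases)
    then show "on_arr F f \<in> Hom E (on_obj F X) (on_obj F Y)"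
      using hom[of X ps Y] by (simp only: F) (simp add: F_def)
  next
    fix f g X Y Z assume *: "f \<in> Hom L X Y" "g \<in> Hom L Y Z"
    then obtain ps qs where "f = cls X Y ps" "is_path C \<Sigma> X ps Y"
      "g = cls Y Z qs" "is_path C \<Sigma> Y qs Z" by (auto elim!: loc_cases)
    then show "on_arr F (g *\<^sub>L f) = on_arr F g *\<^sub>E on_arr F f" by (simp add: loc_comp F app path_append)
  qed
  moreover have "func_eq_on C (F \<circ>\<^sub>F Q) H" unfolding func_eq_on_def by (auto simp: F) (simp add: F_def)
  ultimately show ?thesis by blast
qed

text \<open>A naturality square for \<open>s\<close>, composed on both sides with the images of the
  inverse of \<open>s\<close>, becomes a naturality square for that inverse. Hence naturality on
  arrows of \<open>C\<close> spreads along zigzags, with the same components.\<close>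

lemma (in loc) nat_isomorphic_Q:
  assumes "cat E" "is_functor L E F" "is_functor L E G" "nat_isomorphic C E (F \<circ>\<^sub>F Q) (G \<circ>\<^sub>F Q)"
  shows "nat_isomorphic L E F G"
proof -
  interpret F: fctr L E F using assms L.cat_axioms by (intro fctrI)
  interpret G: fctr L E G using assms L.cat_axioms by (intro fctrI)
  from assms(4) obtain \<tau> where
    \<tau>: "\<And>X. X \<in> Obj C \<Longrightarrow> \<tau> X \<in> Hom E (on_obj F X) (on_obj G X)"
       "\<And>X. X \<in> Obj C \<Longrightarrow> isomorphism E (\<tau> X)"
      "\<And>f. f \<in> Arr C \<Longrightarrow> on_arr G (on_arr Q f) *\<^sub>E \<tau> (Dom C f) = \<tau> (Cod C f) *\<^sub>E on_arr F (on_arr Q f)"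
    unfolding nat_isomorphic_def by auto
  note [simp del] = Q_simps(2) loc_simps(2)
  have nat: "on_arr G p *\<^sub>E \<tau> (Dom L p) = \<tau> (Cod L p) *\<^sub>E on_arr F p" if "p \<in> Arr L" for p using that
  proof (induction rule: loc_induct)
    case (ident X)
    then show ?case using \<tau>(1)[of X] by simp
  next
    case (fwd f p)
    have t: "\<tau> (Dom C f) \<in> Hom E (on_obj F (Dom C f)) (on_obj G (Dom C f))"
      "\<tau> (Cod C f) \<in> Hom E (on_obj F (Cod C f)) (on_obj G (Cod C f))"
      "\<tau> (Cod L p) \<in> Hom E (on_obj F (Cod L p)) (on_obj G (Cod L p))" using fwd \<tau>(1) L.Cod_Obj[of p] by auto
    have IH: "on_arr G p *\<^sub>E \<tau> (Cod C f) = \<tau> (Cod L p) *\<^sub>E on_arr F p" using fwd by simp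
    show ?case using fwd(1-3) t by (simp add: F.comp G.comp \<tau>(3) F.T.reduce[OF IH])
  next
    case (bwd s t p)
    have s: "s \<in> Arr C" using bwd by simp
    have t: "\<tau> (Dom C s) \<in> Hom E (on_obj F (Dom C s)) (on_obj G (Dom C s))"
      "\<tau> (Cod C s) \<in> Hom E (on_obj F (Cod C s)) (on_obj G (Cod C s))"
      "\<tau> (Cod L p) \<in> Hom E (on_obj F (Cod L p)) (on_obj G (Cod L p))" using s bwd \<tau>(1) L.Cod_Obj[of p] by auto
    have IH: "on_arr G p *\<^sub>E \<tau> (Dom C s) = \<tau> (Cod L p) *\<^sub>E on_arr F p" using bwd by simp
    have Gt: "on_arr G t *\<^sub>E on_arr G (on_arr Q s) = Id E (on_obj G (Dom C s))" using bwd s by (simp flip: G.comp)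
    have Ft: "on_arr F (on_arr Q s) *\<^sub>E on_arr F t = Id E (on_obj F (Cod C s))" using bwd s by (simp flip: F.comp)
    have "on_arr G t *\<^sub>E \<tau> (Cod C s) =
        on_arr G t *\<^sub>E \<tau> (Cod C s) *\<^sub>E (on_arr F (on_arr Q s) *\<^sub>E on_arr F t)" using bwd(2) s t Ft by simp
    also have "\<dots> = on_arr G t *\<^sub>E (\<tau> (Cod C s) *\<^sub>E on_arr F (on_arr Q s)) *\<^sub>E on_arr F t" using bwd(2) s t by simp
    also have "\<dots> = (on_arr G t *\<^sub>E on_arr G (on_arr Q s)) *\<^sub>E \<tau> (Dom C s) *\<^sub>E on_arr F t"
      unfolding \<tau>(3)[OF s, symmetric] using bwd(2) s t by simp
    also have "\<dots> = \<tau> (Dom C s) *\<^sub>E on_arr F t" unfolding Gt using bwd(2) s t by simp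
    finally have n: "on_arr G t *\<^sub>E \<tau> (Cod C s) = \<tau> (Dom C s) *\<^sub>E on_arr F t" .
    show ?case using bwd(2,5,6) s t by (simp add: F.comp G.comp n F.T.reduce[OF IH])
  qed
  show ?thesis
  proof (rule nat_isomorphicI[where \<tau> = \<tau>])
    fix f X Y assume "f \<in> Hom L X Y"
    then show "on_arr G f *\<^sub>E \<tau> X = \<tau> Y *\<^sub>E on_arr F f" using nat[of f] by auto
  qed (use \<tau> in auto)
qed

section \<open>Serre quotients\<close>

lemma (in preadditive) mono_of_zero_kernel:
  assumes "is_kernel C f k" "Id C (Dom C k) = Zero C (Dom C k) (Dom C k)"
  shows "monomorphism C f"
proof (rule monoI[of f "Dom C f" "Cod C f"])
  note k = kernelD[OF assms(1)]
  show "f \<in> Hom C (Dom C f) (Cod C f)" using k by simp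
  fix W h assume h: "h \<in> Hom C W (Dom C f)" "f * h = Zero C W (Cod C f)"
  obtain u where u: "u \<in> Hom C W (Dom C k)" "k * u = h" using kernel_factor[OF assms(1) h] by blast
  have W: "W \<in> Obj C" using h by auto
  have "k * u = k * Zero C W (Dom C k)" using zero_arrows(2)[OF assms(2) u(1)] by simp
  then show "h = Zero C W (Dom C f)" using u k W by simp
qed

lemmas (in preadditive) epi_of_zero_cokernel =
  preadditive.mono_of_zero_kernel[OF preadditive_opcat, unfolded op_simps]

lemma (in preadditive) kernel_comp_iso:
  assumes "is_kernel C (f * j) k" "isomorphism C j" "f \<in> Arr C" "Dom C f = Cod C j"
  shows "is_kernel C f (j * k)"
proof -
  have j: "j \<in> Arr C" using assms(2) by (rule iso_Arr)
  note k = kernelD[OF assms(1)]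
  obtain i where i: "i \<in> Hom C (Cod C j) (Dom C j)" "j * i = Id C (Cod C j)" using assms(2) by (rule isoE)
  show ?thesis
  proof (rule kernelI[of _ "Dom C f" "Cod C f" _ "Dom C k"])
    show "monomorphism C (j * k)" using assms j k by (intro mono_comp kernel_mono[OF assms(1)] iso_mono) auto
    fix W h assume h: "h \<in> Hom C W (Dom C f)" "f * h = Zero C W (Cod C f)"
    have "(f * j) * (i * h) = f * ((j * i) * h)" using i(1) j h(1) assms by simp
    also have "\<dots> = Zero C W (Cod C f)" using h assms by (simp only: i(2)) simp
    finally obtain u where u: "u \<in> Hom C W (Dom C k)" "k * u = i * h"
      using kernel_factor[OF assms(1), of "i * h" W] assms j i(1) h(1) by auto
    have "(j * k) * u = (j * i) * h" using u i(1) j h(1) assms(3,4) k(1-3) by simp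
    then have "(j * k) * u = h" using h(1) assms(4) by (simp add: i(2))
    then show "\<exists>u\<in>Hom C W (Dom C k). (j * k) * u = h" using u(1) by blast
  qed (use j k assms(3,4) in auto)
qed

lemma zero_object_opcat [simp]: "zero_object (opcat A) = zero_object A" by (intro ext) (auto simp: zero_object_def)

lemma serreD:
  assumes "serre A S"
  shows "S \<subseteq> Obj A" "zero_object A Z \<Longrightarrow> Z \<in> S"
    "monomorphism A f \<Longrightarrow> Cod A f \<in> S \<Longrightarrow> Dom A f \<in> S"
    "epimorphism A f \<Longrightarrow> Dom A f \<in> S \<Longrightarrow> Cod A f \<in> S"
    "short_exact A f g \<Longrightarrow> Dom A f \<in> S \<Longrightarrow> Cod A g \<in> S \<Longrightarrow> Cod A f \<in> S" using assms unfolding serre_def by blast+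

lemma serre_opcatI:
  assumes "serre A S" shows "serre (opcat A) S"
proof -
  note s = serreD[OF assms]
  have "Dom A f \<in> S" if "short_exact A g f" "Cod A f \<in> S" "Dom A g \<in> S" for f g
  proof -
    have "Cod A g = Dom A f" using that(1) unfolding short_exact_def is_kernel_def by blast
    then show ?thesis using s(5)[OF that(1)] that(2,3) by simp
  qed
  then show ?thesis unfolding serre_def op_simps zero_object_opcat using s by blast
qed

lemma serre_opcat: "serre (opcat A) S \<longleftrightarrow> serre A S" using serre_opcatI[of A S] serre_opcatI[of "opcat A" S] by auto

lemma serre_isos_opcat [simp]: "serre_isos (opcat A) S = serre_isos A S" by (auto simp: serre_isos_def)

locale serre_quot = abelian A for A :: "('o, 'm) addcat" (structure) +
  fixes S :: "'o set"
  assumes serre: "serre A S"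
begin

abbreviation "W \<equiv> serre_isos A S"

lemma serre_quot_opcat: "serre_quot (opcat A) S"
  using abelian_opcat serre by (simp add: serre_quot_def serre_quot_axioms_def serre_opcat)

lemma S_zero: "Z \<in> Obj A \<Longrightarrow> Id A Z = Zero A Z Z \<Longrightarrow> Z \<in> S" using serreD(2)[OF serre] zero_object_iff by blast

lemma S_mono: "monomorphism A f \<Longrightarrow> Cod A f \<in> S \<Longrightarrow> Dom A f \<in> S"
  and S_epi: "epimorphism A f \<Longrightarrow> Dom A f \<in> S \<Longrightarrow> Cod A f \<in> S"
  and S_exact: "short_exact A f g \<Longrightarrow> Dom A f \<in> S \<Longrightarrow> Cod A g \<in> S \<Longrightarrow> Cod A f \<in> S" using serreD[OF serre] by blast+

text \<open>\<open>Dom A u\<close> is an extension of the image of \<open>u\<close>, a subobject of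
  \<open>Cod A u\<close>, by the kernel of \<open>u\<close>.\<close>

lemma S_extension:
  assumes k: "is_kernel A u k" "Dom A k \<in> S" and "Cod A u \<in> S"
  shows "Dom A u \<in> S"
proof -
  note kD = kernelD[OF k(1)]
  obtain I m e where f: "e \<in> Hom A (Dom A u) I" "m \<in> Hom A I (Cod A u)" "m * e = u"
    "monomorphism A m" "epimorphism A e" by (rule image_factor[of u "Dom A u" "Cod A u"]) (use kD in simp)
  have ke: "is_kernel A e k" using kernel_mono_comp[OF f(4), of e k] f(1-3) k by auto
  have "short_exact A k e" using ke epi_cokernel[OF f(5) ke] by (simp add: short_exact_def)
  moreover have "I \<in> S" using S_mono[OF f(4)] f(2) assms(3) by simp
  ultimately show ?thesis using S_exact[of k e] f(1) k(2) kD by simp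
qed

section \<open>Calculus of fractions for the arrows with kernel and cokernel in
  \<open>S\<close>\<close>

lemma W_Arr: "s \<in> W \<Longrightarrow> s \<in> Arr A" by (auto simp: serre_isos_def is_kernel_def)

text \<open>Membership in \<open>serre_isos\<close> supplies one kernel in \<open>S\<close>; any
  other is isomorphic to it, and \<open>S\<close> is closed under subobjects.\<close>

lemma W_kernel:
  assumes "s \<in> W" "is_kernel A s k" shows "Dom A k \<in> S"
proof -
  obtain l where l: "is_kernel A s l" "Dom A l \<in> S" using assms(1) by (auto simp: serre_isos_def)
  obtain j where "j \<in> Hom A (Dom A k) (Dom A l)" "isomorphism A j" using kernel_unique[OF assms(2) l(1)] by blast
  then show ?thesis using S_mono[OF iso_mono, of j] l(2) by auto
qed

text \<open>Kernel and cokernel of an isomorphism are zero objects, and these belong to every Serre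
  subcategory.\<close>

lemma W_Id: assumes "isomorphism A s" shows "s \<in> W"
proof -
  have s: "s \<in> Arr A" using assms by (rule iso_Arr)
  obtain k where k: "is_kernel A s k" using kernel_ex s by blast
  obtain c where c: "is_cokernel A s c" using cokernel_ex s by blast
  have "Dom A k \<in> S" by (rule S_zero) (use kernelD[OF k] kernel_of_mono[OF iso_mono[OF assms] k] in auto)
  moreover have "Cod A c \<in> S" by (rule S_zero) (use cokernelD[OF c]
      preadditive.kernel_of_mono[OF preadditive_opcat, unfolded op_simps, OF iso_epi[OF assms] c] in auto)
  ultimately show ?thesis using k c by (auto simp: serre_isos_def)
qed

text \<open>The arrow \<open>f\<close> restricts to \<open>u\<close> from the kernel of
  \<open>g * f\<close> to the kernel of \<open>g\<close>, and the kernel of \<open>u\<close> embeds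
  into the kernel of \<open>f\<close>. So \<open>S_extension\<close> applies.\<close>

lemma W_comp_kernel:
  assumes "f \<in> W" "g \<in> W" "Dom A g = Cod A f" "is_kernel A (g * f) k"
  shows "Dom A k \<in> S"
proof -
  have fg: "f \<in> Arr A" "g \<in> Arr A" using assms W_Arr by auto
  note kD = kernelD[OF assms(4)]
  have kf: "k \<in> Hom A (Dom A k) (Dom A f)" using kD fg assms by auto
  have gfk: "g * (f * k) = Zero A (Dom A k) (Cod A g)" using kD fg assms by simp
  obtain l where l: "is_kernel A g l" using kernel_ex fg by blast
  note lD = kernelD[OF l]
  obtain h where h: "is_kernel A f h" using kernel_ex fg by blast
  note hD = kernelD[OF h]
  obtain u where u: "u \<in> Hom A (Dom A k) (Dom A l)" "l * u = f * k"
    using kernel_factor[OF l, of "f * k" "Dom A k"] kf gfk fg assms by auto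
  obtain n where n: "is_kernel A u n" using kernel_ex u by auto
  note nD = kernelD[OF n]
  have "f * (k * n) = (f * k) * n" using kf nD(1-3) u(1) fg by simp
  also have "\<dots> = l * (u * n)" unfolding u(2)[symmetric] using lD(1-3) nD(1-3) u(1) by simp
  also have "\<dots> = Zero A (Dom A n) (Cod A f)" unfolding nD(4) using lD nD u assms by simp
  finally obtain v where v: "v \<in> Hom A (Dom A n) (Dom A h)" "h * v = k * n"
    using kernel_factor[OF h, of "k * n" "Dom A n"] kf nD u(1) by auto
  have "monomorphism A (h * v)" unfolding v(2)
    using kernel_mono[OF assms(4)] kernel_mono[OF n] u nD by (intro mono_comp) auto
  then have "monomorphism A v" using v(1) hD by (intro mono_left[of h v]) auto
  then have "Dom A n \<in> S" using S_mono[of v] v(1) W_kernel[OF assms(1) h] by auto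
  then show ?thesis using S_extension[OF n] u(1) W_kernel[OF assms(2) l] by auto
qed

interpretation op: serre_quot "opcat A" S by (rule serre_quot_opcat)

lemma W_cokernel: "s \<in> W \<Longrightarrow> is_cokernel A s c \<Longrightarrow> Cod A c \<in> S" using op.W_kernel by simp

lemma W_comp:
  assumes "f \<in> W" "g \<in> W" "Dom A g = Cod A f"
  shows "g * f \<in> W"
proof -
  have fg: "f \<in> Arr A" "g \<in> Arr A" using assms W_Arr by auto
  obtain k where k: "is_kernel A (g * f) k" using kernel_ex[of "g * f"] fg assms by auto
  obtain c where c: "is_cokernel A (g * f) c" using cokernel_ex[of "g * f"] fg assms by auto
  have "Dom A k \<in> S" by (rule W_comp_kernel[OF assms k])
  moreover have "Cod A c \<in> S" using op.W_comp_kernel[of g f c] assms c by simp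
  ultimately show ?thesis using k c by (auto simp: serre_isos_def)
qed

text \<open>The Ore condition. In a pullback square the kernel of \<open>q\<close> embeds into that
  of \<open>s\<close> by \<open>v\<close>, and the cokernel of \<open>q\<close> embeds into that of
  \<open>s\<close> by \<open>w\<close>.\<close>

lemma W_pullback:
  assumes "s \<in> W" "s \<in> Hom A X Z" "g \<in> Hom A Y Z"
  obtains P p q where "p \<in> Hom A P X" "q \<in> Hom A P Y" "s * p = g * q" "q \<in> W"
proof -
  obtain P p q where P: "p \<in> Hom A P X" "q \<in> Hom A P Y" "s * p = g * q"
    "\<And>W a b. a \<in> Hom A W X \<Longrightarrow> b \<in> Hom A W Y \<Longrightarrow> s * a = g * b \<Longrightarrow>
      \<exists>u\<in>Hom A W P. p * u = a \<and> q * u = b"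
    "\<And>W u v. u \<in> Hom A W P \<Longrightarrow> v \<in> Hom A W P \<Longrightarrow> p * u = p * v \<Longrightarrow> q * u = q * v \<Longrightarrow> u = v"
    by (rule pullback[OF assms(2,3)]) blast
  obtain k where k: "is_kernel A s k" using kernel_ex assms by auto
  note kD = kernelD[OF k]
  obtain n where n: "is_kernel A q n" using kernel_ex[of q] P(2) by auto
  note nD = kernelD[OF n]
  have "s * (p * n) = (s * p) * n" using P(1,2) nD(1-3) assms(2) by simp
  also have "\<dots> = g * (q * n)" unfolding P(3) using P(1,2) nD(1-3) assms(3) by simp
  also have "\<dots> = Zero A (Dom A n) Z" unfolding nD(4) using assms nD P by simp
  finally obtain v where v: "v \<in> Hom A (Dom A n) (Dom A k)" "k * v = p * n"
    using kernel_factor[OF k, of "p * n" "Dom A n"] P nD assms(2) by auto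
  \<comment> \<open>If \<open>v * h = 0\<close>, both projections of \<open>n * h\<close> vanish, so
    \<open>n * h = 0\<close> by uniqueness of arrows into the pullback.\<close>
  have "monomorphism A v"
  proof (rule monoI[OF v(1)])
    fix V h assume h: "h \<in> Hom A V (Dom A n)" "v * h = Zero A V (Dom A k)"
    have V: "V \<in> Obj A" using h by auto
    have "p * (n * h) = (k * v) * h" unfolding v(2) using P nD(1-3) h(1) by simp
    also have "\<dots> = k * (v * h)" using v(1) kD(1-3) h(1) by simp
    also have "\<dots> = Zero A V X" unfolding h(2) using kD V assms(2) by simp
    finally have p: "p * (n * h) = Zero A V X" .
    have "q * (n * h) = (q * n) * h" using P nD(1-3) h(1) by simp
    also have "\<dots> = Zero A V Y" unfolding nD(4) using h P by auto
    finally have q: "q * (n * h) = Zero A V Y" .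
    have "n * h = Zero A V P" using P(5)[of "n * h" V "Zero A V P"] p q V P(1,2) nD h(1) by auto
    then show "h = Zero A V (Dom A n)" using mono_Zero[OF kernel_mono[OF n] h(1)] nD P by simp
  qed
  then have N: "Dom A n \<in> S" using S_mono[of v] v(1) W_kernel[OF assms(1) k] by auto
  obtain c where c: "is_cokernel A s c" using cokernel_ex assms by auto
  note cD = cokernelD[OF c]
  obtain d where d: "is_cokernel A q d" using cokernel_ex[of q] P(2) by auto
  note dD = cokernelD[OF d]
  have "(c * g) * q = (c * s) * p" using P cD(1-3) assms by simp
  also have "\<dots> = Zero A P (Cod A c)" unfolding cD(4) using P assms cD by auto
  finally obtain w where w: "w \<in> Hom A (Cod A d) (Cod A c)" "w * d = c * g"
    using cokernel_factor[OF d, of "c * g" "Cod A c"] cD(1-3) assms P(2) by auto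
  have "monomorphism A w" by (rule pullback_cokernel_mono[OF assms(2,3) P(1,2,4) c _ cokernel_epi[OF d] _ w])
      (use dD P(2) in auto)
  then have "Cod A d \<in> S" using S_mono[of w] w(1) W_cokernel[OF assms(1) c] by auto
  then have "q \<in> W" using n N d by (auto simp: serre_isos_def)
  with P that show ?thesis by blast
qed

text \<open>The kernel of \<open>f\<close> serves as \<open>t\<close>. Its own kernel is zero, and
  its cokernel is the image of \<open>f\<close>, which lies in the kernel of \<open>s\<close> and
  hence in \<open>S\<close>.\<close>

lemma W_cancel:
  assumes "s \<in> W" "f \<in> Hom A X (Dom A s)" "s * f = Zero A X (Cod A s)"
  obtains t where "t \<in> W" "Cod A t = X" "f * t = Zero A (Dom A t) (Dom A s)"
proof -
  have s: "s \<in> Arr A" using assms(1) by (rule W_Arr)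
  obtain I m e where f: "e \<in> Hom A X I" "m \<in> Hom A I (Dom A s)" "m * e = f"
    "monomorphism A m" "epimorphism A e" by (rule image_factor[OF assms(2)])
  obtain t where t: "is_kernel A f t" using kernel_ex assms by auto
  note tD = kernelD[OF t]
  have te: "is_kernel A e t" using kernel_mono_comp[OF f(4), of e t] f(1-3) t by auto
  then have et: "is_cokernel A t e" using epi_cokernel f by blast
  obtain k where k: "is_kernel A s k" using kernel_ex s by auto
  note kD = kernelD[OF k]
  have "(s * m) * e = s * (m * e)" using s f(1,2) by simp
  then have "(s * m) * e = Zero A X (Cod A s)" by (simp only: f(3) assms(3))
  then have "s * m = Zero A I (Cod A s)" using epi_Zero[OF f(5), of "s * m" "Cod A s"] f(1,2) s by auto
  then obtain v where v: "v \<in> Hom A I (Dom A k)" "k * v = m" using kernel_factor[OF k, of m I] f(2) s by auto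
  have "monomorphism A v" using f(4) v kD by (intro mono_left[of k v]) auto
  then have "I \<in> S" using S_mono[of v] v(1) W_kernel[OF assms(1) k] by auto
  moreover obtain l where l: "is_kernel A t l" using kernel_ex tD by blast
  moreover have "Dom A l \<in> S" by (rule S_zero) (use kernelD[OF l] kernel_of_mono[OF kernel_mono[OF t] l] in auto)
  ultimately have "t \<in> W" using et f(1) by (auto simp: serre_isos_def)
  then show ?thesis using that[of t] tD assms(2) by simp
qed

lemmas W_pushout = serre_quot.W_pullback[OF serre_quot_opcat, unfolded op_simps serre_isos_opcat]
  and W_cancel_right = serre_quot.W_cancel[OF serre_quot_opcat, unfolded op_simps serre_isos_opcat]

end

text \<open>Sets over one type, as the target of a functor that separates arrows of the quotient.
  Arrows record source and target, and functions are extensional, so that equal maps are equal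
  arrows.\<close>

definition set_cat :: "('a set, 'a set \<times> 'a set \<times> ('a \<Rightarrow> 'a)) cat" where
  "set_cat = \<lparr>Obj = UNIV, Arr = {f. snd (snd f) \<in> fst f \<rightarrow>\<^sub>E fst (snd f)}, Dom = fst, Cod = (\<lambda>f. fst (snd f)),
     Id = (\<lambda>X. (X, X, \<lambda>x\<in>X. x)),
     Comp = (\<lambda>g f. (fst f, fst (snd g), compose (fst f) (snd (snd g)) (snd (snd f))))\<rparr>"

lemma set_cat: "cat set_cat" by unfold_locales
    (auto simp: set_cat_def Hom_def compose_def PiE_iff extensional_def fun_eq_iff Pi_iff, metis)

lemma set_cat_iso:
  assumes "f = (X, Y, h)" "h \<in> X \<rightarrow>\<^sub>E Y" "bij_betw h X Y"
  shows "isomorphism set_cat f"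
proof (rule cat.isoI[OF set_cat])
  let ?g = "(Y, X, \<lambda>y\<in>Y. inv_into X h y)"
  show "f \<in> Hom set_cat X Y" using assms by (auto simp: set_cat_def Hom_def)
  have "inv_into X h y \<in> X" if "y \<in> Y" for y using that assms(3) by (metis bij_betw_def inv_into_into)
  then show "?g \<in> Hom set_cat Y X" by (auto simp: set_cat_def Hom_def)
  show "?g *\<^bsub>set_cat\<^esub> f = Id set_cat X"
    using assms by (auto simp: set_cat_def compose_def bij_betw_def fun_eq_iff PiE_iff Pi_iff inv_into_f_f)
  show "f *\<^bsub>set_cat\<^esub> ?g = Id set_cat Y"
    using assms by (auto simp: set_cat_def compose_def fun_eq_iff bij_betw_inv_into_right)
qed

section \<open>Roofs, and when two arrows become equal in the quotient\<close>

context serre_quot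
begin

sublocale loc A W by unfold_locales (auto intro: W_Arr)

lemmas [simp del] = Q_simps(2) loc_simps(2)

text \<open>A pair \<open>(s, f)\<close> stands for \<open>f\<close> after the inverse of
  \<open>s\<close>.\<close>

definition roofs :: "'o \<Rightarrow> 'o \<Rightarrow> ('m \<times> 'm) set" where
  "roofs X Y = {(s, f). s \<in> W \<and> Cod A s = X \<and> f \<in> Hom A (Dom A s) Y}"

text \<open>Two roofs agree if they do so after a common refinement. It is the refined denominator
  \<open>fst r * u\<close> that must lie in \<open>W\<close>, not \<open>u\<close> itself.\<close>

definition roof_rel :: "'m \<times> 'm \<Rightarrow> 'm \<times> 'm \<Rightarrow> bool" where
  "roof_rel r r' \<longleftrightarrow> (\<exists>u u'. u \<in> Arr A \<and> u' \<in> Arr A \<and> Dom A u = Dom A u' \<and>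
     Cod A u = Dom A (fst r) \<and> Cod A u' = Dom A (fst r') \<and>
     fst r * u = fst r' * u' \<and> fst r * u \<in> W \<and> snd r * u = snd r' * u')"

lemma roof_rel_refl: "r \<in> roofs X Y \<Longrightarrow> roof_rel r r" unfolding roof_rel_def roofs_def
  by (rule exI[of _ "Id A (Dom A (fst r))"], rule exI[of _ "Id A (Dom A (fst r))"]) auto

lemma roof_rel_sym: "roof_rel r r' \<Longrightarrow> roof_rel r' r" unfolding roof_rel_def by metis

text \<open>\<open>W_pullback\<close> completes the two refinements to a square over the denominator
  \<open>s2\<close>. This square commutes a priori only after composition with \<open>s2\<close>;
  the difference is killed by \<open>s2\<close>, and \<open>W_cancel\<close> yields a further
  refinement \<open>t\<close> that kills it.\<close>

lemma roof_rel_trans: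
  assumes "r1 \<in> roofs X Y" "r2 \<in> roofs X Y" "r3 \<in> roofs X Y" "roof_rel r1 r2" "roof_rel r2 r3"
  shows "roof_rel r1 r3"
proof -
  obtain s1 f1 where r1: "r1 = (s1, f1)" "s1 \<in> W" "Cod A s1 = X" "f1 \<in> Hom A (Dom A s1) Y"
    using assms(1) by (auto simp: roofs_def)
  obtain s2 f2 where r2: "r2 = (s2, f2)" "s2 \<in> W" "Cod A s2 = X" "f2 \<in> Hom A (Dom A s2) Y"
    using assms(2) by (auto simp: roofs_def)
  obtain s3 f3 where r3: "r3 = (s3, f3)" "s3 \<in> W" "Cod A s3 = X" "f3 \<in> Hom A (Dom A s3) Y"
    using assms(3) by (auto simp: roofs_def)
  have sA: "s1 \<in> Arr A" "s2 \<in> Arr A" "s3 \<in> Arr A" using r1 r2 r3 by auto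
  obtain U u u' where u: "u \<in> Hom A U (Dom A s1)" "u' \<in> Hom A U (Dom A s2)"
    "s1 * u = s2 * u'" "s1 * u \<in> W" "f1 * u = f2 * u'" using assms(4) by (auto simp: roof_rel_def r1 r2)
  obtain V v v' where v: "v \<in> Hom A V (Dom A s2)" "v' \<in> Hom A V (Dom A s3)"
    "s2 * v = s3 * v'" "s2 * v \<in> W" "f2 * v = f3 * v'" using assms(5) by (auto simp: roof_rel_def r2 r3)
  obtain P p q where P: "p \<in> Hom A P U" "q \<in> Hom A P V" "(s2 * u') * p = (s2 * v) * q" "q \<in> W"
  proof (rule W_pullback[of "s2 * u'" U X "s2 * v" V])
    show "s2 * u' \<in> W" using u(3,4) by simp
    show "s2 * u' \<in> Hom A U X" "s2 * v \<in> Hom A V X" using u(2) v(1) r2(2,3) by auto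
  qed
  have "s2 * ((u' * p) \<boxplus> neg A (v * q)) = Zero A P X" using P u(2) v(1) r2 sA by (simp add: diff_eq_Zero)
  then obtain t where t: "t \<in> W" "Cod A t = P"
     "((u' * p) \<boxplus> neg A (v * q)) * t = Zero A (Dom A t) (Dom A s2)"
    using W_cancel[OF r2(2), of "(u' * p) \<boxplus> neg A (v * q)" P] P(1,2) u(2) v(1) r2(3) sA by auto
  have tA: "t \<in> Arr A" using t by auto
  have e: "u' * (p * t) = v * (q * t)"
    using t P(1,2) u(2) v(1) tA sA diff_eq_Zero[of "u' * (p * t)" "v * (q * t)" "Dom A t" "Dom A s2"] by simp
  have uv: "u \<in> Arr A" "v' \<in> Arr A" "u' \<in> Arr A" "v \<in> Arr A" using u v by auto
  have d: "Dom A u = U" "Cod A u = Dom A s1" "Dom A u' = U" "Cod A u' = Dom A s2"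
    "Dom A v = V" "Cod A v = Dom A s2" "Dom A v' = V" "Cod A v' = Dom A s3" using u v by auto
  have pq: "p \<in> Arr A" "q \<in> Arr A" "Dom A p = P" "Cod A p = U" "Dom A q = P" "Cod A q = V" using P by auto
  have 1: "s1 * (u * (p * t)) = s2 * (u' * (p * t))" using reduce[OF u(3), of "p * t"] uv d pq tA t(2) sA by simp
  have 2: "s2 * (v * (q * t)) = s3 * (v' * (q * t))" using reduce[OF v(3), of "q * t"] uv d pq tA t(2) sA by simp
  have 3: "f1 * (u * (p * t)) = f2 * (u' * (p * t))"
    using reduce[OF u(5), of "p * t"] uv d pq tA t(2) sA r1(4) r2(4) by simp
  have 4: "f2 * (v * (q * t)) = f3 * (v' * (q * t))"
    using reduce[OF v(5), of "q * t"] uv d pq tA t(2) sA r2(4) r3(4) by simp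
  have qt: "q * t \<in> W" by (rule W_comp) (use P(4) t pq in simp_all)
  have "(s2 * v) * (q * t) \<in> W" by (rule W_comp) (use v(4) qt t(2) tA pq d sA uv in simp_all)
  then have 5: "s1 * (u * (p * t)) \<in> W" using 1 e uv d pq tA t(2) sA by simp
  show ?thesis unfolding roof_rel_def by (rule exI[of _ "u * (p * t)"], rule exI[of _ "v' * (q * t)"])
      (use 1 2 3 4 5 e uv d pq tA t(2) sA r1 r3 in simp)
qed

definition roof_class :: "'o \<Rightarrow> 'o \<Rightarrow> 'm \<times> 'm \<Rightarrow> ('m \<times> 'm) set" where
  "roof_class X Y r = {r' \<in> roofs X Y. roof_rel r r'}"

lemma roof_class_eq:
  assumes "r \<in> roofs X Y" "r' \<in> roofs X Y"
  shows "roof_class X Y r = roof_class X Y r' \<longleftrightarrow> roof_rel r r'"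
proof
  assume "roof_class X Y r = roof_class X Y r'"
  moreover have "r' \<in> roof_class X Y r'" using assms roof_rel_refl by (auto simp: roof_class_def)
  ultimately show "roof_rel r r'" by (auto simp: roof_class_def)
next
  assume "roof_rel r r'"
  then show "roof_class X Y r = roof_class X Y r'"
    unfolding roof_class_def using assms roof_rel_sym roof_rel_trans by blast
qed

definition roof_act :: "'m \<Rightarrow> 'm \<times> 'm \<Rightarrow> 'm \<times> 'm" where
  "roof_act g r = (fst r, g * snd r)"

lemma roof_act: "r \<in> roofs X Y \<Longrightarrow> g \<in> Hom A Y Z \<Longrightarrow> roof_act g r \<in> roofs X Z" by (auto simp: roofs_def roof_act_def)

lemma roof_act_rel:
  assumes "r \<in> roofs X Y" "r' \<in> roofs X Y" "g \<in> Hom A Y Z" "roof_rel r r'"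
  shows "roof_rel (roof_act g r) (roof_act g r')"
proof -
  obtain u u' where u: "u \<in> Arr A" "u' \<in> Arr A" "Dom A u = Dom A u'"
     "Cod A u = Dom A (fst r)" "Cod A u' = Dom A (fst r')"
     "fst r * u = fst r' * u'" "fst r * u \<in> W" "snd r * u = snd r' * u'"
    using assms(4) unfolding roof_rel_def by blast
  have e: "(g * snd r) * u = (g * snd r') * u'"
  proof -
    have f: "snd r \<in> Hom A (Dom A (fst r)) Y" "snd r' \<in> Hom A (Dom A (fst r')) Y"
      using assms by (auto simp: roofs_def)
    then have "(g * snd r) * u = g * (snd r * u)" using assms(3) u(1-5) by simp
    also have "\<dots> = (g * snd r') * u'" unfolding u(8) using assms(3) u(1-5) f by simp
    finally show ?thesis .
  qed
  show ?thesis unfolding roof_rel_def roof_act_def fst_conv snd_conv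
    by (rule exI[of _ u], rule exI[of _ u'], intro conjI) (rule u e)+
qed

definition roof_set :: "'o \<Rightarrow> 'o \<Rightarrow> ('m \<times> 'm) set set" where
  "roof_set X Y = roof_class X Y ` roofs X Y"

text \<open>The class of a roof is pushed forward along \<open>g\<close> through a chosen
  representative; \<open>roof_func_arr\<close> shows that the choice is immaterial.\<close>

definition roof_func :: "'o \<Rightarrow> ('o, 'm, ('m \<times> 'm) set set,
    ('m \<times> 'm) set set \<times> ('m \<times> 'm) set set \<times> (('m \<times> 'm) set \<Rightarrow> ('m \<times> 'm) set)) func" where
  "roof_func X = \<lparr>on_obj = roof_set X, on_arr = (\<lambda>g. (roof_set X (Dom A g), roof_set X (Cod A g),
     \<lambda>c\<in>roof_set X (Dom A g). roof_class X (Cod A g) (roof_act g (SOME r. r \<in> c \<inter> roofs X (Dom A g)))))\<rparr>"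

lemma roof_func_arr:
  assumes "g \<in> Hom A Y Z" "r \<in> roofs X Y"
  shows "snd (snd (on_arr (roof_func X) g)) (roof_class X Y r) = roof_class X Z (roof_act g r)"
proof -
  let ?r = "SOME r'. r' \<in> roof_class X Y r \<inter> roofs X Y"
  have "r \<in> roof_class X Y r \<inter> roofs X Y" using assms roof_rel_refl by (auto simp: roof_class_def)
  then have r: "?r \<in> roof_class X Y r \<inter> roofs X Y" by (rule someI)
  then have "roof_rel r ?r" by (auto simp: roof_class_def)
  then have "roof_class X Z (roof_act g r) = roof_class X Z (roof_act g ?r)"
    using roof_class_eq roof_act roof_act_rel assms r by blast
  then show ?thesis using assms by (auto simp: roof_func_def roof_set_def)
qed

lemma roof_functor: "is_functor A set_cat (roof_func X)"
proof (rule is_functorI)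
  fix Y assume Y: "Y \<in> Obj A"
  show "on_obj (roof_func X) Y \<in> Obj set_cat" by (simp add: set_cat_def)
  have "snd (snd (on_arr (roof_func X) (Id A Y))) c = c" if c: "c \<in> roof_set X Y" for c
  proof -
    obtain r where r: "r \<in> roofs X Y" "c = roof_class X Y r" using c by (auto simp: roof_set_def)
    then have "roof_act (Id A Y) r = r" by (auto simp: roof_act_def roofs_def)
    with r Y roof_func_arr[of "Id A Y" Y Y r X] show ?thesis by simp
  qed
  then show "on_arr (roof_func X) (Id A Y) = Id set_cat (on_obj (roof_func X) Y)"
    using Y by (auto simp: set_cat_def roof_func_def fun_eq_iff)
next
  fix f Y Z assume f: "f \<in> Hom A Y Z"
  have "snd (snd (on_arr (roof_func X) f)) c \<in> roof_set X Z" if c: "c \<in> roof_set X Y" for c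
    using c roof_func_arr[OF f] roof_act[OF _ f] by (auto simp: roof_set_def)
  then show "on_arr (roof_func X) f \<in> Hom set_cat (on_obj (roof_func X) Y) (on_obj (roof_func X) Z)"
    using f by (auto simp: set_cat_def roof_func_def Hom_def)
next
  fix f g U Y Z assume f: "f \<in> Hom A U Y" and g: "g \<in> Hom A Y Z"
  have gf: "g * f \<in> Hom A U Z" using f g by simp
  have "snd (snd (on_arr (roof_func X) (g * f))) c =
     snd (snd (on_arr (roof_func X) g)) (snd (snd (on_arr (roof_func X) f)) c)"
    if c: "c \<in> roof_set X U" for c
  proof -
    obtain r where r: "r \<in> roofs X U" "c = roof_class X U r" using c by (auto simp: roof_set_def)
    then have "roof_act (g * f) r = roof_act g (roof_act f r)" using f g by (auto simp: roof_act_def roofs_def)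
    with r roof_func_arr[OF f r(1)] roof_func_arr[OF gf r(1)] roof_func_arr[OF g roof_act[OF r(1) f]]
    show ?thesis by simp
  qed
  then show "on_arr (roof_func X) (g * f) = on_arr (roof_func X) g *\<^bsub>set_cat\<^esub> on_arr (roof_func X) f"
    using f g by (auto simp: set_cat_def roof_func_def compose_def fun_eq_iff)
qed

text \<open>Injectivity comes from \<open>W_cancel\<close>, which removes \<open>t\<close> from an
  equation of numerators. For surjectivity, \<open>W_pullback\<close> of \<open>t\<close> and
  \<open>f\<close> turns a roof \<open>(s, f)\<close> into one whose numerator ends with
  \<open>t\<close>.\<close>

lemma roof_func_iso:
  assumes "t \<in> W"
  shows "isomorphism set_cat (on_arr (roof_func X) t)"
proof -
  let ?Y = "Dom A t" and ?Z = "Cod A t" and ?h = "snd (snd (on_arr (roof_func X) t))"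
  have tA: "t \<in> Arr A" and tH: "t \<in> Hom A ?Y ?Z" using assms by auto
  have "inj_on ?h (roof_set X ?Y)"
  proof (rule inj_onI)
    fix c c' assume "c \<in> roof_set X ?Y" "c' \<in> roof_set X ?Y" and e: "?h c = ?h c'"
    then obtain r r' where r: "r \<in> roofs X ?Y" "r' \<in> roofs X ?Y" "c = roof_class X ?Y r" "c' = roof_class X ?Y r'"
      by (auto simp: roof_set_def)
    then have "roof_rel (roof_act t r) (roof_act t r')"
      using e roof_func_arr[OF tH] roof_class_eq roof_act[OF _ tH] by simp
    then obtain u u' where u: "u \<in> Arr A" "u' \<in> Arr A" "Dom A u = Dom A u'"
     "Cod A u = Dom A (fst r)" "Cod A u' = Dom A (fst r')"
     "fst r * u = fst r' * u'" "fst r * u \<in> W" "(t * snd r) * u = (t * snd r') * u'"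
      unfolding roof_rel_def by (auto simp: roof_act_def)
    have f: "snd r \<in> Hom A (Dom A (fst r)) ?Y" "snd r' \<in> Hom A (Dom A (fst r')) ?Y"
      "fst r \<in> Arr A" "fst r' \<in> Arr A" using r by (auto simp: roofs_def)
    let ?d = "(snd r * u) \<boxplus> neg A (snd r' * u')"
    have "t * ?d = Zero A (Dom A u) ?Z" using u(1-5,8) f tA by (simp add: diff_eq_Zero)
    then obtain w where w: "w \<in> W" "Cod A w = Dom A u" "?d * w = Zero A (Dom A w) ?Y"
      using W_cancel[OF assms, of ?d "Dom A u"] u(1-5) f by auto
    have wA: "w \<in> Arr A" using w by auto
    have e2: "snd r * (u * w) = snd r' * (u' * w)"
      using w u(1-5) f wA diff_eq_Zero[of "snd r * (u * w)" "snd r' * (u' * w)" "Dom A w" ?Y] by simp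
    have "(fst r * u) * w \<in> W" by (rule W_comp) (use u(1-5,7) w f in auto)
    moreover have "fst r * (u * w) = fst r' * (u' * w)" using reduce[OF u(6), of w] u(1-5) f w(2) wA by simp
    ultimately have "roof_rel r r'" unfolding roof_rel_def using e2 u(1-5) f w(2) wA
      by (intro exI[of _ "u * w"] exI[of _ "u' * w"]) simp
    then show "c = c'" using r roof_class_eq by simp
  qed
  moreover have "?h ` roof_set X ?Y = roof_set X ?Z"
  proof (intro equalityI subsetI)
    fix c assume "c \<in> ?h ` roof_set X ?Y"
    then show "c \<in> roof_set X ?Z" using roof_func_arr[OF tH] roof_act[OF _ tH] by (auto simp: roof_set_def)
  next
    fix c assume "c \<in> roof_set X ?Z"
    then obtain s f where c: "(s, f) \<in> roofs X ?Z" "c = roof_class X ?Z (s, f)" by (auto simp: roof_set_def)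
    then have sf: "s \<in> W" "Cod A s = X" "f \<in> Hom A (Dom A s) ?Z" "s \<in> Arr A" by (auto simp: roofs_def)
    obtain P p q where P: "p \<in> Hom A P ?Y" "q \<in> Hom A P (Dom A s)" "t * p = f * q" "q \<in> W"
      by (rule W_pullback[OF assms tH sf(3)])
    let ?r = "(s * q, p)"
    have sq: "s * q \<in> W" by (rule W_comp) (use sf P in auto)
    then have r: "?r \<in> roofs X ?Y" using sf P by (auto simp: roofs_def)
    have "roof_rel (roof_act t ?r) (s, f)" unfolding roof_rel_def roof_act_def
      by (rule exI[of _ "Id A P"], rule exI[of _ q]) (use P sf sq tA in auto)
    then have "c = ?h (roof_class X ?Y ?r)"
      using c roof_func_arr[OF tH r] roof_class_eq roof_act[OF r tH] roof_rel_sym by simp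
    then show "c \<in> ?h ` roof_set X ?Y" using r by (auto simp: roof_set_def)
  qed
  ultimately have b: "bij_betw ?h (roof_set X ?Y) (roof_set X ?Z)" by (simp add: bij_betw_def)
  show ?thesis by (rule set_cat_iso[OF _ _ b]) (use b in \<open>auto simp: roof_func_def bij_betw_def\<close>)
qed

text \<open>The functor sending \<open>Y\<close> to the set of roofs from \<open>X\<close> to \<open>Y\<close> inverts \<open>W\<close> and hence
  separates arrows of the localisation.\<close>

lemma Q_eqD:
  assumes "f \<in> Hom A X Y" "g \<in> Hom A X Y" "on_arr Q f = on_arr Q g"
  obtains t where "t \<in> W" "Cod A t = X" "f * t = g * t"
proof -
  obtain F where F: "is_functor L set_cat F" "func_eq_on A (F \<circ>\<^sub>F Q) (roof_func X)"
    using universal[OF set_cat roof_functor roof_func_iso] by blast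
  have e: "on_arr (roof_func X) f = on_arr (roof_func X) g"
    using assms(1,2) F(2) unfolding func_eq_on_def by (metis Hom_iff assms(3) comp_func_simps(2))
  have X: "X \<in> Obj A" using assms by auto
  \<comment> \<open>As in the Yoneda lemma, \<open>f\<close> and \<open>g\<close> are recovered from
    their action on the class of the identity roof.\<close>
  let ?r = "(Id A X, Id A X)"
  have IW: "Id A X \<in> W" using X by (intro W_Id) auto
  then have r: "?r \<in> roofs X X" using X by (auto simp: roofs_def)
  have "roof_rel (roof_act f ?r) (roof_act g ?r)" using roof_func_arr[OF assms(1) r] roof_func_arr[OF assms(2) r] e
      roof_class_eq[OF roof_act[OF r assms(1)] roof_act[OF r assms(2)]] by simp
  then obtain u where "u \<in> Arr A" "Cod A u = X" "u \<in> W" "f * u = g * u"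
    unfolding roof_rel_def roof_act_def using assms X by auto
  with that show ?thesis by blast
qed

section \<open>Arrows of the quotient as fractions\<close>

abbreviation "q \<equiv> on_arr Q"

lemma q_W_iso: "s \<in> W \<Longrightarrow> isomorphism L (q s)" by (rule Q_iso)

lemma q_eqI:
  assumes "f \<in> Hom A X Y" "g \<in> Hom A X Y" "t \<in> W" "Cod A t = X" "f * t = g * t"
  shows "q f = q g"
proof (rule L.iso_cancel_right[OF q_W_iso[OF assms(3)]])
  show "q f *\<^sub>L q t = q g *\<^sub>L q t" using assms by (simp flip: Q.comp)
qed (use assms in auto)

text \<open>Induction along a zigzag: a forward step is moved past the denominator by
  \<open>W_pullback\<close>, a backward step is absorbed into the denominator. The relation is
  written as \<open>p\<close> times \<open>q s\<close> so that no inverse has to be named.\<close>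

lemma fraction:
  assumes "p \<in> Arr L"
  obtains s f where "s \<in> W" "Cod A s = Dom L p" "f \<in> Hom A (Dom A s) (Cod L p)" "p *\<^sub>L q s = q f"
proof -
  have "\<exists>s f. s \<in> W \<and> Cod A s = Dom L p \<and> f \<in> Hom A (Dom A s) (Cod L p) \<and> p *\<^sub>L q s = q f" using assms
  proof (induction rule: loc_induct)
    case (ident X)
    then show ?case by (intro exI[of _ "Id A X"]) (simp add: W_Id flip: Q.comp)
  next
    case (fwd g p)
    then obtain s f where s: "s \<in> W" "Cod A s = Cod A g" "f \<in> Hom A (Dom A s) (Cod L p)"
      "p *\<^sub>L q s = q f" by auto
    obtain P a b where P: "a \<in> Hom A P (Dom A s)" "b \<in> Hom A P (Dom A g)" "s * a = g * b" "b \<in> W"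
      by (rule W_pullback[OF s(1), of "Dom A s" "Cod A g" g "Dom A g"]) (use s fwd in auto)
    have "(p *\<^sub>L q g) *\<^sub>L q b = p *\<^sub>L q (g * b)" using fwd(1-3) P(1,2) by (simp add: Q.comp)
    also have "\<dots> = (p *\<^sub>L q s) *\<^sub>L q a"
      unfolding P(3)[symmetric] using fwd(1-3) P(1,2) s(1,2) by (simp add: Q.comp)
    also have "\<dots> = q (f * a)" unfolding s(4) using s(3) P(1) by (simp add: Q.comp)
    finally have "(p *\<^sub>L q g) *\<^sub>L q b = q (f * a)" .
    with P s fwd(1-3) show ?case by (intro exI[of _ b] exI[of _ "f * a"]) simp
  next
    case (bwd z t p)
    then obtain s f where s: "s \<in> W" "Cod A s = Dom A z" "f \<in> Hom A (Dom A s) (Cod L p)"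
      "p *\<^sub>L q s = q f" by auto
    have zs: "z * s \<in> W" by (rule W_comp) (use s bwd in auto)
    have "(p *\<^sub>L t) *\<^sub>L q (z * s) = p *\<^sub>L ((t *\<^sub>L q z) *\<^sub>L q s)" using bwd(1,2,5,6) s(1,2) by (simp add: Q.comp)
    also have "\<dots> = q f" unfolding bwd(3) using s bwd(1) by simp
    finally have "(p *\<^sub>L t) *\<^sub>L q (z * s) = q f" .
    with zs s bwd(1,2,5,6) show ?case by (intro exI[of _ "z * s"] exI[of _ f]) simp
  qed
  then show ?thesis using that by blast
qed

text \<open>A pushout of \<open>s\<close> along \<open>f\<close> turns the right fraction into a
  left one; that the two agree is seen after cancelling the isomorphism \<open>q s\<close>.\<close>

lemma fraction_left:
  assumes "p \<in> Arr L"
  obtains s f where "s \<in> W" "Dom A s = Cod L p" "f \<in> Hom A (Dom L p) (Cod A s)" "q s *\<^sub>L p = q f"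
proof -
  obtain s f where s: "s \<in> W" "Cod A s = Dom L p" "f \<in> Hom A (Dom A s) (Cod L p)" "p *\<^sub>L q s = q f"
    using assms by (rule fraction)
  have sH: "s \<in> Hom A (Dom A s) (Dom L p)" using s by auto
  obtain P a b where P: "a \<in> Hom A (Dom L p) P" "b \<in> Hom A (Cod L p) P" "a * s = b * f" "b \<in> W"
    by (rule W_pushout[OF s(1) sH s(3)])
  have "(q b *\<^sub>L p) *\<^sub>L q s = q b *\<^sub>L q f" unfolding s(4)[symmetric] using P(1,2) s(1,2) assms by simp
  also have "\<dots> = q (b * f)" using P(2) s(3) by (simp add: Q.comp)
  also have "\<dots> = q a *\<^sub>L q s" unfolding P(3)[symmetric] using P(1) sH by (simp add: Q.comp)
  finally have e: "(q b *\<^sub>L p) *\<^sub>L q s = q a *\<^sub>L q s" .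
  have "q b *\<^sub>L p = q a"
    by (rule L.iso_cancel_right[OF q_W_iso[OF s(1)] _ _ _ _ e]) (use P(1,2) assms s(1,2) in auto)
  with P that show ?thesis by auto
qed

lemma refine_fraction:
  assumes "p *\<^sub>L q s = q f" "p \<in> Arr L" "s \<in> Arr A" "Cod A s = Dom L p" "f \<in> Hom A (Dom A s) (Cod L p)"
    "a \<in> Arr A" "Cod A a = Dom A s"
  shows "p *\<^sub>L q (s * a) = q (f * a)" using assms L.reduce[OF assms(1), of "q a"] by (simp add: Q.comp)

text \<open>The denominator can be taken to be a refinement of a prescribed \<open>s\<close>.
  Iterated, this gives common denominators for arrows with the same source.\<close>

lemma fraction_with:
  assumes "p \<in> Arr L" "s \<in> W" "Cod A s = Dom L p"
  obtains a f where "a \<in> Arr A" "Cod A a = Dom A s" "s * a \<in> W" "f \<in> Hom A (Dom A a) (Cod L p)"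
    "p *\<^sub>L q (s * a) = q f"
proof -
  obtain t g where t: "t \<in> W" "Cod A t = Dom L p" "g \<in> Hom A (Dom A t) (Cod L p)" "p *\<^sub>L q t = q g"
    using assms(1) by (rule fraction)
  have tH: "t \<in> Hom A (Dom A t) (Dom L p)" "s \<in> Hom A (Dom A s) (Dom L p)" using t assms by auto
  obtain P a b where P: "a \<in> Hom A P (Dom A s)" "b \<in> Hom A P (Dom A t)" "s * a = t * b" "b \<in> W"
    by (rule W_pullback[OF assms(2) tH(2,1)])
  have "p *\<^sub>L q (s * a) = q (g * b)" unfolding P(3) by (rule refine_fraction[OF t(4)]) (use assms t P in auto)
  moreover have "s * a \<in> W" unfolding P(3) by (rule W_comp) (use t P in auto)
  ultimately show ?thesis using that[of a "g * b"] P(1,2) t(3) by auto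
qed

lemma fractions2:
  assumes "p \<in> Hom L X Y" "r \<in> Hom L X Z"
  obtains s f g where "s \<in> W" "Cod A s = X" "f \<in> Hom A (Dom A s) Y" "g \<in> Hom A (Dom A s) Z"
    "p *\<^sub>L q s = q f" "r *\<^sub>L q s = q g"
proof -
  have A: "p \<in> Arr L" "r \<in> Arr L" using assms by auto
  obtain s f where s: "s \<in> W" "Cod A s = X" "f \<in> Hom A (Dom A s) Y" "p *\<^sub>L q s = q f"
    using fraction[OF A(1)] assms by auto
  obtain a g where a: "a \<in> Arr A" "Cod A a = Dom A s" "s * a \<in> W" "g \<in> Hom A (Dom A a) Z"
    "r *\<^sub>L q (s * a) = q g" using fraction_with[OF A(2) s(1)] assms s by auto
  have "p *\<^sub>L q (s * a) = q (f * a)" by (rule refine_fraction[OF s(4)]) (use assms s a in auto)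
  with that[of "s * a" "f * a" g] a s show ?thesis by auto
qed

lemma fractions3:
  assumes "p \<in> Hom L X Y" "r \<in> Hom L X Z" "u \<in> Hom L X V"
  obtains s f g h where "s \<in> W" "Cod A s = X" "f \<in> Hom A (Dom A s) Y" "g \<in> Hom A (Dom A s) Z"
    "h \<in> Hom A (Dom A s) V"
    "p *\<^sub>L q s = q f" "r *\<^sub>L q s = q g" "u *\<^sub>L q s = q h"
proof -
  obtain s f g where s: "s \<in> W" "Cod A s = X" "f \<in> Hom A (Dom A s) Y" "g \<in> Hom A (Dom A s) Z"
    "p *\<^sub>L q s = q f" "r *\<^sub>L q s = q g" by (rule fractions2[OF assms(1,2)])
  have A: "u \<in> Arr L" using assms by auto
  obtain a h where a: "a \<in> Arr A" "Cod A a = Dom A s" "s * a \<in> W" "h \<in> Hom A (Dom A a) V"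
    "u *\<^sub>L q (s * a) = q h" using fraction_with[OF A s(1)] assms s by auto
  have "p *\<^sub>L q (s * a) = q (f * a)" by (rule refine_fraction[OF s(5)]) (use assms s a in auto)
  moreover have "r *\<^sub>L q (s * a) = q (g * a)" by (rule refine_fraction[OF s(6)]) (use assms s a in auto)
  ultimately show ?thesis using that[of "s * a" "f * a" "g * a" h] a s by auto
qed

section \<open>Addition of arrows in the quotient\<close>

lemma q_Add_cong:
  assumes "f \<in> Hom A X Y" "f' \<in> Hom A X Y" "g \<in> Hom A X Y" "g' \<in> Hom A X Y" "q f = q f'" "q g = q g'"
  shows "q (f \<boxplus> g) = q (f' \<boxplus> g')"
proof -
  obtain t where t: "t \<in> W" "Cod A t = X" "f * t = f' * t" using Q_eqD assms by metis
  obtain u where u: "u \<in> W" "Cod A u = X" "g * u = g' * u" using Q_eqD assms by metis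
  have H: "t \<in> Hom A (Dom A t) X" "u \<in> Hom A (Dom A u) X" using t u by auto
  obtain P a b where P: "a \<in> Hom A P (Dom A t)" "b \<in> Hom A P (Dom A u)" "t * a = u * b" "b \<in> W"
    by (rule W_pullback[OF t(1) H])
  have ub: "u * b \<in> W" by (rule W_comp) (use u P in auto)
  have "f * (u * b) = f' * (u * b)" unfolding P(3)[symmetric] using reduce[OF t(3), of a] assms(1,2) H P(1) by simp
  moreover have "g * (u * b) = g' * (u * b)" using reduce[OF u(3), of b] assms(3,4) H P(2) by simp
  ultimately show ?thesis using assms(1-4) H P(2) by (intro q_eqI[OF _ _ ub, of _ X Y]) auto
qed

text \<open>A sum is first described as a relation, through some common denominator. Existence
  follows from \<open>fractions2\<close> and \<open>divide_W\<close>, independence of the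
  denominator from \<open>add_rel_unique\<close>.\<close>

definition add_rel :: "('o, 'm) larr \<Rightarrow> ('o, 'm) larr \<Rightarrow> ('o, 'm) larr \<Rightarrow> bool" where
  "add_rel p r w \<longleftrightarrow> w \<in> Hom L (Dom L p) (Cod L p) \<and> (\<exists>s f g. s \<in> W \<and> Cod A s = Dom L p \<and>
     f \<in> Hom A (Dom A s) (Cod L p) \<and> g \<in> Hom A (Dom A s) (Cod L p) \<and>
     p *\<^sub>L q s = q f \<and> r *\<^sub>L q s = q g \<and> w *\<^sub>L q s = q (f \<boxplus> g))"

lemma divide_W:
  assumes "s \<in> W" "f \<in> Hom A (Dom A s) Y"
  obtains w where "w \<in> Hom L (Cod A s) Y" "w *\<^sub>L q s = q f"
proof -
  obtain t where t: "t \<in> Hom L (Cod A s) (Dom A s)" "t *\<^sub>L q s = Id L (Dom A s)"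
    using L.isoE[OF q_W_iso[OF assms(1)]] assms(1) by auto
  show ?thesis by (rule that[of "q f *\<^sub>L t"]) (use assms t in auto)
qed

lemma W_cancel_q:
  assumes "s \<in> W" "p \<in> Hom L (Cod A s) Y" "r \<in> Hom L (Cod A s) Y" "p *\<^sub>L q s = r *\<^sub>L q s"
  shows "p = r" by (rule L.iso_cancel_right[OF q_W_iso[OF assms(1)] _ _ _ _ assms(4)]) (use assms in auto)

text \<open>Two denominators are refined to the common one \<open>t * b\<close>. There the
  numerators agree in the quotient, so by \<open>q_Add_cong\<close> their sums do, and the
  isomorphism \<open>q (t * b)\<close> can be cancelled.\<close>

lemma add_rel_unique:
  assumes "add_rel p r w" "add_rel p r w'" "p \<in> Hom L X Y" "r \<in> Hom L X Y"
  shows "w = w'"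
proof -
  obtain s f g where s: "s \<in> W" "Cod A s = X" "f \<in> Hom A (Dom A s) Y" "g \<in> Hom A (Dom A s) Y"
    "p *\<^sub>L q s = q f" "r *\<^sub>L q s = q g" "w *\<^sub>L q s = q (f \<boxplus> g)" "w \<in> Hom L X Y"
    using assms unfolding add_rel_def by auto
  obtain t f' g' where t: "t \<in> W" "Cod A t = X" "f' \<in> Hom A (Dom A t) Y" "g' \<in> Hom A (Dom A t) Y"
    "p *\<^sub>L q t = q f'" "r *\<^sub>L q t = q g'" "w' *\<^sub>L q t = q (f' \<boxplus> g')" "w' \<in> Hom L X Y"
    using assms unfolding add_rel_def by auto
  have H: "s \<in> Hom A (Dom A s) X" "t \<in> Hom A (Dom A t) X" using t s by auto
  obtain P a b where P: "a \<in> Hom A P (Dom A s)" "b \<in> Hom A P (Dom A t)" "s * a = t * b" "b \<in> W"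
    by (rule W_pullback[OF s(1) H])
  have tb: "t * b \<in> W" by (rule W_comp) (use t P in auto)
  have 1: "p *\<^sub>L q (s * a) = q (f * a)" "r *\<^sub>L q (s * a) = q (g * a)"
      "w *\<^sub>L q (s * a) = q ((f \<boxplus> g) * a)"
    using refine_fraction[OF s(5), of a] refine_fraction[OF s(6), of a] refine_fraction[OF s(7), of a]
      s(2-4,8) assms(3,4) H P(1) by simp_all
  have 2: "p *\<^sub>L q (t * b) = q (f' * b)" "r *\<^sub>L q (t * b) = q (g' * b)"
      "w' *\<^sub>L q (t * b) = q ((f' \<boxplus> g') * b)"
    using refine_fraction[OF t(5), of b] refine_fraction[OF t(6), of b] refine_fraction[OF t(7), of b]
      t(2-4,8) assms(3,4) H P(2) by simp_all
  have "q ((f * a) \<boxplus> (g * a)) = q ((f' * b) \<boxplus> (g' * b))"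
    by (rule q_Add_cong[of _ P Y]) (use 1[unfolded P(3)] 2 s(3,4) t(3,4) P(1,2) in simp_all)
  then have "w *\<^sub>L q (t * b) = w' *\<^sub>L q (t * b)" using 1(3) 2(3) s(3,4) t(3,4) P(1,2) unfolding P(3) by simp
  then show ?thesis using W_cancel_q[OF tb] s(8) t(2,8) P(2) H by auto
qed

definition quot_Add :: "('o, 'm) larr \<Rightarrow> ('o, 'm) larr \<Rightarrow> ('o, 'm) larr" where
  "quot_Add p r = (THE w. add_rel p r w)"

lemma quot_Add:
  assumes "p \<in> Hom L X Y" "r \<in> Hom L X Y"
  shows "add_rel p r (quot_Add p r)"
proof -
  obtain s f g where s: "s \<in> W" "Cod A s = X" "f \<in> Hom A (Dom A s) Y" "g \<in> Hom A (Dom A s) Y"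
    "p *\<^sub>L q s = q f" "r *\<^sub>L q s = q g" by (rule fractions2[OF assms])
  obtain w where w: "w \<in> Hom L (Cod A s) Y" "w *\<^sub>L q s = q (f \<boxplus> g)"
    by (rule divide_W[OF s(1), of "f \<boxplus> g" Y]) (use s in auto)
  have a: "add_rel p r w" unfolding add_rel_def using s w assms by auto
  show ?thesis unfolding quot_Add_def by (rule theI[of _ w]) (use a add_rel_unique[OF _ _ assms] in blast)+
qed

lemma quot_Add_Hom:
  assumes "p \<in> Hom L X Y" "r \<in> Hom L X Y"
  shows "quot_Add p r \<in> Hom L X Y" using quot_Add[OF assms] assms unfolding add_rel_def by auto

lemma quot_Add_eq:
  assumes "p \<in> Hom L X Y" "r \<in> Hom L X Y" "s \<in> W" "Cod A s = X" "f \<in> Hom A (Dom A s) Y"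
    "g \<in> Hom A (Dom A s) Y" "p *\<^sub>L q s = q f" "r *\<^sub>L q s = q g"
  shows "quot_Add p r *\<^sub>L q s = q (f \<boxplus> g)"
proof -
  obtain w where w: "w \<in> Hom L (Cod A s) Y" "w *\<^sub>L q s = q (f \<boxplus> g)"
    by (rule divide_W[OF assms(3), of "f \<boxplus> g" Y]) (use assms in auto)
  have "add_rel p r w" unfolding add_rel_def using assms w by auto
  then show ?thesis using add_rel_unique[OF quot_Add _ assms(1,2)] assms(1,2) w by auto
qed

lemma quot_Add_eqI:
  assumes "p \<in> Hom L X Y" "r \<in> Hom L X Y" "s \<in> W" "Cod A s = X" "f \<in> Hom A (Dom A s) Y"
    "g \<in> Hom A (Dom A s) Y" "p *\<^sub>L q s = q f" "r *\<^sub>L q s = q g"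
    and "w \<in> Hom L X Y" "w *\<^sub>L q s = q (f \<boxplus> g)"
  shows "quot_Add p r = w"
  using W_cancel_q[OF assms(3), of "quot_Add p r" Y w] quot_Add_Hom[OF assms(1,2)] quot_Add_eq[OF assms(1-8)] assms
  by auto

text \<open>Distributivity for arrows that come from \<open>A\<close>. For an arbitrary arrow of the
  quotient it will follow by clearing a denominator.\<close>

lemma quot_Add_q_left:
  assumes "p \<in> Hom L X Y" "r \<in> Hom L X Y" "a \<in> Hom A Y Z"
  shows "q a *\<^sub>L quot_Add p r = quot_Add (q a *\<^sub>L p) (q a *\<^sub>L r)"
proof -
  obtain s f g where s: "s \<in> W" "Cod A s = X" "f \<in> Hom A (Dom A s) Y" "g \<in> Hom A (Dom A s) Y"
    "p *\<^sub>L q s = q f" "r *\<^sub>L q s = q g" by (rule fractions2[OF assms(1,2)])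
  note h = quot_Add_Hom[OF assms(1,2)]
  have e: "(q a *\<^sub>L x) *\<^sub>L q s = q (a * y)" if "x *\<^sub>L q s = q y" "x \<in> Hom L X Y" "y \<in> Hom A (Dom A s) Y" for x y
    using that assms(3) s(1,2) by (simp add: Q.comp)
  show ?thesis by (rule quot_Add_eqI[of _ X Z _ s "a * f" "a * g", symmetric])
      (use assms s h e[OF s(5)] e[OF s(6)] e[OF quot_Add_eq[OF assms(1,2) s]] in auto)
qed

lemma quot_Add_q_right:
  assumes "p \<in> Hom L X Y" "r \<in> Hom L X Y" "a \<in> Hom A Z X"
  shows "quot_Add p r *\<^sub>L q a = quot_Add (p *\<^sub>L q a) (r *\<^sub>L q a)"
proof -
  obtain s f g where s: "s \<in> W" "Cod A s = X" "f \<in> Hom A (Dom A s) Y" "g \<in> Hom A (Dom A s) Y"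
    "p *\<^sub>L q s = q f" "r *\<^sub>L q s = q g" by (rule fractions2[OF assms(1,2)])
  note h = quot_Add_Hom[OF assms(1,2)]
  have H: "s \<in> Hom A (Dom A s) X" using s by auto
  obtain P b t where P: "b \<in> Hom A P (Dom A s)" "t \<in> Hom A P Z" "s * b = a * t" "t \<in> W"
    by (rule W_pullback[OF s(1) H assms(3)])
  have e: "(x *\<^sub>L q a) *\<^sub>L q t = q (y * b)" if x: "x *\<^sub>L q s = q y" "x \<in> Hom L X Y" "y \<in> Hom A (Dom A s) Y" for x y
  proof -
    have "(x *\<^sub>L q a) *\<^sub>L q t = x *\<^sub>L q (s * b)" unfolding P(3) using x(2) P(2) assms(3) by (simp add: Q.comp)
    also have "\<dots> = q (y * b)" by (rule refine_fraction[OF x(1)]) (use x s P in auto)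
    finally show ?thesis .
  qed
  show ?thesis by (rule quot_Add_eqI[of _ Z Y _ t "f * b" "g * b", symmetric])
      (use assms s(1-4) P(1,2,4) h e[OF s(5)] e[OF s(6)] e[OF quot_Add_eq[OF assms(1,2) s]] in auto)
qed

text \<open>The Serre quotient again, now as a record that also carries sums and zero arrows.
  \<open>localisation\<close> yields a plain category, so functors and isomorphisms are transferred
  between \<open>L\<close> and \<open>quot\<close>.\<close>

definition quot :: "('o, ('o, 'm) larr) addcat" where
  "quot = \<lparr>Obj = Obj L, Arr = Arr L, Dom = Dom L, Cod = Cod L, Id = Id L, Comp = Comp L,
     Add = quot_Add, Zero = (\<lambda>X Y. q (Zero A X Y))\<rparr>"

lemma quot_simps [simp]:
  "Obj quot = Obj A" "Arr quot = Arr L" "Dom quot = Dom L" "Cod quot = Cod L" "Id quot = Id L"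
  "Comp quot = Comp L" "Add quot = quot_Add" "Zero quot X Y = q (Zero A X Y)" by (simp_all add: quot_def)

lemma Hom_quot [simp]: "Hom quot X Y = Hom L X Y" by (simp add: Hom_def)

lemma quot_preadditive: "preadditive quot"
proof (intro preadditive.intro preadditive_axioms.intro)
  show "cat quot" using L.Dom_Obj L.Cod_Obj L.Id_Hom L.Comp_Hom L.Comp_Id_right L.Comp_Id_left L.Comp_assoc
    by unfold_locales simp_all
  fix X Y assume XY: "X \<in> Obj quot" "Y \<in> Obj quot"
  have Z: "q (Zero A X Y) \<in> Hom L X Y" using XY by auto
  have Z0: "quot_Add (q (Zero A X Y)) p = p" if p: "p \<in> Hom L X Y" for p
  proof -
    obtain s f where s: "s \<in> W" "Cod A s = X" "f \<in> Hom A (Dom A s) Y" "p *\<^sub>L q s = q f"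
      using fraction[of p] p by auto
    then show ?thesis
      using p XY by (intro quot_Add_eqI[OF Z p s(1,2), of "Zero A (Dom A s) Y" f]) (auto simp flip: Q.comp)
  qed
  show "comm_group (hom_group quot X Y)"
  proof (rule comm_groupI)
    fix p r assume pr: "p \<in> carrier (hom_group quot X Y)" "r \<in> carrier (hom_group quot X Y)"
    then have H: "p \<in> Hom L X Y" "r \<in> Hom L X Y" by (auto simp: hom_group_def)
    show "p \<otimes>\<^bsub>hom_group quot X Y\<^esub> r \<in> carrier (hom_group quot X Y)"
      using quot_Add_Hom[OF H] by (simp add: hom_group_def)
    obtain s f g where s: "s \<in> W" "Cod A s = X" "f \<in> Hom A (Dom A s) Y" "g \<in> Hom A (Dom A s) Y"
      "p *\<^sub>L q s = q f" "r *\<^sub>L q s = q g" by (rule fractions2[OF H])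
    have "quot_Add p r = quot_Add r p" using s H quot_Add_Hom[OF H(2,1)] quot_Add_eq[OF H(2,1) s(1,2,4,3,6,5)]
      by (intro quot_Add_eqI[OF H s(1-6)]) (simp_all add: Add_commute[of f g])
    then show "p \<otimes>\<^bsub>hom_group quot X Y\<^esub> r = r \<otimes>\<^bsub>hom_group quot X Y\<^esub> p" by (simp add: hom_group_def)
  next
    show "\<one>\<^bsub>hom_group quot X Y\<^esub> \<in> carrier (hom_group quot X Y)" using Z by (simp add: hom_group_def)
  next
    fix p r u assume "p \<in> carrier (hom_group quot X Y)" "r \<in> carrier (hom_group quot X Y)"
      "u \<in> carrier (hom_group quot X Y)"
    then have H: "p \<in> Hom L X Y" "r \<in> Hom L X Y" "u \<in> Hom L X Y" by (auto simp: hom_group_def)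
    obtain s f g h where s: "s \<in> W" "Cod A s = X" "f \<in> Hom A (Dom A s) Y" "g \<in> Hom A (Dom A s) Y"
      "h \<in> Hom A (Dom A s) Y"
      "p *\<^sub>L q s = q f" "r *\<^sub>L q s = q g" "u *\<^sub>L q s = q h" by (rule fractions3[OF H])
    have pr: "quot_Add p r \<in> Hom L X Y" "quot_Add r u \<in> Hom L X Y" using quot_Add_Hom H by blast+
    have 1: "quot_Add p r *\<^sub>L q s = q (f \<boxplus> g)" by (rule quot_Add_eq[OF H(1,2) s(1-4,6,7)])
    have 2: "quot_Add r u *\<^sub>L q s = q (g \<boxplus> h)" by (rule quot_Add_eq[OF H(2,3) s(1,2,4,5,7,8)])
    have H2: "f \<boxplus> g \<in> Hom A (Dom A s) Y" "g \<boxplus> h \<in> Hom A (Dom A s) Y" using s by auto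
    have "quot_Add (quot_Add p r) u = quot_Add p (quot_Add r u)"
    proof (rule quot_Add_eqI[OF pr(1) H(3) s(1,2) H2(1) s(5) 1 s(8)])
      show "quot_Add p (quot_Add r u) \<in> Hom L X Y" using quot_Add_Hom H pr by blast
      show "quot_Add p (quot_Add r u) *\<^sub>L q s = q ((f \<boxplus> g) \<boxplus> h)"
        using quot_Add_eq[OF H(1) pr(2) s(1-3) H2(2) s(6) 2] s(3-5) by (simp add: Add_assoc)
    qed
    then show "p \<otimes>\<^bsub>hom_group quot X Y\<^esub> r \<otimes>\<^bsub>hom_group quot X Y\<^esub> u =
        p \<otimes>\<^bsub>hom_group quot X Y\<^esub> (r \<otimes>\<^bsub>hom_group quot X Y\<^esub> u)" by (simp add: hom_group_def)
  next
    fix p assume "p \<in> carrier (hom_group quot X Y)"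
    then have H: "p \<in> Hom L X Y" by (auto simp: hom_group_def)
    show "\<one>\<^bsub>hom_group quot X Y\<^esub> \<otimes>\<^bsub>hom_group quot X Y\<^esub> p = p" using Z0[OF H] by (simp add: hom_group_def)
    obtain s f where s: "s \<in> W" "Cod A s = X" "f \<in> Hom A (Dom A s) Y" "p *\<^sub>L q s = q f"
      using fraction[of p] H by auto
    obtain w where w: "w \<in> Hom L (Cod A s) Y" "w *\<^sub>L q s = q (neg A f)"
      by (rule divide_W[OF s(1), of "neg A f" Y]) (use s in auto)
    have "quot_Add w p = q (Zero A X Y)"
      using s w H Z XY by (intro quot_Add_eqI[OF _ H s(1,2), of w "neg A f" f]) (auto simp flip: Q.comp)
    then show "\<exists>w\<in>carrier (hom_group quot X Y). w \<otimes>\<^bsub>hom_group quot X Y\<^esub> p = \<one>\<^bsub>hom_group quot X Y\<^esub>"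
      using w s by (auto simp: hom_group_def)
  qed
next
  fix p r h X Y Z assume "p \<in> Hom quot X Y" "r \<in> Hom quot X Y" "h \<in> Hom quot Y Z"
  then have H: "p \<in> Hom L X Y" "r \<in> Hom L X Y" "h \<in> Hom L Y Z" by auto
  \<comment> \<open>A left fraction is chosen for \<open>h\<close> because the isomorphism
    \<open>q t\<close> then stands on the far left and can be cancelled. For composition on the
    other side a right fraction plays this role.\<close>
  obtain t a where t: "t \<in> W" "Dom A t = Z" "a \<in> Hom A Y (Cod A t)" "q t *\<^sub>L h = q a"
    using fraction_left[of h] H by auto
  have tH: "t \<in> Hom A Z (Cod A t)" using t by auto
  note pr = quot_Add_Hom[OF H(1,2)]
  have hp: "h *\<^sub>L p \<in> Hom L X Z" "h *\<^sub>L r \<in> Hom L X Z" using H by auto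
  have e: "q t *\<^sub>L (h *\<^sub>L x) = q a *\<^sub>L x" if "x \<in> Hom L X Y" for x
    using L.reduce[OF t(4), of x] that H(3) t(1-3) by simp
  have "q t *\<^sub>L (h *\<^sub>L quot_Add p r) = q t *\<^sub>L quot_Add (h *\<^sub>L p) (h *\<^sub>L r)"
    using e[OF pr] e[OF H(1)] e[OF H(2)] quot_Add_q_left[OF H(1,2) t(3)] quot_Add_q_left[OF hp tH] by simp
  then have "h *\<^sub>L quot_Add p r = quot_Add (h *\<^sub>L p) (h *\<^sub>L r)"
    by (rule L.iso_cancel_left[OF q_W_iso[OF t(1)], rotated -1]) (use H pr quot_Add_Hom[OF hp] t tH in auto)
  then show "h *\<^bsub>quot\<^esub> (p \<boxplus>\<^bsub>quot\<^esub> r) = (h *\<^bsub>quot\<^esub> p) \<boxplus>\<^bsub>quot\<^esub> (h *\<^bsub>quot\<^esub> r)" by simp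
next
  fix p r h X Y Z assume "p \<in> Hom quot X Y" "r \<in> Hom quot X Y" "h \<in> Hom quot Z X"
  then have H: "p \<in> Hom L X Y" "r \<in> Hom L X Y" "h \<in> Hom L Z X" by auto
  obtain s a where s: "s \<in> W" "Cod A s = Z" "a \<in> Hom A (Dom A s) X" "h *\<^sub>L q s = q a"
    using fraction[of h] H by auto
  have sH: "s \<in> Hom A (Dom A s) Z" using s by auto
  note pr = quot_Add_Hom[OF H(1,2)]
  have hp: "p *\<^sub>L h \<in> Hom L Z Y" "r *\<^sub>L h \<in> Hom L Z Y" using H by auto
  have e: "(x *\<^sub>L h) *\<^sub>L q s = x *\<^sub>L q a" if "x \<in> Hom L X Y" for x using that H(3) s by simp
  have "(quot_Add p r *\<^sub>L h) *\<^sub>L q s = quot_Add (p *\<^sub>L h) (r *\<^sub>L h) *\<^sub>L q s"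
    unfolding quot_Add_q_right[OF hp sH] e[OF pr] e[OF H(1)] e[OF H(2)] quot_Add_q_right[OF H(1,2) s(3)] ..
  then have "quot_Add p r *\<^sub>L h = quot_Add (p *\<^sub>L h) (r *\<^sub>L h)"
    by (rule W_cancel_q[OF s(1), rotated -1]) (use H pr quot_Add_Hom[OF hp] s in auto)
  then show "(p \<boxplus>\<^bsub>quot\<^esub> r) *\<^bsub>quot\<^esub> h = (p *\<^bsub>quot\<^esub> h) \<boxplus>\<^bsub>quot\<^esub> (r *\<^bsub>quot\<^esub> h)" by simp
qed

end

text \<open>The assumptions are self-dual, so that half of the statements below follow from the other
  half by passing to opposite categories.\<close>

locale fraction_functor = abelian A + B: additive B + Q: addfun A B Q
  for A :: "('o, 'm) addcat" (structure) and B :: "('o, 'n) addcat" and Q +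
  fixes W :: "'m set"
  assumes Obj_eq [simp]: "Obj B = Obj A" and on_obj_eq [simp]: "on_obj Q X = X"
    and W_Arr [simp]: "s \<in> W \<Longrightarrow> s \<in> Arr A"
    and W_iso: "s \<in> W \<Longrightarrow> isomorphism B (on_arr Q s)"
    and fraction_right: "p \<in> Arr B \<Longrightarrow> \<exists>s f. s \<in> W \<and> Cod A s = Dom B p \<and>
      f \<in> Hom A (Dom A s) (Cod B p) \<and> p *\<^sub>B on_arr Q s = on_arr Q f"
    and fraction_left: "p \<in> Arr B \<Longrightarrow> \<exists>s f. s \<in> W \<and> Dom A s = Cod B p \<and>
      f \<in> Hom A (Dom B p) (Cod A s) \<and> on_arr Q s *\<^sub>B p = on_arr Q f"
    and Zero_right: "f \<in> Hom A X Y \<Longrightarrow> on_arr Q f = Zero B X Y \<Longrightarrow>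
      \<exists>t. t \<in> W \<and> Cod A t = X \<and> f * t = Zero A (Dom A t) Y"
    and Zero_left: "f \<in> Hom A X Y \<Longrightarrow> on_arr Q f = Zero B X Y \<Longrightarrow>
      \<exists>t. t \<in> W \<and> Dom A t = Y \<and> t * f = Zero A X (Cod A t)"
begin

abbreviation (input) "q \<equiv> on_arr Q"

lemma dual: "fraction_functor (opcat A) (opcat B) Q W"
proof (intro fraction_functor.intro fraction_functor_axioms.intro addfun.intro addfun_axioms.intro
    abelian_opcat B.additive_opcat preadditive_opcat B.preadditive_opcat)
  show "additive_functor (opcat A) (opcat B) Q" using Q.additive by (simp add: additive_functor_opcat)
qed (use W_iso fraction_right fraction_left Zero_right Zero_left in \<open>simp_all add: op_simps del: Hom_iff\<close>)

text \<open>A test arrow \<open>h\<close> is replaced by a numerator \<open>g\<close> in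
  \<open>A\<close>. What vanishes in \<open>B\<close> vanishes in \<open>A\<close> after a
  refinement, by \<open>Zero_right\<close>, and there the kernel property of \<open>k\<close>
  applies; the denominators are isomorphisms and are divided out at the end.\<close>

lemma q_kernel:
  assumes "is_kernel A f k"
  shows "is_kernel B (q f) (q k)"
proof -
  note kD = kernelD[OF assms]
  note m = kernel_mono[OF assms]
  let ?K = "Dom A k" and ?X = "Dom A f" and ?Y = "Cod A f"
  show ?thesis
  proof (rule B.kernelI[of _ ?X ?Y _ ?K])
    show "q f \<in> Hom B ?X ?Y" "q k \<in> Hom B ?K ?X" using kD by auto
    show "q f *\<^sub>B q k = Zero B ?K ?Y" using kD Q.comp_Zero[OF kD(4)] by auto
    show "monomorphism B (q k)"
    proof (rule B.monoI[of _ ?K ?X])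
      show "q k \<in> Hom B ?K ?X" using kD by auto
      fix V h assume h: "h \<in> Hom B V ?K" "q k *\<^sub>B h = Zero B V ?X"
      obtain s g where s: "s \<in> W" "Cod A s = V" "g \<in> Hom A (Dom A s) ?K" "h *\<^sub>B q s = q g"
        using fraction_right[of h] h by auto
      have O: "Dom A s \<in> Obj A" using s by simp
      have "q (k * g) = q k *\<^sub>B q g" using s(3) kD by (simp add: Q.comp)
      also have "\<dots> = (q k *\<^sub>B h) *\<^sub>B q s" unfolding s(4)[symmetric] using s(1,2) kD h(1) by simp
      also have "\<dots> = Zero B (Dom A s) ?X" unfolding h(2) using s(1,2) kD by simp
      finally obtain t where t: "t \<in> W" "Cod A t = Dom A s" "(k * g) * t = Zero A (Dom A t) ?X"
        using Zero_right[of "k * g" "Dom A s" ?X] s kD by auto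
      have gt: "g * t = Zero A (Dom A t) ?K" using mono_Zero[OF m, of "g * t" "Dom A t"] t s(3) kD by auto
      have "q g *\<^sub>B q t = Zero B (Dom A t) ?K" by (subst Q.comp[symmetric]) (use t(1,2) s(3) gt kD in simp_all)
      then have "q g = Zero B (Dom A s) ?K"
        using B.epi_Zero[OF B.iso_epi[OF W_iso[OF t(1)]], of "q g" ?K] t(1,2) s(3) by simp
      then show "h = Zero B V ?K" using B.epi_Zero[OF B.iso_epi[OF W_iso[OF s(1)]], of h ?K] s(1,2,4) h(1) by simp
    qed
    fix V h assume h: "h \<in> Hom B V ?X" "q f *\<^sub>B h = Zero B V ?Y"
    obtain s g where s: "s \<in> W" "Cod A s = V" "g \<in> Hom A (Dom A s) ?X" "h *\<^sub>B q s = q g"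
      using fraction_right[of h] h by auto
    have "q (f * g) = q f *\<^sub>B q g" using s(3) kD by (simp add: Q.comp)
    also have "\<dots> = (q f *\<^sub>B h) *\<^sub>B q s" unfolding s(4)[symmetric] using s(1,2) kD h(1) by simp
    also have "\<dots> = Zero B (Dom A s) ?Y" unfolding h(2) using s(1,2) kD by simp
    finally obtain t where t: "t \<in> W" "Cod A t = Dom A s" "(f * g) * t = Zero A (Dom A t) ?Y"
      using Zero_right[of "f * g" "Dom A s" ?Y] s kD by auto
    obtain u where u: "u \<in> Hom A (Dom A t) ?K" "k * u = g * t"
      using kernel_factor[OF assms, of "g * t" "Dom A t"] t s(3) kD by auto
    let ?r = "q s *\<^sub>B q t"
    have r: "isomorphism B ?r" by (rule B.iso_comp[OF W_iso[OF t(1)] W_iso[OF s(1)]]) (use s t in simp)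
    obtain i where i: "i \<in> Hom B V (Dom A t)" "i *\<^sub>B ?r = Id B (Dom A t)" using B.isoE[OF r] s(1,2) t(1,2) by auto
    have "(q k *\<^sub>B (q u *\<^sub>B i)) *\<^sub>B ?r = q k *\<^sub>B (q u *\<^sub>B (i *\<^sub>B ?r))"
      using i(1) u(1) kD(1-3) s(1,2) t(1,2) by simp
    also have "\<dots> = q (k * u)" unfolding i(2) using u(1) kD(1-3) by (simp add: Q.comp)
    also have "\<dots> = (h *\<^sub>B q s) *\<^sub>B q t" unfolding u(2) s(4) using s(3) t(1,2) by (simp add: Q.comp)
    also have "\<dots> = h *\<^sub>B ?r" using s(1,2) t(1,2) h(1) by simp
    finally have "q k *\<^sub>B (q u *\<^sub>B i) = h"
      by (rule B.iso_cancel_right[OF r, rotated -1]) (use i(1) u(1) kD s(1,2) t(1,2) h(1) in simp_all)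
    then show "\<exists>u\<in>Hom B V ?K. q k *\<^sub>B u = h" using i(1) u(1) by (intro bexI[of _ "q u *\<^sub>B i"]) simp_all
  qed
qed

lemmas q_cokernel = fraction_functor.q_kernel[OF dual, unfolded op_simps]

lemma fraction_kernel:
  assumes "p \<in> Arr B" "s \<in> W" "Cod A s = Dom B p" "p *\<^sub>B q s = q f" "is_kernel A f k"
  shows "is_kernel B p (q s *\<^sub>B q k)" by (rule B.kernel_comp_iso) (use assms q_kernel W_iso in auto)

lemma fraction_cokernel:
  assumes "p \<in> Arr B" "s \<in> W" "Cod A s = Dom B p" "p *\<^sub>B q s = q f"
  shows "is_cokernel B p c \<longleftrightarrow> is_cokernel B (q f) c" unfolding assms(4)[symmetric]
  by (rule B.cokernel_epi_comp[symmetric]) (use assms W_iso B.iso_epi in auto)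

lemma kernel_exists:
  assumes p: "p \<in> Arr B" shows "\<exists>k. is_kernel B p k"
proof -
  obtain s f where s: "s \<in> W" "Cod A s = Dom B p" "f \<in> Hom A (Dom A s) (Cod B p)" "p *\<^sub>B q s = q f"
    using fraction_right[OF p] by blast
  then show ?thesis using kernel_ex[of f] fraction_kernel[OF p s(1,2,4)] by auto
qed

text \<open>Up to an isomorphism of its source, \<open>p\<close> is the image of some
  \<open>f = m' * e\<close>. As \<open>q e\<close> is a monomorphism, the kernel of \<open>e\<close>
  goes to zero, and \<open>q e\<close>, being the cokernel of this zero arrow, is invertible. So
  \<open>p\<close> is isomorphic to \<open>q m'\<close>, the image of a kernel.\<close>

lemma mono_is_kernel:
  assumes m: "monomorphism B p" and c: "is_cokernel B p c"
  shows "is_kernel B c p"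
proof -
  have p: "p \<in> Arr B" using m by (simp add: monomorphism_def)
  obtain s f where s: "s \<in> W" "Cod A s = Dom B p" "f \<in> Hom A (Dom A s) (Cod B p)"
    "p *\<^sub>B q s = q f" using fraction_right[OF p] by blast
  obtain I m' e where f: "e \<in> Hom A (Dom A s) I" "m' \<in> Hom A I (Cod B p)" "m' * e = f"
    "monomorphism A m'" "epimorphism A e" by (rule image_factor[OF s(3)])
  have qf: "q f = q m' *\<^sub>B q e" unfolding f(3)[symmetric] using f(1,2) by (simp add: Q.comp)
  have "monomorphism B (p *\<^sub>B q s)" using m s(1,2) by (intro B.mono_comp B.iso_mono[OF W_iso]) auto
  then have me: "monomorphism B (q e)" unfolding s(4) qf using f(1,2) by (intro B.mono_left[of "q m'" "q e"]) auto
  obtain k where k: "is_kernel A e k" using kernel_ex[of e] f(1) by auto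
  have qee: "epimorphism B (q e)" using q_cokernel[OF epi_cokernel[OF f(5) k]] by (rule B.cokernel_epi)
  have k0: "q k = Zero B (Dom A k) (Dom A e)"
    using B.kernel_of_mono(1)[OF me q_kernel[OF k]] kernelD[OF k] f(1) by simp
  have "isomorphism B (q e)"
    using preadditive.kernel_Zero_iso[OF B.preadditive_opcat, unfolded op_simps, of "Dom A k" "Dom A e" "q e"]
      q_cokernel[OF epi_cokernel[OF f(5) k]] k0 kernelD[OF k] f(1) by simp
  moreover obtain t where t: "t \<in> Hom B (Cod A s) (Dom A s)" "q s *\<^sub>B t = Id B (Cod A s)"
    "isomorphism B t" using B.isoE[OF W_iso[OF s(1)]] s(1) by auto
  ultimately have j: "isomorphism B (q e *\<^sub>B t)" using f(1) by (intro B.iso_comp) auto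
  have "q m' *\<^sub>B (q e *\<^sub>B t) = (p *\<^sub>B q s) *\<^sub>B t" unfolding s(4) qf using f(1,2) t(1) by simp
  also have "\<dots> = p" using s(1,2) t p by simp
  finally have pe: "q m' *\<^sub>B (q e *\<^sub>B t) = p" .
  obtain d where d: "is_cokernel A m' d" using cokernel_ex[of m'] f(2) by auto
  have k1: "is_kernel B (q d) (q m')" by (rule q_kernel[OF mono_kernel[OF f(4) d]])
  have k2: "is_kernel B (q d) p" using B.kernel_iso[OF k1 j] f(1,2) t(1) unfolding pe by simp
  have "is_cokernel B (q m' *\<^sub>B q e) (q d)"
    using B.cokernel_epi_comp[OF qee, of "q m'" "q d"] q_cokernel[OF d] f(1,2) by simp
  then have "is_cokernel B p (q d)" unfolding fraction_cokernel[OF p s(1,2,4)] qf .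
  then obtain j where "j \<in> Hom B (Cod B (q d)) (Cod B c)" "j *\<^sub>B q d = c" "isomorphism B j"
    by (rule B.cokernel_unique[OF c]) (use B.isoE in blast)
  then show "is_kernel B c p" using B.kernel_mono_comp[OF B.iso_mono, of j "q d" p] k2 B.kernelD(1)[OF k2] by auto
qed

lemma target_abelian: "abelian B"
  by unfold_locales (use kernel_exists mono_is_kernel fraction_functor.kernel_exists[OF dual]
    fraction_functor.mono_is_kernel[OF dual] in \<open>simp_all add: op_simps\<close>)

lemma Q_exact: "exact_functor A B Q" by (rule exact_functorI[OF Q.additive q_kernel q_cokernel])

end

section \<open>The Serre quotient is abelian, and functors induced on it are exact\<close>

context serre_quot
begin

declare quot_simps [simp del] Hom_quot [simp del]

sublocale B: preadditive quot by (rule quot_preadditive)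

lemma Obj_quotI [simp]: "X \<in> Obj A \<Longrightarrow> X \<in> Obj quot" by (simp add: quot_simps)

lemma iso_quot: "isomorphism quot f \<longleftrightarrow> isomorphism L f" by (simp add: isomorphism_def quot_simps Hom_quot)

lemma is_functor_to_quot: "is_functor C quot F \<longleftrightarrow> is_functor C L F"
  by (simp add: is_functor_def quot_simps Hom_quot)

lemma is_functor_from_quot: "is_functor quot C F \<longleftrightarrow> is_functor L C F"
  by (simp add: is_functor_def quot_simps Hom_quot)

lemma nat_isomorphic_to_quot: "nat_isomorphic C quot F G \<longleftrightarrow> nat_isomorphic C L F G"
  by (simp add: nat_isomorphic_def quot_simps Hom_quot iso_quot)

lemma Q_additive: "additive_functor A quot Q" unfolding additive_functor_def
proof (intro conjI ballI)
  show "is_functor A quot Q" using Q_functor by (simp add: is_functor_to_quot)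
  fix X Y f g assume *: "X \<in> Obj A" "Y \<in> Obj A" "f \<in> Hom A X Y" "g \<in> Hom A X Y"
  have "quot_Add (q f) (q g) = q (f \<boxplus> g)"
    using * by (intro quot_Add_eqI[of _ X Y _ "Id A X" f g]) (auto simp: W_Id simp flip: Q.comp)
  then show "q (f \<boxplus> g) = q f \<boxplus>\<^bsub>quot\<^esub> q g" by (simp add: quot_simps)
qed

sublocale QB: addfun A quot Q by unfold_locales (rule Q_additive)

lemma B_iso: "s \<in> W \<Longrightarrow> isomorphism quot (q s)" using q_W_iso by (simp add: iso_quot)

lemmas B_fraction = fraction[folded quot_simps(2-6)]
  and B_fraction_left = fraction_left[folded quot_simps(2-6)]

lemma quot_additive: "additive quot"
proof
  obtain Z where Z: "Z \<in> Obj A" "Id A Z = Zero A Z Z" using zero_ex by blast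
  then have "Id quot Z = Zero quot Z Z" using QB.ident[of Z] by simp
  then show "\<exists>Z\<in>Obj quot. Id quot Z = Zero quot Z Z" using Z by (auto simp: quot_simps(1))
  fix X Y assume "X \<in> Obj quot" "Y \<in> Obj quot"
  then obtain P i j p r where "biprod X Y P i j p r" using biprod_ex[of X Y] by (auto simp: quot_simps(1))
  from QB.biprod[OF this] have "B.biprod X Y P (q i) (q j) (q p) (q r)" by simp
  then show "\<exists>P i j p q. B.biprod X Y P i j p q" by blast
qed

lemma q_Zero:
  assumes "f \<in> Hom A X Y" "q f = Zero quot X Y"
  obtains t where "t \<in> W" "Cod A t = X" "f * t = Zero A (Dom A t) Y"
proof -
  have XY: "X \<in> Obj A" "Y \<in> Obj A" using assms by auto
  then have "q f = q (Zero A X Y)" using assms(2) by simp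
  then obtain t where "t \<in> W" "Cod A t = X" "f * t = Zero A X Y * t"
    using Q_eqD[OF assms(1), of "Zero A X Y"] XY by auto
  then show ?thesis using that[of t] XY by simp
qed

sublocale frac: fraction_functor A quot Q W
proof (intro fraction_functor.intro fraction_functor_axioms.intro abelian_axioms quot_additive QB.addfun_axioms)
  fix f X Y assume f: "f \<in> Hom A X Y" "q f = Zero quot X Y"
  obtain t where t: "t \<in> W" "Cod A t = X" "f * t = Zero A (Dom A t) Y" by (rule q_Zero[OF f])
  then show "\<exists>t. t \<in> W \<and> Cod A t = X \<and> f * t = Zero A (Dom A t) Y" by blast
  show "\<exists>t. t \<in> W \<and> Dom A t = Y \<and> t * f = Zero A X (Cod A t)"
    by (rule W_cancel_right[OF t(1), of f Y]) (use f t in auto)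
next
  fix p assume p: "p \<in> Arr quot"
  show "\<exists>s f. s \<in> W \<and> Cod A s = Dom quot p \<and> f \<in> Hom A (Dom A s) (Cod quot p) \<and> p *\<^bsub>quot\<^esub> q s = q f"
    by (rule B_fraction[OF p]) blast
  show "\<exists>s f. s \<in> W \<and> Dom A s = Cod quot p \<and> f \<in> Hom A (Dom quot p) (Cod A s) \<and> q s *\<^bsub>quot\<^esub> p = q f"
    by (rule B_fraction_left[OF p]) blast
qed (simp_all add: B_iso quot_simps(1))

lemmas quot_abelian = frac.target_abelian and Q_exact = frac.Q_exact

text \<open>Every arrow of the quotient is, up to isomorphism, the image of an arrow of \<open>A\<close>.\<close>

lemma induced_exact:
  assumes E: "exact_fun A D E" and F: "is_functor quot D F" "func_eq_on A (F \<circ>\<^sub>F Q) E"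
  shows "exact_functor quot D F"
proof -
  interpret E: exact_fun A D E by fact
  interpret F: fctr quot D F using F(1) by unfold_locales
  have e: "on_arr F (q f) = on_arr E f" if "f \<in> Arr A" for f using F(2) that by (auto simp: func_eq_on_def)
  have o: "on_obj F X = on_obj E X" if "X \<in> Obj quot" for X
    using F(2) that by (auto simp: func_eq_on_def quot_simps(1))
  \<comment> \<open>These isomorphisms clear denominators in \<open>D\<close>: additivity, kernels
    and cokernels are all compared after multiplication with \<open>on_arr E s\<close>.\<close>
  have EW: "isomorphism D (on_arr E s)" if "s \<in> W" for s using F.iso[OF B_iso[OF that]] e that by simp
  show ?thesis
  proof (rule exact_functorI)
    show "additive_functor quot D F" unfolding additive_functor_def
    proof (intro conjI ballI F(1))
      fix X Y p r assume p: "p \<in> Hom quot X Y" "r \<in> Hom quot X Y"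
      then have pL: "p \<in> Hom L X Y" "r \<in> Hom L X Y" by (simp_all only: Hom_quot)
      obtain s f g where s: "s \<in> W" "Cod A s = X" "f \<in> Hom A (Dom A s) Y" "g \<in> Hom A (Dom A s) Y"
        "p *\<^sub>L q s = q f" "r *\<^sub>L q s = q g" by (rule fractions2[OF pL])
      have oX: "on_obj F X = on_obj E X" using o[of "Cod A s"] s(1,2) by auto
      have pr: "p \<boxplus>\<^bsub>quot\<^esub> r \<in> Hom quot X Y" using p by simp
      have "(p \<boxplus>\<^bsub>quot\<^esub> r) *\<^bsub>quot\<^esub> q s = q (f \<boxplus> g)" using quot_Add_eq[OF pL s] by (simp add: quot_simps)
      then have "on_arr F (p \<boxplus>\<^bsub>quot\<^esub> r) *\<^sub>D on_arr E s = on_arr E (f \<boxplus> g)"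
        using F.comp[of "q s" "p \<boxplus>\<^bsub>quot\<^esub> r"] pr s(1-4) e by (simp del: QB.Add)
      also have "\<dots> = on_arr E f \<boxplus>\<^sub>D on_arr E g" using s by simp
      also have "on_arr E f = on_arr F p *\<^sub>D on_arr E s"
        using F.comp[of "q s" p] p s(1-3) s(5)[folded quot_simps(6)] e by simp
      also have "on_arr E g = on_arr F r *\<^sub>D on_arr E s"
        using F.comp[of "q s" r] p s(1,2,4) s(6)[folded quot_simps(6)] e by simp
      also have "(on_arr F p *\<^sub>D on_arr E s) \<boxplus>\<^sub>D (on_arr F r *\<^sub>D on_arr E s) =
          (on_arr F p \<boxplus>\<^sub>D on_arr F r) *\<^sub>D on_arr E s" using p s(1,2) o by (subst E.T.Add_Comp) auto
      finally show "on_arr F (p \<boxplus>\<^bsub>quot\<^esub> r) = on_arr F p \<boxplus>\<^sub>D on_arr F r"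
        by (rule E.T.iso_cancel_right[OF EW[OF s(1)], rotated -1]) (use p pr s(1,2) oX in simp_all)
    qed
  next
    fix p k assume pk: "is_kernel quot p k"
    then have p: "p \<in> Arr quot" by (simp add: is_kernel_def)
    obtain s f where s: "s \<in> W" "Cod A s = Dom quot p" "f \<in> Hom A (Dom A s) (Cod quot p)"
      "p *\<^bsub>quot\<^esub> q s = q f" by (rule B_fraction[OF p])
    have fA: "f \<in> Arr A" using s by simp
    obtain l where l: "is_kernel A f l" using kernel_ex[OF fA] by blast
    note lD = kernelD[OF l]
    obtain j where j: "j \<in> Hom quot (Dom quot k) (Dom A l)" "(q s *\<^bsub>quot\<^esub> q l) *\<^bsub>quot\<^esub> j = k"
        "isomorphism quot j" using B.kernel_unique[OF pk frac.fraction_kernel[OF p s(1,2,4) l]] s lD by auto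
    have "on_arr F p *\<^sub>D on_arr E s = on_arr E f" using F.comp[of "q s" p] p s e by simp
    then have "is_kernel D (on_arr F p *\<^sub>D on_arr E s) (on_arr E l)" using E.kernel[OF l] by simp
    then have k1: "is_kernel D (on_arr F p) (on_arr E s *\<^sub>D on_arr E l)"
      by (rule E.T.kernel_comp_iso) (use EW s p o B.Dom_Obj[OF p] in simp_all)
    have "on_arr F k = (on_arr E s *\<^sub>D on_arr E l) *\<^sub>D on_arr F j"
      unfolding j(2)[symmetric] using j(1) s lD by (simp add: F.comp e o)
    moreover have "is_kernel D (on_arr F p) ((on_arr E s *\<^sub>D on_arr E l) *\<^sub>D on_arr F j)"
      by (rule E.T.kernel_iso[OF k1]) (use F.iso[OF j(3)] j(1) s lD o in simp_all)
    ultimately show "is_kernel D (on_arr F p) (on_arr F k)" by simp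
  next
    fix p c assume pc: "is_cokernel quot p c"
    then have p: "p \<in> Arr quot" by (simp add: is_cokernel_def)
    obtain s f where s: "s \<in> W" "Cod A s = Dom quot p" "f \<in> Hom A (Dom A s) (Cod quot p)"
      "p *\<^bsub>quot\<^esub> q s = q f" by (rule B_fraction[OF p])
    have fA: "f \<in> Arr A" using s by simp
    obtain d where d: "is_cokernel A f d" using cokernel_ex[OF fA] by blast
    note dD = cokernelD[OF d]
    have "is_cokernel quot (q f) c" using pc frac.fraction_cokernel[OF p s(1,2,4)] by blast
    then obtain j where j: "j \<in> Hom quot (Cod A d) (Cod quot c)" "j *\<^bsub>quot\<^esub> q d = c" "isomorphism quot j"
      using B.cokernel_unique[OF _ frac.q_cokernel[OF d], of c] dD by auto
    have c1: "is_cokernel D (on_arr E f) (on_arr E d)" by (rule E.cokernel[OF d])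
    have "on_arr F c = on_arr F j *\<^sub>D on_arr E d"
      unfolding j(2)[symmetric] using j(1) s dD by (simp add: F.comp e o)
    moreover have "is_cokernel D (on_arr E f) (on_arr F j *\<^sub>D on_arr E d)"
      by (rule E.T.cokernel_iso[OF c1]) (use F.iso[OF j(3)] j(1) s dD o in simp_all)
    moreover have "on_arr E f = on_arr F p *\<^sub>D on_arr E s" using F.comp[of "q s" p] p s e by simp
    ultimately have "is_cokernel D (on_arr F p *\<^sub>D on_arr E s) (on_arr F c)" by simp
    then show "is_cokernel D (on_arr F p) (on_arr F c)"
      using E.T.cokernel_epi_comp[OF E.T.iso_epi[OF EW[OF s(1)]], of "on_arr F p" "on_arr F c"] s p o B.Dom_Obj[OF p] by simp
  qed
qed

end

section \<open>Extending functors along projective presentations\<close>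

lemmas (in preadditive) cokernel_comp_iso =
  preadditive.kernel_comp_iso[OF preadditive_opcat, unfolded op_simps]

text \<open>The model for \<open>T\<close> is the Yoneda functor into coherent functors. The
  condition \<open>lift\<close> says that the objects \<open>T m\<close> are projective with respect
  to the presentations, and \<open>exact\<close> that \<open>\<alpha>\<close> generates all
  relations of \<open>\<pi>\<close>.\<close>

locale presentation = M: additive M + A: preadditive A + T: addfun M A T
  for M :: "('o, 'm) addcat" and A :: "('p, 'n) addcat" and T +
  assumes presentation_ex: "a \<in> Obj A \<Longrightarrow> \<exists>\<alpha> \<pi>. \<alpha> \<in> Arr M \<and> is_cokernel A (on_arr T \<alpha>) \<pi> \<and> Cod A \<pi> = a"
    and lift: "\<alpha> \<in> Arr M \<Longrightarrow> is_cokernel A (on_arr T \<alpha>) \<pi> \<Longrightarrow> m \<in> Obj M \<Longrightarrow>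
      h \<in> Hom A (on_obj T m) (Cod A \<pi>) \<Longrightarrow> \<exists>b\<in>Hom M m (Cod M \<alpha>). \<pi> *\<^sub>A on_arr T b = h"
    and exact: "\<alpha> \<in> Arr M \<Longrightarrow> is_cokernel A (on_arr T \<alpha>) \<pi> \<Longrightarrow> b \<in> Hom M m (Cod M \<alpha>) \<Longrightarrow>
      \<pi> *\<^sub>A on_arr T b = Zero A (on_obj T m) (Cod A \<pi>) \<Longrightarrow> \<exists>d\<in>Hom M m (Dom M \<alpha>). b = \<alpha> *\<^sub>M d"
begin

abbreviation "t \<equiv> on_arr T"
abbreviation "tO \<equiv> on_obj T"

definition "pres \<alpha> \<pi> \<longleftrightarrow> \<alpha> \<in> Arr M \<and> is_cokernel A (t \<alpha>) \<pi>"

lemma presD: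
  assumes "pres \<alpha> \<pi>"
  shows "\<alpha> \<in> Arr M" "is_cokernel A (t \<alpha>) \<pi>" "\<pi> \<in> Arr A" "Dom A \<pi> = tO (Cod M \<alpha>)"
    "\<pi> *\<^sub>A t \<alpha> = Zero A (tO (Dom M \<alpha>)) (Cod A \<pi>)" "epimorphism A \<pi>"
  using assms A.cokernelD[of "t \<alpha>" \<pi>] A.cokernel_epi unfolding pres_def by auto

lemma pres_lift:
  assumes "pres \<alpha> \<pi>" "m \<in> Obj M" "h \<in> Hom A (tO m) (Cod A \<pi>)"
  obtains b where "b \<in> Hom M m (Cod M \<alpha>)" "\<pi> *\<^sub>A t b = h" using assms lift unfolding pres_def by blast

text \<open>An object \<open>T m\<close> is presented by itself, with the zero arrow from a zero
  object as relations. This trivial presentation is what compares an extension with the given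
  functor on \<open>M\<close>.\<close>

lemma Id_pres:
  assumes "m \<in> Obj M"
  obtains \<zeta> where "pres \<zeta> (Id A (tO m))" "\<zeta> = Zero M (Dom M \<zeta>) m" "\<zeta> \<in> Arr M"
proof -
  obtain Z where Z: "Z \<in> Obj M" "Id M Z = Zero M Z Z" using M.zero_ex by blast
  have O: "tO m \<in> Obj A" "tO Z \<in> Obj A" using assms Z by auto
  have "is_cokernel A (t (Zero M Z m)) (Id A (tO m))"
  proof (rule A.cokernelI[of _ "tO Z" "tO m" _ "tO m"])
    show "epimorphism A (Id A (tO m))" using O by (intro A.iso_epi) auto
    fix W h assume "h \<in> Hom A (tO m) W"
    then show "\<exists>u\<in>Hom A (tO m) W. u *\<^sub>A Id A (tO m) = h" by auto
  qed (use O Z assms in auto)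
  then show ?thesis using that[of "Zero M Z m"] Z assms by (simp add: pres_def)
qed

end

text \<open>Both functors send a presentation of \<open>a\<close> to a cokernel, so the isomorphisms
  given on \<open>M\<close> pass to the quotients. Naturality may be tested after the epimorphism
  onto the value at \<open>a\<close>, where an arrow of \<open>A\<close> is replaced by a lift
  between generators.\<close>

lemma (in presentation) nat_isomorphic_unique:
  assumes X: "preadditive X" and H: "is_functor A X H" "is_functor A X H'"
    and pH: "\<And>\<alpha> \<pi>. pres \<alpha> \<pi> \<Longrightarrow> is_cokernel X (on_arr H (t \<alpha>)) (on_arr H \<pi>)"
    and pH': "\<And>\<alpha> \<pi>. pres \<alpha> \<pi> \<Longrightarrow> is_cokernel X (on_arr H' (t \<alpha>)) (on_arr H' \<pi>)"
    and n: "nat_isomorphic M X (H \<circ>\<^sub>F T) (H' \<circ>\<^sub>F T)"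
  shows "nat_isomorphic A X H H'"
proof -
  interpret X: preadditive X by fact
  interpret H: fctr A X H using H by unfold_locales
  interpret H': fctr A X H' using H by unfold_locales
  from n obtain \<sigma> where
    \<sigma>: "\<And>m. m \<in> Obj M \<Longrightarrow> \<sigma> m \<in> Hom X (on_obj H (tO m)) (on_obj H' (tO m))"
       "\<And>m. m \<in> Obj M \<Longrightarrow> isomorphism X (\<sigma> m)"
      "\<And>f. f \<in> Arr M \<Longrightarrow> on_arr H' (t f) *\<^sub>X \<sigma> (Dom M f) = \<sigma> (Cod M f) *\<^sub>X on_arr H (t f)"
    unfolding nat_isomorphic_def by auto
  obtain al pi where pr: "\<And>a. a \<in> Obj A \<Longrightarrow> pres (al a) (pi a) \<and> Cod A (pi a) = a"
    using presentation_ex unfolding pres_def by metis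
  have D: "al a \<in> Arr M" "pi a \<in> Arr A" "Dom A (pi a) = tO (Cod M (al a))" "Cod A (pi a) = a"
    "pres (al a) (pi a)" if "a \<in> Obj A" for a using pr[OF that] presD by auto
  have "\<exists>\<tau>. \<forall>a\<in>Obj A. \<tau> a \<in> Hom X (on_obj H a) (on_obj H' a) \<and> isomorphism X (\<tau> a) \<and>
      \<tau> a *\<^sub>X on_arr H (pi a) = on_arr H' (pi a) *\<^sub>X \<sigma> (Cod M (al a))"
  proof (intro bchoice ballI)
    fix a assume a: "a \<in> Obj A"
    note D = D[OF a]
    let ?s = "\<sigma> (Cod M (al a))"
    have s: "?s \<in> Hom X (on_obj H (tO (Cod M (al a)))) (on_obj H' (tO (Cod M (al a))))"
      "isomorphism X ?s" "isomorphism X (\<sigma> (Dom M (al a)))"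
      "\<sigma> (Dom M (al a)) \<in> Hom X (on_obj H (tO (Dom M (al a)))) (on_obj H' (tO (Dom M (al a))))" using \<sigma> D by auto
    have c: "is_cokernel X (on_arr H (t (al a))) (on_arr H (pi a))" by (rule pH[OF D(5)])
    have c': "is_cokernel X (on_arr H' (t (al a))) (on_arr H' (pi a))" by (rule pH'[OF D(5)])
    have "is_cokernel X (on_arr H' (t (al a)) *\<^sub>X \<sigma> (Dom M (al a))) (on_arr H' (pi a))"
      using X.cokernel_epi_comp[OF X.iso_epi[OF s(3)], of "on_arr H' (t (al a))" "on_arr H' (pi a)"] c' s(4) D by simp
    then have "is_cokernel X (?s *\<^sub>X on_arr H (t (al a))) (on_arr H' (pi a))" using \<sigma>(3)[OF D(1)] by simp
    then have "is_cokernel X (on_arr H (t (al a))) (on_arr H' (pi a) *\<^sub>X ?s)"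
      by (rule X.cokernel_comp_iso) (use s D in auto)
    from X.cokernel_unique[OF this c] obtain j where j: "j \<in> Hom X (on_obj H a) (on_obj H' a)"
       "j *\<^sub>X on_arr H (pi a) = on_arr H' (pi a) *\<^sub>X ?s" "isomorphism X j" using D s(1) a by auto
    then show "\<exists>j. j \<in> Hom X (on_obj H a) (on_obj H' a) \<and> isomorphism X j \<and>
      j *\<^sub>X on_arr H (pi a) = on_arr H' (pi a) *\<^sub>X ?s" by blast
  qed
  then obtain \<tau> where \<tau>: "\<And>a. a \<in> Obj A \<Longrightarrow> \<tau> a \<in> Hom X (on_obj H a) (on_obj H' a)"
    "\<And>a. a \<in> Obj A \<Longrightarrow> isomorphism X (\<tau> a)"
    "\<And>a. a \<in> Obj A \<Longrightarrow> \<tau> a *\<^sub>X on_arr H (pi a) = on_arr H' (pi a) *\<^sub>X \<sigma> (Cod M (al a))" by blast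
  show ?thesis
  proof (rule nat_isomorphicI[where \<tau> = \<tau>])
    fix f a a' assume f: "f \<in> Hom A a a'"
    then have O: "a \<in> Obj A" "a' \<in> Obj A" by auto
    let ?y = "Cod M (al a)" and ?y' = "Cod M (al a')"
    have y: "?y \<in> Obj M" "?y' \<in> Obj M" using D O by auto
    have fp: "f *\<^sub>A pi a \<in> Hom A (tO ?y) (Cod A (pi a'))" using f D[OF O(1)] D[OF O(2)] by simp
    obtain b where b: "b \<in> Hom M ?y ?y'" "pi a' *\<^sub>A t b = f *\<^sub>A pi a" by (rule pres_lift[OF D(5)[OF O(2)] y(1) fp])
    note st = \<tau>(1)[OF O(1)] \<tau>(1)[OF O(2)] \<sigma>(1)[OF y(1)] \<sigma>(1)[OF y(2)]
    have Hb: "on_arr H (pi a') *\<^sub>X on_arr H (t b) = on_arr H f *\<^sub>X on_arr H (pi a)"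
      "on_arr H' (pi a') *\<^sub>X on_arr H' (t b) = on_arr H' f *\<^sub>X on_arr H' (pi a)"
      using arg_cong[OF b(2), of "on_arr H"] arg_cong[OF b(2), of "on_arr H'"]
        b(1) f D(2-4)[OF O(1)] D(2-4)[OF O(2)] by (simp_all add: H.comp H'.comp)
    have nb: "on_arr H' (t b) *\<^sub>X \<sigma> ?y = \<sigma> ?y' *\<^sub>X on_arr H (t b)" using \<sigma>(3)[of b] b(1) by simp
    note DD = D(2-4)[OF O(1)] D(2-4)[OF O(2)]
    have "(\<tau> a' *\<^sub>X on_arr H f) *\<^sub>X on_arr H (pi a) = \<tau> a' *\<^sub>X (on_arr H (pi a') *\<^sub>X on_arr H (t b))"
      unfolding Hb(1) using st f DD by simp
    also have "\<dots> = (\<tau> a' *\<^sub>X on_arr H (pi a')) *\<^sub>X on_arr H (t b)" using st b(1) DD by simp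
    also have "\<dots> = on_arr H' (pi a') *\<^sub>X (\<sigma> ?y' *\<^sub>X on_arr H (t b))"
      unfolding \<tau>(3)[OF O(2)] using st b(1) DD by simp
    also have "\<dots> = (on_arr H' (pi a') *\<^sub>X on_arr H' (t b)) *\<^sub>X \<sigma> ?y"
      unfolding nb[symmetric] using st b(1) DD by simp
    also have "\<dots> = on_arr H' f *\<^sub>X (on_arr H' (pi a) *\<^sub>X \<sigma> ?y)" unfolding Hb(2) using st f DD by simp
    also have "\<dots> = (on_arr H' f *\<^sub>X \<tau> a) *\<^sub>X on_arr H (pi a)"
      unfolding \<tau>(3)[OF O(1), symmetric] using st f DD by simp
    finally have "\<tau> a' *\<^sub>X on_arr H f = on_arr H' f *\<^sub>X \<tau> a"
      by (rule X.epi_cancel[OF X.cokernel_epi[OF pH[OF D(5)[OF O(1)]]], rotated -1]) (use st f DD in simp_all)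
    then show "on_arr H' f *\<^sub>X \<tau> a = \<tau> a' *\<^sub>X on_arr H f" by simp
  qed (use \<tau> in auto)
qed

section \<open>Construction of the extension along presentations\<close>

locale pres_ext = presentation M A T + X: preadditive X + G: addfun M X G
  for M :: "('o, 'm) addcat" and A :: "('p, 'n) addcat" and T and X :: "('q, 'k) addcat" and G +
  assumes X_cokernel: "f \<in> Arr X \<Longrightarrow> \<exists>c. is_cokernel X f c"
begin

abbreviation "g \<equiv> on_arr G"
abbreviation "gO \<equiv> on_obj G"

text \<open>Two lifts of the same arrow differ by a relation, that is by an arrow of the form
  \<open>\<alpha> * d\<close>, and \<open>c\<close> kills the image of \<open>\<alpha>\<close>. This
  makes every choice of a lift harmless.\<close>

lemma cokernel_cong:
  assumes p: "pres \<alpha> \<pi>" and c: "is_cokernel X (g \<alpha>) c"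
    and b: "b \<in> Hom M m (Cod M \<alpha>)" "b' \<in> Hom M m (Cod M \<alpha>)" "\<pi> *\<^sub>A t b = \<pi> *\<^sub>A t b'"
  shows "c *\<^sub>X g b = c *\<^sub>X g b'"
proof -
  note pD = presD[OF p] and cD = X.cokernelD[OF c]
  let ?d = "b \<boxplus>\<^sub>M neg M b'"
  have "\<pi> *\<^sub>A t ?d = Zero A (tO m) (Cod A \<pi>)" using pD(1,3,4) b by (simp add: A.diff_eq_Zero)
  then obtain d where d: "d \<in> Hom M m (Dom M \<alpha>)" "?d = \<alpha> *\<^sub>M d" using exact[OF pD(1,2), of ?d m] b by auto
  have "c *\<^sub>X g ?d = (c *\<^sub>X g \<alpha>) *\<^sub>X g d" unfolding d(2) using cD(1-3) d(1) pD(1) by (simp add: G.comp)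
  also have "\<dots> = Zero X (gO m) (Cod X c)" unfolding cD(4) using cD(2) d(1) pD(1) by simp
  finally have "(c *\<^sub>X g b) \<boxplus>\<^sub>X neg X (c *\<^sub>X g b') = Zero X (gO m) (Cod X c)" using cD(2,3) b(1,2) pD(1) by simp
  then show ?thesis using cD(2,3) b(1,2) pD(1) by (subst (asm) X.diff_eq_Zero) auto
qed

text \<open>One presentation is fixed for each object; the extension takes \<open>a\<close> to the
  target of the cokernel \<open>co a\<close>.\<close>

definition "al a = (SOME \<alpha>. \<exists>\<pi>. pres \<alpha> \<pi> \<and> Cod A \<pi> = a)"
definition "pi a = (SOME \<pi>. pres (al a) \<pi> \<and> Cod A \<pi> = a)"
definition "co a = (SOME c. is_cokernel X (g (al a)) c)"

lemma chosen:
  assumes "a \<in> Obj A"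
  shows "pres (al a) (pi a)" "Cod A (pi a) = a" "is_cokernel X (g (al a)) (co a)"
proof -
  have "\<exists>\<alpha> \<pi>. pres \<alpha> \<pi> \<and> Cod A \<pi> = a" using presentation_ex[OF assms] by (auto simp: pres_def)
  then have "\<exists>\<pi>. pres (al a) \<pi> \<and> Cod A \<pi> = a" unfolding al_def by (rule someI_ex)
  then have *: "pres (al a) (pi a) \<and> Cod A (pi a) = a" unfolding pi_def by (rule someI_ex)
  then show "pres (al a) (pi a)" "Cod A (pi a) = a" by auto
  have "\<exists>c. is_cokernel X (g (al a)) c" using X_cokernel presD(1)[of "al a" "pi a"] * by simp
  then show "is_cokernel X (g (al a)) (co a)" unfolding co_def by (rule someI_ex)
qed

lemma chosenD:
  assumes "a \<in> Obj A"
  shows "al a \<in> Arr M" "pi a \<in> Arr A" "Dom A (pi a) = tO (Cod M (al a))" "Cod A (pi a) = a"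
    "pi a *\<^sub>A t (al a) = Zero A (tO (Dom M (al a))) a" "epimorphism A (pi a)"
    "co a \<in> Arr X" "Dom X (co a) = gO (Cod M (al a))" "epimorphism X (co a)"
  using presD[OF chosen(1)[OF assms]] chosen(2)[OF assms] X.cokernelD[OF chosen(3)[OF assms]]
    X.cokernel_epi[OF chosen(3)[OF assms]] by auto

text \<open>The condition is imposed for all lifts at once, so that any convenient lift can be used
  later. By \<open>cokernel_cong\<close> a single lift determines the arrow.\<close>

definition "is_ext \<phi> u \<longleftrightarrow> u \<in> Hom X (Cod X (co (Dom A \<phi>))) (Cod X (co (Cod A \<phi>))) \<and>
  (\<forall>b\<in>Hom M (Cod M (al (Dom A \<phi>))) (Cod M (al (Cod A \<phi>))).
     pi (Cod A \<phi>) *\<^sub>A t b = \<phi> *\<^sub>A pi (Dom A \<phi>) \<longrightarrow> u *\<^sub>X co (Dom A \<phi>) = co (Cod A \<phi>) *\<^sub>X g b)"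

definition "ext = \<lparr>on_obj = (\<lambda>a. Cod X (co a)), on_arr = (\<lambda>\<phi>. SOME u. is_ext \<phi> u)\<rparr>"

abbreviation "xA \<equiv> on_arr ext"
abbreviation "xO \<equiv> on_obj ext"

lemma arrow_lift:
  assumes "\<phi> \<in> Hom A a a'"
  obtains b where "b \<in> Hom M (Cod M (al a)) (Cod M (al a'))" "pi a' *\<^sub>A t b = \<phi> *\<^sub>A pi a"
proof -
  have O: "a \<in> Obj A" "a' \<in> Obj A" using assms by auto
  show ?thesis by (rule pres_lift[OF chosen(1)[OF O(2)], of "Cod M (al a)" "\<phi> *\<^sub>A pi a"])
      (use that assms chosenD[OF O(1)] chosenD(4)[OF O(2)] in auto)
qed

lemma ext_arr:
  assumes \<phi>: "\<phi> \<in> Hom A a a'"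
  shows "xA \<phi> \<in> Hom X (xO a) (xO a')"
    and "b \<in> Hom M (Cod M (al a)) (Cod M (al a')) \<Longrightarrow> pi a' *\<^sub>A t b = \<phi> *\<^sub>A pi a \<Longrightarrow>
      xA \<phi> *\<^sub>X co a = co a' *\<^sub>X g b"
proof -
  have O: "a \<in> Obj A" "a' \<in> Obj A" using \<phi> by auto
  note D = chosenD[OF O(1)] and D' = chosenD[OF O(2)]
  obtain b where b: "b \<in> Hom M (Cod M (al a)) (Cod M (al a'))" "pi a' *\<^sub>A t b = \<phi> *\<^sub>A pi a"
    by (rule arrow_lift[OF \<phi>])
  \<comment> \<open>A lift carries relations to relations: \<open>b * al a\<close> becomes zero
    after \<open>pi a'\<close>, so \<open>co a'\<close> does not distinguish its image from
    zero.\<close>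
  have "pi a' *\<^sub>A t (b *\<^sub>M al a) = (pi a' *\<^sub>A t b) *\<^sub>A t (al a)" using D(1-4) D'(1-4) b(1) by (simp add: T.comp)
  also have "\<dots> = \<phi> *\<^sub>A (pi a *\<^sub>A t (al a))" unfolding b(2) using D(1-4) \<phi> by simp
  also have "\<dots> = pi a' *\<^sub>A t (Zero M (Dom M (al a)) (Cod M (al a')))" unfolding D(5) using D(1-4) D'(1-4) \<phi> by simp
  finally have "co a' *\<^sub>X g (b *\<^sub>M al a) = co a' *\<^sub>X g (Zero M (Dom M (al a)) (Cod M (al a')))"
    by (rule cokernel_cong[OF chosen(1,3)[OF O(2)], rotated 2]) (use D(1) D'(1) b in auto)
  then have "(co a' *\<^sub>X g b) *\<^sub>X g (al a) = Zero X (gO (Dom M (al a))) (Cod X (co a'))"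
    using D(1,7,8) D'(1,7,8) b(1) by (simp add: G.comp)
  then obtain u where u: "u \<in> Hom X (Cod X (co a)) (Cod X (co a'))" "u *\<^sub>X co a = co a' *\<^sub>X g b"
    using X.cokernel_factor[OF chosen(3)[OF O(1)], of "co a' *\<^sub>X g b" "Cod X (co a')"]
      D(1,7,8) D'(1,7,8) b(1) by auto
  have "is_ext \<phi> u" unfolding is_ext_def
  proof (intro conjI ballI impI)
    fix b' assume "b' \<in> Hom M (Cod M (al (Dom A \<phi>))) (Cod M (al (Cod A \<phi>)))"
      "pi (Cod A \<phi>) *\<^sub>A t b' = \<phi> *\<^sub>A pi (Dom A \<phi>)"
    then have "b' \<in> Hom M (Cod M (al a)) (Cod M (al a'))" "pi a' *\<^sub>A t b' = \<phi> *\<^sub>A pi a" using \<phi> by auto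
    then show "u *\<^sub>X co (Dom A \<phi>) = co (Cod A \<phi>) *\<^sub>X g b'"
      using \<phi> u(2) cokernel_cong[OF chosen(1,3)[OF O(2)] b(1), of b'] b(2) by auto
  qed (use u \<phi> in auto)
  then have e: "is_ext \<phi> (xA \<phi>)" unfolding ext_def func.simps by (rule someI)
  show "xA \<phi> \<in> Hom X (xO a) (xO a')" using e \<phi> by (auto simp: is_ext_def ext_def)
  show "b \<in> Hom M (Cod M (al a)) (Cod M (al a')) \<Longrightarrow> pi a' *\<^sub>A t b = \<phi> *\<^sub>A pi a \<Longrightarrow>
      xA \<phi> *\<^sub>X co a = co a' *\<^sub>X g b" for b using e \<phi> by (auto simp: is_ext_def)
qed

lemma ext_eqI:
  assumes "\<phi> \<in> Hom A a a'" "u \<in> Hom X (xO a) (xO a')"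
    "b \<in> Hom M (Cod M (al a)) (Cod M (al a'))" "pi a' *\<^sub>A t b = \<phi> *\<^sub>A pi a"
    "u *\<^sub>X co a = co a' *\<^sub>X g b"
  shows "xA \<phi> = u"
proof -
  have O: "a \<in> Obj A" "a' \<in> Obj A" using assms(1) by auto
  show ?thesis by (rule X.epi_cancel[OF chosenD(9)[OF O(1)]])
      (use assms ext_arr(1)[OF assms(1)] ext_arr(2)[OF assms(1,3,4)] chosenD[OF O(1)] in \<open>auto simp: ext_def\<close>)
qed

text \<open>Composites and sums of lifts are lifts of composites and sums, and arrows out of a
  cokernel are determined by one lift.\<close>

lemma ext_additive: "additive_functor A X ext" unfolding additive_functor_def
proof (intro conjI ballI)
  show "is_functor A X ext"
  proof (rule is_functorI)
    fix a assume a: "a \<in> Obj A"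
    note D = chosenD[OF a]
    show "xO a \<in> Obj X" using D by (simp add: ext_def)
    show "xA (Id A a) = Id X (xO a)"
      by (rule ext_eqI[of _ a a _ "Id M (Cod M (al a))"]) (use a D in \<open>auto simp: ext_def\<close>)
  next
    fix f a a' assume "f \<in> Hom A a a'"
    then show "xA f \<in> Hom X (xO a) (xO a')" by (rule ext_arr)
  next
    fix f f' a a' a'' assume f: "f \<in> Hom A a a'" "f' \<in> Hom A a' a''"
    then have O: "a \<in> Obj A" "a' \<in> Obj A" "a'' \<in> Obj A" by auto
    note D = chosenD[OF O(1)] and D' = chosenD[OF O(2)] and D'' = chosenD[OF O(3)]
    obtain b where b: "b \<in> Hom M (Cod M (al a)) (Cod M (al a'))" "pi a' *\<^sub>A t b = f *\<^sub>A pi a"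
      by (rule arrow_lift[OF f(1)])
    obtain b' where b': "b' \<in> Hom M (Cod M (al a')) (Cod M (al a''))" "pi a'' *\<^sub>A t b' = f' *\<^sub>A pi a'"
      by (rule arrow_lift[OF f(2)])
    note e = ext_arr[OF f(1)] and e' = ext_arr[OF f(2)]
    have h: "xA f \<in> Hom X (Cod X (co a)) (Cod X (co a'))"
      "xA f' \<in> Hom X (Cod X (co a')) (Cod X (co a''))" using e(1) e'(1) by (auto simp: ext_def)
    show "xA (f' *\<^sub>A f) = xA f' *\<^sub>X xA f"
    proof (rule ext_eqI[of _ a a'' _ "b' *\<^sub>M b"])
      have "pi a'' *\<^sub>A t (b' *\<^sub>M b) = (pi a'' *\<^sub>A t b') *\<^sub>A t b"
        using b(1) b'(1) D(2-4) D''(2-4) by (simp add: T.comp)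
      also have "\<dots> = f' *\<^sub>A (pi a' *\<^sub>A t b)" unfolding b'(2) using b(1) D'(2-4) f by simp
      also have "\<dots> = (f' *\<^sub>A f) *\<^sub>A pi a" unfolding b(2) using D(2-4) f by simp
      finally show "pi a'' *\<^sub>A t (b' *\<^sub>M b) = (f' *\<^sub>A f) *\<^sub>A pi a" .
      have "(xA f' *\<^sub>X xA f) *\<^sub>X co a = xA f' *\<^sub>X (xA f *\<^sub>X co a)" using h D(7,8) by simp
      also have "\<dots> = (xA f' *\<^sub>X co a') *\<^sub>X g b" unfolding e(2)[OF b] using h D'(7,8) b(1) by simp
      also have "\<dots> = co a'' *\<^sub>X g (b' *\<^sub>M b)"
        unfolding e'(2)[OF b'] using D''(7,8) b(1) b'(1) by (simp add: G.comp)
      finally show "(xA f' *\<^sub>X xA f) *\<^sub>X co a = co a'' *\<^sub>X g (b' *\<^sub>M b)" .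
    qed (use f b b' h in \<open>auto simp: ext_def\<close>)
  qed
  fix a a' f f' assume f: "f \<in> Hom A a a'" "f' \<in> Hom A a a'"
  then have O: "a \<in> Obj A" "a' \<in> Obj A" by auto
  note D = chosenD[OF O(1)] and D' = chosenD[OF O(2)]
  obtain b where b: "b \<in> Hom M (Cod M (al a)) (Cod M (al a'))" "pi a' *\<^sub>A t b = f *\<^sub>A pi a"
    by (rule arrow_lift[OF f(1)])
  obtain b' where b': "b' \<in> Hom M (Cod M (al a)) (Cod M (al a'))" "pi a' *\<^sub>A t b' = f' *\<^sub>A pi a"
    by (rule arrow_lift[OF f(2)])
  note e = ext_arr[OF f(1)] and e' = ext_arr[OF f(2)]
  have h: "xA f \<in> Hom X (Cod X (co a)) (Cod X (co a'))"
    "xA f' \<in> Hom X (Cod X (co a)) (Cod X (co a'))" using e(1) e'(1) by (auto simp: ext_def)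
  show "xA (f \<boxplus>\<^sub>A f') = xA f \<boxplus>\<^sub>X xA f'" by (rule ext_eqI[of _ a a' _ "b \<boxplus>\<^sub>M b'"])
      (use f b b' h D(2-4,7,8) D'(2-4,7,8) e(2)[OF b] e'(2)[OF b'] in \<open>auto simp: ext_def\<close>)
qed

sublocale ext: addfun A X ext by unfold_locales (rule ext_additive)

text \<open>The presentation chosen for \<open>tO m\<close> need not be the trivial one.
  Projectivity splits its epimorphism, and the splitting yields the comparison \<open>tau\<close>
  between \<open>G\<close> and the extension.\<close>

definition "sec m = (SOME b. b \<in> Hom M m (Cod M (al (tO m))) \<and>
  pi (tO m) *\<^sub>A t b = Id A (tO m))"

definition "tau m = co (tO m) *\<^sub>X g (sec m)"

lemma sec:
  assumes "m \<in> Obj M"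
  shows "sec m \<in> Hom M m (Cod M (al (tO m)))" "pi (tO m) *\<^sub>A t (sec m) = Id A (tO m)"
proof -
  have O: "tO m \<in> Obj A" using assms by simp
  obtain b where "b \<in> Hom M m (Cod M (al (tO m)))" "pi (tO m) *\<^sub>A t b = Id A (tO m)"
    by (rule pres_lift[OF chosen(1)[OF O] assms, of "Id A (tO m)"]) (use chosen[OF O] O in auto)
  then have "\<exists>b. b \<in> Hom M m (Cod M (al (tO m))) \<and> pi (tO m) *\<^sub>A t b = Id A (tO m)" by blast
  from someI_ex[OF this] show "sec m \<in> Hom M m (Cod M (al (tO m)))"
    "pi (tO m) *\<^sub>A t (sec m) = Id A (tO m)" unfolding sec_def by blast+
qed

lemma tau_Hom:
  assumes "m \<in> Obj M" shows "tau m \<in> Hom X (gO m) (xO (tO m))"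
  using sec[OF assms] chosenD[of "tO m"] assms by (auto simp: tau_def ext_def)

text \<open>Any lift of an arrow out of \<open>tO m\<close> to an arrow out of \<open>m\<close>
  computes its value, without a detour through the presentation chosen for
  \<open>tO m\<close>.\<close>

lemma ext_tau:
  assumes "m \<in> Obj M" "h \<in> Hom A (tO m) a" "b \<in> Hom M m (Cod M (al a))" "pi a *\<^sub>A t b = h"
  shows "xA h *\<^sub>X tau m = co a *\<^sub>X g b"
proof -
  have O: "tO m \<in> Obj A" "a \<in> Obj A" using A.Hom_Obj[OF assms(2)] by auto
  note D = chosenD[OF O(1)] and D' = chosenD[OF O(2)]
  note s = sec[OF assms(1)]
  obtain b1 where b1: "b1 \<in> Hom M (Cod M (al (tO m))) (Cod M (al a))"
    "pi a *\<^sub>A t b1 = h *\<^sub>A pi (tO m)" by (rule arrow_lift[OF assms(2)])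
  have eh: "xA h \<in> Hom X (Cod X (co (tO m))) (Cod X (co a))" using ext_arr(1)[OF assms(2)] by (auto simp: ext_def)
  have "pi a *\<^sub>A t (b1 *\<^sub>M sec m) = (pi a *\<^sub>A t b1) *\<^sub>A t (sec m)" using D'(2-4) b1(1) s(1) by (simp add: T.comp)
  also have "\<dots> = h *\<^sub>A (pi (tO m) *\<^sub>A t (sec m))" unfolding b1(2) using D(2-4) s(1) assms(2) by simp
  also have "\<dots> = pi a *\<^sub>A t b" unfolding s(2) assms(4) using assms(2) by simp
  finally have e: "co a *\<^sub>X g (b1 *\<^sub>M sec m) = co a *\<^sub>X g b"
    by (rule cokernel_cong[OF chosen(1,3)[OF O(2)], rotated 2]) (use b1(1) s(1) assms(3) in auto)
  have "xA h *\<^sub>X tau m = (xA h *\<^sub>X co (tO m)) *\<^sub>X g (sec m)" unfolding tau_def using eh D(7,8) s(1) by simp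
  also have "\<dots> = co a *\<^sub>X g (b1 *\<^sub>M sec m)"
    unfolding ext_arr(2)[OF assms(2) b1] using D'(7,8) b1(1) s(1) by (simp add: G.comp)
  finally show ?thesis using e by simp
qed

lemma tau_natural:
  assumes "f \<in> Hom M m m'"
  shows "xA (t f) *\<^sub>X tau m = tau m' *\<^sub>X g f"
proof -
  have O: "m \<in> Obj M" "m' \<in> Obj M" "tO m' \<in> Obj A" using assms by auto
  note s = sec[OF O(2)] and D = chosenD[OF O(3)]
  have "pi (tO m') *\<^sub>A t (sec m' *\<^sub>M f) = (pi (tO m') *\<^sub>A t (sec m')) *\<^sub>A t f"
    using s(1) assms D(2-4) by (simp add: T.comp)
  also have "\<dots> = t f" unfolding s(2) using assms by simp
  finally have "xA (t f) *\<^sub>X tau m = co (tO m') *\<^sub>X g (sec m' *\<^sub>M f)"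
    by (intro ext_tau[OF O(1)]) (use assms s(1) in auto)
  also have "\<dots> = tau m' *\<^sub>X g f" unfolding tau_def using s(1) assms D(7,8) by (simp add: G.comp)
  finally show ?thesis .
qed

text \<open>Every presentation goes to a cokernel, not only the chosen one. Lifting each
  presentation over the other gives \<open>b\<close> and \<open>b'\<close>, which are mutually
  inverse up to relations, so the two cokernels agree.\<close>

lemma pres_cokernel:
  assumes p: "pres \<alpha> \<kappa>"
  shows "is_cokernel X (g \<alpha>) (xA \<kappa> *\<^sub>X tau (Cod M \<alpha>))"
proof -
  note pD = presD[OF p]
  let ?a = "Cod A \<kappa>" and ?y = "Cod M \<alpha>"
  have O: "?a \<in> Obj A" "?y \<in> Obj M" using pD by auto
  note D = chosenD[OF O(1)]
  have kH: "\<kappa> \<in> Hom A (tO ?y) ?a" using pD by simp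
  obtain b where b: "b \<in> Hom M ?y (Cod M (al ?a))" "pi ?a *\<^sub>A t b = \<kappa>"
    by (rule pres_lift[OF chosen(1)[OF O(1)] O(2), of \<kappa>]) (use kH chosen(2)[OF O(1)] in auto)
  obtain b' where b': "b' \<in> Hom M (Cod M (al ?a)) ?y" "\<kappa> *\<^sub>A t b' = pi ?a"
    by (rule pres_lift[OF p, of "Cod M (al ?a)" "pi ?a"]) (use D in auto)
  obtain c where c: "is_cokernel X (g \<alpha>) c" using X_cokernel[of "g \<alpha>"] pD(1) by auto
  note cD = X.cokernelD[OF c]
  have "xA \<kappa> *\<^sub>X tau ?y = co ?a *\<^sub>X g b" by (rule ext_tau[OF O(2) kH b])
  moreover have "is_cokernel X (g \<alpha>) (co ?a *\<^sub>X g b)"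
  proof (rule X.cokernelI[of _ "gO (Dom M \<alpha>)" "gO ?y" _ "Cod X (co ?a)"])
    show "g \<alpha> \<in> Hom X (gO (Dom M \<alpha>)) (gO ?y)" using pD by simp
    show "co ?a *\<^sub>X g b \<in> Hom X (gO ?y) (Cod X (co ?a))" using b D by simp
    have ba: "b *\<^sub>M \<alpha> \<in> Hom M (Dom M \<alpha>) (Cod M (al ?a))"
      "Zero M (Dom M \<alpha>) (Cod M (al ?a)) \<in> Hom M (Dom M \<alpha>) (Cod M (al ?a))" using b(1) pD(1) D(1) by auto
    have "pi ?a *\<^sub>A t (b *\<^sub>M \<alpha>) = (pi ?a *\<^sub>A t b) *\<^sub>A t \<alpha>" using b(1) pD(1) D(2-4) by (simp add: T.comp)
    also have "\<dots> = pi ?a *\<^sub>A t (Zero M (Dom M \<alpha>) (Cod M (al ?a)))" unfolding b(2) pD(5) using D pD(1) by simp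
    finally have "co ?a *\<^sub>X g (b *\<^sub>M \<alpha>) = co ?a *\<^sub>X g (Zero M (Dom M \<alpha>) (Cod M (al ?a)))"
      by (rule cokernel_cong[OF chosen(1,3)[OF O(1)] ba])
    then show "(co ?a *\<^sub>X g b) *\<^sub>X g \<alpha> = Zero X (gO (Dom M \<alpha>)) (Cod X (co ?a))"
      using b(1) pD(1) D(1,7,8) by (simp add: G.comp)
    have bb: "co ?a *\<^sub>X g (b *\<^sub>M b') = co ?a"
    proof -
      have "pi ?a *\<^sub>A t (b *\<^sub>M b') = (pi ?a *\<^sub>A t b) *\<^sub>A t b'" using b(1) b'(1) D(2-4) by (simp add: T.comp)
      also have "\<dots> = pi ?a *\<^sub>A t (Id M (Cod M (al ?a)))" unfolding b(2) b'(2) using D(1-4) by simp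
      finally have "co ?a *\<^sub>X g (b *\<^sub>M b') = co ?a *\<^sub>X g (Id M (Cod M (al ?a)))"
        by (rule cokernel_cong[OF chosen(1,3)[OF O(1)], rotated 2]) (use b(1) b'(1) D(1) in auto)
      then show ?thesis using D(1,7,8) by simp
    qed
    show "epimorphism X (co ?a *\<^sub>X g b)"
    proof (rule X.epiI[of _ "gO ?y" "Cod X (co ?a)"])
      show "co ?a *\<^sub>X g b \<in> Hom X (gO ?y) (Cod X (co ?a))" using b D by simp
      fix W h assume h: "h \<in> Hom X (Cod X (co ?a)) W" "h *\<^sub>X (co ?a *\<^sub>X g b) = Zero X (gO ?y) W"
      have W: "W \<in> Obj X" using h(1) by auto
      have "h *\<^sub>X co ?a = h *\<^sub>X (co ?a *\<^sub>X g (b *\<^sub>M b'))" by (simp only: bb)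
      also have "\<dots> = (h *\<^sub>X (co ?a *\<^sub>X g b)) *\<^sub>X g b'" using h(1) b(1) b'(1) D(1,7,8) by (simp add: G.comp)
      also have "\<dots> = Zero X (gO (Cod M (al ?a))) W" unfolding h(2) using b'(1) W by simp
      finally show "h = Zero X (Cod X (co ?a)) W" using X.epi_Zero[OF D(9), of h W] h(1) D(8) by simp
    qed
    fix W h assume h: "h \<in> Hom X (gO ?y) W" "h *\<^sub>X g \<alpha> = Zero X (gO (Dom M \<alpha>)) W"
    then obtain v where v: "v \<in> Hom X (Cod X c) W" "v *\<^sub>X c = h"
      using X.cokernel_factor[OF c, of h W] pD(1) by auto
    have hc: "h *\<^sub>X g x = h *\<^sub>X g x'" if "x \<in> Hom M m ?y" "x' \<in> Hom M m ?y" "\<kappa> *\<^sub>A t x = \<kappa> *\<^sub>A t x'" for m x x'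
    proof -
      have "h *\<^sub>X g x = v *\<^sub>X (c *\<^sub>X g x)" unfolding v(2)[symmetric] using v(1) cD that(1) pD(1) by simp
      also have "\<dots> = v *\<^sub>X (c *\<^sub>X g x')" by (simp only: cokernel_cong[OF p c that])
      also have "\<dots> = h *\<^sub>X g x'" unfolding v(2)[symmetric] using v(1) cD that(2) pD(1) by simp
      finally show ?thesis .
    qed
    have W: "W \<in> Obj X" using h(1) by auto
    have "\<kappa> *\<^sub>A t (b' *\<^sub>M al ?a) = (\<kappa> *\<^sub>A t b') *\<^sub>A t (al ?a)" using b'(1) D(1) pD(3,4) by (simp add: T.comp)
    also have "\<dots> = \<kappa> *\<^sub>A t (Zero M (Dom M (al ?a)) ?y)" unfolding b'(2) D(5) using pD D(1) by simp
    finally have "h *\<^sub>X g (b' *\<^sub>M al ?a) = h *\<^sub>X g (Zero M (Dom M (al ?a)) ?y)"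
      by (rule hc[rotated 2]) (use b'(1) D(1) pD(1) in auto)
    then have "(h *\<^sub>X g b') *\<^sub>X g (al ?a) = Zero X (gO (Dom M (al ?a))) W"
      using h(1) b'(1) D(1) pD(1) by (simp add: G.comp)
    then obtain u where u: "u \<in> Hom X (Cod X (co ?a)) W" "u *\<^sub>X co ?a = h *\<^sub>X g b'"
      using X.cokernel_factor[OF chosen(3)[OF O(1)], of "h *\<^sub>X g b'" W] h(1) b'(1) D(1) by auto
    have "u *\<^sub>X (co ?a *\<^sub>X g b) = (u *\<^sub>X co ?a) *\<^sub>X g b" using u(1) D(7,8) b(1) by simp
    also have "\<dots> = h *\<^sub>X g (b' *\<^sub>M b)" unfolding u(2) using h(1) b(1) b'(1) by (simp add: G.comp)
    also have "\<dots> = h *\<^sub>X g (Id M ?y)"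
    proof (rule hc)
      have "\<kappa> *\<^sub>A t (b' *\<^sub>M b) = (\<kappa> *\<^sub>A t b') *\<^sub>A t b" using b(1) b'(1) pD(3,4) by (simp add: T.comp)
      also have "\<dots> = \<kappa> *\<^sub>A t (Id M ?y)" unfolding b'(2) b(2) using pD by simp
      finally show "\<kappa> *\<^sub>A t (b' *\<^sub>M b) = \<kappa> *\<^sub>A t (Id M ?y)" .
    qed (use b b' pD(1) in auto)
    also have "\<dots> = h" using h(1) O(2) by simp
    finally show "\<exists>u\<in>Hom X (Cod X (co ?a)) W. u *\<^sub>X (co ?a *\<^sub>X g b) = h" using u(1) by blast
  qed
  ultimately show ?thesis by simp
qed

text \<open>For the trivial presentation, \<open>pres_cokernel\<close> says that
  \<open>tau m\<close> is a cokernel of a zero arrow.\<close>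

lemma tau_iso:
  assumes "m \<in> Obj M" shows "isomorphism X (tau m)"
proof -
  obtain z where z: "pres z (Id A (tO m))" "z = Zero M (Dom M z) m" "z \<in> Arr M" by (rule Id_pres[OF assms])
  have O: "Dom M z \<in> Obj M" "tO m \<in> Obj A" using z(3) assms by auto
  have zm: "Cod M z = m" by (subst z(2)) (use O assms in simp)
  have "g z = Zero X (gO (Dom M z)) (gO m)" using G.Zero[OF O(1) assms] z(2) by simp
  moreover have "xA (Id A (tO m)) *\<^sub>X tau m = tau m" using O tau_Hom[OF assms] by simp
  ultimately have "is_cokernel X (Zero X (gO (Dom M z)) (gO m)) (tau m)" using pres_cokernel[OF z(1)] zm by simp
  then show ?thesis using preadditive.kernel_Zero_iso[OF X.preadditive_opcat, unfolded op_simps] O assms by auto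
qed

lemma ext_extends: "nat_isomorphic M X G (ext \<circ>\<^sub>F T)" by (rule nat_isomorphicI[where \<tau> = tau])
    (use tau_Hom tau_iso tau_natural in \<open>simp_all only: comp_func_simps\<close>)

text \<open>If \<open>b\<close> lifts the arrow \<open>\<phi>\<close>, the cokernel of
  \<open>\<phi>\<close> is presented by the relations of the target together with \<open>b\<close>;
  these are the two components of \<open>?\<beta>\<close> on a direct sum. Comparing the cokernel of
  \<open>g ?\<beta>\<close> with that of \<open>g (al ?a')\<close>, which is \<open>?e\<close>,
  leaves the cokernel of the image of \<open>\<phi>\<close>.\<close>

lemma ext_cokernel:
  assumes c: "is_cokernel A \<phi> c"
  shows "is_cokernel X (xA \<phi>) (xA c)"
proof -
  note cD = A.cokernelD[OF c]
  let ?a = "Dom A \<phi>" and ?a' = "Cod A \<phi>" and ?d = "Cod A c"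
  have O: "?a \<in> Obj A" "?a' \<in> Obj A" using cD by auto
  note D = chosenD[OF O(1)] and D' = chosenD[OF O(2)]
  let ?x = "Dom M (al ?a')" and ?y' = "Cod M (al ?a')" and ?y = "Cod M (al ?a)"
  have \<phi>H: "\<phi> \<in> Hom A ?a ?a'" using cD by simp
  obtain b where b: "b \<in> Hom M ?y ?y'" "pi ?a' *\<^sub>A t b = \<phi> *\<^sub>A pi ?a" by (rule arrow_lift[OF \<phi>H])
  have xy: "?x \<in> Obj M" "?y \<in> Obj M" "?y' \<in> Obj M" using D D' by auto
  obtain P i j p r where bp: "M.biprod ?x ?y P i j p r" using M.biprod_ex[OF xy(1,2)] by blast
  then have P: "i \<in> Hom M ?x P" "j \<in> Hom M ?y P" "p \<in> Hom M P ?x" "r \<in> Hom M P ?y"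
    "p *\<^sub>M i = Id M ?x" "r *\<^sub>M j = Id M ?y" "r *\<^sub>M i = Zero M ?x ?y" "p *\<^sub>M j = Zero M ?y ?x"
    by (auto simp: M.biprod_def)
  let ?\<beta> = "(al ?a' *\<^sub>M p) \<boxplus>\<^sub>M (b *\<^sub>M r)"
  have \<beta>: "?\<beta> \<in> Hom M P ?y'" using P(3,4) D'(1) b(1) by simp
  have \<beta>i: "?\<beta> *\<^sub>M i = al ?a'" using P D'(1) b(1) xy by simp
  have \<beta>j: "?\<beta> *\<^sub>M j = b" using P D'(1) b(1) xy by simp
  have ce: "epimorphism A c" by (rule A.cokernel_epi[OF c])
  have PO: "P \<in> Obj M" "tO P \<in> Obj A" "?d \<in> Obj A" using P(1) cD M.Hom_Obj[OF P(1)] by auto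
  have "is_cokernel A (t ?\<beta>) (c *\<^sub>A pi ?a')"
  proof (rule A.cokernelI[of _ "tO P" "tO ?y'" _ ?d])
    show "t ?\<beta> \<in> Hom A (tO P) (tO ?y')" using \<beta> by (rule T.Hom)
    show "c *\<^sub>A pi ?a' \<in> Hom A (tO ?y') ?d" using cD D' by simp
    show "epimorphism A (c *\<^sub>A pi ?a')"
      using cat.mono_comp[OF cat_opcat[OF A.cat_axioms], unfolded op_simps, OF ce D'(6)] cD D' by simp
    have "(c *\<^sub>A pi ?a') *\<^sub>A t ?\<beta> = (c *\<^sub>A (pi ?a' *\<^sub>A t (al ?a')) *\<^sub>A t p) \<boxplus>\<^sub>A (c *\<^sub>A (pi ?a' *\<^sub>A t b) *\<^sub>A t r)"
      using cD(1-3) D'(1-4) P(3,4) b(1) by (simp add: T.comp)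
    also have "\<dots> = ((c *\<^sub>A \<phi>) *\<^sub>A (pi ?a *\<^sub>A t r))"
      unfolding D'(5) b(2) using cD(1-3) D'(1-4) D(1-4) P(3,4) PO by simp
    also have "\<dots> = Zero A (tO P) ?d" unfolding cD(4) using D(1-4) P(4) PO by simp
    finally show "(c *\<^sub>A pi ?a') *\<^sub>A t ?\<beta> = Zero A (tO P) ?d" .
    fix W h assume h: "h \<in> Hom A (tO ?y') W" "h *\<^sub>A t ?\<beta> = Zero A (tO P) W"
    have W: "W \<in> Obj A" using h(1) by auto
    have hx: "h *\<^sub>A t (?\<beta> *\<^sub>M z) = Zero A (tO m) W" if z: "z \<in> Hom M m P" for z m
    proof -
      have "h *\<^sub>A t (?\<beta> *\<^sub>M z) = (h *\<^sub>A t ?\<beta>) *\<^sub>A t z"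
        using T.comp[of z ?\<beta>] h(1) \<beta> z T.Hom[OF \<beta>] by (simp del: T.Add M.Add_Comp)
      also have "\<dots> = Zero A (tO m) W" unfolding h(2) using z W by simp
      finally show ?thesis .
    qed
    have "h *\<^sub>A t (al ?a') = Zero A (tO ?x) W" using hx[OF P(1)] \<beta>i by simp
    then obtain u where u: "u \<in> Hom A ?a' W" "u *\<^sub>A pi ?a' = h"
      using A.cokernel_factor[OF presD(2)[OF chosen(1)[OF O(2)]], of h W] h(1) D'(1,4) by auto
    have "(u *\<^sub>A \<phi>) *\<^sub>A pi ?a = u *\<^sub>A (pi ?a' *\<^sub>A t b)" unfolding b(2) using u(1) cD(1) D(2-4) by simp
    also have "\<dots> = h *\<^sub>A t b" unfolding u(2)[symmetric] using u(1) b(1) D'(2-4) by simp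
    also have "\<dots> = Zero A (tO ?y) W" using hx[OF P(2)] \<beta>j by simp
    finally have "u *\<^sub>A \<phi> = Zero A ?a W" using A.epi_Zero[OF D(6), of "u *\<^sub>A \<phi>" W] u(1) cD(1) D(3,4) by simp
    then obtain v where v: "v \<in> Hom A ?d W" "v *\<^sub>A c = u" using A.cokernel_factor[OF c, of u W] u(1) by auto
    have "v *\<^sub>A (c *\<^sub>A pi ?a') = (v *\<^sub>A c) *\<^sub>A pi ?a'" using v(1) cD(2,3) D'(2-4) by simp
    then have "v *\<^sub>A (c *\<^sub>A pi ?a') = h" by (simp only: v(2) u(2))
    then show "\<exists>u\<in>Hom A ?d W. u *\<^sub>A (c *\<^sub>A pi ?a') = h" using v(1) by blast
  qed
  then have pr: "pres ?\<beta> (c *\<^sub>A pi ?a')" using \<beta> by (simp add: pres_def)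
  let ?s = "tau ?y'"
  have sH: "?s \<in> Hom X (gO ?y') (xO (tO ?y'))" by (rule tau_Hom[OF xy(3)])
  have yH: "tau ?y \<in> Hom X (gO ?y) (xO (tO ?y))" by (rule tau_Hom[OF xy(2)])
  have Cod\<beta>: "Cod M ?\<beta> = ?y'" using \<beta> by simp
  have k1: "is_cokernel X (g ?\<beta>) ((xA c *\<^sub>X xA (pi ?a')) *\<^sub>X ?s)"
    using pres_cokernel[OF pr] ext.comp[of "pi ?a'" c] cD(2,3) D'(2-4) unfolding Cod\<beta> by simp
  have k2: "is_cokernel X (g (al ?a')) (xA (pi ?a') *\<^sub>X ?s)" by (rule pres_cokernel[OF chosen(1)[OF O(2)]])
  let ?e = "xA (pi ?a') *\<^sub>X ?s"
  have eH: "?e \<in> Hom X (gO ?y') (xO ?a')" using sH D'(2-4) by simp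
  have ee: "epimorphism X ?e" by (rule X.cokernel_epi[OF k2])
  have k1': "is_cokernel X (g ?\<beta>) (xA c *\<^sub>X ?e)" using k1 sH D'(2-4) cD(2,3) by simp
  have eb: "?e *\<^sub>X g b = xA \<phi> *\<^sub>X (xA (pi ?a) *\<^sub>X tau ?y)"
  proof -
    have "?e *\<^sub>X g b = xA (pi ?a') *\<^sub>X (xA (t b) *\<^sub>X tau ?y)"
      unfolding tau_natural[OF b(1)] using sH D'(2-4) b(1) by simp
    also have "\<dots> = xA (pi ?a' *\<^sub>A t b) *\<^sub>X tau ?y" using yH D'(2-4) b(1) by (simp add: ext.comp)
    also have "\<dots> = xA \<phi> *\<^sub>X (xA (pi ?a) *\<^sub>X tau ?y)" unfolding b(2) using yH D(2-4) cD(1) by (simp add: ext.comp)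
    finally show ?thesis .
  qed
  show ?thesis
  proof (rule X.cokernelI[of _ "xO ?a" "xO ?a'" _ "xO ?d"])
    show "xA \<phi> \<in> Hom X (xO ?a) (xO ?a')"
      "xA c \<in> Hom X (xO ?a') (xO ?d)" using cD by auto
    show "xA c *\<^sub>X xA \<phi> = Zero X (xO ?a) (xO ?d)" using cD by (intro ext.comp_Zero) auto
    show "epimorphism X (xA c)"
      using cat.mono_left[OF cat_opcat[OF X.cat_axioms], unfolded op_simps, OF X.cokernel_epi[OF k1']]
        eH cD(2,3) by simp
    fix W h assume h: "h \<in> Hom X (xO ?a') W" "h *\<^sub>X xA \<phi> = Zero X (xO ?a) W"
    have W: "W \<in> Obj X" using h(1) by auto
    have "(h *\<^sub>X ?e) *\<^sub>X g ?\<beta> = (h *\<^sub>X (?e *\<^sub>X g (al ?a')) *\<^sub>X g p) \<boxplus>\<^sub>X (h *\<^sub>X (?e *\<^sub>X g b) *\<^sub>X g r)"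
      using h(1) sH D'(1-4) P(3,4) b(1) by (simp add: G.comp)
    also have "\<dots> = (h *\<^sub>X xA \<phi>) *\<^sub>X ((xA (pi ?a) *\<^sub>X tau ?y) *\<^sub>X g r)"
      unfolding X.cokernelD(4)[OF k2] eb using h(1) D(2-4) cD(1) yH sH D'(1-4) P(3,4) PO W by simp
    also have "\<dots> = Zero X (gO P) W" unfolding h(2) using D(2-4) yH P(4) W by simp
    finally obtain u where u: "u \<in> Hom X (xO ?d) W" "u *\<^sub>X (xA c *\<^sub>X ?e) = h *\<^sub>X ?e"
      using X.cokernel_factor[OF k1', of "h *\<^sub>X ?e" W] h(1) eH \<beta> T.Hom[OF \<beta>] G.Hom[OF \<beta>] cD(2,3)
      by (auto simp del: G.Add)
    have "u *\<^sub>X xA c = h" by (rule X.epi_cancel[OF ee]) (use u h(1) eH cD(2,3) in simp_all)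
    then show "\<exists>u\<in>Hom X (xO ?d) W. u *\<^sub>X xA c = h" using u(1) by blast
  qed
qed

end

lemma kernel_nat_isomorphic:
  assumes "preadditive X" "is_functor M X F" "is_functor M X G" "cat M" "nat_isomorphic M X F G"
    and k: "f \<in> Hom M x y" "k \<in> Hom M w x" "is_kernel X (on_arr F f) (on_arr F k)"
  shows "is_kernel X (on_arr G f) (on_arr G k)"
proof -
  interpret X: preadditive X by fact
  interpret F: fctr M X F using assms X.cat_axioms by (intro fctrI)
  interpret G: fctr M X G using assms X.cat_axioms by (intro fctrI)
  from assms(5) obtain \<sigma> where
    \<sigma>: "\<And>m. m \<in> Obj M \<Longrightarrow> \<sigma> m \<in> Hom X (on_obj F m) (on_obj G m)"
       "\<And>m. m \<in> Obj M \<Longrightarrow> isomorphism X (\<sigma> m)"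
      "\<And>f. f \<in> Arr M \<Longrightarrow> on_arr G f *\<^sub>X \<sigma> (Dom M f) = \<sigma> (Cod M f) *\<^sub>X on_arr F f"
    unfolding nat_isomorphic_def by auto
  have O: "x \<in> Obj M" "y \<in> Obj M" "w \<in> Obj M" using k(1,2) by auto
  note s = \<sigma>(1)[OF O(1)] \<sigma>(1)[OF O(2)] \<sigma>(1)[OF O(3)]
  have "is_kernel X (\<sigma> y *\<^sub>X on_arr F f) (on_arr F k)"
    using X.kernel_mono_comp[OF X.iso_mono[OF \<sigma>(2)[OF O(2)]], of "on_arr F f" "on_arr F k"] k s by simp
  then have "is_kernel X (on_arr G f *\<^sub>X \<sigma> x) (on_arr F k)" using \<sigma>(3)[of f] k(1) by simp
  then have "is_kernel X (on_arr G f) (\<sigma> x *\<^sub>X on_arr F k)"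
    by (rule X.kernel_comp_iso) (use \<sigma>(2)[OF O(1)] k s in auto)
  also have "\<sigma> x *\<^sub>X on_arr F k = on_arr G k *\<^sub>X \<sigma> w" using \<sigma>(3)[of k] k(2) by simp
  finally have l: "is_kernel X (on_arr G f) (on_arr G k *\<^sub>X \<sigma> w)" .
  obtain i where i: "i \<in> Hom X (Cod X (\<sigma> w)) (Dom X (\<sigma> w))" "\<sigma> w *\<^sub>X i = Id X (Cod X (\<sigma> w))" "isomorphism X i"
    using X.isoE[OF \<sigma>(2)[OF O(3)]] by blast
  have "is_kernel X (on_arr G f) ((on_arr G k *\<^sub>X \<sigma> w) *\<^sub>X i)"
    by (rule X.kernel_iso[OF l i(3)]) (use i(1) s k in simp)
  also have "(on_arr G k *\<^sub>X \<sigma> w) *\<^sub>X i = on_arr G k" using i(1,2) s k by simp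
  finally show ?thesis .
qed

text \<open>Left exactness only has to be checked on monomorphisms. A monomorphism \<open>F' \<rightarrow> F\<close> lifts to
  \<open>\<beta> : z \<rightarrow> y\<close> between projective covers, and the relations of \<open>F'\<close> are the pullback along \<open>\<beta>\<close>
  of the relations of \<open>F\<close>, which \<open>H \<circ> T\<close> preserves.\<close>

lemma (in presentation) exact_if_preserves_kernels:
  assumes "abelian A" "abelian X" and H: "additive_functor A X H"
    and cok: "\<And>f c. is_cokernel A f c \<Longrightarrow> is_cokernel X (on_arr H f) (on_arr H c)"
    and M_ker: "\<And>f. f \<in> Arr M \<Longrightarrow> \<exists>k. is_kernel M f k"
    and kerH: "\<And>f k. is_kernel M f k \<Longrightarrow> is_kernel X (on_arr H (t f)) (on_arr H (t k))"
  shows "exact_functor A X H"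
proof -
  interpret AA: abelian A by fact
  interpret X: abelian X by fact
  interpret H: addfun A X H using H by unfold_locales
  interpret HT: addfun M X "H \<circ>\<^sub>F T" using additive_comp[OF M.preadditive_axioms T.additive H] by unfold_locales
  have mono: "monomorphism X (on_arr H u)" if u: "monomorphism A u" for u
  proof -
    have uA: "u \<in> Arr A" using u by (simp add: monomorphism_def)
    obtain \<alpha> \<pi> where p: "pres \<alpha> \<pi>" "Cod A \<pi> = Cod A u"
      using presentation_ex[of "Cod A u"] uA by (auto simp: pres_def)
    obtain \<alpha>' \<pi>' where p': "pres \<alpha>' \<pi>'" "Cod A \<pi>' = Dom A u"
      using presentation_ex[of "Dom A u"] uA by (auto simp: pres_def)
    note pD = presD[OF p(1)] and pD' = presD[OF p'(1)]
    let ?x = "Dom M \<alpha>" and ?y = "Cod M \<alpha>" and ?z = "Cod M \<alpha>'"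
    have O: "?x \<in> Obj M" "?y \<in> Obj M" "?z \<in> Obj M" using pD pD' by auto
    obtain \<beta> where \<beta>: "\<beta> \<in> Hom M ?z ?y" "\<pi> *\<^sub>A t \<beta> = u *\<^sub>A \<pi>'"
      by (rule pres_lift[OF p(1) O(3), of "u *\<^sub>A \<pi>'"]) (use uA pD' p p' in auto)
    obtain P i j r s where bp: "M.biprod ?x ?z P i j r s" using M.biprod_ex[OF O(1,3)] by blast
    then have P: "i \<in> Hom M ?x P" "j \<in> Hom M ?z P" "r \<in> Hom M P ?x" "s \<in> Hom M P ?z" by (auto simp: M.biprod_def)
    \<comment> \<open>The kernel of this difference is the pullback of \<open>\<alpha>\<close> and
      \<open>\<beta>\<close>, with projections \<open>r * k\<close> and
      \<open>s * k\<close>.\<close>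
    let ?d = "(\<alpha> *\<^sub>M r) \<boxplus>\<^sub>M neg M (\<beta> *\<^sub>M s)"
    have d: "?d \<in> Hom M P ?y" using P pD(1) \<beta>(1) by simp
    obtain k where k: "is_kernel M ?d k" using M_ker d by auto
    note kD = M.kernelD[OF k]
    have kP: "k \<in> Hom M (Dom M k) P" using kD d by simp
    have "(\<alpha> *\<^sub>M (r *\<^sub>M k)) \<boxplus>\<^sub>M neg M (\<beta> *\<^sub>M (s *\<^sub>M k)) = Zero M (Dom M k) ?y" using kD(4) kP P pD(1) \<beta>(1) by simp
    then have sq: "\<alpha> *\<^sub>M (r *\<^sub>M k) = \<beta> *\<^sub>M (s *\<^sub>M k)" using kP P pD(1) \<beta>(1) by (subst (asm) M.diff_eq_Zero) auto
    \<comment> \<open>That \<open>s * k\<close> consists of relations of the subobject may be tested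
      after the monomorphism \<open>u\<close>, where it is a statement about relations of
      \<open>\<alpha>\<close>.\<close>
    have "u *\<^sub>A (\<pi>' *\<^sub>A t (s *\<^sub>M k)) = (\<pi> *\<^sub>A t \<beta>) *\<^sub>A t (s *\<^sub>M k)"
      unfolding \<beta>(2) using uA pD'(1-4) p'(2) P kP by simp
    also have "\<dots> = \<pi> *\<^sub>A t (\<beta> *\<^sub>M (s *\<^sub>M k))" using T.comp[of "s *\<^sub>M k" \<beta>] pD(1-4) P kP \<beta>(1) by simp
    also have "\<dots> = (\<pi> *\<^sub>A t \<alpha>) *\<^sub>A t (r *\<^sub>M k)"
      unfolding sq[symmetric] using T.comp[of "r *\<^sub>M k" \<alpha>] pD(1-4) P kP by simp
    also have "\<dots> = Zero A (tO (Dom M k)) (Cod A u)" unfolding pD(5) using P kP p(2) uA pD(1) by simp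
    finally have z: "\<pi>' *\<^sub>A t (s *\<^sub>M k) = Zero A (tO (Dom M k)) (Dom A u)"
      using A.mono_Zero[OF u, of "\<pi>' *\<^sub>A t (s *\<^sub>M k)" "tO (Dom M k)"] uA pD'(1-4) p'(2) P kP by simp
    let ?h = "on_arr (H \<circ>\<^sub>F T)" and ?o = "on_obj (H \<circ>\<^sub>F T)"
    have hk: "is_kernel X (?h ?d) (?h k)" using kerH[OF k] by (simp only: comp_func_simps)
    have hb: "X.biprod (?o ?x) (?o ?z) (?o P) (?h i) (?h j) (?h r) (?h s)" by (rule HT.biprod[OF bp])
    then have B: "?h r *\<^sub>X ?h i = Id X (?o ?x)" "?h s *\<^sub>X ?h j = Id X (?o ?z)"
      "?h s *\<^sub>X ?h i = Zero X (?o ?x) (?o ?z)" "?h r *\<^sub>X ?h j = Zero X (?o ?z) (?o ?x)"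
      by (auto simp: X.biprod_def)
    note hH = HT.Hom[OF P(1)] HT.Hom[OF P(2)] HT.Hom[OF P(3)] HT.Hom[OF P(4)]
      HT.Hom[OF \<beta>(1)] HT.Hom[OF kP] HT.Hom[OF d]
    have \<alpha>H: "?h \<alpha> \<in> Hom X (?o ?x) (?o ?y)" by (rule HT.Hom) (use pD(1) in simp)
    \<comment> \<open>The composite of \<open>H\<close> and \<open>T\<close> preserves the direct
      sum and, by \<open>kerH\<close>, the kernel \<open>k\<close>, so the square is still a weak
      pullback in \<open>X\<close>.\<close>
    have pb: "\<exists>v\<in>Hom X W (?o (Dom M k)). ?h (r *\<^sub>M k) *\<^sub>X v = a \<and> ?h (s *\<^sub>M k) *\<^sub>X v = b"
      if ab: "a \<in> Hom X W (?o ?x)" "b \<in> Hom X W (?o ?z)" "?h \<alpha> *\<^sub>X a = ?h \<beta> *\<^sub>X b" for W a b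
    proof -
      let ?c = "(?h i *\<^sub>X a) \<boxplus>\<^sub>X (?h j *\<^sub>X b)"
      have W: "W \<in> Obj X" "?o ?x \<in> Obj X" "?o ?z \<in> Obj X" using X.Hom_Obj[OF ab(1)] X.Hom_Obj[OF ab(2)] by auto
      have c: "?c \<in> Hom X W (?o P)" using ab(1,2) hH(1,2) by simp
      have rc: "?h r *\<^sub>X ?c = a"
      proof -
        have "?h r *\<^sub>X ?c = ((?h r *\<^sub>X ?h i) *\<^sub>X a) \<boxplus>\<^sub>X ((?h r *\<^sub>X ?h j) *\<^sub>X b)"
          using ab(1,2) hH(1-4) by (simp del: comp_func_simps)
        then show ?thesis unfolding B using ab(1,2) W by (simp del: comp_func_simps)
      qed
      have sc: "?h s *\<^sub>X ?c = b"
      proof -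
        have "?h s *\<^sub>X ?c = ((?h s *\<^sub>X ?h i) *\<^sub>X a) \<boxplus>\<^sub>X ((?h s *\<^sub>X ?h j) *\<^sub>X b)"
          using ab(1,2) hH(1-4) by (simp del: comp_func_simps)
        then show ?thesis unfolding B using ab(1,2) W by (simp del: comp_func_simps)
      qed
      have hd: "?h ?d = (?h \<alpha> *\<^sub>X ?h r) \<boxplus>\<^sub>X neg X (?h \<beta> *\<^sub>X ?h s)"
        using HT.comp[of r \<alpha>] HT.comp[of s \<beta>] HT.neg[of "\<beta> *\<^sub>M s"]
          HT.Add[of "\<alpha> *\<^sub>M r" "neg M (\<beta> *\<^sub>M s)"] pD(1) P \<beta>(1) by (simp del: comp_func_simps)
      have "?h ?d *\<^sub>X ?c = (?h \<alpha> *\<^sub>X (?h r *\<^sub>X ?c)) \<boxplus>\<^sub>X neg X (?h \<beta> *\<^sub>X (?h s *\<^sub>X ?c))"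
        unfolding hd using c hH \<alpha>H by (simp del: comp_func_simps X.Comp_Add)
      also have "\<dots> = Zero X W (?o ?y)" unfolding rc sc ab(3) using ab(2) hH(5) by (simp del: comp_func_simps)
      finally obtain v where v: "v \<in> Hom X W (?o (Dom M k))" "?h k *\<^sub>X v = ?c"
        using X.kernel_factor[OF hk, of ?c W] c hH(6,7) by (auto simp del: comp_func_simps)
      have "?h (r *\<^sub>M k) *\<^sub>X v = ?h r *\<^sub>X (?h k *\<^sub>X v)" "?h (s *\<^sub>M k) *\<^sub>X v = ?h s *\<^sub>X (?h k *\<^sub>X v)"
        using HT.comp[of k r] HT.comp[of k s] kP P v(1) hH by (simp_all del: comp_func_simps)
      then show ?thesis using v(1) unfolding v(2) rc sc by blast
    qed
    show ?thesis
    proof (rule X.pullback_cokernel_mono[OF \<alpha>H hH(5) _ _ pb])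
      show "?h (r *\<^sub>M k) \<in> Hom X (?o (Dom M k)) (?o ?x)" "?h (s *\<^sub>M k) \<in> Hom X (?o (Dom M k)) (?o ?z)"
        by (rule HT.Hom, use P kP in simp)+
      show "is_cokernel X (?h \<alpha>) (on_arr H \<pi>)" using cok[OF pD(2)] by simp
      show "on_arr H \<pi>' \<in> Hom X (?o ?z) (on_obj H (Dom A u))" using pD'(3,4) p'(2) by simp
      show "epimorphism X (on_arr H \<pi>')" by (rule X.cokernel_epi[OF cok[OF pD'(2)]])
      show "on_arr H \<pi>' *\<^sub>X ?h (s *\<^sub>M k) = Zero X (?o (Dom M k)) (on_obj H (Dom A u))"
        using H.comp_Zero[OF z, of "tO ?z"] pD'(3,4) p'(2) P kP by simp
      show "on_arr H u \<in> Hom X (on_obj H (Dom A u)) (Cod X (on_arr H \<pi>))" using uA p(2) pD(3) by simp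
      have "on_arr H (u *\<^sub>A \<pi>') = on_arr H \<pi> *\<^sub>X on_arr H (t \<beta>)"
        unfolding \<beta>(2)[symmetric] using \<beta>(1) pD(3,4) by (simp add: H.comp)
      then show "on_arr H u *\<^sub>X on_arr H \<pi>' = on_arr H \<pi> *\<^sub>X ?h \<beta>" using uA pD'(3,4) p'(2) by (simp add: H.comp)
    qed
  qed
  show ?thesis
  proof (rule exact_functorI[OF H _ cok])
    \<comment> \<open>With \<open>f = m * e\<close>, the arrow \<open>e\<close> is the cokernel of
      \<open>k\<close>. \<open>H\<close> preserves this cokernel and the monomorphism
      \<open>k\<close>, so \<open>k\<close> remains the kernel of \<open>e\<close>; composing with
      \<open>m\<close>, which stays a monomorphism, does not change kernels.\<close>
    fix f k assume k: "is_kernel A f k"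
    note kD = A.kernelD[OF k]
    obtain I m e where f: "e \<in> Hom A (Dom A f) I" "m \<in> Hom A I (Cod A f)" "m *\<^sub>A e = f"
      "monomorphism A m" "epimorphism A e" by (rule AA.image_factor[of f "Dom A f" "Cod A f"]) (use kD in simp)
    have ke: "is_kernel A e k" using A.kernel_mono_comp[OF f(4), of e k] f(1-3) k by auto
    have "is_cokernel X (on_arr H k) (on_arr H e)" by (rule cok[OF AA.epi_cokernel[OF f(5) ke]])
    then have "is_kernel X (on_arr H e) (on_arr H k)" by (rule X.mono_kernel[OF mono[OF A.kernel_mono[OF k]]])
    then have "is_kernel X (on_arr H m *\<^sub>X on_arr H e) (on_arr H k)"
      using X.kernel_mono_comp[OF mono[OF f(4)], of "on_arr H e" "on_arr H k"] f(1,2) by simp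
    then show "is_kernel X (on_arr H f) (on_arr H k)" unfolding f(3)[symmetric] using f(1,2) by (simp add: H.comp)
  qed
qed

section \<open>Coherent functors\<close>

text \<open>Values of presheaves must be carried by the type of arrows, which excludes cosets. Since
  the choice depends only on the coset, \<open>quot_rep\<close> picks the same representative for
  all of its elements, and these representatives form the quotient group.\<close>

definition quot_rep :: "('a, 'b) monoid_scheme \<Rightarrow> 'a set \<Rightarrow> 'a \<Rightarrow> 'a" where
  "quot_rep G N x = (SOME y. y \<in> carrier G \<and> x \<otimes>\<^bsub>G\<^esub> inv\<^bsub>G\<^esub> y \<in> N)"

definition quot_grp :: "('a, 'b) monoid_scheme \<Rightarrow> 'a set \<Rightarrow> 'a monoid" where
  "quot_grp G N = \<lparr>carrier = quot_rep G N ` carrier G,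
     mult = (\<lambda>x y. quot_rep G N (x \<otimes>\<^bsub>G\<^esub> y)), one = quot_rep G N \<one>\<^bsub>G\<^esub>\<rparr>"

context
  fixes G :: "('a, 'b) monoid_scheme" (structure) and N
  assumes comm: "comm_group G" and sub: "subgroup N G"
begin

interpretation comm_group G by (rule comm)

lemma quot_rep_mem:
  assumes "x \<in> carrier G"
  shows "quot_rep G N x \<in> carrier G" "x \<otimes> inv (quot_rep G N x) \<in> N"
proof -
  have "x \<in> carrier G \<and> x \<otimes> inv x \<in> N" using assms subgroup.one_closed[OF sub] by simp
  then have "quot_rep G N x \<in> carrier G \<and> x \<otimes> inv (quot_rep G N x) \<in> N" unfolding quot_rep_def by (rule someI)
  then show "quot_rep G N x \<in> carrier G" "x \<otimes> inv (quot_rep G N x) \<in> N" by auto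
qed

lemma diff_mem_trans:
  assumes "x \<in> carrier G" "y \<in> carrier G" "z \<in> carrier G" "x \<otimes> inv y \<in> N" "y \<otimes> inv z \<in> N"
  shows "x \<otimes> inv z \<in> N"
proof -
  have "x \<otimes> inv z = (x \<otimes> inv y) \<otimes> (y \<otimes> inv z)" using assms by (simp add: m_assoc) (simp add: m_assoc[symmetric])
  then show ?thesis using subgroup.m_closed[OF sub assms(4,5)] by simp
qed

lemma diff_mem_sym:
  assumes "x \<in> carrier G" "y \<in> carrier G" "x \<otimes> inv y \<in> N"
  shows "y \<otimes> inv x \<in> N" using subgroup.m_inv_closed[OF sub assms(3)] assms(1,2) by (simp add: inv_mult_group)

lemma quot_rep_eq:
  assumes "x \<in> carrier G" "y \<in> carrier G"
  shows "quot_rep G N x = quot_rep G N y \<longleftrightarrow> x \<otimes> inv y \<in> N"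
proof
  assume "quot_rep G N x = quot_rep G N y"
  then show "x \<otimes> inv y \<in> N"
    using quot_rep_mem[OF assms(1)] quot_rep_mem[OF assms(2)] diff_mem_sym diff_mem_trans assms by metis
next
  assume xy: "x \<otimes> inv y \<in> N"
  have "z \<in> carrier G \<and> x \<otimes> inv z \<in> N \<longleftrightarrow> z \<in> carrier G \<and> y \<otimes> inv z \<in> N" for z
    using diff_mem_trans[OF assms(2,1) _ diff_mem_sym[OF assms xy]] diff_mem_trans[OF assms _ xy] by blast
  then show "quot_rep G N x = quot_rep G N y" unfolding quot_rep_def by presburger
qed

lemma quot_rep_mult:
  assumes "x \<in> carrier G" "y \<in> carrier G"
  shows "quot_rep G N (quot_rep G N x \<otimes> quot_rep G N y) = quot_rep G N (x \<otimes> y)"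
proof -
  let ?x = "quot_rep G N x" and ?y = "quot_rep G N y"
  note m = quot_rep_mem[OF assms(1)] quot_rep_mem[OF assms(2)]
  have "(x \<otimes> y) \<otimes> inv (?x \<otimes> ?y) = (x \<otimes> inv ?x) \<otimes> (y \<otimes> inv ?y)" using assms m by (simp add: inv_mult m_ac)
  then have "(x \<otimes> y) \<otimes> inv (?x \<otimes> ?y) \<in> N" using subgroup.m_closed[OF sub m(2,4)] by simp
  then show ?thesis using quot_rep_eq[of "x \<otimes> y" "?x \<otimes> ?y"] assms m by simp
qed

lemma quot_rep_hom: "quot_rep G N \<in> hom G (quot_grp G N)" by (rule homI) (auto simp: quot_grp_def quot_rep_mult)

lemma quot_grp: "comm_group (quot_grp G N)"
proof -
  \<comment> \<open>An auxiliary multiplication on the whole type, not claimed to be a group: the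
    image of a commutative group under a homomorphism into it is one.\<close>
  let ?H = "\<lparr>carrier = UNIV, mult = (\<lambda>x y. quot_rep G N (x \<otimes> y)), one = \<one>\<rparr>"
  have "quot_rep G N \<in> hom G ?H" by (rule homI) (auto simp: quot_rep_mult)
  from hom_imp_img_comm_group[OF this] show ?thesis by (simp add: quot_grp_def)
qed

lemma quot_rep_one: "x \<in> carrier G \<Longrightarrow> quot_rep G N x = \<one>\<^bsub>quot_grp G N\<^esub> \<longleftrightarrow> x \<in> N"
  using quot_rep_eq[of x "\<one>"] by (simp add: quot_grp_def)

end

lemma representable_simps [simp]:
  "carrier (val (representable C Y) U) = Hom C U Y"
  "mult (val (representable C Y) U) = Add C"
  "one (val (representable C Y) U) = Zero C U Y"
  "res (representable C Y) f u = Comp C u f"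
  "val (representable C Y) U = hom_group C U Y" by (simp_all add: representable_def hom_group_def)

lemma hom_group_simps:
  "carrier (hom_group C U Y) = Hom C U Y"
  "mult (hom_group C U Y) = Add C" "one (hom_group C U Y) = Zero C U Y" by (simp_all add: hom_group_def)

declare representable_simps(5) [simp del]

section \<open>The preadditive category of coherent functors and its Yoneda functor\<close>

context additive
begin

declare Hom_iff [simp del]
lemmas Hom_C_iff [simp] = Hom_iff[where C = C]

abbreviation "el F U \<equiv> carrier (val F U)"
abbreviation "un F U \<equiv> \<one>\<^bsub>val F U\<^esub>"
abbreviation "\<K> \<equiv> coh C"

lemma aps:
  assumes "additive_presheaf C F"
  shows aps_group: "X \<in> Obj C \<Longrightarrow> comm_group (val F X)"
    and aps_hom: "f \<in> Hom C X Y \<Longrightarrow> res F f \<in> hom (val F Y) (val F X)"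
    and aps_Id: "X \<in> Obj C \<Longrightarrow> x \<in> el F X \<Longrightarrow> res F (Id C X) x = x"
    and aps_comp: "f \<in> Hom C X Y \<Longrightarrow> g \<in> Hom C Y Z \<Longrightarrow> x \<in> el F Z \<Longrightarrow> res F (g * f) x = res F f (res F g x)"
    and aps_add: "f \<in> Hom C X Y \<Longrightarrow> g \<in> Hom C X Y \<Longrightarrow> x \<in> el F Y \<Longrightarrow>
      res F (f \<boxplus> g) x = res F f x \<otimes>\<^bsub>val F X\<^esub> res F g x"
proof -
  note a = assms[unfolded additive_presheaf_def]
  show "X \<in> Obj C \<Longrightarrow> comm_group (val F X)" using a by blast
  show "f \<in> Hom C X Y \<Longrightarrow> res F f \<in> hom (val F Y) (val F X)" using a by auto
  show "X \<in> Obj C \<Longrightarrow> x \<in> el F X \<Longrightarrow> res F (Id C X) x = x" using a by blast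
  show "f \<in> Hom C X Y \<Longrightarrow> g \<in> Hom C Y Z \<Longrightarrow> x \<in> el F Z \<Longrightarrow> res F (g * f) x = res F f (res F g x)" using a by auto
  show "f \<in> Hom C X Y \<Longrightarrow> g \<in> Hom C X Y \<Longrightarrow> x \<in> el F Y \<Longrightarrow>
      res F (f \<boxplus> g) x = res F f x \<otimes>\<^bsub>val F X\<^esub> res F g x" using a Hom_Obj[of f X Y] by blast
qed

lemma aps_closed: "additive_presheaf C F \<Longrightarrow> f \<in> Hom C X Y \<Longrightarrow> x \<in> el F Y \<Longrightarrow> res F f x \<in> el F X"
  using aps_hom by (auto simp: hom_def)

lemma aps_group_hom:
  assumes "additive_presheaf C F" "f \<in> Hom C X Y"
  shows "group_hom (val F Y) (val F X) (res F f)"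
proof -
  have "X \<in> Obj C" "Y \<in> Obj C" using assms by auto
  then show ?thesis using aps_hom[OF assms] aps_group[OF assms(1)]
    by (auto simp: group_hom_def group_hom_axioms_def comm_group_def)
qed

lemma aps_one: "additive_presheaf C F \<Longrightarrow> f \<in> Hom C X Y \<Longrightarrow> res F f (un F Y) = un F X"
  using aps_group_hom group_hom.hom_one by blast

lemma aps_Zero:
  assumes "additive_presheaf C F" "X \<in> Obj C" "Y \<in> Obj C" "x \<in> el F Y"
  shows "res F (Zero C X Y) x = un F X"
proof -
  interpret comm_group "val F X" by (rule aps_group[OF assms(1,2)])
  have Z: "Zero C X Y \<in> Hom C X Y" using assms by simp
  have "res F (Zero C X Y) x \<otimes>\<^bsub>val F X\<^esub> res F (Zero C X Y) x = res F (Zero C X Y) x"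
    using aps_add[OF assms(1) Z Z assms(4)] Z assms by simp
  then show ?thesis using aps_closed[OF assms(1) Z assms(4)] by (simp add: r_cancel_one)
qed

lemma aps_diff:
  assumes "additive_presheaf C F" "f \<in> Hom C X Y" "g \<in> Hom C X Y" "x \<in> el F Y"
  shows "res F (f \<boxplus> neg C g) x = res F f x \<otimes>\<^bsub>val F X\<^esub> inv\<^bsub>val F X\<^esub> (res F g x)"
proof -
  have O: "X \<in> Obj C" "Y \<in> Obj C" using assms by auto
  interpret comm_group "val F X" by (rule aps_group[OF assms(1) O(1)])
  have n: "neg C g \<in> Hom C X Y" using assms by simp
  have "res F (neg C g) x \<otimes>\<^bsub>val F X\<^esub> res F g x = un F X"
    using aps_add[OF assms(1) n assms(3,4)] aps_Zero[OF assms(1) O assms(4)] assms(3) by simp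
  then have "res F (neg C g) x = inv\<^bsub>val F X\<^esub> (res F g x)"
    using aps_closed[OF assms(1) n assms(4)] aps_closed[OF assms(1,3,4)] inv_equality by metis
  then show ?thesis using aps_add[OF assms(1,2) n assms(4)] by simp
qed

lemma coh_aps: "coherent C F \<Longrightarrow> additive_presheaf C F" by (simp add: coherent_def)

text \<open>Cuts given components down to the index range, so that arrows can be built from
  functions that are not extensional.\<close>

definition mk :: "('a, 'b) presheaf \<Rightarrow> ('a, 'b) presheaf \<Rightarrow> ('a \<Rightarrow> 'b \<Rightarrow> 'b) \<Rightarrow> ('a, 'b) coh_arr" where
  "mk F G \<eta> = CohArr F G (\<lambda>U\<in>Obj C. \<lambda>x\<in>el F U. \<eta> U x)"

lemma coh_simps [simp]:
  "Obj \<K> = Collect (coherent C)"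
  "Id \<K> F = mk F F (\<lambda>U x. x)"
  "Comp \<K> \<theta> \<eta> = mk (csrc \<eta>) (ctgt \<theta>) (\<lambda>U x. comps \<theta> U (comps \<eta> U x))"
  "Add \<K> \<theta> \<eta> = mk (csrc \<theta>) (ctgt \<theta>) (\<lambda>U x. comps \<theta> U x \<otimes>\<^bsub>val (ctgt \<theta>) U\<^esub> comps \<eta> U x)"
  "Zero \<K> F G = mk F G (\<lambda>U x. un G U)" by (simp_all add: coh_def mk_def)

lemma coh_Hom:
  "\<phi> \<in> Hom \<K> F G \<longleftrightarrow> coherent C F \<and> coherent C G \<and> csrc \<phi> = F \<and> ctgt \<phi> = G \<and> nat_trans C F G (comps \<phi>)"
  by (cases \<phi>) (auto simp: Hom_def coh_def)

lemma coh_HomD: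
  assumes "\<phi> \<in> Hom \<K> F G"
  shows "coherent C F" "coherent C G" "csrc \<phi> = F" "ctgt \<phi> = G"
    and "U \<in> Obj C \<Longrightarrow> comps \<phi> U \<in> hom (val F U) (val G U)"
    and "f \<in> Hom C U V \<Longrightarrow> x \<in> el F V \<Longrightarrow> comps \<phi> U (res F f x) = res G f (comps \<phi> V x)"
  using assms by (auto simp: coh_Hom nat_trans_def)

lemma coh_closed: "\<phi> \<in> Hom \<K> F G \<Longrightarrow> U \<in> Obj C \<Longrightarrow> x \<in> el F U \<Longrightarrow> comps \<phi> U x \<in> el G U"
  using hom_in_carrier[OF coh_HomD(5)] by blast

lemma coh_mult: "\<phi> \<in> Hom \<K> F G \<Longrightarrow> U \<in> Obj C \<Longrightarrow> x \<in> el F U \<Longrightarrow> y \<in> el F U \<Longrightarrow>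
  comps \<phi> U (x \<otimes>\<^bsub>val F U\<^esub> y) = comps \<phi> U x \<otimes>\<^bsub>val G U\<^esub> comps \<phi> U y" using hom_mult[OF coh_HomD(5)] by blast

lemma coh_group_hom: "\<phi> \<in> Hom \<K> F G \<Longrightarrow> U \<in> Obj C \<Longrightarrow> group_hom (val F U) (val G U) (comps \<phi> U)"
  using coh_HomD(1,2,5) aps_group[OF coh_aps] by (simp add: group_hom_def group_hom_axioms_def comm_group_def)

lemma coh_one: "\<phi> \<in> Hom \<K> F G \<Longrightarrow> U \<in> Obj C \<Longrightarrow> comps \<phi> U (un F U) = un G U"
  using coh_group_hom group_hom.hom_one by blast

lemma coh_eqI:
  assumes "\<phi> \<in> Hom \<K> F G" "\<psi> \<in> Hom \<K> F G"
    and "\<And>U x. U \<in> Obj C \<Longrightarrow> x \<in> el F U \<Longrightarrow> comps \<phi> U x = comps \<psi> U x"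
  shows "\<phi> = \<psi>"
proof -
  have e: "comps \<phi> \<in> extensional (Obj C)" "comps \<psi> \<in> extensional (Obj C)"
    "\<And>U. U \<in> Obj C \<Longrightarrow> comps \<phi> U \<in> extensional (el F U)" "\<And>U. U \<in> Obj C \<Longrightarrow> comps \<psi> U \<in> extensional (el F U)"
    using assms(1,2) by (auto simp: coh_Hom nat_trans_def PiE_iff)
  have "comps \<phi> = comps \<psi>"
  proof (rule extensionalityI[OF e(1,2)])
    fix U assume U: "U \<in> Obj C"
    show "comps \<phi> U = comps \<psi> U" by (rule extensionalityI[OF e(3)[OF U] e(4)[OF U] assms(3)[OF U]])
  qed
  then show ?thesis using assms(1,2) by (auto simp: coh_Hom coh_arr.expand)
qed

lemma mk_Hom:
  assumes "coherent C F" "coherent C G" "\<And>U. U \<in> Obj C \<Longrightarrow> \<eta> U \<in> hom (val F U) (val G U)"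
    and "\<And>f U V x. f \<in> Hom C U V \<Longrightarrow> x \<in> el F V \<Longrightarrow> \<eta> U (res F f x) = res G f (\<eta> V x)"
  shows "mk F G \<eta> \<in> Hom \<K> F G"
proof -
  have "(\<lambda>x\<in>el F U. \<eta> U x) \<in> hom (val F U) (val G U)" if "U \<in> Obj C" for U
  proof (rule homI)
    interpret comm_group "val F U" using aps_group[OF coh_aps[OF assms(1)] that] .
    fix x y assume *: "x \<in> el F U" "y \<in> el F U"
    show "(\<lambda>x\<in>el F U. \<eta> U x) x \<in> el G U" using assms(3)[OF that] * by (auto simp: hom_def)
    show "(\<lambda>x\<in>el F U. \<eta> U x) (x \<otimes>\<^bsub>val F U\<^esub> y) = (\<lambda>x\<in>el F U. \<eta> U x) x \<otimes>\<^bsub>val G U\<^esub> (\<lambda>x\<in>el F U. \<eta> U x) y"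
      using assms(3)[OF that] * by (auto simp: hom_def)
  qed
  moreover have "res F f x \<in> el F (Dom C f)" if "f \<in> Arr C" "x \<in> el F (Cod C f)" for f x
    using aps_closed[OF coh_aps[OF assms(1)], of f "Dom C f" "Cod C f"] that by simp
  ultimately show ?thesis using assms by (auto simp: coh_Hom mk_def nat_trans_def)
qed

lemma comps_mk [simp]: "U \<in> Obj C \<Longrightarrow> x \<in> el F U \<Longrightarrow> comps (mk F G \<eta>) U x = \<eta> U x"
  and src_mk [simp]: "csrc (mk F G \<eta>) = F" and tgt_mk [simp]: "ctgt (mk F G \<eta>) = G" by (simp_all add: mk_def)

lemma coh_Id_Hom: "coherent C F \<Longrightarrow> mk F F (\<lambda>U x. x) \<in> Hom \<K> F F" by (rule mk_Hom) (auto simp: hom_def)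

lemma coh_Comp_Hom:
  assumes "\<phi> \<in> Hom \<K> F G" "\<psi> \<in> Hom \<K> G H"
  shows "mk F H (\<lambda>U x. comps \<psi> U (comps \<phi> U x)) \<in> Hom \<K> F H"
proof (rule mk_Hom)
  fix U assume U: "U \<in> Obj C"
  show "(\<lambda>x. comps \<psi> U (comps \<phi> U x)) \<in> hom (val F U) (val H U)"
    by (rule homI) (use U coh_closed[OF assms(1)] coh_closed[OF assms(2)] coh_mult[OF assms(1)]
      coh_mult[OF assms(2)] in simp_all)
next
  fix f U V x assume *: "f \<in> Hom C U V" "x \<in> el F V"
  then have V: "V \<in> Obj C" by auto
  show "comps \<psi> U (comps \<phi> U (res F f x)) = res H f (comps \<psi> V (comps \<phi> V x))"
    using coh_HomD(6)[OF assms(1) *] coh_HomD(6)[OF assms(2) *(1) coh_closed[OF assms(1) V *(2)]] by simp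
qed (use coh_HomD[OF assms(1)] coh_HomD[OF assms(2)] in auto)

lemma coh_comps_comp:
  assumes "\<phi> \<in> Hom \<K> F G" "\<psi> \<in> Hom \<K> G H" "U \<in> Obj C" "x \<in> el F U"
  shows "comps (Comp \<K> \<psi> \<phi>) U x = comps \<psi> U (comps \<phi> U x)" using assms coh_HomD(3,4)[OF assms(1)] by simp

lemma coh_cat: "cat \<K>"
proof (intro cat.intro category.intro)
  fix f assume "f \<in> Arr \<K>"
  then have f: "f \<in> Hom \<K> (Dom \<K> f) (Cod \<K> f)" by (simp add: Hom_def)
  show "Dom \<K> f \<in> Obj \<K>" "Cod \<K> f \<in> Obj \<K>" using coh_HomD(1,2)[OF f] by auto
next
  fix F assume "F \<in> Obj \<K>" then show "Id \<K> F \<in> Hom \<K> F F" using coh_Id_Hom by simp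
next
  fix \<phi> \<psi> F G H assume "\<phi> \<in> Hom \<K> F G" "\<psi> \<in> Hom \<K> G H"
  then show "Comp \<K> \<psi> \<phi> \<in> Hom \<K> F H" using coh_Comp_Hom coh_HomD(3,4) by simp
next
  fix \<phi> F G assume \<phi>: "\<phi> \<in> Hom \<K> F G"
  note D = coh_HomD[OF \<phi>]
  show "Comp \<K> \<phi> (Id \<K> F) = \<phi>" by (rule coh_eqI[OF _ \<phi>]) (use coh_Comp_Hom[OF coh_Id_Hom[OF D(1)] \<phi>] D in auto)
  show "Comp \<K> (Id \<K> G) \<phi> = \<phi>"
    by (rule coh_eqI[OF _ \<phi>]) (use coh_Comp_Hom[OF \<phi> coh_Id_Hom[OF D(2)]] D coh_closed[OF \<phi>] in auto)
next
  fix \<phi> \<psi> \<theta> F G H K assume a: "\<phi> \<in> Hom \<K> F G" "\<psi> \<in> Hom \<K> G H" "\<theta> \<in> Hom \<K> H K"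
  note D = coh_HomD[OF a(1)] coh_HomD[OF a(2)] coh_HomD[OF a(3)]
  note c = coh_Comp_Hom[OF a(1,2)] coh_Comp_Hom[OF a(2,3)]
  show "Comp \<K> \<theta> (Comp \<K> \<psi> \<phi>) = Comp \<K> (Comp \<K> \<theta> \<psi>) \<phi>"
    by (rule coh_eqI) (use coh_Comp_Hom[OF c(1) a(3)] coh_Comp_Hom[OF a(1) c(2)] D coh_closed[OF a(1)] in auto)
qed

lemma coh_Add_Hom:
  assumes "\<phi> \<in> Hom \<K> F G" "\<psi> \<in> Hom \<K> F G"
  shows "mk F G (\<lambda>U x. comps \<phi> U x \<otimes>\<^bsub>val G U\<^esub> comps \<psi> U x) \<in> Hom \<K> F G"
proof (rule mk_Hom)
  note D = coh_HomD[OF assms(1)]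
  fix U assume U: "U \<in> Obj C"
  interpret comm_group "val G U" by (rule aps_group[OF coh_aps[OF D(2)] U])
  show "(\<lambda>x. comps \<phi> U x \<otimes>\<^bsub>val G U\<^esub> comps \<psi> U x) \<in> hom (val F U) (val G U)"
    by (rule homI) (use U coh_closed[OF assms(1)] coh_closed[OF assms(2)] coh_mult[OF assms(1)] coh_mult[OF assms(2)] in \<open>simp_all add: m_ac\<close>)
next
  note D = coh_HomD[OF assms(1)]
  fix f U V x assume *: "f \<in> Hom C U V" "x \<in> el F V"
  have V: "V \<in> Obj C" using * by auto
  show "comps \<phi> U (res F f x) \<otimes>\<^bsub>val G U\<^esub> comps \<psi> U (res F f x) = res G f (comps \<phi> V x \<otimes>\<^bsub>val G V\<^esub> comps \<psi> V x)"
    using aps_hom[OF coh_aps[OF D(2)] *(1)] coh_closed[OF assms(1) V *(2)] coh_closed[OF assms(2) V *(2)]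
      coh_HomD(6)[OF assms(1) *] coh_HomD(6)[OF assms(2) *] by (simp add: hom_def)
qed (use coh_HomD[OF assms(1)] in auto)

lemma coh_Zero_Hom:
  assumes "coherent C F" "coherent C G"
  shows "mk F G (\<lambda>U x. un G U) \<in> Hom \<K> F G"
proof (rule mk_Hom)
  fix U assume U: "U \<in> Obj C"
  interpret comm_group "val G U" by (rule aps_group[OF coh_aps[OF assms(2)] U])
  show "(\<lambda>x. un G U) \<in> hom (val F U) (val G U)" by (auto simp: hom_def)
qed (use assms aps_one[OF coh_aps[OF assms(2)]] in auto)

lemma coh_preadditive: "preadditive \<K>"
proof (intro preadditive.intro preadditive_axioms.intro coh_cat)
  fix F G assume FG: "F \<in> Obj \<K>" "G \<in> Obj \<K>"
  then have c: "coherent C F" "coherent C G" by auto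
  have g: "comm_group (val G U)" if "U \<in> Obj C" for U by (rule aps_group[OF coh_aps[OF c(2)] that])
  note Z = coh_Zero_Hom[OF c]
  show "comm_group (hom_group \<K> F G)"
  proof (rule comm_groupI, unfold hom_group_simps)
    fix \<phi> \<psi> assume a: "\<phi> \<in> Hom \<K> F G" "\<psi> \<in> Hom \<K> F G"
    note D = coh_HomD[OF a(1)] coh_HomD[OF a(2)]
    show "\<phi> \<boxplus>\<^sub>\<K> \<psi> \<in> Hom \<K> F G" using coh_Add_Hom[OF a] D by simp
    show "\<phi> \<boxplus>\<^sub>\<K> \<psi> = \<psi> \<boxplus>\<^sub>\<K> \<phi>"
    proof (rule coh_eqI)
      fix U x assume U: "U \<in> Obj C" "x \<in> el F U"
      interpret comm_group "val G U" by (rule g[OF U(1)])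
      show "comps (\<phi> \<boxplus>\<^sub>\<K> \<psi>) U x = comps (\<psi> \<boxplus>\<^sub>\<K> \<phi>) U x"
        using U D coh_closed[OF a(1) U] coh_closed[OF a(2) U] by (simp add: m_comm)
    qed (use coh_Add_Hom[OF a] coh_Add_Hom[OF a(2,1)] D in simp_all)
  next
    show "Zero \<K> F G \<in> Hom \<K> F G" using Z by simp
  next
    fix \<phi> assume a: "\<phi> \<in> Hom \<K> F G"
    note D = coh_HomD[OF a]
    show "Zero \<K> F G \<boxplus>\<^sub>\<K> \<phi> = \<phi>"
    proof (rule coh_eqI[OF _ a])
      show "Zero \<K> F G \<boxplus>\<^sub>\<K> \<phi> \<in> Hom \<K> F G" using coh_Add_Hom[OF Z a] D by simp
      fix U x assume U: "U \<in> Obj C" "x \<in> el F U"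
      interpret comm_group "val G U" by (rule g[OF U(1)])
      show "comps (Zero \<K> F G \<boxplus>\<^sub>\<K> \<phi>) U x = comps \<phi> U x" using U D coh_closed[OF a U] by simp
    qed
    let ?n = "mk F G (\<lambda>U x. inv\<^bsub>val G U\<^esub> (comps \<phi> U x))"
    have n: "?n \<in> Hom \<K> F G"
    proof (rule mk_Hom[OF c])
      fix U assume U: "U \<in> Obj C"
      interpret comm_group "val G U" by (rule g[OF U(1)])
      show "(\<lambda>x. inv\<^bsub>val G U\<^esub> comps \<phi> U x) \<in> hom (val F U) (val G U)"
        by (rule homI) (use U coh_closed[OF a] coh_mult[OF a] in \<open>simp_all add: inv_mult\<close>)
    next
      fix f U V x assume *: "f \<in> Hom C U V" "x \<in> el F V"
      have V: "V \<in> Obj C" using * by auto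
      show "inv\<^bsub>val G U\<^esub> comps \<phi> U (res F f x) = res G f (inv\<^bsub>val G V\<^esub> comps \<phi> V x)"
        using group_hom.hom_inv[OF aps_group_hom[OF coh_aps[OF c(2)] *(1)] coh_closed[OF a V *(2)]]
          coh_HomD(6)[OF a *] by simp
    qed
    show "\<exists>\<psi>\<in>Hom \<K> F G. \<psi> \<boxplus>\<^sub>\<K> \<phi> = Zero \<K> F G"
    proof (rule bexI[OF _ n], rule coh_eqI)
      show "?n \<boxplus>\<^sub>\<K> \<phi> \<in> Hom \<K> F G" using coh_Add_Hom[OF n a] D by simp
      show "Zero \<K> F G \<in> Hom \<K> F G" using Z by simp
      fix U x assume U: "U \<in> Obj C" "x \<in> el F U"
      interpret comm_group "val G U" by (rule g[OF U(1)])
      show "comps (?n \<boxplus>\<^sub>\<K> \<phi>) U x = comps (Zero \<K> F G) U x" using U D coh_closed[OF a U] by simp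
    qed
  next
    fix \<phi> \<psi> \<theta> assume a: "\<phi> \<in> Hom \<K> F G" "\<psi> \<in> Hom \<K> F G" and a3: "\<theta> \<in> Hom \<K> F G"
    note D = coh_HomD[OF a(1)] coh_HomD[OF a(2)]
    note D3 = coh_HomD[OF a3]
    note ad = coh_Add_Hom[OF a] coh_Add_Hom[OF a(2) a3]
    show "\<phi> \<boxplus>\<^sub>\<K> \<psi> \<boxplus>\<^sub>\<K> \<theta> = \<phi> \<boxplus>\<^sub>\<K> (\<psi> \<boxplus>\<^sub>\<K> \<theta>)"
    proof (rule coh_eqI)
      fix U x assume U: "U \<in> Obj C" "x \<in> el F U"
      interpret comm_group "val G U" by (rule g[OF U(1)])
      show "comps (\<phi> \<boxplus>\<^sub>\<K> \<psi> \<boxplus>\<^sub>\<K> \<theta>) U x = comps (\<phi> \<boxplus>\<^sub>\<K> (\<psi> \<boxplus>\<^sub>\<K> \<theta>)) U x"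
        using U D D3 coh_closed[OF a(1) U] coh_closed[OF a(2) U] coh_closed[OF a3 U] by (simp add: m_assoc)
    qed (use coh_Add_Hom[OF ad(1) a3] coh_Add_Hom[OF a(1) ad(2)] D D3 in simp_all)
  qed
next
  fix \<phi> \<psi> \<theta> F G H assume a: "\<phi> \<in> Hom \<K> F G" "\<psi> \<in> Hom \<K> F G" "\<theta> \<in> Hom \<K> G H"
  note D = coh_HomD[OF a(1)] coh_HomD[OF a(2)] coh_HomD[OF a(3)]
  note c = coh_Comp_Hom[OF a(1,3)] coh_Comp_Hom[OF a(2,3)] coh_Add_Hom[OF a(1,2)]
  show "\<theta> *\<^sub>\<K> (\<phi> \<boxplus>\<^sub>\<K> \<psi>) = (\<theta> *\<^sub>\<K> \<phi>) \<boxplus>\<^sub>\<K> (\<theta> *\<^sub>\<K> \<psi>)"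
    by (rule coh_eqI) (use coh_Comp_Hom[OF c(3) a(3)] coh_Add_Hom[OF c(1,2)] D
      coh_closed[OF a(1)] coh_closed[OF a(2)] coh_mult[OF a(3)] in auto)
next
  fix \<phi> \<psi> \<theta> F G H assume a: "\<phi> \<in> Hom \<K> F G" "\<psi> \<in> Hom \<K> F G" "\<theta> \<in> Hom \<K> H F"
  note D = coh_HomD[OF a(1)] coh_HomD[OF a(2)] coh_HomD[OF a(3)]
  note c = coh_Comp_Hom[OF a(3,1)] coh_Comp_Hom[OF a(3,2)] coh_Add_Hom[OF a(1,2)]
  show "(\<phi> \<boxplus>\<^sub>\<K> \<psi>) *\<^sub>\<K> \<theta> = (\<phi> *\<^sub>\<K> \<theta>) \<boxplus>\<^sub>\<K> (\<psi> *\<^sub>\<K> \<theta>)"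
    by (rule coh_eqI) (use coh_Comp_Hom[OF a(3) c(3)] coh_Add_Hom[OF c(1,2)] D
      coh_closed[OF a(3)] in auto)
qed

text \<open>\<open>F\<close> is generated by \<open>e \<in> F Y\<close> and \<open>a : X \<rightarrow> Y\<close> generates the relations of \<open>e\<close>;
  by the Yoneda lemma this is a presentation \<open>Hom(-, X) \<rightarrow> Hom(-, Y) \<rightarrow> F \<rightarrow> 0\<close>.\<close>

definition presented :: "('a, 'b) presheaf \<Rightarrow> 'a \<Rightarrow> 'a \<Rightarrow> 'b \<Rightarrow> 'b \<Rightarrow> bool" where
  "presented F X Y a e \<longleftrightarrow> a \<in> Hom C X Y \<and> e \<in> el F Y \<and> (\<forall>U\<in>Obj C. \<forall>x\<in>el F U. \<exists>u\<in>Hom C U Y. res F u e = x) \<and>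
     (\<forall>U\<in>Obj C. \<forall>u\<in>Hom C U Y. res F u e = un F U \<longleftrightarrow> (\<exists>v\<in>Hom C U X. u = a * v))"

lemma aps_elt_hom:
  assumes "additive_presheaf C F" "U \<in> Obj C" "e \<in> el F Y"
  shows "(\<lambda>u. res F u e) \<in> hom (val (representable C Y) U) (val F U)"
  by (rule homI) (use aps_closed[OF assms(1) _ assms(3)] aps_add[OF assms(1) _ _ assms(3)] in auto)

lemma representable_aps: "Y \<in> Obj C \<Longrightarrow> additive_presheaf C (representable C Y)" unfolding additive_presheaf_def
  by (auto simp: hom_def) (simp add: representable_simps(5) hom_group)

text \<open>By the Yoneda lemma the transformations in the definition are determined by the images
  \<open>a\<close> and \<open>e\<close> of identities, and pointwise exactness becomes the statement
  that \<open>e\<close> generates and \<open>a\<close> generates its relations.\<close>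

lemma coherent_iff:
  "coherent C F \<longleftrightarrow> additive_presheaf C F \<and> (\<exists>X Y a e. presented F X Y a e)"
proof
  assume F: "coherent C F"
  then have ap: "additive_presheaf C F" by (rule coh_aps)
  obtain X Y \<alpha> \<pi> where *: "X \<in> Obj C" "Y \<in> Obj C"
    "nat_trans C (representable C X) (representable C Y) \<alpha>" "nat_trans C (representable C Y) F \<pi>"
    and ex: "\<And>U. U \<in> Obj C \<Longrightarrow> \<alpha> U ` Hom C U X = {u \<in> Hom C U Y. \<pi> U u = un F U} \<and> \<pi> U ` Hom C U Y = el F U"
    using F unfolding coherent_def kernel_def by (auto simp: hom_group_simps)
  let ?a = "\<alpha> X (Id C X)" and ?e = "\<pi> Y (Id C Y)"
  have IX: "Id C X \<in> Hom C X X" "Id C Y \<in> Hom C Y Y" using * by auto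
  have aH: "?a \<in> Hom C X Y" using ex[OF *(1)] IX(1) by blast
  have eF: "?e \<in> el F Y" using ex[OF *(2)] IX(2) by blast
  have \<alpha>: "\<alpha> U v = ?a * v" if "v \<in> Hom C U X" for U v
  proof -
    have "\<forall>f\<in>Arr C. \<forall>x\<in>el (representable C X) (Cod C f).
        \<alpha> (Dom C f) (res (representable C X) f x) = res (representable C Y) f (\<alpha> (Cod C f) x)"
      using *(3) unfolding nat_trans_def by blast
    from this[rule_format, of v "Id C X"] that IX show ?thesis by auto
  qed
  have \<pi>: "\<pi> U u = res F u ?e" if "u \<in> Hom C U Y" for U u
  proof -
    have "\<forall>f\<in>Arr C. \<forall>x\<in>el (representable C Y) (Cod C f).
        \<pi> (Dom C f) (res (representable C Y) f x) = res F f (\<pi> (Cod C f) x)"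
      using *(4) unfolding nat_trans_def by blast
    from this[rule_format, of u "Id C Y"] that IX show ?thesis by auto
  qed
  have "presented F X Y ?a ?e" unfolding presented_def
  proof (intro conjI ballI aH eF)
    fix U x assume U: "U \<in> Obj C" "x \<in> el F U"
    then have "x \<in> \<pi> U ` Hom C U Y" using ex[OF U(1)] by simp
    then obtain u where u: "u \<in> Hom C U Y" "x = \<pi> U u" by (rule imageE)
    show "\<exists>u\<in>Hom C U Y. res F u ?e = x" by (rule bexI[OF _ u(1)]) (simp only: u(2) \<pi>[OF u(1)])
  next
    fix U u assume U: "U \<in> Obj C" "u \<in> Hom C U Y"
    have "res F u ?e = un F U \<longleftrightarrow> u \<in> \<alpha> U ` Hom C U X" using ex[OF U(1)] U(2) \<pi>[OF U(2)] by auto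
    also have "\<dots> \<longleftrightarrow> (\<exists>v\<in>Hom C U X. u = ?a * v)" using \<alpha> by (auto simp del: Hom_C_iff)
    finally show "res F u ?e = un F U \<longleftrightarrow> (\<exists>v\<in>Hom C U X. u = ?a * v)" .
  qed
  with ap show "additive_presheaf C F \<and> (\<exists>X Y a e. presented F X Y a e)" by blast
next
  assume "additive_presheaf C F \<and> (\<exists>X Y a e. presented F X Y a e)"
  then obtain X Y a e where ap: "additive_presheaf C F" and p: "presented F X Y a e" by blast
  then have a: "a \<in> Hom C X Y" and e: "e \<in> el F Y" by (auto simp: presented_def)
  have O: "X \<in> Obj C" "Y \<in> Obj C" using a by auto
  let ?\<alpha> = "\<lambda>U\<in>Obj C. \<lambda>u\<in>el (representable C X) U. a * u"
  let ?\<pi> = "\<lambda>U\<in>Obj C. \<lambda>u\<in>el (representable C Y) U. res F u e"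
  have "nat_trans C (representable C X) (representable C Y) ?\<alpha>"
    unfolding nat_trans_def using a by (auto simp: hom_def)
  moreover have "nat_trans C (representable C Y) F ?\<pi>" unfolding nat_trans_def
    using aps_closed[OF ap _ e] aps_add[OF ap _ _ e] aps_comp[OF ap _ _ e] by (auto simp: hom_def)
  moreover have "?\<alpha> U ` carrier (hom_group C U X) = kernel (hom_group C U Y) (val F U) (?\<pi> U) \<and>
     ?\<pi> U ` carrier (hom_group C U Y) = carrier (val F U)" if U: "U \<in> Obj C" for U
  proof
    have e1: "(u \<in> ?\<alpha> U ` Hom C U X) = (u \<in> Hom C U Y \<and> (\<exists>v\<in>Hom C U X. u = a * v))" for u
      using U a by (auto simp del: Hom_C_iff) (auto simp: Comp_Hom)
    have "(u \<in> ?\<alpha> U ` Hom C U X) = (u \<in> kernel (hom_group C U Y) (val F U) (?\<pi> U))" for u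
      unfolding e1 using p U unfolding presented_def kernel_def by (auto simp: hom_group_simps)
    then show "?\<alpha> U ` carrier (hom_group C U X) = kernel (hom_group C U Y) (val F U) (?\<pi> U)"
      unfolding hom_group_simps by blast
    have "x \<in> ?\<pi> U ` Hom C U Y" if "x \<in> el F U" for x
    proof -
      obtain u where "u \<in> Hom C U Y" "res F u e = x" using p U \<open>x \<in> el F U\<close> unfolding presented_def by blast
      then show ?thesis using U by (auto intro!: image_eqI[of _ _ u])
    qed
    moreover have "x \<in> el F U" if "x \<in> ?\<pi> U ` Hom C U Y" for x using that U aps_closed[OF ap _ e] by auto
    ultimately show "?\<pi> U ` carrier (hom_group C U Y) = carrier (val F U)" unfolding hom_group_simps by blast
  qed
  ultimately show "coherent C F" unfolding coherent_def using ap O by blast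
qed

lemma coh_presented:
  assumes "coherent C F"
  obtains X Y a e where "presented F X Y a e" using assms coherent_iff by blast

lemma presentedD:
  assumes "presented F X Y a e"
  shows "a \<in> Hom C X Y" "e \<in> el F Y" "X \<in> Obj C" "Y \<in> Obj C"
    and "U \<in> Obj C \<Longrightarrow> x \<in> el F U \<Longrightarrow> \<exists>u\<in>Hom C U Y. res F u e = x"
    and "u \<in> Hom C U Y \<Longrightarrow> res F u e = un F U \<longleftrightarrow> (\<exists>v\<in>Hom C U X. u = a * v)"
proof -
  note p = assms[unfolded presented_def]
  show a: "a \<in> Hom C X Y" and "e \<in> el F Y" using p by blast+
  show "X \<in> Obj C" "Y \<in> Obj C" using Hom_Obj[OF a] by auto
  show "U \<in> Obj C \<Longrightarrow> x \<in> el F U \<Longrightarrow> \<exists>u\<in>Hom C U Y. res F u e = x" using p by blast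
  show "res F u e = un F U \<longleftrightarrow> (\<exists>v\<in>Hom C U X. u = a * v)" if "u \<in> Hom C U Y" using p Hom_Obj[OF that] that by blast
qed

text \<open>The identity generates a representable functor, and its only relation is zero.\<close>

lemma representable_coherent [simp]: "Y \<in> Obj C \<Longrightarrow> coherent C (representable C Y)"
proof -
  assume Y: "Y \<in> Obj C"
  have "presented (representable C Y) Y Y (Zero C Y Y) (Id C Y)"
    unfolding presented_def using Y by (auto, metis Zero_simps)
  then show ?thesis using coherent_iff representable_aps[OF Y] by blast
qed

text \<open>The arrow out of a representable functor that corresponds to the element
  \<open>e\<close> under the Yoneda lemma.\<close>

definition elt :: "('a, 'b) presheaf \<Rightarrow> 'a \<Rightarrow> 'b \<Rightarrow> ('a, 'b) coh_arr" where
  "elt F Y e = mk (representable C Y) F (\<lambda>U u. res F u e)"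

lemma elt_Hom:
  assumes "coherent C F" "Y \<in> Obj C" "e \<in> el F Y"
  shows "elt F Y e \<in> Hom \<K> (representable C Y) F" unfolding elt_def
proof (rule mk_Hom)
  note ap = coh_aps[OF assms(1)]
  show "\<And>U. U \<in> Obj C \<Longrightarrow> (\<lambda>u. res F u e) \<in> hom (val (representable C Y) U) (val F U)"
    by (rule aps_elt_hom[OF ap _ assms(3)])
  show "\<And>f U V x. f \<in> Hom C U V \<Longrightarrow> x \<in> el (representable C Y) V \<Longrightarrow>
    res F (res (representable C Y) f x) e = res F f (res F x e)" using aps_comp[OF ap _ _ assms(3)] by simp
qed (use assms in auto)

lemma comps_elt: "u \<in> Hom C U Y \<Longrightarrow> comps (elt F Y e) U u = res F u e" by (auto simp: elt_def)

lemma elt_eq: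
  assumes "\<phi> \<in> Hom \<K> (representable C Y) F" "Y \<in> Obj C"
  shows "\<phi> = elt F Y (comps \<phi> Y (Id C Y))" "comps \<phi> Y (Id C Y) \<in> el F Y"
proof -
  have I: "Id C Y \<in> el (representable C Y) Y" using assms by simp
  show e: "comps \<phi> Y (Id C Y) \<in> el F Y" by (rule coh_closed[OF assms I])
  show "\<phi> = elt F Y (comps \<phi> Y (Id C Y))"
  proof (rule coh_eqI[OF assms(1) elt_Hom[OF coh_HomD(2)[OF assms(1)] assms(2) e]])
    fix U u assume U: "U \<in> Obj C" "u \<in> el (representable C Y) U"
    then have u: "u \<in> Hom C U Y" by simp
    have "comps \<phi> U (res (representable C Y) u (Id C Y)) = res F u (comps \<phi> Y (Id C Y))"
      by (rule coh_HomD(6)[OF assms(1) u I])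
    then show "comps \<phi> U u = comps (elt F Y (comps \<phi> Y (Id C Y))) U u" using u by (simp add: comps_elt)
  qed
qed

lemma comp_elt:
  assumes "\<phi> \<in> Hom \<K> F G" "Y \<in> Obj C" "e \<in> el F Y"
  shows "\<phi> *\<^sub>\<K> elt F Y e = elt G Y (comps \<phi> Y e)"
proof -
  note D = coh_HomD[OF assms(1)]
  note E = elt_Hom[OF D(1) assms(2,3)]
  have c: "\<phi> *\<^sub>\<K> elt F Y e \<in> Hom \<K> (representable C Y) G"
    using cat.Comp_simps[OF coh_cat] E assms(1) by (simp add: Hom_iff)
  have "comps (\<phi> *\<^sub>\<K> elt F Y e) Y (Id C Y) = comps \<phi> Y e" using assms(2,3) aps_Id[OF coh_aps[OF D(1)]]
    by (subst coh_comps_comp[OF E assms(1)]) (simp_all add: comps_elt)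
  then show ?thesis using elt_eq(1)[OF c assms(2)] by simp
qed

lemma yoneda_arr: "f \<in> Arr C \<Longrightarrow> on_arr (yoneda C) f = elt (representable C (Cod C f)) (Dom C f) f"
  by (simp add: yoneda_def elt_def mk_def)

lemma yoneda_obj [simp]: "on_obj (yoneda C) X = representable C X" by (simp add: yoneda_def)

lemma yoneda_Hom: "f \<in> Hom C X Y \<Longrightarrow> on_arr (yoneda C) f \<in> Hom \<K> (representable C X) (representable C Y)"
  using elt_Hom[of "representable C Y" X f] by (auto simp: yoneda_arr)

lemma comps_yoneda: "f \<in> Hom C X Y \<Longrightarrow> u \<in> Hom C U X \<Longrightarrow> comps (on_arr (yoneda C) f) U u = f * u"
  by (auto simp: yoneda_arr comps_elt)

lemma yoneda_additive: "additive_functor C \<K> (yoneda C)" unfolding additive_functor_def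
proof (intro conjI ballI)
  show "is_functor C \<K> (yoneda C)"
  proof (rule is_functorI)
    fix X assume X: "X \<in> Obj C"
    then have I: "Id C X \<in> Hom C X X" by simp
    show "on_arr (yoneda C) (Id C X) = Id \<K> (on_obj (yoneda C) X)" by (rule coh_eqI[OF yoneda_Hom[OF I]])
        (use X comps_yoneda[OF I] coh_Id_Hom[of "representable C X"] in auto)
  next
    fix f X Y assume "f \<in> Hom C X Y"
    then show "on_arr (yoneda C) f \<in> Hom \<K> (on_obj (yoneda C) X) (on_obj (yoneda C) Y)"
      unfolding yoneda_obj by (rule yoneda_Hom)
  next
    fix f g X Y Z assume f: "f \<in> Hom C X Y" and g: "g \<in> Hom C Y Z"
    then have gf: "g * f \<in> Hom C X Z" by simp
    have c: "on_arr (yoneda C) g *\<^sub>\<K> on_arr (yoneda C) f \<in> Hom \<K> (representable C X) (representable C Z)"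
      using cat.Comp_simps[OF coh_cat] yoneda_Hom[OF f] yoneda_Hom[OF g] by (simp add: Hom_iff)
    show "on_arr (yoneda C) (g * f) = on_arr (yoneda C) g *\<^sub>\<K> on_arr (yoneda C) f"
    proof (rule coh_eqI[OF yoneda_Hom[OF gf] c])
      fix U u assume "U \<in> Obj C" "u \<in> el (representable C X) U"
      then show "comps (on_arr (yoneda C) (g * f)) U u = comps (on_arr (yoneda C) g *\<^sub>\<K> on_arr (yoneda C) f) U u"
        using f g comps_yoneda[OF gf, of u U] comps_yoneda[OF f, of u U] comps_yoneda[OF g, of "f * u" U]
          coh_comps_comp[OF yoneda_Hom[OF f] yoneda_Hom[OF g], of U u] by simp
    qed
  qed simp
  fix X Y f g assume *: "f \<in> Hom C X Y" "g \<in> Hom C X Y"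
  then have fg: "f \<boxplus> g \<in> Hom C X Y" by simp
  note D = coh_HomD(3,4)[OF yoneda_Hom[OF *(1)]]
  show "on_arr (yoneda C) (f \<boxplus> g) = on_arr (yoneda C) f \<boxplus>\<^sub>\<K> on_arr (yoneda C) g"
  proof (rule coh_eqI[OF yoneda_Hom[OF fg]])
    show "on_arr (yoneda C) f \<boxplus>\<^sub>\<K> on_arr (yoneda C) g \<in> Hom \<K> (representable C X) (representable C Y)"
      using coh_Add_Hom[OF yoneda_Hom[OF *(1)] yoneda_Hom[OF *(2)]] D by simp
    fix U u assume "U \<in> Obj C" "u \<in> el (representable C X) U"
    then show "comps (on_arr (yoneda C) (f \<boxplus> g)) U u =
        comps (on_arr (yoneda C) f \<boxplus>\<^sub>\<K> on_arr (yoneda C) g) U u"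
      using * D comps_yoneda[OF fg, of u U] comps_yoneda[OF *(1), of u U] comps_yoneda[OF *(2), of u U] by simp
  qed
qed

lemma coh_Zero_iff:
  assumes "\<phi> \<in> Hom \<K> F G"
  shows "\<phi> = Zero \<K> F G \<longleftrightarrow> (\<forall>U\<in>Obj C. \<forall>x\<in>el F U. comps \<phi> U x = un G U)"
proof
  assume "\<phi> = Zero \<K> F G"
  then show "\<forall>U\<in>Obj C. \<forall>x\<in>el F U. comps \<phi> U x = un G U" by simp
next
  assume *: "\<forall>U\<in>Obj C. \<forall>x\<in>el F U. comps \<phi> U x = un G U"
  show "\<phi> = Zero \<K> F G" by (rule coh_eqI[OF assms]) (use coh_Zero_Hom[OF coh_HomD(1,2)[OF assms]] * in simp_all)
qed

end

text \<open>Exactness in abelian groups at every object. Constructions and chases use these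
  predicates, and the lemmas below connect them with the kernels and cokernels of the category of
  coherent functors.\<close>

definition (in additive) "pointwise_kernel \<phi> k \<longleftrightarrow> (\<forall>U\<in>Obj C. inj_on (comps k U) (el (csrc k) U) \<and>
  comps k U ` el (csrc k) U = {x \<in> el (csrc \<phi>) U. comps \<phi> U x = un (ctgt \<phi>) U})"

definition (in additive) "pointwise_cokernel \<phi> c \<longleftrightarrow> (\<forall>U\<in>Obj C. comps c U ` el (csrc c) U = el (ctgt c) U \<and>
  {x \<in> el (csrc c) U. comps c U x = un (ctgt c) U} = comps \<phi> U ` el (csrc \<phi>) U)"

context additive
begin

lemma coh_diff_one:
  assumes "\<phi> \<in> Hom \<K> F G" "U \<in> Obj C" "x \<in> el F U" "y \<in> el F U"
  shows "comps \<phi> U (x \<otimes>\<^bsub>val F U\<^esub> inv\<^bsub>val F U\<^esub> y) = un G U \<longleftrightarrow> comps \<phi> U x = comps \<phi> U y"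
proof -
  interpret group_hom "val F U" "val G U" "comps \<phi> U" by (rule coh_group_hom[OF assms(1,2)])
  show ?thesis using assms(3,4) H.inv_equality[of "comps \<phi> U x" "inv\<^bsub>val G U\<^esub> comps \<phi> U y"] by (auto simp: hom_inv)
qed

lemma pointwise_kernel_is_kernel:
  assumes f: "\<phi> \<in> Hom \<K> F G" and k: "k \<in> Hom \<K> K F" and p: "pointwise_kernel \<phi> k"
  shows "is_kernel \<K> \<phi> k"
proof -
  interpret coh: preadditive "coh C" by (rule coh_preadditive)
  note fD = coh_HomD[OF f] and kD = coh_HomD[OF k]
  have pk: "inj_on (comps k U) (el K U)" "comps k U ` el K U = {x \<in> el F U. comps \<phi> U x = un G U}"
    if "U \<in> Obj C" for U using p that kD(3) fD(3,4) by (auto simp: pointwise_kernel_def)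
  show ?thesis
  proof (rule coh.kernelI[OF f k])
    have fk: "\<phi> *\<^sub>\<K> k \<in> Hom \<K> K G" by (rule coh.Comp_Hom[OF k f])
    show "\<phi> *\<^sub>\<K> k = Zero \<K> K G" unfolding coh_Zero_iff[OF fk]
    proof (intro ballI)
      fix U x assume U: "U \<in> Obj C" "x \<in> el K U"
      then have "comps k U x \<in> comps k U ` el K U" by blast
      then show "comps (\<phi> *\<^sub>\<K> k) U x = un G U" unfolding pk(2)[OF U(1)] coh_comps_comp[OF k f U] by blast
    qed
    show "monomorphism \<K> k"
    proof (rule coh.monoI[OF k])
      fix W h assume h: "h \<in> Hom \<K> W K" "k *\<^sub>\<K> h = Zero \<K> W F"
      have "comps h U x = un K U" if U: "U \<in> Obj C" "x \<in> el W U" for U x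
      proof (rule inj_onD[OF pk(1)[OF U(1)]])
        interpret K: comm_group "val K U" by (rule aps_group[OF coh_aps[OF kD(1)] U(1)])
        have "comps (k *\<^sub>\<K> h) U x = un F U" unfolding h(2) using U by simp
        then show "comps k U (comps h U x) = comps k U (un K U)"
          using coh_comps_comp[OF h(1) k U] coh_one[OF k U(1)] by (simp del: coh_simps)
        show "comps h U x \<in> el K U" by (rule coh_closed[OF h(1) U])
        show "un K U \<in> el K U" by simp
      qed
      then show "h = Zero \<K> W K" using coh_Zero_iff[OF h(1)] by blast
    qed
    fix W h assume h: "h \<in> Hom \<K> W F" "\<phi> *\<^sub>\<K> h = Zero \<K> W G"
    note hD = coh_HomD[OF h(1)]
    let ?u = "\<lambda>U x. inv_into (el K U) (comps k U) (comps h U x)"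
    have hk: "comps h U x \<in> comps k U ` el K U" if U: "U \<in> Obj C" "x \<in> el W U" for U x
    proof -
      have "comps (\<phi> *\<^sub>\<K> h) U x = un G U" unfolding h(2) using U by simp
      then show ?thesis using coh_comps_comp[OF h(1) f U] coh_closed[OF h(1) U] pk(2)[OF U(1)]
        by (simp del: coh_simps)
    qed
    have ku: "?u U x \<in> el K U" "comps k U (?u U x) = comps h U x" if U: "U \<in> Obj C" "x \<in> el W U" for U x
      using hk[OF U] by (auto intro: inv_into_into f_inv_into_f)
    have uu: "?u U x = y" if "U \<in> Obj C" "x \<in> el W U" "y \<in> el K U" "comps k U y = comps h U x" for U x y
      using inj_onD[OF pk(1)[OF that(1)], of "?u U x" y] ku[OF that(1,2)] that by simp
    have u: "mk W K ?u \<in> Hom \<K> W K"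
    proof (rule mk_Hom[OF hD(1) kD(1)])
      fix U assume U: "U \<in> Obj C"
      interpret W: comm_group "val W U" by (rule aps_group[OF coh_aps[OF hD(1)] U])
      interpret K: comm_group "val K U" by (rule aps_group[OF coh_aps[OF kD(1)] U])
      show "?u U \<in> hom (val W U) (val K U)"
      proof (rule homI)
        fix x y assume xy: "x \<in> el W U" "y \<in> el W U"
        show "?u U (x \<otimes>\<^bsub>val W U\<^esub> y) = ?u U x \<otimes>\<^bsub>val K U\<^esub> ?u U y"
          by (rule uu[OF U]) (use xy ku[OF U] coh_mult[OF k U] coh_mult[OF h(1) U] in auto)
      qed (use ku(1)[OF U] in auto)
    next
      fix g U V x assume g: "g \<in> Hom C U V" "x \<in> el W V"
      then have O: "U \<in> Obj C" "V \<in> Obj C" by auto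
      show "?u U (res W g x) = res K g (?u V x)"
      proof (rule uu[OF O(1)])
        show "res W g x \<in> el W U" by (rule aps_closed[OF coh_aps[OF hD(1)] g])
        show "res K g (?u V x) \<in> el K U" by (rule aps_closed[OF coh_aps[OF kD(1)] g(1) ku(1)[OF O(2) g(2)]])
        show "comps k U (res K g (?u V x)) = comps h U (res W g x)"
          using coh_HomD(6)[OF k g(1) ku(1)[OF O(2) g(2)]] ku(2)[OF O(2) g(2)] coh_HomD(6)[OF h(1) g] by simp
      qed
    qed
    have "k *\<^sub>\<K> mk W K ?u = h"
      by (rule coh_eqI[OF coh.Comp_Hom[OF u k] h(1)]) (use coh_comps_comp[OF u k] ku(2) in \<open>simp del: coh_simps\<close>)
    with u show "\<exists>u\<in>Hom \<K> W K. k *\<^sub>\<K> u = h" by blast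
  qed
qed

lemma pointwise_cokernel_is_cokernel:
  assumes f: "\<phi> \<in> Hom \<K> F G" and c: "c \<in> Hom \<K> G K" and p: "pointwise_cokernel \<phi> c"
  shows "is_cokernel \<K> \<phi> c"
proof -
  interpret coh: preadditive "coh C" by (rule coh_preadditive)
  note fD = coh_HomD[OF f] and cD = coh_HomD[OF c]
  have pc: "comps c U ` el G U = el K U" "{x \<in> el G U. comps c U x = un K U} = comps \<phi> U ` el F U"
    if "U \<in> Obj C" for U using p that cD(3,4) fD(3) by (auto simp: pointwise_cokernel_def)
  show ?thesis
  proof (rule coh.cokernelI[OF f c])
    have cf: "c *\<^sub>\<K> \<phi> \<in> Hom \<K> F K" by (rule coh.Comp_Hom[OF f c])
    show "c *\<^sub>\<K> \<phi> = Zero \<K> F K" unfolding coh_Zero_iff[OF cf]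
    proof (intro ballI)
      fix U x assume U: "U \<in> Obj C" "x \<in> el F U"
      then have "comps \<phi> U x \<in> comps \<phi> U ` el F U" by blast
      then show "comps (c *\<^sub>\<K> \<phi>) U x = un K U"
        unfolding pc(2)[OF U(1), symmetric] coh_comps_comp[OF f c U] by blast
    qed
    show "epimorphism \<K> c"
    proof (rule coh.epiI[OF c])
      fix W h assume h: "h \<in> Hom \<K> K W" "h *\<^sub>\<K> c = Zero \<K> G W"
      have "comps h U y = un W U" if U: "U \<in> Obj C" "y \<in> el K U" for U y
      proof -
        obtain x where x: "x \<in> el G U" "y = comps c U x" using pc(1)[OF U(1)] U(2) by blast
        have "comps (h *\<^sub>\<K> c) U x = un W U" unfolding h(2) using U x by simp
        then show ?thesis using coh_comps_comp[OF c h(1) U(1) x(1)] x(2) by (simp del: coh_simps)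
      qed
      then show "h = Zero \<K> K W" using coh_Zero_iff[OF h(1)] by blast
    qed
    fix W h assume h: "h \<in> Hom \<K> G W" "h *\<^sub>\<K> \<phi> = Zero \<K> F W"
    note hD = coh_HomD[OF h(1)]
    \<comment> \<open>Preimages under \<open>c\<close> are chosen arbitrarily: two of them differ by
      an element of the image of \<open>\<phi>\<close>, which \<open>h\<close> kills. This is the
      content of \<open>uu\<close>.\<close>
    let ?u = "\<lambda>U y. comps h U (inv_into (el G U) (comps c U) y)"
    have uu: "?u U (comps c U x) = comps h U x" if U: "U \<in> Obj C" "x \<in> el G U" for U x
    proof -
      let ?x = "inv_into (el G U) (comps c U) (comps c U x)"
      have x: "?x \<in> el G U" "comps c U ?x = comps c U x" using U(2) by (auto intro: inv_into_into f_inv_into_f)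
      interpret comm_group "val G U" by (rule aps_group[OF coh_aps[OF cD(1)] U(1)])
      have "?x \<otimes>\<^bsub>val G U\<^esub> inv\<^bsub>val G U\<^esub> x \<in> comps \<phi> U ` el F U"
        using coh_diff_one[OF c U(1) x(1) U(2)] x U(2) unfolding pc(2)[OF U(1), symmetric] by simp
      then obtain z where z: "z \<in> el F U" "?x \<otimes>\<^bsub>val G U\<^esub> inv\<^bsub>val G U\<^esub> x = comps \<phi> U z" by blast
      have "comps (h *\<^sub>\<K> \<phi>) U z = un W U" unfolding h(2) using U z by simp
      then show ?thesis using coh_comps_comp[OF f h(1) U(1) z(1)] z(2) coh_diff_one[OF h(1) U(1) x(1) U(2)]
        by (simp del: coh_simps)
    qed
    have u: "mk K W ?u \<in> Hom \<K> K W"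
    proof (rule mk_Hom[OF cD(2) hD(2)])
      fix U assume U: "U \<in> Obj C"
      interpret G: comm_group "val G U" by (rule aps_group[OF coh_aps[OF cD(1)] U])
      show "?u U \<in> hom (val K U) (val W U)"
      proof (rule homI)
        fix y assume y: "y \<in> el K U"
        then obtain x where x: "x \<in> el G U" "y = comps c U x" unfolding pc(1)[OF U, symmetric] by (rule imageE)
        show "?u U y \<in> el W U" using uu[OF U x(1)] coh_closed[OF h(1) U x(1)] x(2) by simp
        fix y' assume "y' \<in> el K U"
        then obtain x' where "x' \<in> el G U" "y' = comps c U x'" unfolding pc(1)[OF U, symmetric] by (rule imageE)
        with x show "?u U (y \<otimes>\<^bsub>val K U\<^esub> y') = ?u U y \<otimes>\<^bsub>val W U\<^esub> ?u U y'"
          using uu[OF U] uu[OF U, of "x \<otimes>\<^bsub>val G U\<^esub> x'"] coh_mult[OF c U] coh_mult[OF h(1) U] by simp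
      qed
    next
      fix g U V y assume g: "g \<in> Hom C U V" "y \<in> el K V"
      then have O: "U \<in> Obj C" "V \<in> Obj C" by auto
      obtain x where x: "x \<in> el G V" "y = comps c V x" using pc(1)[OF O(2)] g(2) by blast
      show "?u U (res K g y) = res W g (?u V y)"
        using uu[OF O(1) aps_closed[OF coh_aps[OF cD(1)] g(1) x(1)]] uu[OF O(2) x(1)] x(2)
          coh_HomD(6)[OF c g(1) x(1)] coh_HomD(6)[OF h(1) g(1) x(1)] by simp
    qed
    have "mk K W ?u *\<^sub>\<K> c = h" by (rule coh_eqI[OF coh.Comp_Hom[OF c u] h(1)])
        (use coh_comps_comp[OF c u] uu coh_closed[OF c] in \<open>simp del: coh_simps\<close>)
    with u show "\<exists>u\<in>Hom \<K> K W. u *\<^sub>\<K> c = h" by blast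
  qed
qed

end

text \<open>Cokernels commute with direct sums. For coherent functors cokernels are constructed
  before direct sums, and this lemma yields the latter: the direct sum of two functors is the
  cokernel of the direct sum of their presentations, which already exists among
  representables.\<close>

lemma (in preadditive) biprod_of_cokernels:
  assumes a: "biprod A A' AA ia ja pa qa" and b: "biprod B B' BB i j p q"
    and f: "f \<in> Hom C A B" "f' \<in> Hom C A' B'" and c: "is_cokernel C f c" and c': "is_cokernel C f' c'"
    and h: "is_cokernel C ((i * f * pa) \<boxplus> (j * f' * qa)) h"
  shows "\<exists>\<iota> \<kappa> \<pi> \<rho>. biprod (Cod C c) (Cod C c') (Cod C h) \<iota> \<kappa> \<pi> \<rho>"
proof -
  note a = a[unfolded biprod_def] and b = b[unfolded biprod_def]
  have O: "A \<in> Obj C" "A' \<in> Obj C" "B \<in> Obj C" "B' \<in> Obj C" using f Hom_Obj by blast+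
  note cD = cokernelD[OF c] and cD' = cokernelD[OF c'] and hD = cokernelD[OF h]
  have bA: "i \<in> Hom C B BB" "j \<in> Hom C B' BB" "p \<in> Hom C BB B" "q \<in> Hom C BB B'"
    "ia \<in> Hom C A AA" "ja \<in> Hom C A' AA" "pa \<in> Hom C AA A" "qa \<in> Hom C AA A'" using a b by blast+
  have be: "p * i = Id C B" "q * j = Id C B'" "q * i = Zero C B B'" "p * j = Zero C B' B"
    "pa * ia = Id C A" "qa * ja = Id C A'" "qa * ia = Zero C A A'" "pa * ja = Zero C A' A" using a b by blast+
  have s: "(i * p) \<boxplus> (j * q) = Id C BB" using b by blast
  let ?F = "(i * f * pa) \<boxplus> (j * f' * qa)"
  have F: "?F \<in> Hom C AA BB" using bA f by simp
  have OO: "AA \<in> Obj C" "BB \<in> Obj C" using Hom_Obj[OF F] by auto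
  have hH: "h \<in> Hom C BB (Cod C h)" using hD F by simp
  have cH: "c \<in> Hom C B (Cod C c)" "c' \<in> Hom C B' (Cod C c')" using cD cD' f by simp_all
  note r = reduce[OF be(1)] reduce[OF be(2)] reduce[OF be(3)] reduce[OF be(4)]
  have Fi: "?F * ia = i * f" "?F * ja = j * f'" using bA f be(5-8) O by simp_all
  have pF: "p * ?F = f * pa" "q * ?F = f' * qa" using bA f O OO by (simp_all add: r)
  have "(h * i) * f = h * (?F * ia)" unfolding Fi using hH bA f by simp
  also have "\<dots> = (h * ?F) * ia" using hH bA F by (simp del: Add_Comp Comp_Add)
  also have "\<dots> = Zero C A (Cod C h)" unfolding hD(4) using F bA hD(2) by (simp del: Add_Comp Comp_Add)
  finally obtain \<iota> where \<iota>: "\<iota> \<in> Hom C (Cod C c) (Cod C h)" "\<iota> * c = h * i"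
    using cokernel_factor[OF c, of "h * i" "Cod C h"] hH bA f by auto
  have "(h * j) * f' = h * (?F * ja)" unfolding Fi using hH bA f by simp
  also have "\<dots> = (h * ?F) * ja" using hH bA F by (simp del: Add_Comp Comp_Add)
  also have "\<dots> = Zero C A' (Cod C h)" unfolding hD(4) using F bA hD(2) by (simp del: Add_Comp Comp_Add)
  finally obtain \<kappa> where \<kappa>: "\<kappa> \<in> Hom C (Cod C c') (Cod C h)" "\<kappa> * c' = h * j"
    using cokernel_factor[OF c', of "h * j" "Cod C h"] hH bA f by auto
  have "(c * p) * ?F = c * (p * ?F)" using cH bA F by (simp del: Add_Comp Comp_Add)
  also have "\<dots> = (c * f) * pa" unfolding pF using cH f bA by simp
  also have "\<dots> = Zero C AA (Cod C c)" unfolding cD(4) using bA f cD(2) by simp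
  finally obtain \<pi> where \<pi>: "\<pi> \<in> Hom C (Cod C h) (Cod C c)" "\<pi> * h = c * p"
    using cokernel_factor[OF h, of "c * p" "Cod C c"] cH bA F by (auto simp del: Add_Comp Comp_Add)
  have "(c' * q) * ?F = c' * (q * ?F)" using cH bA F by (simp del: Add_Comp Comp_Add)
  also have "\<dots> = (c' * f') * qa" unfolding pF using cH f bA by simp
  also have "\<dots> = Zero C AA (Cod C c')" unfolding cD'(4) using bA f cD'(2) by simp
  finally obtain \<rho> where \<rho>: "\<rho> \<in> Hom C (Cod C h) (Cod C c')" "\<rho> * h = c' * q"
    using cokernel_factor[OF h, of "c' * q" "Cod C c'"] cH bA F by (auto simp del: Add_Comp Comp_Add)
  have CO: "Cod C c \<in> Obj C" "Cod C c' \<in> Obj C" "Cod C h \<in> Obj C" using cD cD' hD by auto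
  \<comment> \<open>An identity \<open>x * y = w\<close> is checked after the epimorphism
    \<open>d\<close>. There \<open>y\<close> is replaced by \<open>h * z\<close> and
    \<open>x * h\<close> is known, so only arrows between the original direct sums remain.\<close>
  have via: "x * y = w" if xy: "x \<in> Hom C (Cod C h) W" "y \<in> Hom C V (Cod C h)" "w \<in> Hom C V W" and
     d: "epimorphism C d" "d \<in> Hom C D V" and e: "y * d = h * z" "z \<in> Hom C D BB" "x * h = v" "v * z = w * d"
    for x y w W V d D z v
  proof -
    have "(x * y) * d = x * (h * z)" unfolding e(1)[symmetric] using xy d by simp
    also have "\<dots> = (x * h) * z" using xy(1) hH e(2) by simp
    also have "\<dots> = w * d" unfolding e(3) by (rule e(4))
    finally show ?thesis by (rule epi_cancel[OF d(1), rotated -1]) (use xy d(2) in simp_all)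
  qed
  note ce = cokernel_epi[OF c] cokernel_epi[OF c']
  have 1: "\<pi> * \<iota> = Id C (Cod C c)"
    by (rule via[OF \<pi>(1) \<iota>(1) _ ce(1) cH(1) \<iota>(2) bA(1) \<pi>(2)]) (use cH bA be CO O in simp_all)
  have 2: "\<rho> * \<kappa> = Id C (Cod C c')"
    by (rule via[OF \<rho>(1) \<kappa>(1) _ ce(2) cH(2) \<kappa>(2) bA(2) \<rho>(2)]) (use cH bA be CO O in simp_all)
  have 3: "\<rho> * \<iota> = Zero C (Cod C c) (Cod C c')"
    by (rule via[OF \<rho>(1) \<iota>(1) _ ce(1) cH(1) \<iota>(2) bA(1) \<rho>(2)]) (use cH bA be CO O in simp_all)
  have 4: "\<pi> * \<kappa> = Zero C (Cod C c') (Cod C c)"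
    by (rule via[OF \<pi>(1) \<kappa>(1) _ ce(2) cH(2) \<kappa>(2) bA(2) \<pi>(2)]) (use cH bA be CO O in simp_all)
  have "((\<iota> * \<pi>) \<boxplus> (\<kappa> * \<rho>)) * h = (\<iota> * (\<pi> * h)) \<boxplus> (\<kappa> * (\<rho> * h))" using \<iota>(1) \<kappa>(1) \<pi>(1) \<rho>(1) hH by simp
  also have "\<dots> = ((\<iota> * c) * p) \<boxplus> ((\<kappa> * c') * q)" unfolding \<pi>(2) \<rho>(2) using \<iota>(1) \<kappa>(1) cH bA by simp
  also have "\<dots> = h * ((i * p) \<boxplus> (j * q))" unfolding \<iota>(2) \<kappa>(2) using hH bA by simp
  also have "\<dots> = Id C (Cod C h) * h" unfolding s using hH by simp
  finally have 5: "(\<iota> * \<pi>) \<boxplus> (\<kappa> * \<rho>) = Id C (Cod C h)"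
    by (rule epi_cancel[OF cokernel_epi[OF h], rotated -1]) (use \<iota>(1) \<kappa>(1) \<pi>(1) \<rho>(1) hH CO in simp_all)
  show ?thesis unfolding biprod_def using 1 2 3 4 5 \<iota>(1) \<kappa>(1) \<pi>(1) \<rho>(1) by blast
qed

section \<open>Cokernels, direct sums and kernels of coherent functors\<close>

context additive
begin

text \<open>The cokernel is the pointwise quotient of \<open>G\<close> by the image of
  \<open>\<phi>\<close>. It is coherent because \<open>\<phi>\<close> lifts to an arrow
  \<open>b\<close> between generators: the generator of \<open>G\<close> still generates, and its
  relations are those of \<open>G\<close> together with \<open>b\<close>.\<close>

lemma coh_cokernel_ex:
  assumes f: "\<phi> \<in> Hom \<K> F G"
  obtains H c where "c \<in> Hom \<K> G H" "pointwise_cokernel \<phi> c"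
proof -
  note D = coh_HomD[OF f]
  note apF = coh_aps[OF D(1)] and apG = coh_aps[OF D(2)]
  define N where "N U = comps \<phi> U ` el F U" for U
  define r where "r U = quot_rep (val G U) (N U)" for U
  define H where "H = \<lparr>val = (\<lambda>U. quot_grp (val G U) (N U)), res = (\<lambda>f x. r (Dom C f) (res G f x))\<rparr>"
  have cg: "comm_group (val G U)" "subgroup (N U) (val G U)" if "U \<in> Obj C" for U
    using aps_group[OF apG that] group_hom.img_is_subgroup[OF coh_group_hom[OF f that]] by (simp_all add: N_def)
  have rr: "x \<in> el G U \<Longrightarrow> r U x \<in> el G U"
      "x \<in> el G U \<Longrightarrow> x \<otimes>\<^bsub>val G U\<^esub> inv\<^bsub>val G U\<^esub> (r U x) \<in> N U"
      "x \<in> el G U \<Longrightarrow> y \<in> el G U \<Longrightarrow> r U x = r U y \<longleftrightarrow> x \<otimes>\<^bsub>val G U\<^esub> inv\<^bsub>val G U\<^esub> y \<in> N U"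
      "x \<in> el G U \<Longrightarrow> y \<in> el G U \<Longrightarrow> r U (r U x \<otimes>\<^bsub>val G U\<^esub> r U y) = r U (x \<otimes>\<^bsub>val G U\<^esub> y)"
      "r U \<in> hom (val G U) (quot_grp (val G U) (N U))"
      "x \<in> el G U \<Longrightarrow> r U x = \<one>\<^bsub>quot_grp (val G U) (N U)\<^esub> \<longleftrightarrow> x \<in> N U"
    if U: "U \<in> Obj C" for U x y
    unfolding r_def using quot_rep_mem[OF cg[OF U]] quot_rep_eq[OF cg[OF U]] quot_rep_mult[OF cg[OF U]]
      quot_rep_hom[OF cg[OF U]] quot_rep_one[OF cg[OF U]] by blast+
  have elH: "el H U = r U ` el G U" "mult (val H U) = (\<lambda>x y. r U (x \<otimes>\<^bsub>val G U\<^esub> y))"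
    "res H f = (\<lambda>x. r (Dom C f) (res G f x))" for U f by (simp_all add: H_def quot_grp_def r_def)
  have vH: "val H U = quot_grp (val G U) (N U)" for U by (simp add: H_def)
  \<comment> \<open>Restriction respects cosets because \<open>\<phi>\<close> is natural. Hence it
    makes no difference whether representatives are taken before or after restricting.\<close>
  have res_r: "r U (res G f (r V x)) = r U (res G f x)" if f1: "f \<in> Hom C U V" "x \<in> el G V" for f U V x
  proof -
    have O: "U \<in> Obj C" "V \<in> Obj C" using f1 by auto
    note m = rr(1,2)[OF O(2) f1(2)]
    interpret gh: group_hom "val G V" "val G U" "res G f" by (rule aps_group_hom[OF apG f1(1)])
    obtain z where z: "z \<in> el F V" "x \<otimes>\<^bsub>val G V\<^esub> inv\<^bsub>val G V\<^esub> r V x = comps \<phi> V z" using m(2) by (auto simp: N_def)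
    have "res G f x \<otimes>\<^bsub>val G U\<^esub> inv\<^bsub>val G U\<^esub> res G f (r V x) = res G f (x \<otimes>\<^bsub>val G V\<^esub> inv\<^bsub>val G V\<^esub> r V x)"
      using f1(2) m(1) by (simp add: gh.hom_inv)
    also have "\<dots> = comps \<phi> U (res F f z)" unfolding z(2) using coh_HomD(6)[OF f f1(1) z(1)] by simp
    also have "\<dots> \<in> N U" using aps_closed[OF apF f1(1) z(1)] by (simp add: N_def)
    finally show ?thesis using rr(3)[OF O(1), of "res G f x" "res G f (r V x)"] f1(2) m(1) by simp
  qed
  have rid: "r U (r U x) = r U x" if "U \<in> Obj C" "x \<in> el G U" for U x
    using res_r[of "Id C U" U U x] aps_Id[OF apG that(1)] that rr(1)[OF that] by simp
  have apH: "additive_presheaf C H" unfolding additive_presheaf_def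
  proof (intro conjI ballI impI)
    fix U assume U: "U \<in> Obj C"
    show "comm_group (val H U)" unfolding vH by (rule quot_grp[OF cg[OF U]])
  next
    fix f assume f1: "f \<in> Arr C"
    let ?U = "Dom C f" and ?V = "Cod C f"
    have fH: "f \<in> Hom C ?U ?V" using f1 by simp
    have O: "?U \<in> Obj C" "?V \<in> Obj C" using f1 by auto
    interpret GV: comm_group "val G ?V" by (rule cg[OF O(2)])
    interpret GU: comm_group "val G ?U" by (rule cg[OF O(1)])
    show "res H f \<in> hom (val H ?V) (val H ?U)"
    proof (rule homI)
      fix x assume "x \<in> el H ?V"
      then have x: "x \<in> el G ?V" using rr(1)[OF O(2)] by (auto simp: elH)
      then show "res H f x \<in> el H ?U" using aps_closed[OF apG fH] by (simp add: elH)
      fix y assume "y \<in> el H ?V"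
      then have y: "y \<in> el G ?V" using rr(1)[OF O(2)] by (auto simp: elH)
      show "res H f (x \<otimes>\<^bsub>val H ?V\<^esub> y) = res H f x \<otimes>\<^bsub>val H ?U\<^esub> res H f y"
        using x y res_r[OF fH, of "x \<otimes>\<^bsub>val G ?V\<^esub> y"] hom_mult[OF aps_hom[OF apG fH]] rr(4)[OF O(1)]
          aps_closed[OF apG fH] by (simp add: elH)
    qed
  next
    fix U x assume U: "U \<in> Obj C" "x \<in> el H U"
    then obtain x' where x: "x' \<in> el G U" "x = r U x'" by (auto simp: elH)
    then show "res H (Id C U) x = x" using U aps_Id[OF apG U(1)] rid[OF U(1)] rr(1)[OF U(1)] by (simp add: elH)
  next
    fix f g x assume *: "f \<in> Arr C" "g \<in> Arr C" "Dom C g = Cod C f" "x \<in> el H (Cod C g)"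
    then have fg: "f \<in> Hom C (Dom C f) (Dom C g)" "g \<in> Hom C (Dom C g) (Cod C g)" by auto
    have x: "x \<in> el G (Cod C g)" using rr(1)[of "Cod C g"] * by (auto simp: elH)
    show "res H (g * f) x = res H f (res H g x)"
      using * aps_comp[OF apG fg x] res_r[OF fg(1) aps_closed[OF apG fg(2) x]] by (simp add: elH)
  next
    fix U V f g x assume *: "U \<in> Obj C" "V \<in> Obj C" "f \<in> Hom C U V" "g \<in> Hom C U V" "x \<in> el H V"
    have x: "x \<in> el G V" using rr(1)[of V] * by (auto simp: elH)
    show "res H (f \<boxplus> g) x = res H f x \<otimes>\<^bsub>val H U\<^esub> res H g x"
      using * aps_add[OF apG *(3,4) x] rr(4)[OF *(1) aps_closed[OF apG *(3) x] aps_closed[OF apG *(4) x]]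
      by (simp add: elH)
  qed
  obtain X1 Y1 a1 e1 where p1: "presented F X1 Y1 a1 e1" using coh_presented[OF D(1)] by blast
  obtain X Y a e where p: "presented G X Y a e" using coh_presented[OF D(2)] by blast
  note P1 = presentedD[OF p1] and P = presentedD[OF p]
  obtain b where b: "b \<in> Hom C Y1 Y" "res G b e = comps \<phi> Y1 e1"
    using P(5)[OF P1(4) coh_closed[OF f P1(4,2)]] by blast
  obtain B i j s t where bp: "biprod X Y1 B i j s t" using biprod_ex[OF P(3) P1(4)] by blast
  then have bA: "i \<in> Hom C X B" "j \<in> Hom C Y1 B" "s \<in> Hom C B X" "t \<in> Hom C B Y1"
    and be: "s * i = Id C X" "t * j = Id C Y1" "t * i = Zero C X Y1" "s * j = Zero C Y1 X"
    by (auto simp: biprod_def)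
  let ?\<beta> = "(a * s) \<boxplus> (b * t)"
  have \<beta>: "?\<beta> \<in> Hom C B Y" using bA P(1) b(1) by simp
  \<comment> \<open>The two components of \<open>?\<beta>\<close> are the relations \<open>a\<close>
    of \<open>G\<close> and the lift \<open>b\<close> of \<open>\<phi>\<close>.\<close>
  have "presented H B Y ?\<beta> (r Y e)" unfolding presented_def
  proof (intro conjI ballI \<beta>)
    show "r Y e \<in> el H Y" using P(2) by (simp add: elH)
    fix U x assume U: "U \<in> Obj C" "x \<in> el H U"
    then obtain x' where x: "x' \<in> el G U" "x = r U x'" by (auto simp: elH)
    obtain u where u: "u \<in> Hom C U Y" "res G u e = x'" using P(5)[OF U(1) x(1)] by blast
    show "\<exists>u\<in>Hom C U Y. res H u (r Y e) = x"
      by (rule bexI[OF _ u(1)]) (use u x res_r[OF u(1) P(2)] in \<open>simp add: elH\<close>)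
  next
    fix U u assume U: "U \<in> Obj C" "u \<in> Hom C U Y"
    have uG: "res G u e \<in> el G U" by (rule aps_closed[OF apG U(2) P(2)])
    \<comment> \<open>The chain says that \<open>u\<close> is a relation in the quotient if and only
      if \<open>u - b * w\<close> is a relation \<open>a * v\<close> in \<open>G\<close> for some
      \<open>w\<close>, that is \<open>u = a * v + b * w\<close>.\<close>
    have "res H u (r Y e) = un H U \<longleftrightarrow> res G u e \<in> N U"
      using U res_r[OF U(2) P(2)] rr(6)[OF U(1) uG] by (simp add: elH vH)
    also have "\<dots> \<longleftrightarrow> (\<exists>w\<in>Hom C U Y1. res G u e = res G (b * w) e)"
    proof -
      have e1: "comps \<phi> U (res F w e1) = res G (b * w) e" if w: "w \<in> Hom C U Y1" for w
        using coh_HomD(6)[OF f w P1(2)] aps_comp[OF apG w b(1) P(2)] b(2) by simp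
      show ?thesis
      proof
        assume "res G u e \<in> N U"
        then obtain z where z: "z \<in> el F U" "res G u e = comps \<phi> U z" by (auto simp: N_def)
        obtain w where w: "w \<in> Hom C U Y1" "res F w e1 = z" using P1(5)[OF U(1) z(1)] by blast
        show "\<exists>w\<in>Hom C U Y1. res G u e = res G (b * w) e"
          by (rule bexI[OF _ w(1)]) (use e1[OF w(1)] w(2) z(2) in simp)
      next
        assume "\<exists>w\<in>Hom C U Y1. res G u e = res G (b * w) e"
        then obtain w where w: "w \<in> Hom C U Y1" "res G u e = res G (b * w) e" by blast
        then have "res G u e = comps \<phi> U (res F w e1)" using e1 by simp
        then show "res G u e \<in> N U" using aps_closed[OF apF w(1) P1(2)] by (simp add: N_def)
      qed
    qed
    also have "\<dots> \<longleftrightarrow> (\<exists>w\<in>Hom C U Y1. \<exists>v\<in>Hom C U X. u \<boxplus> neg C (b * w) = a * v)"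
    proof (rule bex_cong[OF HOL.refl])
      fix w assume w: "w \<in> Hom C U Y1"
      then have bw: "b * w \<in> Hom C U Y" and d: "u \<boxplus> neg C (b * w) \<in> Hom C U Y" using b(1) U by auto
      interpret comm_group "val G U" by (rule cg[OF U(1)])
      have bG: "res G (b * w) e \<in> el G U" by (rule aps_closed[OF apG bw P(2)])
      have "res G u e = res G (b * w) e \<longleftrightarrow> res G (u \<boxplus> neg C (b * w)) e = un G U"
        unfolding aps_diff[OF apG U(2) bw P(2)] using uG bG by (metis inv_closed inv_equality inv_inv r_inv)
      then show "(res G u e = res G (b * w) e) = (\<exists>v\<in>Hom C U X. u \<boxplus> neg C (b * w) = a * v)"
        using P(6)[OF d] by simp
    qed
    also have "\<dots> \<longleftrightarrow> (\<exists>v\<in>Hom C U B. u = ?\<beta> * v)"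
    proof
      assume "\<exists>w\<in>Hom C U Y1. \<exists>v\<in>Hom C U X. u \<boxplus> neg C (b * w) = a * v"
      then obtain w v where wv: "w \<in> Hom C U Y1" "v \<in> Hom C U X" "u \<boxplus> neg C (b * w) = a * v" by blast
      have "?\<beta> * ((i * v) \<boxplus> (j * w)) = (a * v) \<boxplus> (b * w)" using wv(1,2) bA P(1,3) P1(4) b(1) U(1)
        by (simp add: reduce[OF be(1)] reduce[OF be(2)] reduce[OF be(3)] reduce[OF be(4)])
      also have "\<dots> = u" unfolding wv(3)[symmetric] using wv(1) b(1) U by (simp add: Add_assoc)
      finally show "\<exists>v\<in>Hom C U B. u = ?\<beta> * v" using wv(1,2) bA by (intro bexI[of _ "(i * v) \<boxplus> (j * w)"]) simp_all
    next
      assume "\<exists>v\<in>Hom C U B. u = ?\<beta> * v"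
      then obtain v where v: "v \<in> Hom C U B" "u = ?\<beta> * v" by blast
      have "u \<boxplus> neg C (b * (t * v)) = a * (s * v)" unfolding v(2) using v(1) bA P(1) b(1) by (simp add: Add_assoc)
      moreover have "t * v \<in> Hom C U Y1" "s * v \<in> Hom C U X" using v bA by auto
      ultimately show "\<exists>w\<in>Hom C U Y1. \<exists>v\<in>Hom C U X. u \<boxplus> neg C (b * w) = a * v" by blast
    qed
    finally show "res H u (r Y e) = un H U \<longleftrightarrow> (\<exists>v\<in>Hom C U B. u = ?\<beta> * v)" .
  qed
  then have cH: "coherent C H" using apH coherent_iff by blast
  have cM: "mk G H r \<in> Hom \<K> G H"
  proof (rule mk_Hom[OF D(2) cH])
    fix U assume "U \<in> Obj C" then show "r U \<in> hom (val G U) (val H U)" unfolding vH by (rule rr(5))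
  next
    fix f U V x assume fx: "f \<in> Hom C U V" "x \<in> el G V"
    then show "r U (res G f x) = res H f (r V x)" using res_r[OF fx] by (simp add: elH)
  qed
  have "pointwise_cokernel \<phi> (mk G H r)" unfolding pointwise_cokernel_def
  proof (intro ballI conjI)
    fix U assume U: "U \<in> Obj C"
    show "comps (mk G H r) U ` el (csrc (mk G H r)) U = el (ctgt (mk G H r)) U"
      using U by (simp add: elH image_def)
    show "{x \<in> el (csrc (mk G H r)) U. comps (mk G H r) U x = \<one>\<^bsub>val (ctgt (mk G H r)) U\<^esub>} =
        comps \<phi> U ` el (csrc \<phi>) U" using U rr(6)[OF U] coh_closed[OF f U] D(3) by (auto simp: vH N_def)
  qed
  with cM that show ?thesis by blast
qed

text \<open>An arbitrary cokernel differs by an isomorphism from the one constructed pointwise, and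
  isomorphisms are bijective at each object.\<close>

lemma coh_cokernel_pointwise:
  assumes c: "is_cokernel \<K> \<phi> c"
  shows "pointwise_cokernel \<phi> c"
proof -
  interpret coh: preadditive "coh C" by (rule coh_preadditive)
  note D = coh.cokernelD[OF c]
  let ?F = "Dom \<K> \<phi>" and ?G = "Cod \<K> \<phi>" and ?K = "Cod \<K> c"
  have f: "\<phi> \<in> Hom \<K> ?F ?G" and cH: "c \<in> Hom \<K> ?G ?K" using D by (simp_all add: Hom_iff)
  obtain H d where d: "d \<in> Hom \<K> ?G H" "pointwise_cokernel \<phi> d" by (rule coh_cokernel_ex[OF f])
  have "is_cokernel \<K> \<phi> d" by (rule pointwise_cokernel_is_cokernel[OF f d])
  then obtain j where j: "j \<in> Hom \<K> (Cod \<K> d) ?K" "j *\<^sub>\<K> d = c" "isomorphism \<K> j"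
    by (rule coh.cokernel_unique[OF c]) (use coh.isoE in blast)
  have jH: "j \<in> Hom \<K> H ?K" using j(1) d(1) by (simp add: Hom_iff)
  obtain i where i: "i \<in> Hom \<K> ?K H" "i *\<^sub>\<K> j = Id \<K> H" "j *\<^sub>\<K> i = Id \<K> ?K"
    using coh.isoE[OF j(3)] jH by (metis Hom_iff)
  have ij: "comps i U (comps j U x) = x" if "U \<in> Obj C" "x \<in> el H U" for U x
    using coh_comps_comp[OF jH i(1) that] that by (simp add: i(2) del: coh_simps(3))
  have ji: "comps j U (comps i U x) = x" if "U \<in> Obj C" "x \<in> el ?K U" for U x
    using coh_comps_comp[OF i(1) jH that] that by (simp add: i(3) del: coh_simps(3))
  have cj: "comps c U x = comps j U (comps d U x)" if "U \<in> Obj C" "x \<in> el ?G U" for U x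
    using coh_comps_comp[OF d(1) jH that] by (simp add: j(2) del: coh_simps(3))
  note dc = coh_HomD(3,4)[OF d(1)] coh_HomD(3,4)[OF cH] coh_HomD(3,4)[OF f]
  show ?thesis unfolding pointwise_cokernel_def dc
  proof (intro ballI conjI)
    fix U assume U: "U \<in> Obj C"
    have pd: "comps d U ` el ?G U = el H U" "{x \<in> el ?G U. comps d U x = un H U} = comps \<phi> U ` el ?F U"
      using d(2) U dc unfolding pointwise_cokernel_def by auto
    have "comps c U ` el ?G U = comps j U ` comps d U ` el ?G U"
      unfolding image_image by (rule image_cong[OF HOL.refl cj[OF U]])
    also have "\<dots> = el ?K U" unfolding pd(1)
      using coh_closed[OF jH U] ji[OF U] coh_closed[OF i(1) U] by (auto intro!: image_eqI[of _ "comps j U" "comps i U _"])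
    finally show "comps c U ` el ?G U = el ?K U" .
    have "comps c U x = un ?K U \<longleftrightarrow> comps d U x = un H U" if x: "x \<in> el ?G U" for x
      using cj[OF U x] ij[OF U coh_closed[OF d(1) U x]] coh_one[OF jH U] coh_one[OF i(1) U] by metis
    then show "{x \<in> el ?G U. comps c U x = un ?K U} = comps \<phi> U ` el ?F U" unfolding pd(2)[symmetric] by blast
  qed
qed

text \<open>Passes from generators and relations in terms of elements to a cokernel of
  representables, the form used by the locale \<open>presentation\<close>.\<close>

lemma presented_cokernel:
  assumes "coherent C F" "presented F X Y a e"
  shows "is_cokernel \<K> (on_arr (yoneda C) a) (elt F Y e)"
proof -
  note P = presentedD[OF assms(2)]
  note y = yoneda_Hom[OF P(1)] and E = elt_Hom[OF assms(1) P(4,2)]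
  show ?thesis
  proof (rule pointwise_cokernel_is_cokernel[OF y E])
    show "pointwise_cokernel (on_arr (yoneda C) a) (elt F Y e)"
      unfolding pointwise_cokernel_def coh_HomD(3,4)[OF y] coh_HomD(3,4)[OF E] representable_simps(1-4)
    proof (intro ballI conjI)
      fix U assume U: "U \<in> Obj C"
      have "comps (elt F Y e) U ` Hom C U Y = (\<lambda>u. res F u e) ` Hom C U Y"
        by (rule image_cong[OF HOL.refl comps_elt])
      also have "\<dots> = el F U" using P(5)[OF U] aps_closed[OF coh_aps[OF assms(1)] _ P(2)] by blast
      finally show "comps (elt F Y e) U ` Hom C U Y = el F U" .
      have "comps (on_arr (yoneda C) a) U ` Hom C U X = (\<lambda>v. a * v) ` Hom C U X"
        by (rule image_cong[OF HOL.refl comps_yoneda[OF P(1)]])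
      also have "\<dots> = {u \<in> Hom C U Y. comps (elt F Y e) U u = un F U}"
        using P(6) comps_elt Comp_Hom[OF _ P(1)] by (auto simp del: Hom_C_iff)
      finally show "{u \<in> Hom C U Y. comps (elt F Y e) U u = un F U} =
          comps (on_arr (yoneda C) a) U ` Hom C U X" by simp
    qed
  qed
qed

lemma coh_additive: "additive \<K>"
proof -
  interpret coh: preadditive "coh C" by (rule coh_preadditive)
  interpret Y: addfun C "coh C" "yoneda C" using yoneda_additive by unfold_locales
  show ?thesis
  proof
    obtain Z where Z: "Z \<in> Obj C" "Id C Z = Zero C Z Z" using zero_ex by blast
    then have "Id \<K> (representable C Z) = Zero \<K> (representable C Z) (representable C Z)"
      using Y.ident[of Z] Y.Zero[of Z Z] by (simp del: coh_simps)
    then show "\<exists>Z\<in>Obj \<K>. Id \<K> Z = Zero \<K> Z Z"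
      using Z(1) by (intro bexI[of _ "representable C Z"]) (simp_all only: coh_simps(1) mem_Collect_eq representable_coherent)
  next
    fix F G assume "F \<in> Obj \<K>" "G \<in> Obj \<K>"
    then have c: "coherent C F" "coherent C G" by auto
    obtain X Y a e where p: "presented F X Y a e" using coh_presented[OF c(1)] by blast
    obtain X' Y' a' e' where p': "presented G X' Y' a' e'" using coh_presented[OF c(2)] by blast
    note P = presentedD[OF p] and P' = presentedD[OF p']
    obtain A ia ja pa qa where A: "biprod X X' A ia ja pa qa" using biprod_ex[OF P(3) P'(3)] by blast
    obtain B i j s t where B: "biprod Y Y' B i j s t" using biprod_ex[OF P(4) P'(4)] by blast
    let ?y = "on_arr (yoneda C)"
    have bA: "i \<in> Hom C Y B" "j \<in> Hom C Y' B" "pa \<in> Hom C A X" "qa \<in> Hom C A X'"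
      using A B by (simp_all add: biprod_def)
    let ?F = "(?y i *\<^sub>\<K> ?y a *\<^sub>\<K> ?y pa) \<boxplus>\<^sub>\<K> (?y j *\<^sub>\<K> ?y a' *\<^sub>\<K> ?y qa)"
    note ys = yoneda_Hom[OF bA(1)] yoneda_Hom[OF bA(2)] yoneda_Hom[OF bA(3)] yoneda_Hom[OF bA(4)]
      yoneda_Hom[OF P(1)] yoneda_Hom[OF P'(1)]
    have F: "?F \<in> Hom \<K> (representable C A) (representable C B)" using ys by (simp add: Hom_iff del: coh_simps)
    obtain H h where h: "h \<in> Hom \<K> (representable C B) H" "pointwise_cokernel ?F h" by (rule coh_cokernel_ex[OF F])
    have hc: "is_cokernel \<K> ?F h" by (rule pointwise_cokernel_is_cokernel[OF F h])
    have C: "Cod \<K> (elt F Y e) = F" "Cod \<K> (elt G Y' e') = G"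
      using elt_Hom[OF c(1) P(4,2)] elt_Hom[OF c(2) P'(4,2)] by (simp_all add: Hom_iff)
    show "\<exists>B i j p q. coh.biprod F G B i j p q"
      using coh.biprod_of_cokernels[OF Y.biprod[OF A] Y.biprod[OF B] _ _ presented_cokernel[OF c(1) p]
        presented_cokernel[OF c(2) p'] hc] ys(5,6) unfolding C yoneda_obj by blast
  qed
qed

text \<open>Arrows out of a representable functor are elements, so lifting and exactness at
  \<open>m\<close> are surjectivity and exactness of the cokernel sequence evaluated at
  \<open>m\<close>, read off at the identity of \<open>m\<close>.\<close>

lemma coh_presentation: "presentation C \<K> (yoneda C)"
proof -
  interpret coh: preadditive "coh C" by (rule coh_preadditive)
  interpret Y: addfun C "coh C" "yoneda C" using yoneda_additive by unfold_locales
  have pt: "comps \<pi> U ` Hom C U (Cod C \<alpha>) = el (Cod \<K> \<pi>) U"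
      "{x \<in> Hom C U (Cod C \<alpha>). comps \<pi> U x = \<one>\<^bsub>val (Cod \<K> \<pi>) U\<^esub>} = (\<lambda>v. \<alpha> * v) ` Hom C U (Dom C \<alpha>)"
      "\<pi> \<in> Hom \<K> (representable C (Cod C \<alpha>)) (Cod \<K> \<pi>)"
    if \<alpha>: "\<alpha> \<in> Arr C" and p: "is_cokernel \<K> (on_arr (yoneda C) \<alpha>) \<pi>" and U: "U \<in> Obj C" for \<alpha> \<pi> U
  proof -
    have \<alpha>H: "\<alpha> \<in> Hom C (Dom C \<alpha>) (Cod C \<alpha>)" using \<alpha> by simp
    note y = yoneda_Hom[OF \<alpha>H]
    show pH: "\<pi> \<in> Hom \<K> (representable C (Cod C \<alpha>)) (Cod \<K> \<pi>)" using coh.cokernelD[OF p] y by (simp add: Hom_iff)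
    note pp = coh_cokernel_pointwise[OF p, unfolded pointwise_cokernel_def coh_HomD(3,4)[OF y]
      coh_HomD(3,4)[OF pH] representable_simps(1-4), rule_format, OF U]
    show "comps \<pi> U ` Hom C U (Cod C \<alpha>) = el (Cod \<K> \<pi>) U" using pp by blast
    have "comps (on_arr (yoneda C) \<alpha>) U ` Hom C U (Dom C \<alpha>) = (\<lambda>v. \<alpha> * v) ` Hom C U (Dom C \<alpha>)"
      by (rule image_cong[OF HOL.refl comps_yoneda[OF \<alpha>H]])
    then show "{x \<in> Hom C U (Cod C \<alpha>). comps \<pi> U x = \<one>\<^bsub>val (Cod \<K> \<pi>) U\<^esub>} = (\<lambda>v. \<alpha> * v) ` Hom C U (Dom C \<alpha>)"
      using pp by simp
  qed
  have yb: "\<pi> *\<^sub>\<K> on_arr (yoneda C) b = elt (Cod \<K> \<pi>) m (comps \<pi> m b)"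
    if "\<pi> \<in> Hom \<K> (representable C y) (Cod \<K> \<pi>)" "b \<in> Hom C m y" for \<pi> b m y
    using comp_elt[OF that(1), of m b] that(2) by (auto simp: yoneda_arr simp del: coh_simps)
  show ?thesis
  proof
    fix F assume "F \<in> Obj \<K>"
    then have c: "coherent C F" by simp
    obtain X Y a e where p: "presented F X Y a e" using coh_presented[OF c] by blast
    note P = presentedD[OF p]
    show "\<exists>\<alpha> \<pi>. \<alpha> \<in> Arr C \<and> is_cokernel \<K> (on_arr (yoneda C) \<alpha>) \<pi> \<and> Cod \<K> \<pi> = F"
      using presented_cokernel[OF c p] P(1) elt_Hom[OF c P(4,2)] by (auto simp: Hom_iff)
  next
    fix \<alpha> \<pi> m h assume \<alpha>: "\<alpha> \<in> Arr C" and p: "is_cokernel \<K> (on_arr (yoneda C) \<alpha>) \<pi>"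
      and m: "m \<in> Obj C" and h: "h \<in> Hom \<K> (on_obj (yoneda C) m) (Cod \<K> \<pi>)"
    note pp = pt[OF \<alpha> p m]
    have hh: "h \<in> Hom \<K> (representable C m) (Cod \<K> \<pi>)" using h by (simp only: yoneda_obj)
    note he = elt_eq[OF hh m]
    have "comps h m (Id C m) \<in> comps \<pi> m ` Hom C m (Cod C \<alpha>)" using he(2) by (simp only: pp(1))
    then obtain b where b: "comps h m (Id C m) = comps \<pi> m b" "b \<in> Hom C m (Cod C \<alpha>)" by (rule imageE)
    show "\<exists>b\<in>Hom C m (Cod C \<alpha>). \<pi> *\<^sub>\<K> on_arr (yoneda C) b = h"
      by (rule bexI[OF _ b(2)]) (simp only: yb[OF pp(3) b(2)] b(1)[symmetric] he(1)[symmetric])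
  next
    fix \<alpha> \<pi> b m assume \<alpha>: "\<alpha> \<in> Arr C" and p: "is_cokernel \<K> (on_arr (yoneda C) \<alpha>) \<pi>"
      and b: "b \<in> Hom C m (Cod C \<alpha>)"
      and z: "\<pi> *\<^sub>\<K> on_arr (yoneda C) b = Zero \<K> (on_obj (yoneda C) m) (Cod \<K> \<pi>)"
    have m: "m \<in> Obj C" using b by auto
    note pp = pt[OF \<alpha> p m]
    have I: "Id C m \<in> Hom C m m" using m by simp
    have bm: "comps \<pi> m b \<in> el (Cod \<K> \<pi>) m" unfolding pp(1)[symmetric] using b by (rule imageI)
    have cc: "coherent C (Cod \<K> \<pi>)" by (rule coh_HomD(2)[OF pp(3)])
    have "comps \<pi> m b = comps (elt (Cod \<K> \<pi>) m (comps \<pi> m b)) m (Id C m)"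
      using comps_elt[OF I] aps_Id[OF coh_aps[OF cc] m bm] by simp
    also have "\<dots> = \<one>\<^bsub>val (Cod \<K> \<pi>) m\<^esub>" unfolding yb[OF pp(3) b, symmetric] z using m by simp
    finally have "b \<in> {x \<in> Hom C m (Cod C \<alpha>). comps \<pi> m x = \<one>\<^bsub>val (Cod \<K> \<pi>) m\<^esub>}" by (intro CollectI conjI b)
    then have "b \<in> (\<lambda>v. \<alpha> * v) ` Hom C m (Dom C \<alpha>)" by (simp only: pp(2))
    then show "\<exists>d\<in>Hom C m (Dom C \<alpha>). b = \<alpha> * d" by (rule imageE) (rule bexI)
  qed
qed

text \<open>Hom functors are left exact. Applied to \<open>opcat (coh C)\<close> in place of
  \<open>C\<close>, this says that the embedding of \<open>coh C\<close> into the hull preserves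
  cokernels.\<close>

lemma yoneda_kernel:
  assumes "is_kernel C f k"
  shows "is_kernel \<K> (on_arr (yoneda C) f) (on_arr (yoneda C) k)"
proof -
  note kD = kernelD[OF assms]
  let ?X = "Dom C f" and ?Y = "Cod C f" and ?K = "Dom C k"
  have H: "f \<in> Hom C ?X ?Y" "k \<in> Hom C ?K ?X" using kD by simp_all
  note y = yoneda_Hom[OF H(1)] yoneda_Hom[OF H(2)]
  show ?thesis
  proof (rule pointwise_kernel_is_kernel[OF y])
    show "pointwise_kernel (on_arr (yoneda C) f) (on_arr (yoneda C) k)"
      unfolding pointwise_kernel_def coh_HomD(3,4)[OF y(1)] coh_HomD(3,4)[OF y(2)] representable_simps(1-4)
    proof (intro ballI conjI)
      fix U assume U: "U \<in> Obj C"
      show "inj_on (comps (on_arr (yoneda C) k) U) (Hom C U ?K)"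
      proof (rule inj_onI)
        fix u v assume uv: "u \<in> Hom C U ?K" "v \<in> Hom C U ?K"
          "comps (on_arr (yoneda C) k) U u = comps (on_arr (yoneda C) k) U v"
        then have "k * u = k * v" using comps_yoneda[OF H(2)] by (simp del: Hom_C_iff)
        then show "u = v" using uv(1,2) mono_cancel[OF kernel_mono[OF assms], of u v] by simp
      qed
      have "comps (on_arr (yoneda C) k) U ` Hom C U ?K = (\<lambda>v. k * v) ` Hom C U ?K"
        by (rule image_cong[OF HOL.refl comps_yoneda[OF H(2)]])
      also have "\<dots> = {x \<in> Hom C U ?X. f * x = Zero C U ?Y}"
      proof (intro equalityI subsetI)
        fix x assume "x \<in> (\<lambda>v. k * v) ` Hom C U ?K"
        then obtain v where v: "v \<in> Hom C U ?K" "x = k * v" by blast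
        have "f * x = (f * k) * v" unfolding v(2) using v(1) kD(1-3) by simp
        then show "x \<in> {x \<in> Hom C U ?X. f * x = Zero C U ?Y}" unfolding kD(4) using v kD by simp
      next
        fix x assume "x \<in> {x \<in> Hom C U ?X. f * x = Zero C U ?Y}"
        then obtain v where "v \<in> Hom C U ?K" "k * v = x" using kernel_factor[OF assms, of x U] by blast
        then show "x \<in> (\<lambda>v. k * v) ` Hom C U ?K" by blast
      qed
      also have "\<dots> = {x \<in> Hom C U ?X. comps (on_arr (yoneda C) f) U x = Zero C U ?Y}"
        using comps_yoneda[OF H(1)] by (auto simp del: Hom_C_iff)
      finally show "comps (on_arr (yoneda C) k) U ` Hom C U ?K =
        {x \<in> Hom C U ?X. comps (on_arr (yoneda C) f) U x = Zero C U ?Y}" .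
    qed
  qed
qed

text \<open>The pointwise kernel is coherent thanks to two pullbacks in \<open>C\<close>. Elements
  \<open>res F u e\<close> killed by \<open>\<phi>\<close> are those for which \<open>b * u\<close>
  is a relation \<open>a' * v\<close>, so the pullback \<open>W\<close> of \<open>b\<close> and
  \<open>a'\<close> carries a generator; the pullback \<open>W'\<close> of \<open>q\<close> and
  \<open>a\<close> then carries its relations.\<close>

lemma coh_kernel_ex:
  assumes ker: "\<And>f. f \<in> Arr C \<Longrightarrow> \<exists>k. is_kernel C f k" and f: "\<phi> \<in> Hom \<K> F G"
  obtains K k where "k \<in> Hom \<K> K F" "pointwise_kernel \<phi> k"
proof -
  note D = coh_HomD[OF f]
  note apF = coh_aps[OF D(1)] and apG = coh_aps[OF D(2)]
  define K where "K = \<lparr>val = (\<lambda>U. (val F U)\<lparr>carrier := {x \<in> el F U. comps \<phi> U x = un G U}\<rparr>), res = res F\<rparr>"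
  have K: "el K U = {x \<in> el F U. comps \<phi> U x = un G U}" "mult (val K U) = mult (val F U)"
    "one (val K U) = one (val F U)" "res K = res F" for U by (simp_all add: K_def)
  have Kf: "x \<in> el F U" "comps \<phi> U x = un G U" if "x \<in> el K U" for x U using that by (simp_all add: K)
  have closed: "res F g x \<in> el K U" if g: "g \<in> Hom C U V" "x \<in> el K V" for g U V x
    using aps_closed[OF apF g(1) Kf(1)[OF g(2)]] coh_HomD(6)[OF f g(1) Kf(1)[OF g(2)]] Kf(2)[OF g(2)]
      aps_one[OF apG g(1)] by (simp add: K(1))
  have apK: "additive_presheaf C K" unfolding additive_presheaf_def
  proof (intro conjI ballI impI)
    fix U assume U: "U \<in> Obj C"
    interpret F: comm_group "val F U" by (rule aps_group[OF apF U])
    interpret gh: group_hom "val F U" "val G U" "comps \<phi> U" by (rule coh_group_hom[OF f U])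
    show "comm_group (val K U)" by (rule comm_groupI)
        (auto simp: K F.m_ac gh.hom_inv intro!: bexI[of _ "inv\<^bsub>val F U\<^esub> _"])
  next
    fix g assume "g \<in> Arr C"
    then have g: "g \<in> Hom C (Dom C g) (Cod C g)" by simp
    show "res K g \<in> hom (val K (Cod C g)) (val K (Dom C g))"
      by (rule homI) (use closed[OF g] hom_mult[OF aps_hom[OF apF g]] Kf(1) in \<open>simp_all add: K(2,4)\<close>)
  next
    fix U x assume "U \<in> Obj C" "x \<in> el K U"
    then show "res K (Id C U) x = x" using aps_Id[OF apF] Kf(1) by (simp add: K(4))
  next
    fix g h x assume *: "g \<in> Arr C" "h \<in> Arr C" "Dom C h = Cod C g" "x \<in> el K (Cod C h)"
    then show "res K (h * g) x = res K g (res K h x)"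
      using aps_comp[OF apF, of g "Dom C g" "Dom C h" h "Cod C h" x] Kf(1) by (simp add: K(4))
  next
    fix U V g h x assume "U \<in> Obj C" "V \<in> Obj C" "g \<in> Hom C U V" "h \<in> Hom C U V" "x \<in> el K V"
    then show "res K (g \<boxplus> h) x = res K g x \<otimes>\<^bsub>val K U\<^esub> res K h x"
      using aps_add[OF apF, of g U V h x] Kf(1) by (simp add: K(2,4))
  qed
  obtain X Y a e where p: "presented F X Y a e" using coh_presented[OF D(1)] by blast
  obtain X' Y' a' e' where p': "presented G X' Y' a' e'" using coh_presented[OF D(2)] by blast
  note P = presentedD[OF p] and P' = presentedD[OF p']
  obtain b where b: "b \<in> Hom C Y Y'" "res G b e' = comps \<phi> Y e"
    using P'(5)[OF P(4) coh_closed[OF f P(4,2)]] by blast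
  obtain W q s where W: "q \<in> Hom C W Y" "s \<in> Hom C W X'" "b * q = a' * s"
    "\<And>U u v. u \<in> Hom C U Y \<Longrightarrow> v \<in> Hom C U X' \<Longrightarrow> b * u = a' * v \<Longrightarrow> \<exists>w\<in>Hom C U W. q * w = u \<and> s * w = v"
    by (rule pullback_ex[OF ker b(1) P'(1)], assumption) blast
  obtain W' r z where W': "r \<in> Hom C W' W" "z \<in> Hom C W' X" "q * r = a * z"
    "\<And>U u v. u \<in> Hom C U W \<Longrightarrow> v \<in> Hom C U X \<Longrightarrow> q * u = a * v \<Longrightarrow> \<exists>w\<in>Hom C U W'. r * w = u \<and> z * w = v"
    by (rule pullback_ex[OF ker W(1) P(1)], assumption) blast
  have \<phi>e: "comps \<phi> U (res F u e) = res G (b * u) e'" if u: "u \<in> Hom C U Y" for U u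
    using coh_HomD(6)[OF f u P(2)] b(2) aps_comp[OF apG u b(1) P'(2)] by simp
  have "presented K W' W r (res F q e)" unfolding presented_def
  proof (intro conjI ballI W'(1))
    have "b * q \<in> Hom C W Y'" using b(1) W(1) by simp
    then have "res G (b * q) e' = un G W" using P'(6) W(2,3) by blast
    then show "res F q e \<in> el K W" using aps_closed[OF apF W(1) P(2)] \<phi>e[OF W(1)] by (simp add: K(1))
    fix U x assume U: "U \<in> Obj C" and x: "x \<in> el K U"
    obtain u where u: "u \<in> Hom C U Y" "res F u e = x" using P(5)[OF U Kf(1)[OF x]] by blast
    have "b * u \<in> Hom C U Y'" "res G (b * u) e' = un G U" using b(1) u Kf(2)[OF x] \<phi>e[OF u(1)] by simp_all
    then obtain v where v: "v \<in> Hom C U X'" "b * u = a' * v" using P'(6) by blast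
    obtain w where w: "w \<in> Hom C U W" "q * w = u" using W(4)[OF u(1) v] by blast
    show "\<exists>u\<in>Hom C U W. res K u (res F q e) = x"
      by (rule bexI[OF _ w(1)]) (use aps_comp[OF apF w(1) W(1) P(2)] w(2) u(2) in \<open>simp add: K(4)\<close>)
  next
    fix U u assume U: "U \<in> Obj C" and u: "u \<in> Hom C U W"
    have qu: "q * u \<in> Hom C U Y" using W(1) u by simp
    have "res K u (res F q e) = un K U \<longleftrightarrow> res F (q * u) e = un F U"
      using aps_comp[OF apF u W(1) P(2)] by (simp add: K(3,4))
    also have "\<dots> \<longleftrightarrow> (\<exists>v\<in>Hom C U X. q * u = a * v)" by (rule P(6)[OF qu])
    also have "\<dots> \<longleftrightarrow> (\<exists>w\<in>Hom C U W'. u = r * w)"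
    proof
      assume "\<exists>v\<in>Hom C U X. q * u = a * v"
      then show "\<exists>w\<in>Hom C U W'. u = r * w" using W'(4)[OF u] by blast
    next
      assume "\<exists>w\<in>Hom C U W'. u = r * w"
      then obtain w where w: "w \<in> Hom C U W'" "u = r * w" by blast
      have "q * u = (q * r) * w" unfolding w(2) using W(1) W'(1) w(1) by simp
      also have "\<dots> = a * (z * w)" unfolding W'(3) using P(1) W'(2) w(1) by simp
      finally show "\<exists>v\<in>Hom C U X. q * u = a * v" using Comp_Hom[OF w(1) W'(2)] by blast
    qed
    finally show "res K u (res F q e) = un K U \<longleftrightarrow> (\<exists>w\<in>Hom C U W'. u = r * w)" .
  qed
  then have cK: "coherent C K" using apK coherent_iff by blast
  have kM: "mk K F (\<lambda>U x. x) \<in> Hom \<K> K F" by (rule mk_Hom[OF cK D(1)]) (auto simp: hom_def K)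
  have "pointwise_kernel \<phi> (mk K F (\<lambda>U x. x))"
    unfolding pointwise_kernel_def using D(3,4) by (auto simp: inj_on_def K(1))
  with kM that show ?thesis by blast
qed

text \<open>Since kernels and cokernels exist pointwise, monomorphisms are pointwise injective and
  epimorphisms pointwise surjective. The abelian axioms then reduce to those of abelian groups at
  each object.\<close>

lemma coh_abelian:
  assumes ker: "\<And>f. f \<in> Arr C \<Longrightarrow> \<exists>k. is_kernel C f k"
  shows "abelian \<K>"
proof -
  interpret coh: additive "coh C" by (rule coh_additive)
  have H: "\<phi> \<in> Hom \<K> (Dom \<K> \<phi>) (Cod \<K> \<phi>)" if "\<phi> \<in> Arr \<K>" for \<phi> using that by (simp add: Hom_iff)
  have one: "un F U \<in> el F U" if "coherent C F" "U \<in> Obj C" for F U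
  proof -
    interpret comm_group "val F U" by (rule aps_group[OF coh_aps[OF that(1)] that(2)])
    show ?thesis by simp
  qed
  have inj: "inj_on (comps \<phi> U) (el F U)"
    if m: "monomorphism \<K> \<phi>" and f: "\<phi> \<in> Hom \<K> F G" and U: "U \<in> Obj C" for \<phi> F G U
  proof -
    obtain K k where k: "k \<in> Hom \<K> K F" "pointwise_kernel \<phi> k" by (rule coh_kernel_ex[OF ker f])
    note kk = pointwise_kernel_is_kernel[OF f k]
    have k0: "k = Zero \<K> K F" using coh.kernel_of_mono(1)[OF m kk] k(1) f by (simp add: Hom_iff del: coh_simps)
    have z: "x = un F U" if "x \<in> el F U" "comps \<phi> U x = un G U" for x
    proof -
      have "x \<in> comps k U ` el K U"
        using k(2) U that coh_HomD(3,4)[OF k(1)] coh_HomD(3,4)[OF f] unfolding pointwise_kernel_def by auto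
      then show ?thesis unfolding k0 using U by auto
    qed
    interpret comm_group "val F U" by (rule aps_group[OF coh_aps[OF coh_HomD(1)[OF f]] U])
    show ?thesis
    proof (rule inj_onI)
      fix x y assume *: "x \<in> el F U" "y \<in> el F U" "comps \<phi> U x = comps \<phi> U y"
      then have "x \<otimes>\<^bsub>val F U\<^esub> inv\<^bsub>val F U\<^esub> y = un F U" using coh_diff_one[OF f U *(1,2)] by (intro z) simp_all
      then show "x = y" using *(1,2) by (metis inv_closed inv_equality inv_inv)
    qed
  qed
  have surj: "comps \<phi> U ` el F U = el G U"
    if m: "epimorphism \<K> \<phi>" and f: "\<phi> \<in> Hom \<K> F G" and U: "U \<in> Obj C" for \<phi> F G U
  proof -
    obtain K c where c: "c \<in> Hom \<K> G K" "pointwise_cokernel \<phi> c" by (rule coh_cokernel_ex[OF f])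
    note cc = pointwise_cokernel_is_cokernel[OF f c]
    have c0: "c = Zero \<K> G K"
      using coh.epi_Zero[OF m, of c K] coh.cokernelD(4)[OF cc] c(1) f by (simp add: Hom_iff del: coh_simps)
    have "{x \<in> el G U. comps c U x = un K U} = comps \<phi> U ` el F U"
      using c(2) U coh_HomD(3,4)[OF c(1)] coh_HomD(3,4)[OF f] unfolding pointwise_cokernel_def by auto
    moreover have "comps c U x = un K U" if "x \<in> el G U" for x unfolding c0 using U that by simp
    ultimately show ?thesis by blast
  qed
  show ?thesis
  proof
    fix \<phi> assume "\<phi> \<in> Arr \<K>"
    note f = H[OF this]
    show "\<exists>k. is_kernel \<K> \<phi> k" using coh_kernel_ex[OF ker f] pointwise_kernel_is_kernel[OF f] by metis
    show "\<exists>c. is_cokernel \<K> \<phi> c" using coh_cokernel_ex[OF f] pointwise_cokernel_is_cokernel[OF f] by metis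
  next
    fix \<phi> c assume m: "monomorphism \<K> \<phi>" and c: "is_cokernel \<K> \<phi> c"
    note cD = coh.cokernelD[OF c]
    note f = H[OF cD(1)]
    have cH: "c \<in> Hom \<K> (Cod \<K> \<phi>) (Cod \<K> c)" using cD by (simp add: Hom_iff)
    note S = coh_HomD(3,4)[OF f] coh_HomD(3,4)[OF cH]
    show "is_kernel \<K> c \<phi>"
    proof (rule pointwise_kernel_is_kernel[OF cH f])
      show "pointwise_kernel c \<phi>" using coh_cokernel_pointwise[OF c] inj[OF m f]
        unfolding pointwise_kernel_def pointwise_cokernel_def S by blast
    qed
  next
    fix \<phi> l assume m: "epimorphism \<K> \<phi>" and l: "is_kernel \<K> \<phi> l"
    note lD = coh.kernelD[OF l]
    let ?F = "Dom \<K> \<phi>"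
    note f = H[OF lD(1)]
    have lH: "l \<in> Hom \<K> (Dom \<K> l) ?F" using lD by (simp add: Hom_iff)
    obtain K k where k: "k \<in> Hom \<K> K ?F" "pointwise_kernel \<phi> k" by (rule coh_kernel_ex[OF ker f])
    note kk = pointwise_kernel_is_kernel[OF f k]
    obtain j where j: "j \<in> Hom \<K> K (Dom \<K> l)" "l *\<^sub>\<K> j = k" "isomorphism \<K> j"
      using coh.kernel_unique[OF kk l] k(1) by (metis Hom_iff)
    obtain i where i: "i \<in> Hom \<K> (Dom \<K> l) K" "k *\<^sub>\<K> i = l"
      using coh.kernel_unique[OF l kk] k(1) by (metis Hom_iff)
    have ck: "pointwise_cokernel k \<phi>" using k(2) surj[OF m f]
      unfolding pointwise_cokernel_def pointwise_kernel_def coh_HomD(3,4)[OF f] coh_HomD(3,4)[OF k(1)] by blast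
    have "is_cokernel \<K> (l *\<^sub>\<K> j) \<phi>" unfolding j(2) by (rule pointwise_cokernel_is_cokernel[OF k(1) f ck])
    then show "is_cokernel \<K> l \<phi>"
      using coh.cokernel_epi_comp[OF coh.iso_epi[OF j(3)], of l \<phi>] lD(2) j(1) by (simp add: Hom_iff del: coh_simps)
  qed
qed

end

section \<open>The abelian hull\<close>

lemma nat_isomorphic_opcat:
  assumes "nat_isomorphic (opcat C) (opcat D) F G"
  shows "nat_isomorphic C D G F"
proof -
  from assms obtain \<tau> where
    "\<And>X. X \<in> Obj C \<Longrightarrow> \<tau> X \<in> Hom D (on_obj G X) (on_obj F X)"
    "\<And>X. X \<in> Obj C \<Longrightarrow> isomorphism D (\<tau> X)"
    "\<And>f. f \<in> Arr C \<Longrightarrow> \<tau> (Cod C f) *\<^sub>D on_arr G f = on_arr F f *\<^sub>D \<tau> (Dom C f)"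
    unfolding nat_isomorphic_def op_simps by metis
  then show ?thesis by (intro nat_isomorphicI[where \<tau> = \<tau>]) (auto simp: Hom_iff)
qed

lemma comp_func_assoc: "H \<circ>\<^sub>F G \<circ>\<^sub>F F = H \<circ>\<^sub>F (G \<circ>\<^sub>F F)" by (simp add: comp_func_def comp_assoc)

lemma additive_is_functor: "additive_functor A B F \<Longrightarrow> is_functor A B F" by (simp add: additive_functor_def)

lemma exact_additive: "exact_functor A B F \<Longrightarrow> additive_functor A B F" by (simp add: exact_functor_def)

lemma exact_is_functor: "exact_functor A B F \<Longrightarrow> is_functor A B F"
  by (simp add: exact_functor_def additive_functor_def)

context additive
begin

lemma op_coh_additive: "additive (opcat \<K>)" by (rule additive.additive_opcat[OF coh_additive])

text \<open>Cokernels in \<open>coh C\<close> are kernels in its opposite. This is the input that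
  makes the second application of \<open>coh\<close> abelian.\<close>

lemma op_coh_kernel:
  assumes "f \<in> Arr (opcat \<K>)"
  shows "\<exists>k. is_kernel (opcat \<K>) f k"
proof -
  have "f \<in> Hom \<K> (Dom \<K> f) (Cod \<K> f)" using assms by (simp add: Hom_iff)
  then show ?thesis unfolding op_simps
    by (rule coh_cokernel_ex) (use pointwise_cokernel_is_cokernel \<open>f \<in> Hom \<K> _ _\<close> in blast)
qed

lemma ab_hull_abelian: "abelian (ab_hull C)" unfolding ab_hull_def
  by (rule abelian.abelian_opcat[OF additive.coh_abelian[OF op_coh_additive op_coh_kernel]])

text \<open>The first extension, to \<open>coh C\<close>, preserves cokernels. Between the opposite
  categories it therefore preserves kernels, and \<open>exact_if_preserves_kernels\<close> makes the
  second extension exact.\<close>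

lemma ab_hull_extension:
  assumes X: "abelian X" and G: "additive_functor C X G"
  obtains E where "exact_functor (ab_hull C) X E" "nat_isomorphic C X (E \<circ>\<^sub>F ab_embedding C) G"
proof -
  interpret X: abelian X by fact
  interpret coh: additive "coh C" by (rule coh_additive)
  interpret M: additive "opcat \<K>" by (rule op_coh_additive)
  interpret P1: presentation C "coh C" "yoneda C" by (rule coh_presentation)
  interpret P2: presentation "opcat \<K>" "coh (opcat \<K>)" "yoneda (opcat \<K>)" by (rule M.coh_presentation)
  interpret G: addfun C X G using G by unfold_locales
  interpret E1: pres_ext C "coh C" "yoneda C" X G by unfold_locales (rule X.cokernel_ex)
  let ?M = "opcat \<K>" and ?X = "opcat X"
  interpret XO: abelian ?X by (rule X.abelian_opcat)
  have H1: "additive_functor ?M ?X E1.ext" using E1.ext_additive by (simp add: additive_functor_opcat)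
  interpret H1: addfun ?M ?X E1.ext using H1 by unfold_locales
  interpret E2: pres_ext ?M "coh ?M" "yoneda ?M" ?X E1.ext by unfold_locales (use X.kernel_ex in simp)
  have cohM: "abelian (coh ?M)" by (rule M.coh_abelian[OF op_coh_kernel])
  have "exact_functor (coh ?M) ?X E2.ext"
  proof (rule P2.exact_if_preserves_kernels[OF cohM XO.abelian_axioms E2.ext_additive E2.ext_cokernel op_coh_kernel])
    fix f k assume k: "is_kernel ?M f k"
    have kX: "is_kernel ?X (on_arr E1.ext f) (on_arr E1.ext k)" using E1.ext_cokernel k by simp
    have "is_kernel ?X (on_arr (E2.ext \<circ>\<^sub>F yoneda ?M) f) (on_arr (E2.ext \<circ>\<^sub>F yoneda ?M) k)"
    proof (rule kernel_nat_isomorphic[OF XO.preadditive_axioms _ _ M.cat_axioms E2.ext_extends _ _ kX])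
      show "is_functor ?M ?X E1.ext" by (rule additive_is_functor[OF H1])
      show "is_functor ?M ?X (E2.ext \<circ>\<^sub>F yoneda ?M)"
        by (rule comp_functor[OF M.cat_axioms additive_is_functor additive_is_functor])
          (rule M.yoneda_additive E2.ext_additive)+
      show "f \<in> Hom ?M (Dom ?M f) (Cod ?M f)" "k \<in> Hom ?M (Dom ?M k) (Dom ?M f)"
        using M.kernelD[OF k] by (simp_all only: Hom_iff)
    qed
    then show "is_kernel ?X (on_arr E2.ext (on_arr (yoneda ?M) f)) (on_arr E2.ext (on_arr (yoneda ?M) k))"
      by (simp only: comp_func_simps)
  qed
  then have ex: "exact_functor (ab_hull C) X E2.ext"
    unfolding ab_hull_def using exact_functor_opcat[of "coh ?M" ?X E2.ext] by simp
  let ?y = "yoneda C" and ?y2 = "yoneda ?M"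
  have y: "is_functor C \<K> ?y" by (rule additive_is_functor[OF yoneda_additive])
  have E1f: "is_functor \<K> X E1.ext" by (rule additive_is_functor[OF E1.ext_additive])
  have f2: "is_functor \<K> X (E2.ext \<circ>\<^sub>F ?y2)"
    using comp_functor[OF M.cat_axioms additive_is_functor[OF M.yoneda_additive]
      additive_is_functor[OF E2.ext_additive]] by (simp add: is_functor_opcat)
  have n2: "nat_isomorphic \<K> X (E2.ext \<circ>\<^sub>F ?y2) E1.ext" by (rule nat_isomorphic_opcat[OF E2.ext_extends])
  have n1: "nat_isomorphic C X (E1.ext \<circ>\<^sub>F ?y) G"
    by (rule nat_isomorphic_sym[OF cat_axioms X.cat_axioms additive_is_functor[OF G]
      comp_functor[OF cat_axioms y E1f] E1.ext_extends])
  have "nat_isomorphic C X (E2.ext \<circ>\<^sub>F ?y2 \<circ>\<^sub>F ?y) G"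
    by (rule nat_isomorphic_trans[OF cat_axioms X.cat_axioms comp_functor[OF cat_axioms y f2]
      comp_functor[OF cat_axioms y E1f] additive_is_functor[OF G]
      nat_isomorphic_whisker_right[OF cat_axioms coh.cat_axioms y n2] n1])
  then have "nat_isomorphic C X (E2.ext \<circ>\<^sub>F ab_embedding C) G" by (simp add: ab_embedding_def comp_func_assoc)
  with ex that show ?thesis by blast
qed

lemma ab_embedding_additive: "additive_functor C (ab_hull C) (ab_embedding C)"
proof -
  interpret M: additive "opcat \<K>" by (rule op_coh_additive)
  have "additive_functor \<K> (ab_hull C) (yoneda (opcat \<K>))" unfolding ab_hull_def using M.yoneda_additive
    additive_functor_opcat[of "opcat \<K>" "coh (opcat \<K>)" "yoneda (opcat \<K>)"] by simp
  then show ?thesis unfolding ab_embedding_def by (rule additive_comp[OF preadditive_axioms yoneda_additive])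
qed

text \<open>\<open>nat_isomorphic_unique\<close> is used once for each application of
  \<open>coh\<close>. At the inner stage the presentations of coherent functors remain cokernels in
  the hull by \<open>yoneda_kernel\<close>, and exact functors preserve them. Passing to opposites
  reverses isomorphisms, which is why the two functors change places.\<close>

lemma ab_hull_unique:
  assumes X: "abelian X" and E: "exact_functor (ab_hull C) X E" "exact_functor (ab_hull C) X E'"
    and n: "nat_isomorphic C X (E \<circ>\<^sub>F ab_embedding C) (E' \<circ>\<^sub>F ab_embedding C)"
  shows "nat_isomorphic (ab_hull C) X E E'"
proof -
  interpret X: abelian X by fact
  interpret coh: additive "coh C" by (rule coh_additive)
  interpret M: additive "opcat \<K>" by (rule op_coh_additive)
  interpret P1: presentation C "coh C" "yoneda C" by (rule coh_presentation)
  interpret P2: presentation "opcat \<K>" "coh (opcat \<K>)" "yoneda (opcat \<K>)" by (rule M.coh_presentation)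
  let ?M = "opcat \<K>" and ?X = "opcat X" and ?y2 = "yoneda (opcat \<K>)"
  interpret XO: abelian ?X by (rule X.abelian_opcat)
  interpret E: exact_fun "ab_hull C" X E by (rule exact_funI[OF ab_hull_abelian X E(1)])
  interpret E': exact_fun "ab_hull C" X E' by (rule exact_funI[OF ab_hull_abelian X E(2)])
  have opE: "is_functor (coh ?M) ?X F" if "exact_functor (ab_hull C) X F" for F
    using exact_is_functor[OF that] is_functor_opcat[of "coh ?M" ?X F] by (simp add: ab_hull_def)
  have fM: "is_functor \<K> X (F \<circ>\<^sub>F ?y2)" if "exact_functor (ab_hull C) X F" for F
    using comp_functor[OF M.cat_axioms additive_is_functor[OF M.yoneda_additive] opE[OF that]]
    by (simp add: is_functor_opcat)
  have yk: "is_cokernel (ab_hull C) (on_arr ?y2 (on_arr (yoneda C) \<alpha>)) (on_arr ?y2 \<pi>)" if "P1.pres \<alpha> \<pi>" for \<alpha> \<pi>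
    using M.yoneda_kernel[of "on_arr (yoneda C) \<alpha>" \<pi>] P1.presD(2)[OF that] by (simp add: ab_hull_def)
  have k2: "is_kernel (ab_hull C) (on_arr ?y2 \<alpha>) \<pi>" if "P2.pres \<alpha> \<pi>" for \<alpha> \<pi>
    using P2.presD(2)[OF that] by (simp add: ab_hull_def)
  have "nat_isomorphic \<K> X (E' \<circ>\<^sub>F ?y2) (E \<circ>\<^sub>F ?y2)"
  proof (rule P1.nat_isomorphic_unique[OF X.preadditive_axioms fM[OF E(2)] fM[OF E(1)]])
    show "\<And>\<alpha> \<pi>. P1.pres \<alpha> \<pi> \<Longrightarrow>
      is_cokernel X (on_arr (E \<circ>\<^sub>F ?y2) (on_arr (yoneda C) \<alpha>)) (on_arr (E \<circ>\<^sub>F ?y2) \<pi>)"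
      using E.cokernel[OF yk] by simp
    show "\<And>\<alpha> \<pi>. P1.pres \<alpha> \<pi> \<Longrightarrow>
      is_cokernel X (on_arr (E' \<circ>\<^sub>F ?y2) (on_arr (yoneda C) \<alpha>)) (on_arr (E' \<circ>\<^sub>F ?y2) \<pi>)"
      using E'.cokernel[OF yk] by simp
    have y: "is_functor C \<K> (yoneda C)" by (rule additive_is_functor[OF yoneda_additive])
    show "nat_isomorphic C X (E' \<circ>\<^sub>F ?y2 \<circ>\<^sub>F yoneda C) (E \<circ>\<^sub>F ?y2 \<circ>\<^sub>F yoneda C)"
      using nat_isomorphic_sym[OF cat_axioms X.cat_axioms comp_functor[OF cat_axioms y fM[OF E(1)]]
        comp_functor[OF cat_axioms y fM[OF E(2)]]] n by (simp add: ab_embedding_def comp_func_assoc)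
  qed
  then have n1: "nat_isomorphic ?M ?X (E \<circ>\<^sub>F ?y2) (E' \<circ>\<^sub>F ?y2)"
    using nat_isomorphic_opcat[of ?M ?X "E' \<circ>\<^sub>F ?y2" "E \<circ>\<^sub>F ?y2"] by simp
  have "nat_isomorphic (coh ?M) ?X E' E"
  proof (rule P2.nat_isomorphic_unique[OF XO.preadditive_axioms opE[OF E(2)] opE[OF E(1)]])
    show "\<And>\<alpha> \<pi>. P2.pres \<alpha> \<pi> \<Longrightarrow> is_cokernel ?X (on_arr E (on_arr ?y2 \<alpha>)) (on_arr E \<pi>)" using E.kernel[OF k2] by simp
    show "\<And>\<alpha> \<pi>. P2.pres \<alpha> \<pi> \<Longrightarrow> is_cokernel ?X (on_arr E' (on_arr ?y2 \<alpha>)) (on_arr E' \<pi>)"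
      using E'.kernel[OF k2] by simp
    have y: "is_functor ?M (coh ?M) ?y2" by (rule additive_is_functor[OF M.yoneda_additive])
    show "nat_isomorphic ?M ?X (E' \<circ>\<^sub>F ?y2) (E \<circ>\<^sub>F ?y2)"
      by (rule nat_isomorphic_sym[OF M.cat_axioms XO.cat_axioms comp_functor[OF M.cat_axioms y opE[OF E(1)]]
        comp_functor[OF M.cat_axioms y opE[OF E(2)]] n1])
  qed
  then show ?thesis unfolding ab_hull_def using nat_isomorphic_opcat[of "opcat (coh ?M)" X E' E] by simp
qed

end

section \<open>The additive hull\<close>

definition frag_comp :: "('o, 'm, 'z) cat_scheme \<Rightarrow> ('m \<Rightarrow>\<^sub>0 int) \<Rightarrow> ('m \<Rightarrow>\<^sub>0 int) \<Rightarrow> ('m \<Rightarrow>\<^sub>0 int)" where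
  "frag_comp C b a = frag_extend (\<lambda>g. frag_extend (\<lambda>f. frag_of (Comp C g f)) a) b"

lemma frag_extend_fun_diff:
  "frag_extend (\<lambda>x. f x - g x) c = frag_extend f c - frag_extend g c"
  using subset_UNIV by (induction c rule: frag_induction) (auto simp: frag_extend_diff)

lemma frag_comp_simps [simp]:
  "frag_comp C 0 a = 0" "frag_comp C b 0 = 0"
  "frag_comp C (frag_of g) (frag_of f) = frag_of (Comp C g f)"
  by (auto simp: frag_comp_def intro: frag_extend_eq_0)

lemma frag_comp_diff:
  "frag_comp C (b - b') a = frag_comp C b a - frag_comp C b' a"
  "frag_comp C b (a - a') = frag_comp C b a - frag_comp C b a'"
  by (simp_all add: frag_comp_def frag_extend_diff frag_extend_fun_diff)

lemma frag_comp_add: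
  "frag_comp C (b + b') a = frag_comp C b a + frag_comp C b' a"
  "frag_comp C b (a + a') = frag_comp C b a + frag_comp C b a'"
  subgoal using frag_comp_diff(1)[of C "b + b'" b' a] by (simp add: algebra_simps)
  subgoal using frag_comp_diff(2)[of C b "a + a'" a'] by (simp add: algebra_simps)
  done

lemma lin_simps [simp]:
  "Obj (linearisation C) = Obj C" "Dom (linearisation C) = zsrc" "Cod (linearisation C) = ztgt"
  "Id (linearisation C) X = ZArr X X (frag_of (Id C X))"
  "Comp (linearisation C) b a = ZArr (zsrc a) (ztgt b) (frag_comp C (coeffs b) (coeffs a))"
  "Add (linearisation C) a b = ZArr (zsrc a) (ztgt a) (coeffs a + coeffs b)"
  "Zero (linearisation C) X Y = ZArr X Y 0" by (simp_all add: linearisation_def frag_comp_def)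

lemma lin_Hom:
  "z \<in> Hom (linearisation C) X Y \<longleftrightarrow>
     zsrc z = X \<and> ztgt z = Y \<and> X \<in> Obj C \<and> Y \<in> Obj C \<and> Poly_Mapping.keys (coeffs z) \<subseteq> Hom C X Y"
  by (cases z) (auto simp: linearisation_def Hom_iff)

definition lin_emb :: "('o, 'm, 'z) cat_scheme \<Rightarrow> ('o, 'm, 'o, ('o, 'm) zarr) func" where
  "lin_emb C = \<lparr>on_obj = (\<lambda>X. X), on_arr = (\<lambda>f. ZArr (Dom C f) (Cod C f) (frag_of f))\<rparr>"

lemma lin_emb_simps [simp]:
  "on_obj (lin_emb C) X = X" "on_arr (lin_emb C) f = ZArr (Dom C f) (Cod C f) (frag_of f)"
  by (simp_all add: lin_emb_def)

context cat
begin

declare Hom_iff [simp del]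
lemmas Hom_cat_iff [simp] = Hom_iff[where C = C]

lemma keys_frag_comp:
  assumes "Poly_Mapping.keys a \<subseteq> Hom C X Y" "Poly_Mapping.keys b \<subseteq> Hom C Y Z"
  shows "Poly_Mapping.keys (frag_comp C b a) \<subseteq> Hom C X Z"
proof -
  have "Poly_Mapping.keys (frag_extend (\<lambda>f. frag_of (g * f)) a) \<subseteq> Hom C X Z"
    if "g \<in> Poly_Mapping.keys b" for g using keys_frag_extend[of "\<lambda>f. frag_of (g * f)" a] assms that by fastforce
  then show ?thesis unfolding frag_comp_def
    using keys_frag_extend[of "\<lambda>g. frag_extend (\<lambda>f. frag_of (g * f)) a" b] by blast
qed

text \<open>Both sides are additive in each of the three arguments, which reduces the claim to
  single arrows by nested inductions.\<close>

lemma frag_comp_assoc: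
  assumes a: "Poly_Mapping.keys a \<subseteq> Hom C W X" and b: "Poly_Mapping.keys b \<subseteq> Hom C X Y"
    and c: "Poly_Mapping.keys c \<subseteq> Hom C Y Z"
  shows "frag_comp C c (frag_comp C b a) = frag_comp C (frag_comp C c b) a" using c
proof (induction c rule: frag_induction)
  case (one h)
  note h = one
  show ?case using b
  proof (induction b rule: frag_induction)
    case (one g)
    note g = one
    show ?case using a
    proof (induction a rule: frag_induction)
      case (one f)
      then show ?case using g h by simp
    qed (simp_all add: frag_comp_diff)
  qed (simp_all add: frag_comp_diff)
qed (simp_all add: frag_comp_diff)

lemma frag_comp_Id:
  assumes a: "Poly_Mapping.keys a \<subseteq> Hom C X Y"
  shows "frag_comp C a (frag_of (Id C X)) = a" "frag_comp C (frag_of (Id C Y)) a = a"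
  using a by (induction a rule: frag_induction) (simp_all add: frag_comp_diff)

abbreviation "\<L> \<equiv> linearisation C"

lemma lin_preadditive: "preadditive \<L>"
proof (intro preadditive.intro preadditive_axioms.intro cat.intro category.intro)
  fix f assume f: "f \<in> Arr \<L>"
  then have "f \<in> Hom \<L> (zsrc f) (ztgt f)" by (simp add: Hom_iff)
  then show "Dom \<L> f \<in> Obj \<L>" "Cod \<L> f \<in> Obj \<L>" by (simp_all add: lin_Hom)
next
  fix X Y assume "X \<in> Obj \<L>" "Y \<in> Obj \<L>"
  then have O: "X \<in> Obj C" "Y \<in> Obj C" by simp_all
  have k: "Poly_Mapping.keys (a + b) \<subseteq> Hom C X Y"
    if "Poly_Mapping.keys a \<subseteq> Hom C X Y" "Poly_Mapping.keys b \<subseteq> Hom C X Y" for a b :: "'m \<Rightarrow>\<^sub>0 int"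
    using that Poly_Mapping.keys_add[of a b] by blast
  show "comm_group (hom_group \<L> X Y)"
  proof (rule comm_groupI)
    fix z assume "z \<in> carrier (hom_group \<L> X Y)"
    then show "\<exists>y\<in>carrier (hom_group \<L> X Y).
        y \<otimes>\<^bsub>hom_group \<L> X Y\<^esub> z = \<one>\<^bsub>hom_group \<L> X Y\<^esub>"
      by (intro bexI[of _ "ZArr X Y (- coeffs z)"]) (simp_all add: hom_group_simps lin_Hom)
  qed (use k O in \<open>simp_all add: hom_group_simps lin_Hom algebra_simps zarr.expand\<close>)
next
  fix X Y Z f g assume "f \<in> Hom \<L> X Y" "g \<in> Hom \<L> Y Z"
  then show "g *\<^sub>\<L> f \<in> Hom \<L> X Z" using keys_frag_comp[of "coeffs f" X Y "coeffs g" Z] by (simp add: lin_Hom)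
next
  fix f X Y assume "f \<in> Hom \<L> X Y"
  then show "f *\<^sub>\<L> Id \<L> X = f" "Id \<L> Y *\<^sub>\<L> f = f"
    using frag_comp_Id[of "coeffs f" X Y] by (simp_all add: lin_Hom zarr.expand)
next
  fix f g h W X Y Z
  assume "f \<in> Hom \<L> W X" "g \<in> Hom \<L> X Y" "h \<in> Hom \<L> Y Z"
  then show "h *\<^sub>\<L> (g *\<^sub>\<L> f) = (h *\<^sub>\<L> g) *\<^sub>\<L> f"
    using frag_comp_assoc[of "coeffs f" W X "coeffs g" Y "coeffs h" Z] by (simp add: lin_Hom)
qed (auto simp: lin_Hom frag_comp_add)

lemma lin_emb_functor: "is_functor C \<L> (lin_emb C)" by (rule is_functorI) (simp_all add: lin_Hom)

lemma lin_emb_Hom: "f \<in> Hom C X Y \<Longrightarrow> on_arr (lin_emb C) f \<in> Hom \<L> X Y" by (auto simp: lin_Hom)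

text \<open>The arrows of \<open>C\<close> generate the hom groups of the linearisation, so closure
  under differences suffices.\<close>

lemma lin_induct [consumes 1, case_names Zero emb diff]:
  assumes z: "z \<in> Hom \<L> X Y"
    and 0: "P (Zero \<L> X Y)"
    and e: "\<And>f. f \<in> Hom C X Y \<Longrightarrow> P (on_arr (lin_emb C) f)"
    and d: "\<And>a b. a \<in> Hom \<L> X Y \<Longrightarrow> b \<in> Hom \<L> X Y \<Longrightarrow> P a \<Longrightarrow> P b \<Longrightarrow>
      P (a \<boxplus>\<^sub>\<L> neg \<L> b)"
  shows "P z"
proof -
  interpret Z: preadditive \<L> by (rule lin_preadditive)
  have O: "X \<in> Obj C" "Y \<in> Obj C" and k: "Poly_Mapping.keys (coeffs z) \<subseteq> Hom C X Y" and zz: "z = ZArr X Y (coeffs z)"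
    using z by (auto simp: lin_Hom zarr.expand)
  have "Poly_Mapping.keys a \<subseteq> Hom C X Y \<and> P (ZArr X Y a)" if "Poly_Mapping.keys a \<subseteq> Hom C X Y" for a using that
  proof (induction a rule: frag_induction)
    case zero
    then show ?case using 0 by simp
  next
    case (one f)
    then show ?case using e[of f] by auto
  next
    case (diff a b)
    have H: "ZArr X Y a \<in> Hom \<L> X Y" "ZArr X Y b \<in> Hom \<L> X Y"
      "ZArr X Y (- b) \<in> Hom \<L> X Y" using diff O by (auto simp: lin_Hom)
    have "ZArr X Y (- b) = neg \<L> (ZArr X Y b)" by (rule Z.Add_group(7)[OF H(3,2)]) simp
    then have eq: "ZArr X Y (a - b) = ZArr X Y a \<boxplus>\<^sub>\<L> neg \<L> (ZArr X Y b)"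
      by (metis (no_types, lifting) ab_group_add_class.ab_diff_conv_add_uminus lin_simps(6) zarr.sel)
    have "P (ZArr X Y (a - b))" unfolding eq using diff by (intro d[OF H(1,2)]) simp_all
    then show ?case using diff Poly_Mapping.keys_diff[of a b] by blast
  qed
  then show ?thesis using zz k by metis
qed

text \<open>On each hom set the extension is the homomorphism given by the universal property of
  free abelian groups. Compatibility with composition is bilinear and is reduced to arrows of
  \<open>C\<close> in one factor after the other.\<close>

lemma lin_extension:
  assumes X: "preadditive X" and J: "is_functor C X J"
  obtains H where "additive_functor \<L> X H" "func_eq_on C (H \<circ>\<^sub>F lin_emb C) J"
proof -
  interpret X: preadditive X by fact
  interpret J: fctr C X J using J by unfold_locales
  let ?Z = \<L>
  interpret Z: preadditive ?Z by (rule lin_preadditive)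
  have "\<exists>h. h \<in> hom (free_Abelian_group (Hom C U V)) (hom_group X (on_obj J U) (on_obj J V)) \<and>
      (\<forall>f\<in>Hom C U V. h (frag_of f) = on_arr J f)" if "U \<in> Obj C" "V \<in> Obj C" for U V
  proof -
    interpret comm_group "hom_group X (on_obj J U) (on_obj J V)" by (rule X.hom_group) (use that in auto)
    have "on_arr J ` Hom C U V \<subseteq> carrier (hom_group X (on_obj J U) (on_obj J V))"
      by (auto simp: hom_group_simps Hom_iff)
    from free_Abelian_group_universal[OF this] show ?thesis by metis
  qed
  then obtain h where h: "\<And>U V. U \<in> Obj C \<Longrightarrow> V \<in> Obj C \<Longrightarrow>
      h U V \<in> hom (free_Abelian_group (Hom C U V)) (hom_group X (on_obj J U) (on_obj J V))"
    "\<And>U V f. U \<in> Obj C \<Longrightarrow> V \<in> Obj C \<Longrightarrow> f \<in> Hom C U V \<Longrightarrow> h U V (frag_of f) = on_arr J f" by metis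
  define H where "H = \<lparr>on_obj = on_obj J, on_arr = (\<lambda>z. h (zsrc z) (ztgt z) (coeffs z))\<rparr>"
  have Hh: "on_arr H z = h U V (coeffs z)" if "z \<in> Hom ?Z U V" for z U V using that by (auto simp: H_def lin_Hom)
  have HHom: "on_arr H z \<in> Hom X (on_obj J U) (on_obj J V)" if z: "z \<in> Hom ?Z U V" for z U V
    using hom_in_carrier[OF h(1), of U V "coeffs z"] z unfolding Hh[OF z] by (auto simp: lin_Hom hom_group_simps)
  have Hemb: "on_arr H (on_arr (lin_emb C) f) = on_arr J f" if f: "f \<in> Hom C U V" for f U V
    using h(2)[of U V f] Hom_Obj[OF f] f Hh[OF lin_emb_Hom[OF f]] by simp
  have HAdd: "on_arr H (a \<boxplus>\<^sub>?Z b) = on_arr H a \<boxplus>\<^sub>X on_arr H b" if ab: "a \<in> Hom ?Z U V" "b \<in> Hom ?Z U V" for a b U V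
  proof -
    have "a \<boxplus>\<^sub>?Z b \<in> Hom ?Z U V" using ab by (simp add: Hom_iff del: lin_simps)
    then show ?thesis
      using hom_mult[OF h(1), of U V "coeffs a" "coeffs b"] ab Hh[OF ab(1)] Hh[OF ab(2)] Hh[of "a \<boxplus>\<^sub>?Z b" U V]
      by (simp add: lin_Hom hom_group_simps)
  qed
  have HZero: "on_arr H (Zero ?Z U V) = Zero X (on_obj J U) (on_obj J V)" if O: "U \<in> Obj C" "V \<in> Obj C" for U V
  proof -
    have z: "Zero ?Z U V \<in> Hom ?Z U V" using O by (simp add: lin_Hom)
    have "on_arr H (Zero ?Z U V) \<boxplus>\<^sub>X on_arr H (Zero ?Z U V) = on_arr H (Zero ?Z U V)" using HAdd[OF z z] by simp
    then show ?thesis using X.Add_group(8) HHom[OF z] by blast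
  qed
  have Hdiff: "on_arr H (a \<boxplus>\<^sub>?Z neg ?Z b) = on_arr H a \<boxplus>\<^sub>X neg X (on_arr H b)"
    if ab: "a \<in> Hom ?Z U V" "b \<in> Hom ?Z U V" for a b U V
  proof -
    have n: "neg ?Z b \<in> Hom ?Z U V" using ab by (simp add: Hom_iff del: lin_simps)
    have O: "U \<in> Obj C" "V \<in> Obj C" using ab by (auto simp: lin_Hom)
    have "on_arr H (neg ?Z b) \<boxplus>\<^sub>X on_arr H b = Zero X (on_obj J U) (on_obj J V)"
      using HAdd[OF n ab(2)] Z.Add_group(5)[OF ab(2,2)] HZero[OF O] by (simp del: lin_simps)
    then have "on_arr H (neg ?Z b) = neg X (on_arr H b)" using X.Add_group(7)[OF HHom[OF n] HHom[OF ab(2)]] by simp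
    then show ?thesis using HAdd[OF ab(1) n] by simp
  qed
  have "is_functor ?Z X H"
  proof (rule is_functorI)
    fix U assume "U \<in> Obj ?Z"
    then have U: "U \<in> Obj C" by simp
    then show "on_obj H U \<in> Obj X" by (simp add: H_def)
    show "on_arr H (Id ?Z U) = Id X (on_obj H U)" using Hemb[of "Id C U" U U] U by (simp add: H_def)
  next
    fix z U V assume "z \<in> Hom ?Z U V"
    from HHom[OF this] show "on_arr H z \<in> Hom X (on_obj H U) (on_obj H V)" by (simp add: H_def)
  next
    fix a b U V W assume a: "a \<in> Hom ?Z U V" and b: "b \<in> Hom ?Z V W"
    have O: "U \<in> Obj C" "V \<in> Obj C" "W \<in> Obj C" using a b by (auto simp: lin_Hom)
    have JO: "on_obj J U \<in> Obj X" "on_obj J V \<in> Obj X" "on_obj J W \<in> Obj X" using O by auto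
    have ZO: "U \<in> Obj ?Z" "V \<in> Obj ?Z" "W \<in> Obj ?Z" using O by auto
    show "on_arr H (b *\<^sub>?Z a) = on_arr H b *\<^sub>X on_arr H a" using b
    proof (induction rule: lin_induct)
      case Zero
      show ?case using Z.Zero_Comp[of a V W] a HHom[OF a] HZero[OF O(1,3)] HZero[OF O(2,3)] ZO JO
        by (simp add: Hom_iff del: lin_simps)
    next
      case (emb g)
      note g = emb
      note gZ = lin_emb_Hom[OF g]
      show ?case using a
      proof (induction rule: lin_induct)
        case Zero
        show ?case using Z.Comp_Zero[of "on_arr (lin_emb C) g" V U] gZ HHom[OF gZ] HZero[OF O(1,3)] HZero[OF O(1,2)] ZO JO
          by (simp add: Hom_iff del: lin_simps lin_emb_simps)
      next
        case (emb f)
        have gf: "g * f \<in> Hom C U W" using emb g by simp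
        have "on_arr (lin_emb C) g *\<^sub>?Z on_arr (lin_emb C) f = on_arr (lin_emb C) (g * f)" using emb g by auto
        then show ?case using Hemb[OF gf] Hemb[OF g] Hemb[OF emb] J.comp[of f g] emb g by simp
      next
        case (diff c d)
        have e: "on_arr (lin_emb C) g *\<^sub>?Z c \<in> Hom ?Z U W" "on_arr (lin_emb C) g *\<^sub>?Z d \<in> Hom ?Z U W"
          using Z.Comp_Hom[OF _ gZ] diff(1,2) by blast+
        have "on_arr (lin_emb C) g *\<^sub>?Z (c \<boxplus>\<^sub>?Z neg ?Z d) =
            (on_arr (lin_emb C) g *\<^sub>?Z c) \<boxplus>\<^sub>?Z neg ?Z (on_arr (lin_emb C) g *\<^sub>?Z d)"
          using gZ diff(1,2) by (simp add: Hom_iff del: lin_simps lin_emb_simps)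
        then show ?case
          using Hdiff[OF e] Hdiff[OF diff(1,2)] diff(3,4) HHom[OF gZ] HHom[OF diff(1)] HHom[OF diff(2)]
          by (simp add: Hom_iff del: lin_simps lin_emb_simps)
      qed
    next
      case (diff c d)
      have e: "c *\<^sub>?Z a \<in> Hom ?Z U W" "d *\<^sub>?Z a \<in> Hom ?Z U W" using Z.Comp_Hom[OF a] diff(1,2) by blast+
      have "(c \<boxplus>\<^sub>?Z neg ?Z d) *\<^sub>?Z a = (c *\<^sub>?Z a) \<boxplus>\<^sub>?Z neg ?Z (d *\<^sub>?Z a)"
        using a diff(1,2) by (simp add: Hom_iff del: lin_simps)
      then show ?case using Hdiff[OF e] Hdiff[OF diff(1,2)] diff(3,4) HHom[OF a] HHom[OF diff(1)] HHom[OF diff(2)]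
        by (simp add: Hom_iff del: lin_simps)
    qed
  qed
  then have "additive_functor ?Z X H" unfolding additive_functor_def using HAdd by blast
  moreover have "func_eq_on C (H \<circ>\<^sub>F lin_emb C) J" unfolding func_eq_on_def using Hemb by (auto simp: H_def)
  ultimately show ?thesis by (rule that)
qed

lemma lin_unique:
  assumes X: "preadditive X" and H: "additive_functor \<L> X H" "additive_functor \<L> X H'"
    and n: "nat_isomorphic C X (H \<circ>\<^sub>F lin_emb C) (H' \<circ>\<^sub>F lin_emb C)"
  shows "nat_isomorphic \<L> X H H'"
proof -
  interpret X: preadditive X by fact
  let ?Z = \<L>
  interpret Z: preadditive ?Z by (rule lin_preadditive)
  interpret H: addfun ?Z X H using H by unfold_locales
  interpret H': addfun ?Z X H' using H by unfold_locales
  from n obtain \<tau> where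
    \<tau>: "\<And>U. U \<in> Obj C \<Longrightarrow> \<tau> U \<in> Hom X (on_obj H U) (on_obj H' U)"
       "\<And>U. U \<in> Obj C \<Longrightarrow> isomorphism X (\<tau> U)"
      "\<And>f. f \<in> Arr C \<Longrightarrow> on_arr H' (on_arr (lin_emb C) f) *\<^sub>X \<tau> (Dom C f) =
         \<tau> (Cod C f) *\<^sub>X on_arr H (on_arr (lin_emb C) f)"
    unfolding nat_isomorphic_def comp_func_simps lin_emb_simps(1) by blast
  show ?thesis
  proof (rule nat_isomorphicI[where \<tau> = \<tau>])
    fix z U V assume z: "z \<in> Hom ?Z U V"
    then have O: "U \<in> Obj C" "V \<in> Obj C" "U \<in> Obj ?Z" "V \<in> Obj ?Z" by (auto simp: lin_Hom)
    note t = \<tau>(1)[OF O(1)] \<tau>(1)[OF O(2)]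
    have XO: "on_obj H U \<in> Obj X" "on_obj H V \<in> Obj X" "on_obj H' U \<in> Obj X" "on_obj H' V \<in> Obj X"
      using O(3,4) H.obj H'.obj by blast+
    show "on_arr H' z *\<^sub>X \<tau> U = \<tau> V *\<^sub>X on_arr H z" using z
    proof (induction rule: lin_induct)
      case Zero
      show ?case using H.Zero[OF O(3,4)] H'.Zero[OF O(3,4)] t XO by (simp add: Hom_iff del: lin_simps)
    next
      case (emb f)
      then show ?case using \<tau>(3)[of f] by (simp del: lin_emb_simps)
    next
      case (diff a b)
      then show ?case using t by (simp add: Hom_iff del: lin_simps)
    qed
  qed (use \<tau> in auto)
qed

end

text \<open>The sums occurring in matrix products, with an initial segment of the naturals as index
  set so that proofs can use induction on its length.\<close>

definition hom_sum :: "('o, 'm, 'z) addcat_scheme \<Rightarrow> 'o \<Rightarrow> 'o \<Rightarrow> (nat \<Rightarrow> 'm) \<Rightarrow> nat \<Rightarrow> 'm" where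
  "hom_sum C X Y f n = finprod (hom_group C X Y) f {..<n}"

lemma hom_sum_opcat: "hom_sum (opcat C) X Y f n = hom_sum C Y X f n" by (simp add: hom_sum_def)

definition mkmat :: "'o list \<Rightarrow> 'o list \<Rightarrow> (nat \<Rightarrow> nat \<Rightarrow> 'm) \<Rightarrow> ('o, 'm) marr" where
  "mkmat Xs Ys m = MArr Xs Ys (\<lambda>(i, j) \<in> mat_index Xs Ys. m i j)"

lemma mkmat_simps [simp]:
  "msrc (mkmat Xs Ys m) = Xs" "mtgt (mkmat Xs Ys m) = Ys"
  "i < length Ys \<Longrightarrow> j < length Xs \<Longrightarrow> entries (mkmat Xs Ys m) (i, j) = m i j" by (simp_all add: mkmat_def)

lemma mat_simps [simp]:
  "Obj (matrix_cat C) = lists (Obj C)" "Dom (matrix_cat C) = msrc" "Cod (matrix_cat C) = mtgt"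
  "Id (matrix_cat C) Xs = mkmat Xs Xs (\<lambda>i j. if i = j then Id C (Xs ! i) else Zero C (Xs ! j) (Xs ! i))"
  "Comp (matrix_cat C) N M = mkmat (msrc M) (mtgt N) (\<lambda>i k. hom_sum C (msrc M ! k) (mtgt N ! i)
     (\<lambda>j. Comp C (entries N (i, j)) (entries M (j, k))) (length (mtgt M)))"
  "Add (matrix_cat C) M N = mkmat (msrc M) (mtgt M) (\<lambda>i j. Add C (entries M (i, j)) (entries N (i, j)))"
  "Zero (matrix_cat C) Xs Ys = mkmat Xs Ys (\<lambda>i j. Zero C (Xs ! j) (Ys ! i))"
  by (simp_all add: matrix_cat_def mkmat_def hom_sum_def restrict_def fun_eq_iff)

lemma mat_Hom:
  "M \<in> Hom (matrix_cat C) Xs Ys \<longleftrightarrow> Xs \<in> lists (Obj C) \<and> Ys \<in> lists (Obj C) \<and> msrc M = Xs \<and> mtgt M = Ys \<and>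
     entries M \<in> extensional (mat_index Xs Ys) \<and>
     (\<forall>i<length Ys. \<forall>j<length Xs. entries M (i, j) \<in> Hom C (Xs ! j) (Ys ! i))"
  by (cases M) (auto simp: matrix_cat_def Hom_def PiE_def Pi_def)

lemma mat_eqI:
  assumes "M \<in> Hom (matrix_cat C) Xs Ys" "N \<in> Hom (matrix_cat C) Xs Ys"
    and "\<And>i j. i < length Ys \<Longrightarrow> j < length Xs \<Longrightarrow> entries M (i, j) = entries N (i, j)"
  shows "M = N"
proof (rule marr.expand, intro conjI)
  show "entries M = entries N"
    by (rule extensionalityI[of _ "mat_index Xs Ys"]) (use assms in \<open>auto simp: mat_Hom\<close>)
qed (use assms in \<open>auto simp: mat_Hom\<close>)

lemma mkmat_Hom:
  assumes "Xs \<in> lists (Obj C)" "Ys \<in> lists (Obj C)"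
    and "\<And>i j. i < length Ys \<Longrightarrow> j < length Xs \<Longrightarrow> m i j \<in> Hom C (Xs ! j) (Ys ! i)"
  shows "mkmat Xs Ys m \<in> Hom (matrix_cat C) Xs Ys" using assms unfolding mat_Hom by (simp add: mkmat_def)

lemma nth_Obj: "Xs \<in> lists (Obj C) \<Longrightarrow> j < length Xs \<Longrightarrow> Xs ! j \<in> Obj C" by auto

definition mat_emb :: "('o, 'm, 'z) addcat_scheme \<Rightarrow> ('o, 'm, 'o list, ('o, 'm) marr) func" where
  "mat_emb C = \<lparr>on_obj = (\<lambda>X. [X]), on_arr = (\<lambda>f. MArr [Dom C f] [Cod C f] (\<lambda>ij \<in> {(0, 0)}. f))\<rparr>"

lemma mat_emb_simps [simp]:
  "on_obj (mat_emb C) X = [X]" "on_arr (mat_emb C) f = mkmat [Dom C f] [Cod C f] (\<lambda>_ _. f)"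
  by (auto simp: mat_emb_def mkmat_def)

section \<open>Finite sums of arrows and finite biproducts\<close>

context preadditive
begin

lemma hom_sum_0 [simp]:
  assumes "X \<in> Obj C" "Y \<in> Obj C" shows "hom_sum C X Y f 0 = Zero C X Y"
proof -
  interpret comm_group "hom_group C X Y" using assms by (intro hom_group)
  show ?thesis using finprod_empty by (simp add: hom_sum_def hom_group_simps)
qed

lemma hom_sum_Hom:
  assumes "X \<in> Obj C" "Y \<in> Obj C" "\<And>j. j < n \<Longrightarrow> f j \<in> Hom C X Y"
  shows "hom_sum C X Y f n \<in> Hom C X Y"
proof -
  interpret comm_group "hom_group C X Y" using assms by (intro hom_group)
  have "f \<in> {..<n} \<rightarrow> carrier (hom_group C X Y)" using assms(3) by (simp add: hom_group_simps)
  from finprod_closed[OF this] show ?thesis by (simp add: hom_sum_def hom_group_simps)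
qed

lemma hom_sum_Suc:
  assumes "\<And>j. j \<le> n \<Longrightarrow> f j \<in> Hom C X Y"
  shows "hom_sum C X Y f (Suc n) = hom_sum C X Y f n \<boxplus> f n"
proof -
  have O: "X \<in> Obj C" "Y \<in> Obj C" using Hom_Obj[OF assms[of 0]] by simp_all
  interpret comm_group "hom_group C X Y" using O by (intro hom_group)
  have f: "f \<in> {..<n} \<rightarrow> carrier (hom_group C X Y)" "f n \<in> carrier (hom_group C X Y)"
    using assms by (simp_all add: hom_group_simps)
  show ?thesis using finprod_insert[OF _ _ f] m_comm[OF f(2) finprod_closed[OF f(1)]]
    by (simp add: hom_sum_def lessThan_Suc hom_group_simps)
qed

lemma hom_sum_cong:
  assumes "X \<in> Obj C" "Y \<in> Obj C" "\<And>j. j < n \<Longrightarrow> f j = g j" "\<And>j. j < n \<Longrightarrow> g j \<in> Hom C X Y"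
  shows "hom_sum C X Y f n = hom_sum C X Y g n"
proof -
  interpret comm_group "hom_group C X Y" using assms by (intro hom_group)
  show ?thesis unfolding hom_sum_def by (rule finprod_cong') (use assms in \<open>simp_all add: hom_group_simps\<close>)
qed

lemma Comp_hom_sum:
  assumes O: "X \<in> Obj C" "Y \<in> Obj C" and h: "h \<in> Hom C Y Z" and f: "\<And>j. j < n \<Longrightarrow> f j \<in> Hom C X Y"
  shows "h * hom_sum C X Y f n = hom_sum C X Z (\<lambda>j. h * f j) n" using f
proof (induction n)
  case (Suc n)
  have "hom_sum C X Y f n \<in> Hom C X Y" using Suc.prems by (intro hom_sum_Hom O) simp
  then show ?case using Suc h hom_sum_Suc[of n f X Y] hom_sum_Suc[of n "\<lambda>j. h * f j" X Z] by simp
qed (use O h Hom_Obj[OF h] in simp)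

lemma hom_sum_Comp:
  assumes "X \<in> Obj C" "Y \<in> Obj C" "h \<in> Hom C W X" "\<And>j. j < n \<Longrightarrow> f j \<in> Hom C X Y"
  shows "hom_sum C X Y f n * h = hom_sum C W Y (\<lambda>j. f j * h) n"
  by (rule preadditive.Comp_hom_sum[OF preadditive_opcat, unfolded op_simps hom_sum_opcat, OF assms(2,1,3,4)])

lemma hom_sum_Add:
  assumes O: "X \<in> Obj C" "Y \<in> Obj C"
    and f: "\<And>j. j < n \<Longrightarrow> f j \<in> Hom C X Y" and g: "\<And>j. j < n \<Longrightarrow> g j \<in> Hom C X Y"
  shows "hom_sum C X Y (\<lambda>j. f j \<boxplus> g j) n = hom_sum C X Y f n \<boxplus> hom_sum C X Y g n"
proof -
  interpret comm_group "hom_group C X Y" using O by (intro hom_group)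
  have "f \<in> {..<n} \<rightarrow> carrier (hom_group C X Y)" "g \<in> {..<n} \<rightarrow> carrier (hom_group C X Y)"
    using f g by (simp_all add: hom_group_simps)
  from finprod_multf[OF this] show ?thesis by (simp add: hom_sum_def hom_group_simps)
qed

lemma hom_sum_Add_cong:
  assumes O: "X \<in> Obj C" "Y \<in> Obj C" and f: "\<And>j. j < n \<Longrightarrow> f j \<in> Hom C X Y" "\<And>j. j < n \<Longrightarrow> g j \<in> Hom C X Y"
    and h: "\<And>j. j < n \<Longrightarrow> h j = f j \<boxplus> g j"
  shows "hom_sum C X Y h n = hom_sum C X Y f n \<boxplus> hom_sum C X Y g n"
proof -
  have "hom_sum C X Y h n = hom_sum C X Y (\<lambda>j. f j \<boxplus> g j) n" by (rule hom_sum_cong[OF O h]) (use f in simp_all)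
  then show ?thesis by (simp only: hom_sum_Add[OF O f])
qed

lemma hom_sum_Zero:
  assumes O: "X \<in> Obj C" "Y \<in> Obj C" and f: "\<And>j. j < n \<Longrightarrow> f j = Zero C X Y"
  shows "hom_sum C X Y f n = Zero C X Y" using f
proof (induction n)
  case (Suc n)
  then show ?case using hom_sum_Suc[of n f X Y] O by simp
qed (use O in simp)

lemma hom_sum_single:
  assumes O: "X \<in> Obj C" "Y \<in> Obj C" and i: "i < n" "f i \<in> Hom C X Y"
    and f: "\<And>j. j < n \<Longrightarrow> j \<noteq> i \<Longrightarrow> f j = Zero C X Y"
  shows "hom_sum C X Y f n = f i"
proof -
  have fH: "f j \<in> Hom C X Y" if "j < n" for j using that i f[of j] O by (cases "j = i") simp_all
  show ?thesis using i(1) f fH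
  proof (induction n)
    case (Suc n)
    show ?case
    proof (cases "i = n")
      case True
      then show ?thesis using hom_sum_Suc[of n f X Y] hom_sum_Zero[OF O, of n f] Suc.prems i(2) by simp
    next
      case False
      then show ?thesis using hom_sum_Suc[of n f X Y] Suc i(2) by simp
    qed
  qed simp
qed

lemma hom_sum_swap:
  assumes O: "X \<in> Obj C" "Y \<in> Obj C" and f: "\<And>i j. i < m \<Longrightarrow> j < n \<Longrightarrow> f i j \<in> Hom C X Y"
  shows "hom_sum C X Y (\<lambda>i. hom_sum C X Y (f i) n) m = hom_sum C X Y (\<lambda>j. hom_sum C X Y (\<lambda>i. f i j) m) n" using f
proof (induction m)
  case 0
  then show ?case using hom_sum_Zero[OF O, of n "\<lambda>_. Zero C X Y"] O by simp
next
  case (Suc m)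
  have i: "hom_sum C X Y (f i) n \<in> Hom C X Y" if "i < Suc m" for i
    using Suc.prems[OF that] by (intro hom_sum_Hom O)
  have j: "hom_sum C X Y (\<lambda>i. f i j) m \<in> Hom C X Y" if "j < n" for j
    using Suc.prems[OF _ that] by (intro hom_sum_Hom O) simp
  have "hom_sum C X Y (\<lambda>i. hom_sum C X Y (f i) n) (Suc m) =
      hom_sum C X Y (\<lambda>j. hom_sum C X Y (\<lambda>i. f i j) m) n \<boxplus> hom_sum C X Y (f m) n"
    using hom_sum_Suc[of m "\<lambda>i. hom_sum C X Y (f i) n" X Y] i Suc by simp
  also have "\<dots> = hom_sum C X Y (\<lambda>j. hom_sum C X Y (\<lambda>i. f i j) m \<boxplus> f m j) n"
    by (rule hom_sum_Add[OF O j Suc.prems, symmetric]) simp_all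
  also have "\<dots> = hom_sum C X Y (\<lambda>j. hom_sum C X Y (\<lambda>i. f i j) (Suc m)) n"
  proof (rule hom_sum_cong[OF O])
    fix j assume "j < n"
    with Suc.prems have "f i j \<in> Hom C X Y" if "i < Suc m" for i using that by blast
    then show "hom_sum C X Y (\<lambda>i. f i j) m \<boxplus> f m j = hom_sum C X Y (\<lambda>i. f i j) (Suc m)"
      "hom_sum C X Y (\<lambda>i. f i j) (Suc m) \<in> Hom C X Y"
      using hom_sum_Suc[of m "\<lambda>i. f i j" X Y] hom_sum_Hom[OF O, of "Suc m" "\<lambda>i. f i j"] by simp_all
  qed
  finally show ?case .
qed

text \<open>The exchange of summations behind associativity of the matrix product. It is stated for
  arrows in any preadditive category because the functor built from direct sums needs the same
  computation.\<close>

lemma hom_sum_assoc: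
  assumes A: "A \<in> Obj C" and D: "D \<in> Obj C"
    and P: "\<And>l. l < m \<Longrightarrow> P l \<in> Obj C" and R: "\<And>j. j < n \<Longrightarrow> R j \<in> Obj C"
    and f: "\<And>l. l < m \<Longrightarrow> f l \<in> Hom C A (P l)" and h: "\<And>j. j < n \<Longrightarrow> h j \<in> Hom C (R j) D"
    and g: "\<And>j l. j < n \<Longrightarrow> l < m \<Longrightarrow> g j l \<in> Hom C (P l) (R j)"
  shows "hom_sum C A D (\<lambda>j. h j * hom_sum C A (R j) (\<lambda>l. g j l * f l) m) n =
    hom_sum C A D (\<lambda>l. hom_sum C (P l) D (\<lambda>j. h j * g j l) n * f l) m"
proof -
  let ?s = "\<lambda>j l. h j * (g j l * f l)"
  have s: "?s j l \<in> Hom C A D" if "j < n" "l < m" for j l using f[OF that(2)] g[OF that] h[OF that(1)] by simp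
  have l: "h j * hom_sum C A (R j) (\<lambda>l. g j l * f l) m = hom_sum C A D (?s j) m" if "j < n" for j
    by (rule Comp_hom_sum[OF A R[OF that] h[OF that]]) (use f g[OF that] in simp)
  have r: "hom_sum C A D (\<lambda>j. ?s j l) n = hom_sum C (P l) D (\<lambda>j. h j * g j l) n * f l" if l: "l < m" for l
  proof -
    have "hom_sum C (P l) D (\<lambda>j. h j * g j l) n * f l = hom_sum C A D (\<lambda>j. (h j * g j l) * f l) n"
      by (rule hom_sum_Comp[OF P[OF l] D f[OF l]]) (use h g[OF _ l] in simp)
    also have "\<dots> = hom_sum C A D (\<lambda>j. ?s j l) n"
      by (rule hom_sum_cong[OF A D _ s[OF _ l]]) (use f[OF l] h g[OF _ l] in simp_all)
    finally show ?thesis by (rule HOL.sym)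
  qed
  have "hom_sum C A D (\<lambda>j. h j * hom_sum C A (R j) (\<lambda>l. g j l * f l) m) n =
      hom_sum C A D (\<lambda>j. hom_sum C A D (?s j) m) n" by (rule hom_sum_cong[OF A D l hom_sum_Hom[OF A D s]])
  also have "\<dots> = hom_sum C A D (\<lambda>l. hom_sum C A D (\<lambda>j. ?s j l) n) m" by (rule hom_sum_swap[OF A D s])
  also have "\<dots> = hom_sum C A D (\<lambda>l. hom_sum C (P l) D (\<lambda>j. h j * g j l) n * f l) m"
  proof (rule hom_sum_cong[OF A D r])
    fix l assume l: "l < m"
    show "hom_sum C (P l) D (\<lambda>j. h j * g j l) n * f l \<in> Hom C A D"
      unfolding r[OF l, symmetric] by (rule hom_sum_Hom[OF A D s[OF _ l]])
  qed
  finally show ?thesis .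
qed

text \<open>Direct sums of \<open>n\<close> objects by equations, like \<open>biprod\<close>. For
  \<open>n = 0\<close> the sum is empty, and the last equation describes a zero object.\<close>

definition nbiprod :: "nat \<Rightarrow> (nat \<Rightarrow> 'o) \<Rightarrow> 'o \<Rightarrow> (nat \<Rightarrow> 'm) \<Rightarrow> (nat \<Rightarrow> 'm) \<Rightarrow> bool" where
  "nbiprod n A S \<iota> \<pi> \<longleftrightarrow> S \<in> Obj C \<and> (\<forall>j<n. \<iota> j \<in> Hom C (A j) S \<and> \<pi> j \<in> Hom C S (A j)) \<and>
     (\<forall>i<n. \<forall>j<n. \<pi> i * \<iota> j = (if i = j then Id C (A i) else Zero C (A j) (A i))) \<and>
     hom_sum C S S (\<lambda>j. \<iota> j * \<pi> j) n = Id C S"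

lemma nbiprodD:
  assumes "nbiprod n A S \<iota> \<pi>"
  shows "S \<in> Obj C" "j < n \<Longrightarrow> A j \<in> Obj C" "j < n \<Longrightarrow> \<iota> j \<in> Hom C (A j) S" "j < n \<Longrightarrow> \<pi> j \<in> Hom C S (A j)"
    "j < n \<Longrightarrow> \<pi> j * \<iota> j = Id C (A j)" "i < n \<Longrightarrow> j < n \<Longrightarrow> i \<noteq> j \<Longrightarrow> \<pi> i * \<iota> j = Zero C (A j) (A i)"
    "hom_sum C S S (\<lambda>j. \<iota> j * \<pi> j) n = Id C S"
proof -
  note b = assms[unfolded nbiprod_def]
  show "S \<in> Obj C" "hom_sum C S S (\<lambda>j. \<iota> j * \<pi> j) n = Id C S" using b by simp_all
  show i: "\<iota> j \<in> Hom C (A j) S" "\<pi> j \<in> Hom C S (A j)" if "j < n" for j using b that by simp_all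
  show "A j \<in> Obj C" if "j < n" using Hom_Obj[OF i(1)[OF that]] by simp
  show "j < n \<Longrightarrow> \<pi> j * \<iota> j = Id C (A j)" "i < n \<Longrightarrow> j < n \<Longrightarrow> i \<noteq> j \<Longrightarrow> \<pi> i * \<iota> j = Zero C (A j) (A i)"
    using b by simp_all
qed

text \<open>The injections are jointly epimorphic because the sum of the composites of injections
  and projections is the identity.\<close>

lemma nbiprod_eqI:
  assumes b: "nbiprod n A S \<iota> \<pi>" and h: "h \<in> Hom C S T" "h' \<in> Hom C S T"
    and eq: "\<And>j. j < n \<Longrightarrow> h * \<iota> j = h' * \<iota> j"
  shows "h = h'"
proof -
  note bD = nbiprodD[OF b]
  have T: "T \<in> Obj C" using Hom_Obj[OF h(1)] by simp
  have x: "x = hom_sum C S T (\<lambda>j. (x * \<iota> j) * \<pi> j) n" if x: "x \<in> Hom C S T" for x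
  proof -
    have "x = x * hom_sum C S S (\<lambda>j. \<iota> j * \<pi> j) n" using x unfolding bD(7) by simp
    also have "\<dots> = hom_sum C S T (\<lambda>j. x * (\<iota> j * \<pi> j)) n"
      by (rule Comp_hom_sum[OF bD(1,1) x]) (use bD(3,4) in simp)
    also have "\<dots> = hom_sum C S T (\<lambda>j. (x * \<iota> j) * \<pi> j) n"
      by (rule hom_sum_cong[OF bD(1) T]) (use bD(3,4) x in simp_all)
    finally show ?thesis .
  qed
  have "hom_sum C S T (\<lambda>j. (h * \<iota> j) * \<pi> j) n = hom_sum C S T (\<lambda>j. (h' * \<iota> j) * \<pi> j) n"
    by (rule hom_sum_cong[OF bD(1) T]) (use eq bD(3,4) h in simp_all)
  then show ?thesis using x[OF h(1)] x[OF h(2)] by simp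
qed

lemma nbiprod_ex:
  assumes b: "nbiprod n A S \<iota> \<pi>" and T: "T \<in> Obj C" and a: "\<And>j. j < n \<Longrightarrow> a j \<in> Hom C (A j) T"
  obtains h where "h \<in> Hom C S T" "\<And>j. j < n \<Longrightarrow> h * \<iota> j = a j"
proof
  note bD = nbiprodD[OF b]
  have H: "a j * \<pi> j \<in> Hom C S T" if "j < n" for j using bD(4)[OF that] a[OF that] by simp
  show "hom_sum C S T (\<lambda>j. a j * \<pi> j) n \<in> Hom C S T" using H by (intro hom_sum_Hom bD T)
  fix k assume k: "k < n"
  have "hom_sum C S T (\<lambda>j. a j * \<pi> j) n * \<iota> k = hom_sum C (A k) T (\<lambda>j. (a j * \<pi> j) * \<iota> k) n"
    by (rule hom_sum_Comp[OF bD(1) T bD(3)[OF k]]) (use H in simp)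
  also have "\<dots> = hom_sum C (A k) T (\<lambda>j. if j = k then a k else Zero C (A k) T) n"
    by (rule hom_sum_cong[OF bD(2)[OF k] T]) (use k a bD(2-6) T in simp_all)
  also have "\<dots> = a k" using hom_sum_single[OF bD(2)[OF k] T k, of "\<lambda>j. if j = k then a k else Zero C (A k) T"] a[OF k] by simp
  finally show "hom_sum C S T (\<lambda>j. a j * \<pi> j) n * \<iota> k = a k" .
qed

end

lemma (in additive) nbiprod_exists:
  assumes "\<And>j. j < n \<Longrightarrow> A j \<in> Obj C"
  shows "\<exists>S \<iota> \<pi>. nbiprod n A S \<iota> \<pi>" using assms
proof (induction n)
  case 0
  from zero_ex show ?case by (auto simp: nbiprod_def)
next
  case (Suc n)
  then obtain S \<iota> \<pi> where b: "nbiprod n A S \<iota> \<pi>" by auto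
  note bD = nbiprodD[OF b]
  have An: "A n \<in> Obj C" using Suc.prems by simp
  obtain B i j p q where "biprod S (A n) B i j p q" using biprod_ex[OF bD(1) An] by blast
  then have c: "i \<in> Hom C S B" "j \<in> Hom C (A n) B" "p \<in> Hom C B S" "q \<in> Hom C B (A n)"
    and d: "p * i = Id C S" "q * j = Id C (A n)" "q * i = Zero C S (A n)" "p * j = Zero C (A n) S"
    and s: "(i * p) \<boxplus> (j * q) = Id C B" by (auto simp: biprod_def)
  have B: "B \<in> Obj C" using c by auto
  \<comment> \<open>Index \<open>n\<close> is the new summand; the earlier ones are reached through
    \<open>S\<close>.\<close>
  let ?\<iota> = "\<lambda>k. if k = n then j else i * \<iota> k" and ?\<pi> = "\<lambda>k. if k = n then q else \<pi> k * p"
  have H: "?\<iota> k * ?\<pi> k \<in> Hom C B B" if "k \<le> n" for k using that c bD(3,4)[of k] by simp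
  have "hom_sum C B B (\<lambda>k. ?\<iota> k * ?\<pi> k) n = hom_sum C B B (\<lambda>k. i * ((\<iota> k * \<pi> k) * p)) n"
    by (rule hom_sum_cong[OF B B]) (use c bD(3,4) in simp_all)
  also have "\<dots> = i * hom_sum C B S (\<lambda>k. (\<iota> k * \<pi> k) * p) n"
    by (rule Comp_hom_sum[OF B bD(1) c(1), symmetric]) (use c bD(3,4) in simp)
  also have "hom_sum C B S (\<lambda>k. (\<iota> k * \<pi> k) * p) n = hom_sum C S S (\<lambda>k. \<iota> k * \<pi> k) n * p"
    by (rule hom_sum_Comp[OF bD(1,1) c(3), symmetric]) (use bD(3,4) in simp)
  finally have "hom_sum C B B (\<lambda>k. ?\<iota> k * ?\<pi> k) n = i * p" unfolding bD(7) using c by simp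
  then have "hom_sum C B B (\<lambda>k. ?\<iota> k * ?\<pi> k) (Suc n) = Id C B"
    using hom_sum_Suc[of n "\<lambda>k. ?\<iota> k * ?\<pi> k" B B] H s by simp
  moreover have "?\<pi> k * ?\<iota> l = (if k = l then Id C (A k) else Zero C (A l) (A k))"
    if kl: "k < Suc n" "l < Suc n" for k l
  proof -
    consider "k = n" "l = n" | "k = n" "l < n" | "k < n" "l = n" | "k < n" "l < n"
      using kl unfolding less_Suc_eq by blast
    then show ?thesis
    proof cases
      case 2
      then show ?thesis using c bD(3)[of l] An by (simp add: reduce[OF d(3)])
    next
      case 3
      then show ?thesis using c bD(4)[of k] An d(4) by simp
    next
      case 4
      then show ?thesis using c bD(3)[of l] bD(4)[of k] bD(5)[of l] bD(6)[of k l] by (simp add: reduce[OF d(1)])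
    qed (use d(2) in simp)
  qed
  moreover have "?\<iota> k \<in> Hom C (A k) B \<and> ?\<pi> k \<in> Hom C B (A k)" if "k < Suc n" for k
    using that c bD(3,4)[of k] by simp
  ultimately have "nbiprod (Suc n) A B ?\<iota> ?\<pi>" unfolding nbiprod_def using B by blast
  then show ?case by blast
qed

context addfun
begin

lemma hom_sum:
  assumes O: "X \<in> Obj A" "Y \<in> Obj A" and f: "\<And>j. j < n \<Longrightarrow> f j \<in> Hom A X Y"
  shows "on_arr F (hom_sum A X Y f n) = hom_sum B (on_obj F X) (on_obj F Y) (\<lambda>j. on_arr F (f j)) n" using f
proof (induction n)
  case 0
  then show ?case using Zero[OF O] O by simp
next
  case (Suc n)
  have "hom_sum A X Y f n \<in> Hom A X Y" using Suc.prems by (intro S.hom_sum_Hom O) simp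
  then show ?case
    using Suc S.hom_sum_Suc[of n f X Y] T.hom_sum_Suc[of n "\<lambda>j. on_arr F (f j)" "on_obj F X" "on_obj F Y"]
    by (simp add: Hom_iff)
qed

lemma nbiprod:
  assumes b: "S.nbiprod n G U \<iota> \<pi>"
  shows "T.nbiprod n (\<lambda>j. on_obj F (G j)) (on_obj F U) (\<lambda>j. on_arr F (\<iota> j)) (\<lambda>j. on_arr F (\<pi> j))"
proof -
  note bD = S.nbiprodD[OF b]
  have H: "\<iota> j *\<^sub>A \<pi> j \<in> Hom A U U" if "j < n" for j using bD(3,4)[OF that] by (simp add: Hom_iff)
  have c: "on_arr F (\<pi> i) *\<^sub>B on_arr F (\<iota> j) = on_arr F (\<pi> i *\<^sub>A \<iota> j)" if "i < n" "j < n" for i j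
    using bD(3)[OF that(2)] bD(4)[OF that(1)] by (simp add: comp Hom_iff)
  have "on_arr F (hom_sum A U U (\<lambda>j. \<iota> j *\<^sub>A \<pi> j) n) =
      hom_sum B (on_obj F U) (on_obj F U) (\<lambda>j. on_arr F (\<iota> j *\<^sub>A \<pi> j)) n" by (rule hom_sum[OF bD(1,1) H])
  also have "\<dots> = hom_sum B (on_obj F U) (on_obj F U) (\<lambda>j. on_arr F (\<iota> j) *\<^sub>B on_arr F (\<pi> j)) n"
    by (rule T.hom_sum_cong[OF obj[OF bD(1)] obj[OF bD(1)]]) (use bD(3,4) in \<open>simp_all add: comp Hom_iff\<close>)
  finally have "hom_sum B (on_obj F U) (on_obj F U) (\<lambda>j. on_arr F (\<iota> j) *\<^sub>B on_arr F (\<pi> j)) n = Id B (on_obj F U)"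
    unfolding bD(7) using bD(1) by simp
  then show ?thesis unfolding T.nbiprod_def using c bD(1-6) Hom Zero by simp
qed

end

declare mat_simps(2-) [simp del]

section \<open>Matrices over a preadditive category\<close>

context preadditive
begin

abbreviation "\<M> \<equiv> matrix_cat C"

lemma mat_Comp_entry:
  assumes "M \<in> Hom \<M> Xs Ys" "N \<in> Hom \<M> Ys Zs" "i < length Zs" "k < length Xs"
  shows "entries (N *\<^sub>\<M> M) (i, k) =
    hom_sum C (Xs ! k) (Zs ! i) (\<lambda>j. entries N (i, j) * entries M (j, k)) (length Ys)"
proof -
  have "msrc M = Xs" "mtgt M = Ys" "mtgt N = Zs" using assms(1,2) by (simp_all add: mat_Hom)
  then show ?thesis using assms(3,4) by (simp add: mat_simps)
qed

lemma mat_Add_entry: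
  assumes "M \<in> Hom \<M> Xs Ys" "N \<in> Hom \<M> Xs Ys" "i < length Ys" "j < length Xs"
  shows "entries (M \<boxplus>\<^sub>\<M> N) (i, j) = entries M (i, j) \<boxplus> entries N (i, j)"
proof -
  have "msrc M = Xs" "mtgt M = Ys" using assms(1) by (simp_all add: mat_Hom)
  then show ?thesis using assms(3,4) by (simp add: mat_simps)
qed

lemma mat_entry:
  "M \<in> Hom \<M> Xs Ys \<Longrightarrow> i < length Ys \<Longrightarrow> j < length Xs \<Longrightarrow> entries M (i, j) \<in> Hom C (Xs ! j) (Ys ! i)"
  by (simp add: mat_Hom)

lemma mat_lists: "M \<in> Hom \<M> Xs Ys \<Longrightarrow> Xs \<in> lists (Obj C)" "M \<in> Hom \<M> Xs Ys \<Longrightarrow> Ys \<in> lists (Obj C)"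
  by (simp_all add: mat_Hom)

lemma mat_Comp_Hom:
  assumes M: "M \<in> Hom \<M> Xs Ys" and N: "N \<in> Hom \<M> Ys Zs"
  shows "N *\<^sub>\<M> M \<in> Hom \<M> Xs Zs"
proof -
  have e: "msrc M = Xs" "mtgt M = Ys" "mtgt N = Zs" using assms by (simp_all add: mat_Hom)
  note O = nth_Obj[OF mat_lists(1)[OF M]] nth_Obj[OF mat_lists(2)[OF N]]
  show ?thesis unfolding mat_simps e
  proof (rule mkmat_Hom[OF mat_lists(1)[OF M] mat_lists(2)[OF N]])
    fix i k assume ik: "i < length Zs" "k < length Xs"
    show "hom_sum C (Xs ! k) (Zs ! i) (\<lambda>j. entries N (i, j) * entries M (j, k)) (length Ys) \<in> Hom C (Xs ! k) (Zs ! i)"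
    proof (rule hom_sum_Hom[OF O(1)[OF ik(2)] O(2)[OF ik(1)]])
      fix j assume j: "j < length Ys"
      show "entries N (i, j) * entries M (j, k) \<in> Hom C (Xs ! k) (Zs ! i)"
        using mat_entry[OF M j ik(2)] mat_entry[OF N ik(1) j] by simp
    qed
  qed
qed

lemma mat_assoc:
  assumes f: "f \<in> Hom \<M> Ws Xs" and g: "g \<in> Hom \<M> Xs Ys" and h: "h \<in> Hom \<M> Ys Zs"
  shows "h *\<^sub>\<M> (g *\<^sub>\<M> f) = (h *\<^sub>\<M> g) *\<^sub>\<M> f"
proof -
  note gf = mat_Comp_Hom[OF f g] and hg = mat_Comp_Hom[OF g h]
  show ?thesis
  proof (rule mat_eqI[OF mat_Comp_Hom[OF gf h] mat_Comp_Hom[OF f hg]])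
    fix i k assume i: "i < length Zs" and k: "k < length Ws"
    note O = nth_Obj[OF mat_lists(1)[OF f] k] nth_Obj[OF mat_lists(2)[OF h] i]
    note e = mat_entry[OF f _ k] mat_entry[OF g] mat_entry[OF h i]
    have "entries (h *\<^sub>\<M> (g *\<^sub>\<M> f)) (i, k) = hom_sum C (Ws ! k) (Zs ! i)
        (\<lambda>j. entries h (i, j) * hom_sum C (Ws ! k) (Ys ! j) (\<lambda>l. entries g (j, l) * entries f (l, k)) (length Xs)) (length Ys)"
      unfolding mat_Comp_entry[OF gf h i k] by (rule hom_sum_cong[OF O, symmetric])
        (use mat_entry[OF gf _ k] e(3) in \<open>simp_all add: mat_Comp_entry[OF f g _ k, symmetric]\<close>)
    also have "\<dots> = hom_sum C (Ws ! k) (Zs ! i) (\<lambda>l. hom_sum C (Xs ! l) (Zs ! i)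
        (\<lambda>j. entries h (i, j) * entries g (j, l)) (length Ys) * entries f (l, k)) (length Xs)"
      by (rule hom_sum_assoc[OF O nth_Obj[OF mat_lists(1)[OF g]] nth_Obj[OF mat_lists(1)[OF h]] e(1,3,2)])
    also have "\<dots> = entries ((h *\<^sub>\<M> g) *\<^sub>\<M> f) (i, k)" unfolding mat_Comp_entry[OF f hg i k]
      by (rule hom_sum_cong[OF O])
        (use mat_entry[OF hg i] e(1) in \<open>simp_all add: mat_Comp_entry[OF g h i, symmetric]\<close>)
    finally show "entries (h *\<^sub>\<M> (g *\<^sub>\<M> f)) (i, k) = entries ((h *\<^sub>\<M> g) *\<^sub>\<M> f) (i, k)" .
  qed
qed

text \<open>Row \<open>a\<close> of a selection matrix is the projection to the component given by \<open>\<phi> a\<close>, or zero.\<close>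

definition sel :: "'o list \<Rightarrow> 'o list \<Rightarrow> (nat \<Rightarrow> nat option) \<Rightarrow> ('o, 'm) marr" where
  "sel Xs Ys \<phi> = mkmat Xs Ys (\<lambda>a b. if \<phi> a = Some b then Id C (Ys ! a) else Zero C (Xs ! b) (Ys ! a))"

text \<open>Ensures that the identities placed by \<open>sel\<close> are arrows between the objects
  required at their positions.\<close>

definition selects :: "'o list \<Rightarrow> 'o list \<Rightarrow> (nat \<Rightarrow> nat option) \<Rightarrow> bool" where
  "selects Xs Ys \<phi> \<longleftrightarrow> Xs \<in> lists (Obj C) \<and> Ys \<in> lists (Obj C) \<and>
     (\<forall>a<length Ys. \<forall>b. \<phi> a = Some b \<longrightarrow> b < length Xs \<and> Xs ! b = Ys ! a)"

lemma sel_Hom: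
  assumes "selects Xs Ys \<phi>" shows "sel Xs Ys \<phi> \<in> Hom \<M> Xs Ys" unfolding sel_def
  by (rule mkmat_Hom) (use assms nth_Obj[of Ys C] nth_Obj[of Xs C] in \<open>auto simp: selects_def\<close>)

lemma sel_cong: "(\<And>a. a < length Ys \<Longrightarrow> \<phi> a = \<psi> a) \<Longrightarrow> sel Xs Ys \<phi> = sel Xs Ys \<psi>"
  unfolding sel_def mkmat_def by (auto simp: restrict_def fun_eq_iff)

lemma sel_Comp:
  assumes s: "selects Ys Zs \<phi>" and M: "M \<in> Hom \<M> Xs Ys" and a: "a < length Zs" and b: "b < length Xs"
  shows "entries (sel Ys Zs \<phi> *\<^sub>\<M> M) (a, b) =
    (case \<phi> a of None \<Rightarrow> Zero C (Xs ! b) (Zs ! a) | Some c \<Rightarrow> entries M (c, b))"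
proof -
  have Zs: "Zs \<in> lists (Obj C)" using s by (simp add: selects_def)
  note O = nth_Obj[OF mat_lists(1)[OF M] b] nth_Obj[OF Zs a]
  let ?f = "\<lambda>j. entries (sel Ys Zs \<phi>) (a, j) * entries M (j, b)"
  have f: "?f j = (if \<phi> a = Some j then entries M (j, b) else Zero C (Xs ! b) (Zs ! a))" if j: "j < length Ys" for j
    using mat_entry[OF M j b] j a O s by (simp add: sel_def selects_def)
  show ?thesis
  proof (cases "\<phi> a")
    case None
    then show ?thesis unfolding mat_Comp_entry[OF M sel_Hom[OF s] a b]
      using hom_sum_Zero[OF O, of "length Ys" ?f] f by simp
  next
    case (Some c)
    then have c: "c < length Ys" "Ys ! c = Zs ! a" using s a by (simp_all add: selects_def)
    have "?f c \<in> Hom C (Xs ! b) (Zs ! a)" using f[OF c(1)] Some mat_entry[OF M c(1) b] c(2) by simp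
    with f Some c(1) hom_sum_single[OF O c(1), of ?f] show ?thesis
      unfolding mat_Comp_entry[OF M sel_Hom[OF s] a b] by simp
  qed
qed

lemma selects_bind:
  "selects Ys Zs \<phi> \<Longrightarrow> selects Xs Ys \<psi> \<Longrightarrow> selects Xs Zs (\<lambda>a. Option.bind (\<phi> a) \<psi>)"
  unfolding selects_def bind_eq_Some_conv by metis

text \<open>Selection matrices multiply like partial functions on indices. Equations between
  structural maps of direct sums thus become equations between such functions.\<close>

lemma sel_sel:
  assumes s: "selects Ys Zs \<phi>" and t: "selects Xs Ys \<psi>"
  shows "sel Ys Zs \<phi> *\<^sub>\<M> sel Xs Ys \<psi> = sel Xs Zs (\<lambda>a. Option.bind (\<phi> a) \<psi>)"
proof (rule mat_eqI[OF mat_Comp_Hom[OF sel_Hom[OF t] sel_Hom[OF s]] sel_Hom[OF selects_bind[OF s t]]])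
  fix a b assume ab: "a < length Zs" "b < length Xs"
  have "c < length Ys \<and> Ys ! c = Zs ! a" if "\<phi> a = Some c" for c using s that ab by (simp add: selects_def)
  then show "entries (sel Ys Zs \<phi> *\<^sub>\<M> sel Xs Ys \<psi>) (a, b) = entries (sel Xs Zs (\<lambda>a. Option.bind (\<phi> a) \<psi>)) (a, b)"
    unfolding sel_Comp[OF s sel_Hom[OF t] ab] using ab by (cases "\<phi> a") (simp_all add: sel_def)
qed

lemma mat_Id: "Id \<M> Xs = sel Xs Xs Some" by (simp add: mat_simps sel_def)

lemma mat_Zero: "Zero \<M> Xs Ys = sel Xs Ys (\<lambda>_. None)" by (simp add: mat_simps sel_def)

lemma selects_simple:
  assumes "Xs \<in> lists (Obj C)"
  shows "selects Xs Xs Some" "Ys \<in> lists (Obj C) \<Longrightarrow> selects Xs Ys (\<lambda>_. None)"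
  using assms by (simp_all add: selects_def)

lemma mat_Add_Hom:
  assumes M: "M \<in> Hom \<M> Xs Ys" and N: "N \<in> Hom \<M> Xs Ys"
  shows "M \<boxplus>\<^sub>\<M> N \<in> Hom \<M> Xs Ys"
proof -
  have e: "msrc M = Xs" "mtgt M = Ys" using M by (simp_all add: mat_Hom)
  show ?thesis unfolding mat_simps e
  proof (rule mkmat_Hom[OF mat_lists[OF M]])
    fix i j assume ij: "i < length Ys" "j < length Xs"
    show "entries M (i, j) \<boxplus> entries N (i, j) \<in> Hom C (Xs ! j) (Ys ! i)"
      using mat_entry[OF M ij] mat_entry[OF N ij] by simp
  qed
qed

lemma mat_preadditive: "preadditive \<M>"
proof (intro preadditive.intro preadditive_axioms.intro cat.intro category.intro)
  fix M assume "M \<in> Arr \<M>"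
  then have "M \<in> Hom \<M> (msrc M) (mtgt M)" by (simp add: Hom_iff mat_simps)
  then show "Dom \<M> M \<in> Obj \<M>" "Cod \<M> M \<in> Obj \<M>" by (simp_all add: mat_Hom mat_simps)
next
  fix Xs assume "Xs \<in> Obj \<M>"
  then show "Id \<M> Xs \<in> Hom \<M> Xs Xs" unfolding mat_Id by (intro sel_Hom selects_simple) simp
next
  fix M Xs Ys assume M: "M \<in> Hom \<M> Xs Ys"
  note s = selects_simple(1)[OF mat_lists(1)[OF M]] and t = selects_simple(1)[OF mat_lists(2)[OF M]]
  show "Id \<M> Ys *\<^sub>\<M> M = M" unfolding mat_Id
    by (rule mat_eqI[OF mat_Comp_Hom[OF M sel_Hom[OF t]] M]) (simp add: sel_Comp[OF t M])
  show "M *\<^sub>\<M> Id \<M> Xs = M" unfolding mat_Id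
  proof (rule mat_eqI[OF mat_Comp_Hom[OF sel_Hom[OF s] M] M])
    fix i j assume ij: "i < length Ys" "j < length Xs"
    note O = nth_Obj[OF mat_lists(1)[OF M]] nth_Obj[OF mat_lists(2)[OF M] ij(1)]
    have f: "entries M (i, l) * entries (sel Xs Xs Some) (l, j) =
        (if l = j then entries M (i, j) else Zero C (Xs ! j) (Ys ! i))" if l: "l < length Xs" for l
      using mat_entry[OF M ij(1) l] ij l O(1)[OF l] O(1)[OF ij(2)] O(2) by (cases "l = j") (simp_all add: sel_def)
    have "entries M (i, j) * entries (sel Xs Xs Some) (j, j) \<in> Hom C (Xs ! j) (Ys ! i)"
      using f[OF ij(2)] mat_entry[OF M ij] by simp
    with f ij(2) hom_sum_single[OF O(1)[OF ij(2)] O(2) ij(2),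
        of "\<lambda>l. entries M (i, l) * entries (sel Xs Xs Some) (l, j)"]
    show "entries (M *\<^sub>\<M> sel Xs Xs Some) (i, j) = entries M (i, j)"
      unfolding mat_Comp_entry[OF sel_Hom[OF s] M ij] by simp
  qed
next
  fix Xs Ys assume "Xs \<in> Obj \<M>" "Ys \<in> Obj \<M>"
  then have O: "Xs \<in> lists (Obj C)" "Ys \<in> lists (Obj C)" by simp_all
  have Z: "Zero \<M> Xs Ys \<in> Hom \<M> Xs Ys" unfolding mat_Zero by (intro sel_Hom selects_simple O)
  have Ze: "entries (Zero \<M> Xs Ys) (i, j) = Zero C (Xs ! j) (Ys ! i)" if "i < length Ys" "j < length Xs" for i j
    using that by (simp add: mat_simps)
  show "comm_group (hom_group \<M> Xs Ys)"
  proof (rule comm_groupI; unfold hom_group_simps)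
    fix f g assume f: "f \<in> Hom \<M> Xs Ys" and g: "g \<in> Hom \<M> Xs Ys"
    show "f \<boxplus>\<^sub>\<M> g \<in> Hom \<M> Xs Ys" by (rule mat_Add_Hom[OF f g])
    show "f \<boxplus>\<^sub>\<M> g = g \<boxplus>\<^sub>\<M> f"
    proof (rule mat_eqI[OF mat_Add_Hom[OF f g] mat_Add_Hom[OF g f]])
      fix i j assume ij: "i < length Ys" "j < length Xs"
      show "entries (f \<boxplus>\<^sub>\<M> g) (i, j) = entries (g \<boxplus>\<^sub>\<M> f) (i, j)"
        unfolding mat_Add_entry[OF f g ij] mat_Add_entry[OF g f ij]
        by (rule Add_commute) (use mat_entry[OF f ij] mat_entry[OF g ij] in simp_all)
    qed
    fix h assume h: "h \<in> Hom \<M> Xs Ys"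
    note fg = mat_Add_Hom[OF f g] and gh = mat_Add_Hom[OF g h]
    show "(f \<boxplus>\<^sub>\<M> g) \<boxplus>\<^sub>\<M> h = f \<boxplus>\<^sub>\<M> (g \<boxplus>\<^sub>\<M> h)"
    proof (rule mat_eqI[OF mat_Add_Hom[OF fg h] mat_Add_Hom[OF f gh]])
      fix i j assume ij: "i < length Ys" "j < length Xs"
      show "entries ((f \<boxplus>\<^sub>\<M> g) \<boxplus>\<^sub>\<M> h) (i, j) = entries (f \<boxplus>\<^sub>\<M> (g \<boxplus>\<^sub>\<M> h)) (i, j)"
        unfolding mat_Add_entry[OF fg h ij] mat_Add_entry[OF f gh ij] mat_Add_entry[OF f g ij] mat_Add_entry[OF g h ij]
        by (rule Add_assoc) (use mat_entry[OF f ij] mat_entry[OF g ij] mat_entry[OF h ij] in simp_all)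
    qed
  next
    show "Zero \<M> Xs Ys \<in> Hom \<M> Xs Ys" by (rule Z)
  next
    fix f assume f: "f \<in> Hom \<M> Xs Ys"
    show "Zero \<M> Xs Ys \<boxplus>\<^sub>\<M> f = f"
    proof (rule mat_eqI[OF mat_Add_Hom[OF Z f] f])
      fix i j assume ij: "i < length Ys" "j < length Xs"
      show "entries (Zero \<M> Xs Ys \<boxplus>\<^sub>\<M> f) (i, j) = entries f (i, j)"
        unfolding mat_Add_entry[OF Z f ij] Ze[OF ij] using mat_entry[OF f ij] by simp
    qed
    let ?n = "mkmat Xs Ys (\<lambda>i j. neg C (entries f (i, j)))"
    have n: "?n \<in> Hom \<M> Xs Ys" by (rule mkmat_Hom[OF O]) (use mat_entry[OF f] in simp)
    have "?n \<boxplus>\<^sub>\<M> f = Zero \<M> Xs Ys"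
    proof (rule mat_eqI[OF mat_Add_Hom[OF n f] Z])
      fix i j assume ij: "i < length Ys" "j < length Xs"
      show "entries (?n \<boxplus>\<^sub>\<M> f) (i, j) = entries (Zero \<M> Xs Ys) (i, j)"
        unfolding mat_Add_entry[OF n f ij] Ze[OF ij] using mat_entry[OF f ij] ij by simp
    qed
    with n show "\<exists>y\<in>Hom \<M> Xs Ys. y \<boxplus>\<^sub>\<M> f = Zero \<M> Xs Ys" by blast
  qed
next
  fix f g h Xs Ys Zs assume f: "f \<in> Hom \<M> Xs Ys" and g: "g \<in> Hom \<M> Xs Ys" and h: "h \<in> Hom \<M> Ys Zs"
  note a = mat_Add_Hom[OF f g] and hf = mat_Comp_Hom[OF f h] and hg = mat_Comp_Hom[OF g h]
  show "h *\<^sub>\<M> (f \<boxplus>\<^sub>\<M> g) = (h *\<^sub>\<M> f) \<boxplus>\<^sub>\<M> (h *\<^sub>\<M> g)"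
  proof (rule mat_eqI[OF mat_Comp_Hom[OF a h] mat_Add_Hom[OF hf hg]])
    fix i k assume ik: "i < length Zs" "k < length Xs"
    note O = nth_Obj[OF mat_lists(1)[OF f] ik(2)] nth_Obj[OF mat_lists(2)[OF h] ik(1)]
    show "entries (h *\<^sub>\<M> (f \<boxplus>\<^sub>\<M> g)) (i, k) = entries ((h *\<^sub>\<M> f) \<boxplus>\<^sub>\<M> (h *\<^sub>\<M> g)) (i, k)"
      unfolding mat_Add_entry[OF hf hg ik] mat_Comp_entry[OF a h ik] mat_Comp_entry[OF f h ik] mat_Comp_entry[OF g h ik]
    proof (rule hom_sum_Add_cong[OF O])
      fix j assume j: "j < length Ys"
      note e = mat_entry[OF f j ik(2)] mat_entry[OF g j ik(2)] mat_entry[OF h ik(1) j]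
      show "entries h (i, j) * entries f (j, k) \<in> Hom C (Xs ! k) (Zs ! i)"
        "entries h (i, j) * entries g (j, k) \<in> Hom C (Xs ! k) (Zs ! i)" using e by simp_all
      show "entries h (i, j) * entries (f \<boxplus>\<^sub>\<M> g) (j, k) =
          (entries h (i, j) * entries f (j, k)) \<boxplus> (entries h (i, j) * entries g (j, k))"
        unfolding mat_Add_entry[OF f g j ik(2)] using e by simp
    qed
  qed
next
  fix f g h Ws Xs Ys assume f: "f \<in> Hom \<M> Xs Ys" and g: "g \<in> Hom \<M> Xs Ys" and h: "h \<in> Hom \<M> Ws Xs"
  note a = mat_Add_Hom[OF f g] and hf = mat_Comp_Hom[OF h f] and hg = mat_Comp_Hom[OF h g]
  show "(f \<boxplus>\<^sub>\<M> g) *\<^sub>\<M> h = (f *\<^sub>\<M> h) \<boxplus>\<^sub>\<M> (g *\<^sub>\<M> h)"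
  proof (rule mat_eqI[OF mat_Comp_Hom[OF h a] mat_Add_Hom[OF hf hg]])
    fix i k assume ik: "i < length Ys" "k < length Ws"
    note O = nth_Obj[OF mat_lists(1)[OF h] ik(2)] nth_Obj[OF mat_lists(2)[OF f] ik(1)]
    show "entries ((f \<boxplus>\<^sub>\<M> g) *\<^sub>\<M> h) (i, k) = entries ((f *\<^sub>\<M> h) \<boxplus>\<^sub>\<M> (g *\<^sub>\<M> h)) (i, k)"
      unfolding mat_Add_entry[OF hf hg ik] mat_Comp_entry[OF h a ik] mat_Comp_entry[OF h f ik] mat_Comp_entry[OF h g ik]
    proof (rule hom_sum_Add_cong[OF O])
      fix j assume j: "j < length Xs"
      note e = mat_entry[OF f ik(1) j] mat_entry[OF g ik(1) j] mat_entry[OF h j ik(2)]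
      show "entries f (i, j) * entries h (j, k) \<in> Hom C (Ws ! k) (Ys ! i)"
        "entries g (i, j) * entries h (j, k) \<in> Hom C (Ws ! k) (Ys ! i)" using e by simp_all
      show "entries (f \<boxplus>\<^sub>\<M> g) (i, j) * entries h (j, k) =
          (entries f (i, j) * entries h (j, k)) \<boxplus> (entries g (i, j) * entries h (j, k))"
        unfolding mat_Add_entry[OF f g ik(1) j] using e by simp
    qed
  qed
qed (fact mat_Comp_Hom mat_assoc)+

text \<open>The empty list is a zero object, and concatenation is a direct sum. Its injections and
  projections are selection matrices; only their final sum has to be computed entry by
  entry.\<close>

lemma mat_additive: "additive \<M>"
proof (intro additive.intro additive_axioms.intro mat_preadditive)
  show "\<exists>Z\<in>Obj \<M>. Id \<M> Z = Zero \<M> Z Z" by (rule bexI[of _ "[]"]) (auto simp: mat_Id mat_Zero intro: sel_cong)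
  fix Xs Ys assume "Xs \<in> Obj \<M>" "Ys \<in> Obj \<M>"
  then have O: "Xs \<in> lists (Obj C)" "Ys \<in> lists (Obj C)" by simp_all
  let ?n = "length Xs" and ?Z = "Xs @ Ys"
  have Z: "?Z \<in> lists (Obj C)" using O by simp
  let ?\<iota>1 = "\<lambda>a. if a < ?n then Some a else None" and ?\<iota>2 = "\<lambda>a. if a < ?n then None else Some (a - ?n)"
  have s: "selects Xs ?Z ?\<iota>1" "selects Ys ?Z ?\<iota>2" "selects ?Z Xs Some" "selects ?Z Ys (\<lambda>a. Some (a + ?n))"
    using O Z by (auto simp: selects_def nth_append)
  note ip = s(1,3) and jq = s(2,4)
  note h = sel_Hom[OF selects_bind[OF ip]] sel_Hom[OF selects_bind[OF jq]]
  have "(sel Xs ?Z ?\<iota>1 *\<^sub>\<M> sel ?Z Xs Some) \<boxplus>\<^sub>\<M> (sel Ys ?Z ?\<iota>2 *\<^sub>\<M> sel ?Z Ys (\<lambda>a. Some (a + ?n))) = Id \<M> ?Z"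
    unfolding sel_sel[OF ip] sel_sel[OF jq] mat_Id
  proof (rule mat_eqI[OF mat_Add_Hom[OF h] sel_Hom[OF selects_simple(1)[OF Z]]])
    fix a b assume ab: "a < length ?Z" "b < length ?Z"
    note OZ = nth_Obj[OF Z ab(1)] nth_Obj[OF Z ab(2)]
    show "entries (sel ?Z ?Z (\<lambda>a. Option.bind (?\<iota>1 a) Some) \<boxplus>\<^bsub>\<M>\<^esub>
        sel ?Z ?Z (\<lambda>a. Option.bind (?\<iota>2 a) (\<lambda>a. Some (a + ?n)))) (a, b) = entries (sel ?Z ?Z Some) (a, b)"
      unfolding mat_Add_entry[OF h ab] using ab OZ by (cases "a < ?n"; cases "a = b") (simp_all add: sel_def)
  qed
  moreover have "sel ?Z Xs Some *\<^sub>\<M> sel Xs ?Z ?\<iota>1 = Id \<M> Xs" "sel ?Z Ys (\<lambda>a. Some (a + ?n)) *\<^sub>\<M> sel Ys ?Z ?\<iota>2 = Id \<M> Ys"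
    "sel ?Z Ys (\<lambda>a. Some (a + ?n)) *\<^sub>\<M> sel Xs ?Z ?\<iota>1 = Zero \<M> Xs Ys" "sel ?Z Xs Some *\<^sub>\<M> sel Ys ?Z ?\<iota>2 = Zero \<M> Ys Xs"
    unfolding sel_sel[OF s(3,1)] sel_sel[OF s(4,2)] sel_sel[OF s(4,1)] sel_sel[OF s(3,2)] mat_Id mat_Zero
    by (rule sel_cong; simp)+
  ultimately have "preadditive.biprod \<M> Xs Ys ?Z (sel Xs ?Z ?\<iota>1) (sel Ys ?Z ?\<iota>2) (sel ?Z Xs Some) (sel ?Z Ys (\<lambda>a. Some (a + ?n)))"
    unfolding preadditive.biprod_def[OF mat_preadditive] using sel_Hom[OF s(1)] sel_Hom[OF s(2)] sel_Hom[OF s(3)] sel_Hom[OF s(4)] by blast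
  then show "\<exists>B i j p q. preadditive.biprod \<M> Xs Ys B i j p q" by blast
qed

lemma mat_emb_Hom: "f \<in> Hom C X Y \<Longrightarrow> on_arr (mat_emb C) f \<in> Hom \<M> [X] [Y]"
  using Hom_Obj[of f X Y] by (auto intro!: mkmat_Hom)

lemma mat_emb_entry:
  assumes M: "M \<in> Hom \<M> [X] [Y]" shows "M = on_arr (mat_emb C) (entries M (0, 0))"
proof (rule mat_eqI[OF M mat_emb_Hom])
  show e: "entries M (0, 0) \<in> Hom C X Y" using mat_entry[OF M, of 0 0] by simp
  fix i j assume "i < length [Y]" "j < length [X]"
  then show "entries M (i, j) = entries (on_arr (mat_emb C) (entries M (0, 0))) (i, j)" using e by simp
qed

lemma mat_emb_additive: "additive_functor C \<M> (mat_emb C)"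
proof -
  have e: "entries (on_arr (mat_emb C) f) (0, 0) = f" for f by simp
  have eq: "M = N" if "M \<in> Hom \<M> [X] [Y]" "N \<in> Hom \<M> [X] [Y]" "entries M (0, 0) = entries N (0, 0)" for M N X Y
    using mat_emb_entry[OF that(1)] mat_emb_entry[OF that(2)] that(3) by simp
  have "is_functor C \<M> (mat_emb C)"
  proof (rule is_functorI)
    fix X assume "X \<in> Obj C"
    then show "on_obj (mat_emb C) X \<in> Obj \<M>" "on_arr (mat_emb C) (Id C X) = Id \<M> (on_obj (mat_emb C) X)"
      by (auto simp: mat_simps mkmat_def restrict_def fun_eq_iff)
  next
    fix f X Y assume f: "f \<in> Hom C X Y"
    show "on_arr (mat_emb C) f \<in> Hom \<M> (on_obj (mat_emb C) X) (on_obj (mat_emb C) Y)"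
      using mat_emb_Hom[OF f] by (simp only: mat_emb_simps(1))
    fix g Z assume g: "g \<in> Hom C Y Z"
    have gf: "g * f \<in> Hom C X Z" using f g by simp
    have O: "X \<in> Obj C" "Z \<in> Obj C" using f g by auto
    note m = mat_emb_Hom[OF f] mat_emb_Hom[OF g]
    show "on_arr (mat_emb C) (g * f) = on_arr (mat_emb C) g *\<^sub>\<M> on_arr (mat_emb C) f"
    proof (rule eq[OF mat_emb_Hom[OF gf] mat_Comp_Hom[OF m]])
      have "entries (on_arr (mat_emb C) g *\<^sub>\<M> on_arr (mat_emb C) f) (0, 0) =
          hom_sum C X Z (\<lambda>j. entries (on_arr (mat_emb C) g) (0, j) * entries (on_arr (mat_emb C) f) (j, 0)) 1"
        using mat_Comp_entry[OF m, of 0 0] by (simp del: mat_emb_simps)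
      also have "\<dots> = hom_sum C X Z (\<lambda>j. g * f) 1" by (rule hom_sum_cong[OF O]) (use f g in simp_all)
      also have "\<dots> = g * f" using hom_sum_single[OF O, of 0 1 "\<lambda>j. g * f"] gf by simp
      finally show "entries (on_arr (mat_emb C) (g * f)) (0, 0) =
          entries (on_arr (mat_emb C) g *\<^sub>\<M> on_arr (mat_emb C) f) (0, 0)" by simp
    qed
  qed
  moreover have "on_arr (mat_emb C) (f \<boxplus> g) = on_arr (mat_emb C) f \<boxplus>\<^sub>\<M> on_arr (mat_emb C) g"
    if f: "f \<in> Hom C X Y" and g: "g \<in> Hom C X Y" for f g X Y
  proof (rule eq[OF mat_emb_Hom mat_Add_Hom[OF mat_emb_Hom[OF f] mat_emb_Hom[OF g]]])
    show "f \<boxplus> g \<in> Hom C X Y" using f g by simp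
    show "entries (on_arr (mat_emb C) (f \<boxplus> g)) (0, 0) = entries (on_arr (mat_emb C) f \<boxplus>\<^sub>\<M> on_arr (mat_emb C) g) (0, 0)"
      using mat_Add_entry[OF mat_emb_Hom[OF f] mat_emb_Hom[OF g], of 0 0] by simp
  qed
  ultimately show ?thesis unfolding additive_functor_def by blast
qed

definition inj_at :: "'o list \<Rightarrow> nat \<Rightarrow> ('o, 'm) marr" where
  "inj_at Xs j = sel [Xs ! j] Xs (\<lambda>a. if a = j then Some 0 else None)"

definition prj_at :: "'o list \<Rightarrow> nat \<Rightarrow> ('o, 'm) marr" where
  "prj_at Xs j = sel Xs [Xs ! j] (\<lambda>_. Some j)"

text \<open>Every list is the direct sum of its one-element lists. This is why an additive functor
  on matrices is determined by its restriction to \<open>C\<close>.\<close>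

lemma mat_nbiprod:
  assumes Xs: "Xs \<in> lists (Obj C)"
  shows "preadditive.nbiprod \<M> (length Xs) (\<lambda>j. [Xs ! j]) Xs (inj_at Xs) (prj_at Xs)"
proof -
  interpret M: preadditive \<M> by (rule mat_preadditive)
  have s: "selects [Xs ! j] Xs (\<lambda>a. if a = j then Some 0 else None)" "selects Xs [Xs ! j] (\<lambda>_. Some j)"
    if "j < length Xs" for j using that Xs by (auto simp: selects_def)
  have h: "inj_at Xs j \<in> Hom \<M> [Xs ! j] Xs" "prj_at Xs j \<in> Hom \<M> Xs [Xs ! j]" if "j < length Xs" for j
    unfolding inj_at_def prj_at_def by (rule sel_Hom[OF s(1)[OF that]], rule sel_Hom[OF s(2)[OF that]])
  have XO: "Xs \<in> Obj \<M>" using Xs by simp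
  have sumH: "hom_sum \<M> Xs Xs f n \<in> Hom \<M> Xs Xs" if "\<And>j. j < n \<Longrightarrow> f j \<in> Hom \<M> Xs Xs" for f n
    by (rule M.hom_sum_Hom[OF XO XO that])
  \<comment> \<open>Sums of matrices are formed entrywise; in the sum considered next, the diagonal
    entry at \<open>a\<close> receives a contribution from the term with index \<open>a\<close>
    alone.\<close>
  have ent: "entries (hom_sum \<M> Xs Xs f n) (a, b) = hom_sum C (Xs ! b) (Xs ! a) (\<lambda>j. entries (f j) (a, b)) n"
    if ab: "a < length Xs" "b < length Xs" and f: "\<And>j. j < n \<Longrightarrow> f j \<in> Hom \<M> Xs Xs" for f n a b using f
  proof (induction n)
    case 0
    then show ?case using ab XO nth_Obj[OF Xs] M.hom_sum_0[OF XO XO, of f] by (simp add: mat_Zero sel_def)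
  next
    case (Suc n)
    have f: "f j \<in> Hom \<M> Xs Xs" if "j \<le> n" for j using Suc.prems that by simp
    have "entries (f j) (a, b) \<in> Hom C (Xs ! b) (Xs ! a)" if "j \<le> n" for j by (rule mat_entry[OF f[OF that] ab])
    moreover have "entries (hom_sum \<M> Xs Xs f (Suc n)) (a, b) = entries (hom_sum \<M> Xs Xs f n) (a, b) \<boxplus> entries (f n) (a, b)"
      by (subst M.hom_sum_Suc[of n f Xs Xs, OF f], assumption) (rule mat_Add_entry[OF sumH[OF f] f ab], simp_all)
    ultimately show ?case using Suc.IH f hom_sum_Suc[of n "\<lambda>j. entries (f j) (a, b)" "Xs ! b" "Xs ! a"] by simp
  qed
  let ?e = "\<lambda>j. inj_at Xs j *\<^sub>\<M> prj_at Xs j"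
  have eH: "?e j \<in> Hom \<M> Xs Xs" if "j < length Xs" for j by (rule mat_Comp_Hom[OF h(2,1)[OF that]])
  have "hom_sum \<M> Xs Xs ?e (length Xs) = Id \<M> Xs" unfolding mat_Id
  proof (rule mat_eqI[OF sumH[OF eH] sel_Hom[OF selects_simple(1)[OF Xs]]])
    fix a b assume ab: "a < length Xs" "b < length Xs"
    note O = nth_Obj[OF Xs ab(2)] nth_Obj[OF Xs ab(1)]
    have e: "entries (?e j) (a, b) = (if a = j \<and> a = b then Id C (Xs ! a) else Zero C (Xs ! b) (Xs ! a))"
      if j: "j < length Xs" for j
    proof -
      have "entries (?e j) (a, b) = (if a = j then entries (prj_at Xs j) (0, b) else Zero C (Xs ! b) (Xs ! a))"
        using sel_Comp[OF s(1)[OF j] h(2)[OF j] ab] by (cases "a = j") (simp_all add: inj_at_def)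
      then show ?thesis using ab j by (auto simp: prj_at_def sel_def)
    qed
    have "hom_sum C (Xs ! b) (Xs ! a) (\<lambda>j. entries (?e j) (a, b)) (length Xs) = entries (?e a) (a, b)"
      by (rule hom_sum_single[OF O ab(1)]) (use e ab O in simp_all)
    then show "entries (hom_sum \<M> Xs Xs ?e (length Xs)) (a, b) = entries (sel Xs Xs Some) (a, b)"
      using ent[OF ab eH] e ab by (simp add: sel_def)
  qed
  moreover have "prj_at Xs i *\<^sub>\<M> inj_at Xs j = (if i = j then Id \<M> [Xs ! i] else Zero \<M> [Xs ! j] [Xs ! i])"
    if ij: "i < length Xs" "j < length Xs" for i j
    unfolding inj_at_def prj_at_def sel_sel[OF s(2)[OF ij(1)] s(1)[OF ij(2)]] mat_Id mat_Zero
    by (auto intro: sel_cong)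
  ultimately show ?thesis unfolding M.nbiprod_def using h XO by blast
qed

text \<open>The given isomorphisms on one-element lists assemble to isomorphisms between the images
  of a list, as these are direct sums. Naturality is reduced by \<open>nbiprod_eqI\<close> to arrows
  out of one-element lists.\<close>

lemma mat_unique:
  assumes X: "preadditive X" and H: "additive_functor \<M> X H" "additive_functor \<M> X H'"
    and n: "nat_isomorphic C X (H \<circ>\<^sub>F mat_emb C) (H' \<circ>\<^sub>F mat_emb C)"
  shows "nat_isomorphic \<M> X H H'"
proof -
  interpret X: preadditive X by fact
  interpret M: preadditive \<M> by (rule mat_preadditive)
  interpret H: addfun \<M> X H using H by unfold_locales
  interpret H': addfun \<M> X H' using H by unfold_locales
  note [simp del] = mat_emb_simps
  note [simp] = Hom_iff[where C = X]
  from n obtain t where t: "\<And>U. U \<in> Obj C \<Longrightarrow> t U \<in> Hom X (on_obj H [U]) (on_obj H' [U])"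
    "\<And>U. U \<in> Obj C \<Longrightarrow> isomorphism X (t U)"
    "\<And>f. f \<in> Arr C \<Longrightarrow> on_arr H' (on_arr (mat_emb C) f) *\<^sub>X t (Dom C f) = t (Cod C f) *\<^sub>X on_arr H (on_arr (mat_emb C) f)"
    unfolding nat_isomorphic_def comp_func_simps mat_emb_simps(1) by blast
  note nb = M.nbiprodD[OF mat_nbiprod]
  have "\<exists>u. u \<in> Hom X (on_obj H U) (on_obj H' U) \<and> isomorphism X u \<and>
      (\<forall>j<length U. u *\<^sub>X on_arr H (inj_at U j) = on_arr H' (inj_at U j) *\<^sub>X t (U ! j))" if U: "U \<in> lists (Obj C)" for U
  proof -
    have UM: "U \<in> Obj \<M>" using U by simp
    note b = H.nbiprod[OF mat_nbiprod[OF U]] and b' = H'.nbiprod[OF mat_nbiprod[OF U]]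
    note i = X.nbiprodD(3)[OF b] and i' = X.nbiprodD(3)[OF b']
    have UO: "U ! j \<in> Obj C" if "j < length U" for j by (rule nth_Obj[OF U that])
    have "\<exists>s. s \<in> Hom X (on_obj H' [U ! j]) (on_obj H [U ! j]) \<and> s *\<^sub>X t (U ! j) = Id X (on_obj H [U ! j]) \<and>
        t (U ! j) *\<^sub>X s = Id X (on_obj H' [U ! j])" if "j < length U" for j
      using X.isoE[OF t(2)[OF UO[OF that]]] t(1)[OF UO[OF that]] by (metis Hom_iff)
    then obtain s where s: "\<And>j. j < length U \<Longrightarrow> s j \<in> Hom X (on_obj H' [U ! j]) (on_obj H [U ! j])"
      "\<And>j. j < length U \<Longrightarrow> s j *\<^sub>X t (U ! j) = Id X (on_obj H [U ! j])"
      "\<And>j. j < length U \<Longrightarrow> t (U ! j) *\<^sub>X s j = Id X (on_obj H' [U ! j])" by metis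
    have O: "on_obj H U \<in> Obj X" "on_obj H' U \<in> Obj X" using UM by simp_all
    have a: "on_arr H' (inj_at U j) *\<^sub>X t (U ! j) \<in> Hom X (on_obj H [U ! j]) (on_obj H' U)" if "j < length U" for j
      using i'[OF that] t(1)[OF UO[OF that]] by simp
    have a': "on_arr H (inj_at U j) *\<^sub>X s j \<in> Hom X (on_obj H' [U ! j]) (on_obj H U)" if "j < length U" for j
      using i[OF that] s(1)[OF that] by simp
    obtain u where u: "u \<in> Hom X (on_obj H U) (on_obj H' U)"
      "\<And>j. j < length U \<Longrightarrow> u *\<^sub>X on_arr H (inj_at U j) = on_arr H' (inj_at U j) *\<^sub>X t (U ! j)"
      using X.nbiprod_ex[OF b O(2) a] by blast
    obtain v where v: "v \<in> Hom X (on_obj H' U) (on_obj H U)"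
      "\<And>j. j < length U \<Longrightarrow> v *\<^sub>X on_arr H' (inj_at U j) = on_arr H (inj_at U j) *\<^sub>X s j"
      using X.nbiprod_ex[OF b' O(1) a'] by blast
    have "v *\<^sub>X u = Id X (on_obj H U)"
    proof (rule X.nbiprod_eqI[OF b])
      fix j assume j: "j < length U"
      note ty = i[OF j] i'[OF j] t(1)[OF UO[OF j]] s(1)[OF j] u(1) v(1)
      show "(v *\<^sub>X u) *\<^sub>X on_arr H (inj_at U j) = Id X (on_obj H U) *\<^sub>X on_arr H (inj_at U j)"
        using ty u(2)[OF j] s(2)[OF j] by (simp add: X.reduce[OF v(2)[OF j]])
    qed (use u(1) v(1) O in simp_all)
    moreover have "u *\<^sub>X v = Id X (on_obj H' U)"
    proof (rule X.nbiprod_eqI[OF b'])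
      fix j assume j: "j < length U"
      note ty = i[OF j] i'[OF j] t(1)[OF UO[OF j]] s(1)[OF j] u(1) v(1)
      show "(u *\<^sub>X v) *\<^sub>X on_arr H' (inj_at U j) = Id X (on_obj H' U) *\<^sub>X on_arr H' (inj_at U j)"
        using ty v(2)[OF j] s(3)[OF j] by (simp add: X.reduce[OF u(2)[OF j]])
    qed (use u(1) v(1) O in simp_all)
    ultimately have "isomorphism X u" by (rule X.isoI[OF u(1) v(1)])
    with u show ?thesis by blast
  qed
  then obtain \<tau> where \<tau>: "\<And>U. U \<in> lists (Obj C) \<Longrightarrow> \<tau> U \<in> Hom X (on_obj H U) (on_obj H' U)"
    "\<And>U. U \<in> lists (Obj C) \<Longrightarrow> isomorphism X (\<tau> U)"
    "\<And>U j. U \<in> lists (Obj C) \<Longrightarrow> j < length U \<Longrightarrow> \<tau> U *\<^sub>X on_arr H (inj_at U j) = on_arr H' (inj_at U j) *\<^sub>X t (U ! j)"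
    by metis
  \<comment> \<open>An arrow out of a one-element list is a single column, hence a sum of injections
    composed with arrows \<open>d i\<close> of \<open>C\<close>, for which naturality is
    given.\<close>
  have col: "\<tau> V *\<^sub>X on_arr H c = on_arr H' c *\<^sub>X t W" if c: "c \<in> Hom \<M> [W] V" for c W V
  proof -
    have V: "V \<in> lists (Obj C)" and W: "W \<in> Obj C" "[W] \<in> Obj \<M>" "V \<in> Obj \<M>" using mat_lists[OF c] by simp_all
    note ty = \<tau>(1)[OF V] t(1)[OF W(1)]
    define d where "d i = entries (prj_at V i *\<^sub>\<M> c) (0, 0)" for i
    let ?d = "\<lambda>i. on_arr (mat_emb C) (d i)"
    have pc: "prj_at V i *\<^sub>\<M> c \<in> Hom \<M> [W] [V ! i]" if "i < length V" for i
      by (rule mat_Comp_Hom[OF c nb(4)[OF V that]])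
    have dH: "d i \<in> Hom C W (V ! i)" if "i < length V" for i
      using mat_entry[OF pc[OF that], of 0 0] by (simp add: d_def)
    have dM: "?d i \<in> Hom \<M> [W] [V ! i]" if "i < length V" for i by (rule mat_emb_Hom[OF dH[OF that]])
    have e: "inj_at V i *\<^sub>\<M> ?d i \<in> Hom \<M> [W] V" if "i < length V" for i
      by (rule mat_Comp_Hom[OF dM[OF that] nb(3)[OF V that]])
    have "c = hom_sum \<M> V V (\<lambda>j. inj_at V j *\<^sub>\<M> prj_at V j) (length V) *\<^sub>\<M> c"
      unfolding nb(7)[OF V] using M.Comp_Id_left[OF c] by simp
    also have "\<dots> = hom_sum \<M> [W] V (\<lambda>j. (inj_at V j *\<^sub>\<M> prj_at V j) *\<^sub>\<M> c) (length V)"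
      by (rule M.hom_sum_Comp[OF W(3,3) c]) (rule mat_Comp_Hom[OF nb(4)[OF V] nb(3)[OF V]])
    also have "\<dots> = hom_sum \<M> [W] V (\<lambda>j. inj_at V j *\<^sub>\<M> ?d j) (length V)"
    proof (rule M.hom_sum_cong[OF W(2,3)])
      fix j assume j: "j < length V"
      have "?d j = prj_at V j *\<^sub>\<M> c" using mat_emb_entry[OF pc[OF j]] by (simp only: d_def)
      then show "(inj_at V j *\<^sub>\<M> prj_at V j) *\<^sub>\<M> c = inj_at V j *\<^sub>\<M> ?d j"
        by (simp only: mat_assoc[OF c nb(4)[OF V j] nb(3)[OF V j]])
    qed (rule e)
    finally have ce: "c = hom_sum \<M> [W] V (\<lambda>j. inj_at V j *\<^sub>\<M> ?d j) (length V)" .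
    note HO = H.obj[OF W(2)] H.obj[OF W(3)] H'.obj[OF W(2)] H'.obj[OF W(3)]
    have "\<tau> V *\<^sub>X on_arr H c = \<tau> V *\<^sub>X hom_sum X (on_obj H [W]) (on_obj H V) (\<lambda>j. on_arr H (inj_at V j *\<^sub>\<M> ?d j)) (length V)"
      by (subst ce, subst H.hom_sum[OF W(2,3) e]) simp_all
    also have "\<dots> = hom_sum X (on_obj H [W]) (on_obj H' V) (\<lambda>j. \<tau> V *\<^sub>X on_arr H (inj_at V j *\<^sub>\<M> ?d j)) (length V)"
      by (rule X.Comp_hom_sum[OF HO(1,2) \<tau>(1)[OF V] H.Hom[OF e]])
    also have "\<dots> = hom_sum X (on_obj H [W]) (on_obj H' V) (\<lambda>j. on_arr H' (inj_at V j *\<^sub>\<M> ?d j) *\<^sub>X t W) (length V)"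
    proof (rule X.hom_sum_cong[OF HO(1,4)])
      fix j assume j: "j < length V"
      note Vj = nth_Obj[OF V j]
      note i = nb(3)[OF V j]
      note q = H.Hom[OF i] H'.Hom[OF i] H.Hom[OF dM[OF j]] H'.Hom[OF dM[OF j]] t(1)[OF Vj]
      have c1: "on_arr H (inj_at V j *\<^sub>\<M> ?d j) = on_arr H (inj_at V j) *\<^sub>X on_arr H (?d j)"
        "on_arr H' (inj_at V j *\<^sub>\<M> ?d j) = on_arr H' (inj_at V j) *\<^sub>X on_arr H' (?d j)"
        using i dM[OF j] H.comp[of "?d j" "inj_at V j"] H'.comp[of "?d j" "inj_at V j"]
        by (simp_all add: Hom_iff[where C = \<M>])
      have c2: "on_arr H' (?d j) *\<^sub>X t W = t (V ! j) *\<^sub>X on_arr H (?d j)" using t(3)[of "d j"] dH[OF j] by simp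
      show "\<tau> V *\<^sub>X on_arr H (inj_at V j *\<^sub>\<M> ?d j) = on_arr H' (inj_at V j *\<^sub>\<M> ?d j) *\<^sub>X t W"
        unfolding c1 using q ty by (simp add: c2 X.reduce[OF \<tau>(3)[OF V j]])
      show "on_arr H' (inj_at V j *\<^sub>\<M> ?d j) *\<^sub>X t W \<in> Hom X (on_obj H [W]) (on_obj H' V)"
        unfolding c1 using q ty by simp
    qed
    also have "\<dots> = hom_sum X (on_obj H' [W]) (on_obj H' V) (\<lambda>j. on_arr H' (inj_at V j *\<^sub>\<M> ?d j)) (length V) *\<^sub>X t W"
      by (rule X.hom_sum_Comp[OF HO(3,4) t(1)[OF W(1)] H'.Hom[OF e], symmetric])
    also have "\<dots> = on_arr H' c *\<^sub>X t W" by (subst ce, subst H'.hom_sum[OF W(2,3) e]) simp_all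
    finally show ?thesis .
  qed
  show ?thesis
  proof (rule nat_isomorphicI[where \<tau> = \<tau>])
    fix f U V assume f: "f \<in> Hom \<M> U V"
    note U = mat_lists(1)[OF f] and V = mat_lists(2)[OF f]
    show "on_arr H' f *\<^sub>X \<tau> U = \<tau> V *\<^sub>X on_arr H f"
    proof (rule X.nbiprod_eqI[OF H.nbiprod[OF mat_nbiprod[OF U]], of _ "on_obj H' V"])
      fix j assume j: "j < length U"
      note i = nb(3)[OF U j]
      note fi = mat_Comp_Hom[OF i f]
      have c: "on_arr H (f *\<^sub>\<M> inj_at U j) = on_arr H f *\<^sub>X on_arr H (inj_at U j)"
        "on_arr H' (f *\<^sub>\<M> inj_at U j) = on_arr H' f *\<^sub>X on_arr H' (inj_at U j)"
        using i f H.comp[of "inj_at U j" f] H'.comp[of "inj_at U j" f] by (simp_all add: Hom_iff[where C = \<M>])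
      note q = H.Hom[OF i] H'.Hom[OF i] H.Hom[OF f] H'.Hom[OF f] t(1)[OF nth_Obj[OF U j]] \<tau>(1)[OF U] \<tau>(1)[OF V]
      show "(on_arr H' f *\<^sub>X \<tau> U) *\<^sub>X on_arr H (inj_at U j) = (\<tau> V *\<^sub>X on_arr H f) *\<^sub>X on_arr H (inj_at U j)"
        using q col[OF fi] unfolding c by (simp add: \<tau>(3)[OF U j])
    qed (use H.Hom[OF f] H'.Hom[OF f] \<tau>(1)[OF U] \<tau>(1)[OF V] in simp_all)
  qed (use \<tau> in auto)
qed

end

text \<open>A list goes to a chosen direct sum of the images of its members, a matrix to the arrow
  with the corresponding columns. On \<open>C\<close> this agrees with \<open>J\<close> only up to
  isomorphism, since the chosen sum of a single object need not be that object.\<close>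

lemma (in preadditive) mat_extension:
  assumes X: "additive X" and J: "additive_functor C X J"
  obtains H where "additive_functor \<M> X H" "nat_isomorphic C X (H \<circ>\<^sub>F mat_emb C) J"
proof -
  interpret X: additive X by fact
  interpret J: addfun C X J using J by unfold_locales
  note [simp] = Hom_iff[where C = X]
  have "\<exists>S \<iota> \<pi>. X.nbiprod (length U) (\<lambda>j. on_obj J (U ! j)) S \<iota> \<pi>" if "U \<in> lists (Obj C)" for U
    by (rule X.nbiprod_exists) (use nth_Obj[OF that] in simp)
  then obtain S \<iota> \<pi> where nb: "\<And>U. U \<in> lists (Obj C) \<Longrightarrow> X.nbiprod (length U) (\<lambda>j. on_obj J (U ! j)) (S U) (\<iota> U) (\<pi> U)"
    by metis
  note b = X.nbiprodD[OF nb]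
  have JM: "on_arr J (entries M (i, j)) \<in> Hom X (on_obj J (U ! j)) (on_obj J (V ! i))"
    if "M \<in> Hom \<M> U V" "i < length V" "j < length U" for M U V i j by (rule J.Hom[OF mat_entry[OF that]])
  \<comment> \<open>The arrow into the direct sum \<open>S V\<close> formed from the
    \<open>j\<close>-th column of the matrix.\<close>
  define col where "col U V M j = hom_sum X (on_obj J (U ! j)) (S V) (\<lambda>i. \<iota> V i *\<^sub>X on_arr J (entries M (i, j))) (length V)"
    for U V and M :: "('o, 'm) marr" and j
  have c: "\<iota> V i *\<^sub>X on_arr J (entries M (i, j)) \<in> Hom X (on_obj J (U ! j)) (S V)"
    if M: "M \<in> Hom \<M> U V" and "i < length V" "j < length U" for M U V i j
    using JM[OF that] b(3)[OF mat_lists(2)[OF M] that(2)] by simp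
  have col: "col U V M j \<in> Hom X (on_obj J (U ! j)) (S V)" if M: "M \<in> Hom \<M> U V" and j: "j < length U" for M U V j
    unfolding col_def by (rule X.hom_sum_Hom[OF b(2)[OF mat_lists(1)[OF M] j] b(1)[OF mat_lists(2)[OF M]] c[OF M _ j]])
  define H where "H = \<lparr>on_obj = S, on_arr = (\<lambda>M. SOME h. h \<in> Hom X (S (msrc M)) (S (mtgt M)) \<and>
      (\<forall>j<length (msrc M). h *\<^sub>X \<iota> (msrc M) j = col (msrc M) (mtgt M) M j))\<rparr>"
  have HS: "on_obj H = S" by (simp add: H_def)
  have H: "on_arr H M \<in> Hom X (S U) (S V) \<and> (\<forall>j<length U. on_arr H M *\<^sub>X \<iota> U j = col U V M j)"
    if M: "M \<in> Hom \<M> U V" for M U V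
  proof -
    have e: "msrc M = U" "mtgt M = V" using M by (simp_all add: mat_Hom)
    obtain h where "h \<in> Hom X (S U) (S V)" "\<And>j. j < length U \<Longrightarrow> h *\<^sub>X \<iota> U j = col U V M j"
      using X.nbiprod_ex[OF nb[OF mat_lists(1)[OF M]] b(1)[OF mat_lists(2)[OF M]] col[OF M]] by blast
    then have "\<exists>h. h \<in> Hom X (S U) (S V) \<and> (\<forall>j<length U. h *\<^sub>X \<iota> U j = col U V M j)" by blast
    from someI_ex[OF this] show ?thesis unfolding H_def func.simps e .
  qed
  note HH = conjunct1[OF H] and Hcol = conjunct2[OF H, rule_format]
  \<comment> \<open>An arrow out of a direct sum is determined by its columns, so the functor laws
    and additivity are all checked column by column.\<close>
  have HI: "on_arr H M = h" if M: "M \<in> Hom \<M> U V" and h: "h \<in> Hom X (S U) (S V)"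
      "\<And>j. j < length U \<Longrightarrow> h *\<^sub>X \<iota> U j = col U V M j" for M U V h
    by (rule X.nbiprod_eqI[OF nb[OF mat_lists(1)[OF M]] HH[OF M] h(1)]) (use Hcol[OF M] h(2) in simp)
  have "is_functor \<M> X H"
  proof (rule is_functorI; (unfold HS)?)
    fix U assume "U \<in> Obj \<M>"
    then have U: "U \<in> lists (Obj C)" by simp
    show "S U \<in> Obj X" by (rule b(1)[OF U])
    have I: "Id \<M> U \<in> Hom \<M> U U" unfolding mat_Id by (rule sel_Hom[OF selects_simple(1)[OF U]])
    show "on_arr H (Id \<M> U) = Id X (S U)"
    proof (rule HI[OF I])
      show "Id X (S U) \<in> Hom X (S U) (S U)" using b(1)[OF U] by simp
      fix j assume j: "j < length U"
      let ?f = "\<lambda>i. \<iota> U i *\<^sub>X on_arr J (entries (Id \<M> U) (i, j))"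
      have f: "?f i = (if i = j then \<iota> U j else Zero X (on_obj J (U ! j)) (S U))" if i: "i < length U" for i
        using b(3)[OF U i] j i nth_Obj[OF U] b(2)[OF U j] by (cases "i = j") (simp_all add: mat_Id sel_def)
      have "col U U (Id \<M> U) j = ?f j" unfolding col_def
        by (rule X.hom_sum_single[OF b(2)[OF U j] b(1)[OF U] j]) (use f j b(3)[OF U j] in simp_all)
      then show "Id X (S U) *\<^sub>X \<iota> U j = col U U (Id \<M> U) j" using f[OF j] b(3)[OF U j] by simp
    qed
  next
    fix M U V assume M: "M \<in> Hom \<M> U V"
    show "on_arr H M \<in> Hom X (S U) (S V)" by (rule HH[OF M])
    fix N W assume N: "N \<in> Hom \<M> V W"
    note NM = mat_Comp_Hom[OF M N]
    note U = mat_lists(1)[OF M] and V = mat_lists(1)[OF N] and W = mat_lists(2)[OF N]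
    show "on_arr H (N *\<^sub>\<M> M) = on_arr H N *\<^sub>X on_arr H M"
    proof (rule HI[OF NM])
      show "on_arr H N *\<^sub>X on_arr H M \<in> Hom X (S U) (S W)" using HH[OF M] HH[OF N] by simp
      fix k assume k: "k < length U"
      let ?M = "\<lambda>j. on_arr J (entries M (j, k))" and ?N = "\<lambda>i j. on_arr J (entries N (i, j))"
      note Uk = b(2)[OF U k] and SW = b(1)[OF W]
      have "(on_arr H N *\<^sub>X on_arr H M) *\<^sub>X \<iota> U k = on_arr H N *\<^sub>X col U V M k"
        using HH[OF M] HH[OF N] b(3)[OF U k] Hcol[OF M k] by simp
      also have "\<dots> = hom_sum X (on_obj J (U ! k)) (S W) (\<lambda>j. on_arr H N *\<^sub>X (\<iota> V j *\<^sub>X ?M j)) (length V)"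
        unfolding col_def by (rule X.Comp_hom_sum[OF Uk b(1)[OF V] HH[OF N] c[OF M _ k]])
      also have "\<dots> = hom_sum X (on_obj J (U ! k)) (S W) (\<lambda>j. col V W N j *\<^sub>X ?M j) (length V)"
      proof (rule X.hom_sum_cong[OF Uk SW])
        fix j assume j: "j < length V"
        note ty = HH[OF N] b(3)[OF V j] JM[OF M j k]
        show "on_arr H N *\<^sub>X (\<iota> V j *\<^sub>X ?M j) = col V W N j *\<^sub>X ?M j"
          using ty by (simp add: X.reduce[OF Hcol[OF N j]])
        show "col V W N j *\<^sub>X ?M j \<in> Hom X (on_obj J (U ! k)) (S W)" using col[OF N j] ty by simp
      qed
      also have "\<dots> = hom_sum X (on_obj J (U ! k)) (S W) (\<lambda>i. \<iota> W i *\<^sub>X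
          hom_sum X (on_obj J (U ! k)) (on_obj J (W ! i)) (\<lambda>j. ?N i j *\<^sub>X ?M j) (length V)) (length W)"
        unfolding col_def by (rule X.hom_sum_assoc[OF Uk SW b(2)[OF V] b(2)[OF W] JM[OF M _ k] b(3)[OF W] JM[OF N], symmetric])
      also have "\<dots> = col U W (N *\<^sub>\<M> M) k" unfolding col_def
      proof (rule X.hom_sum_cong[OF Uk SW _ c[OF NM _ k]])
        fix i assume i: "i < length W"
        note O = nth_Obj[OF U k] nth_Obj[OF W i]
        have "on_arr J (entries (N *\<^sub>\<M> M) (i, k)) = hom_sum X (on_obj J (U ! k)) (on_obj J (W ! i))
            (\<lambda>j. on_arr J (entries N (i, j) * entries M (j, k))) (length V)"
          unfolding mat_Comp_entry[OF M N i k] by (rule J.hom_sum[OF O])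
            (use mat_entry[OF M _ k] mat_entry[OF N i] in simp)
        also have "\<dots> = hom_sum X (on_obj J (U ! k)) (on_obj J (W ! i)) (\<lambda>j. ?N i j *\<^sub>X ?M j) (length V)"
        proof (rule X.hom_sum_cong[OF J.obj[OF O(1)] J.obj[OF O(2)]])
          fix j assume j: "j < length V"
          show "on_arr J (entries N (i, j) * entries M (j, k)) = ?N i j *\<^sub>X ?M j"
            by (rule J.comp) (use mat_entry[OF M j k] mat_entry[OF N i j] in simp_all)
          show "?N i j *\<^sub>X ?M j \<in> Hom X (on_obj J (U ! k)) (on_obj J (W ! i))"
            using JM[OF M j k] JM[OF N i j] by simp
        qed
        finally show "\<iota> W i *\<^sub>X hom_sum X (on_obj J (U ! k)) (on_obj J (W ! i)) (\<lambda>j. ?N i j *\<^sub>X ?M j) (length V) =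
            \<iota> W i *\<^sub>X on_arr J (entries (N *\<^sub>\<M> M) (i, k))" by (simp only:)
      qed
      finally show "(on_arr H N *\<^sub>X on_arr H M) *\<^sub>X \<iota> U k = col U W (N *\<^sub>\<M> M) k" .
    qed
  qed
  moreover have "on_arr H (M \<boxplus>\<^sub>\<M> N) = on_arr H M \<boxplus>\<^sub>X on_arr H N"
    if M: "M \<in> Hom \<M> U V" and N: "N \<in> Hom \<M> U V" for M N U V
  proof (rule HI[OF mat_Add_Hom[OF M N]])
    show "on_arr H M \<boxplus>\<^sub>X on_arr H N \<in> Hom X (S U) (S V)" using HH[OF M] HH[OF N] by simp
    note U = mat_lists(1)[OF M] and V = mat_lists(2)[OF M]
    fix j assume j: "j < length U"
    have "(on_arr H M \<boxplus>\<^sub>X on_arr H N) *\<^sub>X \<iota> U j = col U V M j \<boxplus>\<^sub>X col U V N j"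
      using HH[OF M] HH[OF N] b(3)[OF U j] Hcol[OF M j] Hcol[OF N j] by simp
    also have "\<dots> = hom_sum X (on_obj J (U ! j)) (S V)
        (\<lambda>i. (\<iota> V i *\<^sub>X on_arr J (entries M (i, j))) \<boxplus>\<^sub>X (\<iota> V i *\<^sub>X on_arr J (entries N (i, j)))) (length V)"
      unfolding col_def by (rule X.hom_sum_Add[OF b(2)[OF U j] b(1)[OF V] c[OF M _ j] c[OF N _ j], symmetric])
    also have "\<dots> = col U V (M \<boxplus>\<^sub>\<M> N) j" unfolding col_def
    proof (rule X.hom_sum_cong[OF b(2)[OF U j] b(1)[OF V] _ c[OF mat_Add_Hom[OF M N] _ j]])
      fix i assume i: "i < length V"
      show "(\<iota> V i *\<^sub>X on_arr J (entries M (i, j))) \<boxplus>\<^sub>X (\<iota> V i *\<^sub>X on_arr J (entries N (i, j))) =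
          \<iota> V i *\<^sub>X on_arr J (entries (M \<boxplus>\<^sub>\<M> N) (i, j))" unfolding mat_Add_entry[OF M N i j]
        using b(3)[OF V i] JM[OF M i j] JM[OF N i j] mat_entry[OF M i j] mat_entry[OF N i j] by simp
    qed
    finally show "(on_arr H M \<boxplus>\<^sub>X on_arr H N) *\<^sub>X \<iota> U j = col U V (M \<boxplus>\<^sub>\<M> N) j" .
  qed
  ultimately have "additive_functor \<M> X H" unfolding additive_functor_def by blast
  moreover have "nat_isomorphic C X (H \<circ>\<^sub>F mat_emb C) J"
  proof (rule nat_isomorphicI[where \<tau> = "\<lambda>U. \<pi> [U] 0"]; (unfold comp_func_simps mat_emb_simps(1) HS)?)
    have l: "[U] \<in> lists (Obj C)" "0 < length [U]" if "U \<in> Obj C" for U using that by simp_all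
    have p: "\<pi> [U] 0 \<in> Hom X (S [U]) (on_obj J U)" "\<iota> [U] 0 \<in> Hom X (on_obj J U) (S [U])"
      "\<pi> [U] 0 *\<^sub>X \<iota> [U] 0 = Id X (on_obj J U)" if "U \<in> Obj C" for U
      using b(4)[OF l[OF that]] b(3)[OF l[OF that]] b(5)[OF l[OF that]] by simp_all
    fix U assume U: "U \<in> Obj C"
    show "\<pi> [U] 0 \<in> Hom X (S [U]) (on_obj J U)" by (rule p(1)[OF U])
    \<comment> \<open>For a one-element list the sum in \<open>nbiprod\<close> has a single term,
      which makes the projection and injection mutually inverse.\<close>
    have "\<iota> [U] 0 *\<^sub>X \<pi> [U] 0 = Id X (S [U])" using b(7)[OF l(1)[OF U]] p(1,2)[OF U] b(1)[OF l(1)[OF U]]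
        X.hom_sum_single[of "S [U]" "S [U]" 0 1 "\<lambda>j. \<iota> [U] j *\<^sub>X \<pi> [U] j"] by simp
    then show "isomorphism X (\<pi> [U] 0)" by (rule X.isoI[OF p(1,2)[OF U] _ p(3)[OF U], rotated -1])
  next
    fix f U V assume f: "f \<in> Hom C U V"
    have U: "U \<in> Obj C" and V: "V \<in> Obj C" using f by auto
    have l: "[U] \<in> lists (Obj C)" "0 < length [U]" if "U \<in> Obj C" for U using that by simp_all
    have p: "\<pi> [U] 0 \<in> Hom X (S [U]) (on_obj J U)" "\<iota> [U] 0 \<in> Hom X (on_obj J U) (S [U])"
      "\<pi> [U] 0 *\<^sub>X \<iota> [U] 0 = Id X (on_obj J U)" if "U \<in> Obj C" for U
      using b(4)[OF l[OF that]] b(3)[OF l[OF that]] b(5)[OF l[OF that]] by simp_all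
    let ?f = "on_arr (mat_emb C) f"
    note m = mat_emb_Hom[OF f]
    have "on_arr H ?f *\<^sub>X \<iota> [U] 0 = hom_sum X (on_obj J U) (S [V]) (\<lambda>i. \<iota> [V] i *\<^sub>X on_arr J (entries ?f (i, 0))) 1"
      using Hcol[OF m, of 0] by (simp add: col_def del: mat_emb_simps)
    also have "\<dots> = \<iota> [V] 0 *\<^sub>X on_arr J (entries ?f (0, 0))"
      by (rule X.hom_sum_single) (use c[OF m, of 0 0] p(2)[OF V] U b(1)[OF l(1)[OF V]] in \<open>simp_all del: mat_emb_simps\<close>)
    also have "entries ?f (0, 0) = f" by simp
    finally have h: "on_arr H ?f *\<^sub>X \<iota> [U] 0 = \<iota> [V] 0 *\<^sub>X on_arr J f" .
    note q = J.Hom[OF f] p(1,2)[OF U] p(1,2)[OF V] HH[OF m]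
    show "on_arr J f *\<^sub>X \<pi> [U] 0 = \<pi> [V] 0 *\<^sub>X on_arr H ?f"
    proof (rule X.nbiprod_eqI[OF nb[OF l(1)[OF U]], of _ "on_obj J V"])
      fix j assume "j < length [U]"
      then have j: "j = 0" by simp
      show "(on_arr J f *\<^sub>X \<pi> [U] 0) *\<^sub>X \<iota> [U] j = (\<pi> [V] 0 *\<^sub>X on_arr H ?f) *\<^sub>X \<iota> [U] j"
        unfolding j using q p(3)[OF U] h by (simp add: X.reduce[OF p(3)[OF V]] del: mat_emb_simps)
    qed (use q in \<open>simp_all del: mat_emb_simps\<close>)
  qed
  ultimately show ?thesis by (rule that)
qed

lemma add_embedding_eq: "add_embedding C = mat_emb (linearisation C) \<circ>\<^sub>F lin_emb C"
  by (simp add: add_embedding_def mat_emb_def lin_emb_def comp_func_def comp_def)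

section \<open>The universal property of the hull of a category\<close>

context cat
begin

lemma add_hull_additive: "additive (add_hull C)"
  unfolding add_hull_def by (rule preadditive.mat_additive[OF lin_preadditive])

lemma hull_abelian: "abelian (ab_hull (add_hull C))" by (rule additive.ab_hull_abelian[OF add_hull_additive])

lemma add_embedding_functor: "is_functor C (add_hull C) (add_embedding C)" unfolding add_embedding_eq add_hull_def
  by (rule comp_functor[OF cat_axioms lin_emb_functor
        additive_is_functor[OF preadditive.mat_emb_additive[OF lin_preadditive]]])

lemma hull_embedding_functor: "is_functor C (ab_hull (add_hull C)) (hull_embedding C)" unfolding hull_embedding_def
  by (rule comp_functor[OF cat_axioms add_embedding_functor
        additive_is_functor[OF additive.ab_embedding_additive[OF add_hull_additive]]])

text \<open>The extensions to linearisation, matrices and hull are composed; the first is strict,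
  the other two hold up to isomorphism. The types of \<open>X\<close> are arbitrary, so that
  \<open>X\<close> may be a Serre quotient, whose arrows are classes of zigzags.\<close>

theorem hull_extension:
  assumes X: "abelian X" and J: "is_functor C X J"
  obtains E where "exact_functor (ab_hull (add_hull C)) X E" "nat_isomorphic C X (E \<circ>\<^sub>F hull_embedding C) J"
proof -
  interpret X: abelian X by fact
  interpret Z: preadditive "linearisation C" by (rule lin_preadditive)
  interpret M: additive "add_hull C" by (rule add_hull_additive)
  note Mdef = add_hull_def[of C, symmetric]
  note Me = Z.mat_emb_additive[unfolded Mdef]
  obtain H1 where H1: "additive_functor (linearisation C) X H1" "func_eq_on C (H1 \<circ>\<^sub>F lin_emb C) J"
    by (rule lin_extension[OF X.preadditive_axioms J])
  obtain H2 where H2: "additive_functor (add_hull C) X H2"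
    "nat_isomorphic (linearisation C) X (H2 \<circ>\<^sub>F mat_emb (linearisation C)) H1"
    by (rule Z.mat_extension[OF X.additive_axioms H1(1), unfolded Mdef])
  obtain E where E: "exact_functor (ab_hull (add_hull C)) X E"
    "nat_isomorphic (add_hull C) X (E \<circ>\<^sub>F ab_embedding (add_hull C)) H2" by (rule M.ab_hull_extension[OF X H2(1)])
  note fH1 = additive_is_functor[OF H1(1)] and fH2 = additive_is_functor[OF H2(1)]
  note Ef = exact_is_functor[OF E(1)]
  note f1 = comp_functor[OF cat_axioms hull_embedding_functor Ef]
  note f2 = comp_functor[OF cat_axioms add_embedding_functor fH2]
  note f3 = comp_functor[OF cat_axioms lin_emb_functor fH1]
  have n1: "nat_isomorphic C X (E \<circ>\<^sub>F hull_embedding C) (H2 \<circ>\<^sub>F add_embedding C)"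
    using nat_isomorphic_whisker_right[OF cat_axioms M.cat_axioms add_embedding_functor E(2)]
    by (simp only: hull_embedding_def comp_func_assoc)
  have n2: "nat_isomorphic C X (H2 \<circ>\<^sub>F add_embedding C) (H1 \<circ>\<^sub>F lin_emb C)"
    using nat_isomorphic_whisker_right[OF cat_axioms Z.cat_axioms lin_emb_functor H2(2)]
    by (simp only: add_embedding_eq comp_func_assoc)
  have n3: "nat_isomorphic C X (H1 \<circ>\<^sub>F lin_emb C) J"
    by (rule func_eq_nat_isomorphic[OF cat_axioms X.cat_axioms f3 J H1(2)])
  have "nat_isomorphic C X (H2 \<circ>\<^sub>F add_embedding C) J"
    by (rule nat_isomorphic_trans[OF cat_axioms X.cat_axioms f2 f3 J n2 n3])
  then have "nat_isomorphic C X (E \<circ>\<^sub>F hull_embedding C) J"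
    by (rule nat_isomorphic_trans[OF cat_axioms X.cat_axioms f1 f2 J n1])
  with E(1) show ?thesis by (rule that)
qed

theorem hull_unique:
  assumes X: "abelian X"
    and E: "exact_functor (ab_hull (add_hull C)) X E" "exact_functor (ab_hull (add_hull C)) X E'"
    and n: "nat_isomorphic C X (E \<circ>\<^sub>F hull_embedding C) (E' \<circ>\<^sub>F hull_embedding C)"
  shows "nat_isomorphic (ab_hull (add_hull C)) X E E'"
proof -
  interpret X: abelian X by fact
  interpret Z: preadditive "linearisation C" by (rule lin_preadditive)
  interpret M: additive "add_hull C" by (rule add_hull_additive)
  note Mdef = add_hull_def[of C, symmetric]
  note a = additive_comp[OF M.preadditive_axioms M.ab_embedding_additive exact_additive[OF E(1)]]
    additive_comp[OF M.preadditive_axioms M.ab_embedding_additive exact_additive[OF E(2)]]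
  note Me = Z.mat_emb_additive[unfolded Mdef]
  note c = additive_comp[OF Z.preadditive_axioms Me a(1)] additive_comp[OF Z.preadditive_axioms Me a(2)]
  have "nat_isomorphic (linearisation C) X (E \<circ>\<^sub>F ab_embedding (add_hull C) \<circ>\<^sub>F mat_emb (linearisation C))
      (E' \<circ>\<^sub>F ab_embedding (add_hull C) \<circ>\<^sub>F mat_emb (linearisation C))"
    by (rule lin_unique[OF X.preadditive_axioms c])
      (use n in \<open>simp only: hull_embedding_def add_embedding_eq comp_func_assoc\<close>)
  then have "nat_isomorphic (add_hull C) X (E \<circ>\<^sub>F ab_embedding (add_hull C)) (E' \<circ>\<^sub>F ab_embedding (add_hull C))"
    by (rule Z.mat_unique[OF X.preadditive_axioms, unfolded Mdef, OF a])
  then show ?thesis by (rule M.ab_hull_unique[OF X E])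
qed

end

section \<open>The equivalence\<close>

lemma id_comp_func: "id_func \<circ>\<^sub>F F = F" by (cases F) (simp add: comp_func_def id_func_def comp_def)

lemma nat_isomorphic_reflects_iso:
  assumes c: "cat C" "cat D" "is_functor C D F" "is_functor C D G" "nat_isomorphic C D F G"
    and f: "f \<in> Arr C" "isomorphism D (on_arr G f)"
  shows "isomorphism D (on_arr F f)"
proof -
  interpret F: fctr C D F using c by (intro fctrI)
  interpret G: fctr C D G using c by (intro fctrI)
  from c(5) obtain \<tau> where t: "\<And>X. X \<in> Obj C \<Longrightarrow> \<tau> X \<in> Hom D (on_obj F X) (on_obj G X)"
    "\<And>X. X \<in> Obj C \<Longrightarrow> isomorphism D (\<tau> X)"
    "on_arr G f *\<^sub>D \<tau> (Dom C f) = \<tau> (Cod C f) *\<^sub>D on_arr F f" using f(1) unfolding nat_isomorphic_def by blast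
  have O: "Dom C f \<in> Obj C" "Cod C f \<in> Obj C" using f(1) by simp_all
  note u = t(1)[OF O(1)] t(1)[OF O(2)]
  obtain s where s: "s \<in> Hom D (Cod D (\<tau> (Cod C f))) (Dom D (\<tau> (Cod C f)))"
    "s *\<^sub>D \<tau> (Cod C f) = Id D (Dom D (\<tau> (Cod C f)))" "isomorphism D s" using F.T.isoE[OF t(2)[OF O(2)]] by metis
  have "on_arr F f = s *\<^sub>D (on_arr G f *\<^sub>D \<tau> (Dom C f))"
    unfolding t(3) using s(1) u f(1) by (simp add: F.T.reduce[OF s(2)])
  moreover have "isomorphism D (on_arr G f *\<^sub>D \<tau> (Dom C f))"
    by (rule F.T.iso_comp[OF t(2)[OF O(1)] f(2)]) (use u f(1) in simp)
  then have "isomorphism D (s *\<^sub>D (on_arr G f *\<^sub>D \<tau> (Dom C f)))"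
    by (rule F.T.iso_comp[OF _ s(3)]) (use s(1) u f(1) in simp)
  ultimately show ?thesis by simp
qed

text \<open>The witness \<open>T\<close> keeps the defining intersection nonempty: over the empty
  family it would be \<open>UNIV\<close>, which need not lie inside \<open>Obj A\<close>. Closure
  under each operation is inherited from all members of the family.\<close>

lemma serre_serre_generated:
  assumes T: "serre A T" "K \<subseteq> T"
  shows "serre A (serre_generated A K)"
proof -
  let ?G = "serre_generated A K"
  have m: "X \<in> S" if "X \<in> ?G" "serre A S" "K \<subseteq> S" for X S using that unfolding serre_generated_def by blast
  have i: "X \<in> ?G" if "\<And>S. serre A S \<Longrightarrow> K \<subseteq> S \<Longrightarrow> X \<in> S" for X using that unfolding serre_generated_def by blast
  show ?thesis unfolding serre_def
  proof (intro conjI allI impI)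
    show "?G \<subseteq> Obj A" using m[OF _ T] serreD(1)[OF T(1)] by blast
    show "Z \<in> ?G" if "zero_object A Z" for Z by (rule i) (rule serreD(2)[OF _ that])
    show "Dom A f \<in> ?G" if "monomorphism A f \<and> Cod A f \<in> ?G" for f
      by (rule i, rule serreD(3)[OF _ conjunct1[OF that]], assumption) (rule m[OF conjunct2[OF that]])
    show "Cod A f \<in> ?G" if "epimorphism A f \<and> Dom A f \<in> ?G" for f
      by (rule i, rule serreD(4)[OF _ conjunct1[OF that]], assumption) (rule m[OF conjunct2[OF that]])
    show "Cod A f \<in> ?G" if "short_exact A f g \<and> Dom A f \<in> ?G \<and> Cod A g \<in> ?G" for f g
      by (rule i, rule serreD(5)[OF _ conjunct1[OF that]], assumption)
        (rule m[OF conjunct1[OF conjunct2[OF that]]] m[OF conjunct2[OF conjunct2[OF that]]]; assumption)+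
  qed
qed

context preadditive
begin

lemmas cokernel_of_epi = preadditive.kernel_of_mono[OF preadditive_opcat, unfolded op_simps]

end

lemma (in exact_fun) kernels_cokernels_inverted:
  assumes "\<And>f. f \<in> \<Phi> \<Longrightarrow> isomorphism B (on_arr F f)"
  shows "kernels_cokernels A \<Phi> \<subseteq> {X \<in> Obj A. Id B (on_obj F X) = Zero B (on_obj F X) (on_obj F X)}"
proof
  fix X assume "X \<in> kernels_cokernels A \<Phi>"
  then consider f k where "f \<in> \<Phi>" "is_kernel A f k" "X = Dom A k" | f c where "f \<in> \<Phi>" "is_cokernel A f c" "X = Cod A c"
    unfolding kernels_cokernels_def by blast
  then show "X \<in> {X \<in> Obj A. Id B (on_obj F X) = Zero B (on_obj F X) (on_obj F X)}"
  proof cases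
    case 1
    then show ?thesis
      using T.kernel_of_mono(2)[OF T.iso_mono[OF assms[OF 1(1)]] kernel[OF 1(2)]] S.kernelD(2)[OF 1(2)] by simp
  next
    case 2
    then show ?thesis
      using T.cokernel_of_epi(2)[OF T.iso_epi[OF assms[OF 2(1)]] cokernel[OF 2(2)]] S.cokernelD(2)[OF 2(2)] by simp
  qed
qed

lemma (in exact_fun) inverts_serre_isos:
  assumes S: "S \<subseteq> {X \<in> Obj A. Id B (on_obj F X) = Zero B (on_obj F X) (on_obj F X)}" and f: "f \<in> serre_isos A S"
  shows "isomorphism B (on_arr F f)"
proof -
  from f obtain k c where k: "is_kernel A f k" "Dom A k \<in> S" and c: "is_cokernel A f c" "Cod A c \<in> S"
    unfolding serre_isos_def by blast
  have "monomorphism B (on_arr F f)"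
    by (rule T.mono_of_zero_kernel[OF kernel[OF k(1)]]) (use k(2) S S.kernelD(2)[OF k(1)] in auto)
  moreover have "epimorphism B (on_arr F f)"
    by (rule T.epi_of_zero_cokernel[OF cokernel[OF c(1)]]) (use c(2) S S.cokernelD(2)[OF c(1)] in auto)
  ultimately show ?thesis by (rule T.mono_epi_iso)
qed

text \<open>The extension of the localisation functor to the hulls is determined only up to
  isomorphism, hence the claim for every such \<open>E\<close>. In contrast \<open>F\<close> agrees
  with \<open>E\<close> strictly along the quotient functor, as the universal property of a
  localisation provides.\<close>

theorem proposition6:
  fixes C :: "('o, 'm) cat" and \<Sigma> :: "'m set"
  assumes "category C"
    and "\<Sigma> \<subseteq> Arr C"
  shows
    "let D = localisation C \<Sigma>;
         A = ab_hull (add_hull C);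
         B = ab_hull (add_hull D);
         S = serre_generated A (kernels_cokernels A (on_arr (hull_embedding C) ` \<Sigma>));
         extends = (\<lambda>E. exact_functor A B E \<and>
           nat_isomorphic C B (E \<circ>\<^sub>F hull_embedding C) (hull_embedding D \<circ>\<^sub>F loc_func C \<Sigma>));
         induced = (\<lambda>E F. is_functor (quotient_cat A S) B F \<and>
           func_eq_on A (F \<circ>\<^sub>F quotient_func A S) E)
     in (\<exists>E. extends E) \<and>
        (\<forall>E. extends E \<longrightarrow>
           (\<exists>F. induced E F) \<and>
           (\<forall>F. induced E F \<longrightarrow> is_equivalence (quotient_cat A S) B F))"
proof -
  interpret C: loc C \<Sigma> using assms by (intro loc.intro cat.intro loc_axioms.intro)
  define D where "D = localisation C \<Sigma>"
  define A where "A = ab_hull (add_hull C)"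
  define B where "B = ab_hull (add_hull D)"
  define hC where "hC = hull_embedding C"
  define hD where "hD = hull_embedding D"
  define P where "P = loc_func C \<Sigma>"
  define S where "S = serre_generated A (kernels_cokernels A (on_arr hC ` \<Sigma>))"
  note defs = D_def A_def B_def hC_def hD_def P_def
  interpret D: cat D unfolding D_def by (rule C.loc_cat)
  interpret A: abelian A unfolding A_def by (rule C.hull_abelian)
  interpret B: abelian B unfolding B_def by (rule D.hull_abelian)
  note cats = C.cat_axioms D.cat_axioms A.cat_axioms B.cat_axioms
  have hC: "is_functor C A hC" unfolding defs by (rule C.hull_embedding_functor)
  have hD: "is_functor D B hD" unfolding B_def hD_def by (rule D.hull_embedding_functor)
  have P: "is_functor C D P" unfolding defs by (rule C.Q_functor)
  have Piso: "isomorphism D (on_arr P s)" if "s \<in> \<Sigma>" for s unfolding defs by (rule C.Q_iso[OF that])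
  note hDP = comp_functor[OF cats(1) P hD]
  have "(\<exists>F. is_functor (quotient_cat A S) B F \<and> func_eq_on A (F \<circ>\<^sub>F quotient_func A S) E) \<and>
      (\<forall>F. is_functor (quotient_cat A S) B F \<and> func_eq_on A (F \<circ>\<^sub>F quotient_func A S) E \<longrightarrow>
        is_equivalence (quotient_cat A S) B F)"
    if E: "exact_functor A B E" and n: "nat_isomorphic C B (E \<circ>\<^sub>F hC) (hD \<circ>\<^sub>F P)" for E
  proof -
    interpret E: exact_fun A B E by (rule exact_funI[OF A.abelian_axioms B.abelian_axioms E])
    note Ef = exact_is_functor[OF E]
    note EhC = comp_functor[OF cats(1) hC Ef]
    interpret hD: fctr D B hD by (rule fctrI[OF cats(2,4) hD])
    \<comment> \<open>The functor \<open>E\<close> after \<open>hC\<close> is isomorphic to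
      \<open>hD\<close> after \<open>P\<close>, and \<open>P\<close> already inverts
      \<open>\<Sigma>\<close>.\<close>
    have "isomorphism B (on_arr E (on_arr hC s))" if s: "s \<in> \<Sigma>" for s
      using nat_isomorphic_reflects_iso[OF cats(1,4) EhC hDP n, of s] hD.iso[OF Piso[OF s]] C.Sigma[OF s] by simp
    then have K: "kernels_cokernels A (on_arr hC ` \<Sigma>) \<subseteq>
        {X \<in> Obj A. Id B (on_obj E X) = Zero B (on_obj E X) (on_obj E X)}"
      by (intro E.kernels_cokernels_inverted) blast
    \<comment> \<open>The objects killed by \<open>E\<close> form a Serre subcategory that contains
      the generators of \<open>S\<close>, so \<open>E\<close> kills all of \<open>S\<close>.\<close>
    have SK: "S \<subseteq> {X \<in> Obj A. Id B (on_obj E X) = Zero B (on_obj E X) (on_obj E X)}"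
      unfolding S_def serre_generated_def using K E.serre_kernel by blast
    \<comment> \<open>The same subcategory of killed objects witnesses that the intersection
      defining \<open>S\<close> is over a nonempty family.\<close>
    interpret Q: serre_quot A S unfolding S_def by unfold_locales (rule serre_serre_generated[OF E.serre_kernel K])
    have qc: "quotient_cat A S = Q.L" and qf: "quotient_func A S = Q.Q"
      by (simp_all add: quotient_cat_def quotient_func_def)
    interpret R: abelian Q.quot by (rule Q.quot_abelian)
    have Rc: "cat Q.quot" by unfold_locales
    note Qf = exact_is_functor[OF Q.Q_exact]
    have "\<exists>F. is_functor Q.L B F \<and> func_eq_on A (F \<circ>\<^sub>F Q.Q) E"
      by (rule Q.universal[OF cats(4) Ef]) (rule E.inverts_serre_isos[OF SK])
    moreover have "is_equivalence Q.L B F" if F: "is_functor Q.L B F" "func_eq_on A (F \<circ>\<^sub>F Q.Q) E" for F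
    proof -
      have Fq: "is_functor Q.quot B F" using F(1) by (simp only: Q.is_functor_from_quot)
      have Fe: "exact_functor Q.quot B F" by (rule Q.induced_exact[OF E.exact_fun_axioms Fq F(2)])
      have FQ: "nat_isomorphic A B (F \<circ>\<^sub>F Q.Q) E"
        by (rule func_eq_nat_isomorphic[OF cats(3,4) comp_functor[OF cats(3) Qf Fq] Ef F(2)])
      interpret hC: fctr C A hC by (rule fctrI[OF cats(1,3) hC])
      note QhC = comp_functor[OF cats(1) hC Qf]
      have QhCi: "isomorphism Q.quot (on_arr (Q.Q \<circ>\<^sub>F hC) s)" if s: "s \<in> \<Sigma>" for s
      proof -
        have a: "on_arr hC s \<in> Arr A" using C.Sigma[OF s] by simp
        obtain k c where k: "is_kernel A (on_arr hC s) k" and c: "is_cokernel A (on_arr hC s) c"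
          using A.kernel_ex[OF a] A.cokernel_ex[OF a] by blast
        have "Dom A k \<in> kernels_cokernels A (on_arr hC ` \<Sigma>)" "Cod A c \<in> kernels_cokernels A (on_arr hC ` \<Sigma>)"
          using k c s unfolding kernels_cokernels_def by blast+
        then have "Dom A k \<in> S" "Cod A c \<in> S" unfolding S_def serre_generated_def by blast+
        then have "on_arr hC s \<in> Q.W" using k c unfolding serre_isos_def by blast
        from Q.Q_iso[OF this] show ?thesis by (simp add: Q.iso_quot)
      qed
      \<comment> \<open>\<open>J\<close> is the functor on the localisation induced by the composite
        of \<open>C\<close> with the quotient, and its exact extension to the hull will be the
        inverse \<open>G\<close>.\<close>
      obtain J where J: "is_functor D Q.quot J" "func_eq_on C (J \<circ>\<^sub>F P) (Q.Q \<circ>\<^sub>F hC)"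
        using C.universal[OF Rc QhC QhCi] unfolding D_def P_def by blast
      obtain G where G: "exact_functor B Q.quot G" "nat_isomorphic D Q.quot (G \<circ>\<^sub>F hD) J"
        unfolding B_def hD_def by (rule D.hull_extension[OF Q.quot_abelian J(1)])
      note Gf = exact_is_functor[OF G(1)]
      note fs = comp_functor[OF cats(1) hC comp_functor[OF cats(3) Ef Gf]]
        comp_functor[OF cats(1) P comp_functor[OF cats(2) hD Gf]] comp_functor[OF cats(1) P J(1)] QhC
      have JP: "nat_isomorphic C Q.quot (J \<circ>\<^sub>F P) (Q.Q \<circ>\<^sub>F hC)"
        by (rule func_eq_nat_isomorphic[OF cats(1) Rc fs(3,4) J(2)])
      \<comment> \<open>On \<open>C\<close>, the composite of \<open>G\<close> and \<open>E\<close>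
        is isomorphic through \<open>hD\<close> and \<open>J\<close> to the quotient functor. By
        uniqueness on the hull of \<open>C\<close> the two exact functors are isomorphic on all of
        \<open>A\<close>.\<close>
      have 1: "nat_isomorphic C Q.quot ((G \<circ>\<^sub>F E) \<circ>\<^sub>F hC) ((G \<circ>\<^sub>F hD) \<circ>\<^sub>F P)"
        using nat_isomorphic_whisker_left[OF cats(1,4) Rc EhC hDP Gf n] by (simp only: comp_func_assoc)
      have 2: "nat_isomorphic C Q.quot ((G \<circ>\<^sub>F hD) \<circ>\<^sub>F P) (J \<circ>\<^sub>F P)"
        by (rule nat_isomorphic_whisker_right[OF cats(1,2) P G(2)])
      have "nat_isomorphic C Q.quot ((G \<circ>\<^sub>F E) \<circ>\<^sub>F hC) (Q.Q \<circ>\<^sub>F hC)"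
        by (rule nat_isomorphic_trans[OF cats(1) Rc fs(1,2,4) 1
              nat_isomorphic_trans[OF cats(1) Rc fs(2,3,4) 2 JP]])
      then have GE: "nat_isomorphic A Q.quot (G \<circ>\<^sub>F E) Q.Q"
        by (rule C.hull_unique[folded A_def hC_def, OF Q.quot_abelian exact_comp[OF A.preadditive_axioms E G(1)] Q.Q_exact])
      note gs = comp_functor[OF cats(3) Qf comp_functor[OF Rc Fq Gf]] comp_functor[OF cats(3) Ef Gf]
      \<comment> \<open>An isomorphism between functors on the quotient can be produced after
        restriction along the quotient functor, where \<open>F\<close> becomes
        \<open>E\<close>.\<close>
      have "nat_isomorphic A Q.quot ((G \<circ>\<^sub>F F) \<circ>\<^sub>F Q.Q) (G \<circ>\<^sub>F E)"
        using nat_isomorphic_whisker_left[OF cats(3,4) Rc comp_functor[OF cats(3) Qf Fq] Ef Gf FQ]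
        by (simp only: comp_func_assoc)
      then have "nat_isomorphic A Q.quot ((G \<circ>\<^sub>F F) \<circ>\<^sub>F Q.Q) Q.Q"
        by (rule nat_isomorphic_trans[OF cats(3) Rc gs(1,2) Qf _ GE])
      moreover have "id_func \<circ>\<^sub>F Q.Q = Q.Q" by (rule id_comp_func)
      ultimately have "nat_isomorphic A Q.L ((G \<circ>\<^sub>F F) \<circ>\<^sub>F Q.Q) (id_func \<circ>\<^sub>F Q.Q)"
        by (simp only: Q.nat_isomorphic_to_quot)
      moreover have GL: "is_functor B Q.L G" using Gf by (simp only: Q.is_functor_to_quot)
      ultimately have GF: "nat_isomorphic Q.L Q.L (G \<circ>\<^sub>F F) id_func"
        by (intro Q.nat_isomorphic_Q[OF Q.loc_cat comp_functor[OF Q.loc_cat F(1) GL] id_functor[OF Q.loc_cat]])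
      note FG = exact_comp[OF B.preadditive_axioms G(1) Fe]
      note FGf = exact_is_functor[OF FG]
      note ks = comp_functor[OF cats(2) hD FGf] comp_functor[OF cats(2) J(1) Fq]
      note ls = comp_functor[OF cats(1) P ks(1)] comp_functor[OF cats(1) P ks(2)] comp_functor[OF cats(1) QhC Fq] EhC hDP
      \<comment> \<open>The other composite is exact on the hull of \<open>D\<close>, so it is
        compared with the identity on \<open>D\<close>, and there only on arrows from
        \<open>C\<close> by the localisation property. On \<open>C\<close> the chain runs from
        \<open>F\<close> after \<open>J\<close> through the quotient functor and \<open>E\<close>
        back to \<open>hD\<close>.\<close>
      have FJ: "nat_isomorphic D B ((F \<circ>\<^sub>F G) \<circ>\<^sub>F hD) (F \<circ>\<^sub>F J)"
        using nat_isomorphic_whisker_left[OF cats(2) Rc cats(4) comp_functor[OF cats(2) hD Gf] J(1) Fq G(2)]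
        by (simp only: comp_func_assoc)
      have 3: "nat_isomorphic C B ((F \<circ>\<^sub>F J) \<circ>\<^sub>F P) (F \<circ>\<^sub>F (Q.Q \<circ>\<^sub>F hC))"
        using nat_isomorphic_whisker_left[OF cats(1) Rc cats(4) fs(3,4) Fq JP] by (simp only: comp_func_assoc)
      have 4: "nat_isomorphic C B (F \<circ>\<^sub>F (Q.Q \<circ>\<^sub>F hC)) (E \<circ>\<^sub>F hC)"
        using nat_isomorphic_whisker_right[OF cats(1,3) hC FQ] by (simp only: comp_func_assoc)
      have 5: "nat_isomorphic C B ((F \<circ>\<^sub>F J) \<circ>\<^sub>F P) (hD \<circ>\<^sub>F P)"
        by (rule nat_isomorphic_trans[OF cats(1,4) ls(2,3,5) 3 nat_isomorphic_trans[OF cats(1,4) ls(3,4,5) 4 n]])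
      have "nat_isomorphic D B (F \<circ>\<^sub>F J) hD" using 5 ks(2) hD unfolding D_def P_def
        by (intro C.nat_isomorphic_Q[OF cats(4)])
      then have "nat_isomorphic D B ((F \<circ>\<^sub>F G) \<circ>\<^sub>F hD) hD" by (rule nat_isomorphic_trans[OF cats(2,4) ks hD FJ])
      moreover have "id_func \<circ>\<^sub>F hD = hD" by (rule id_comp_func)
      ultimately have "nat_isomorphic D B ((F \<circ>\<^sub>F G) \<circ>\<^sub>F hD) (id_func \<circ>\<^sub>F hD)" by simp
      then have "nat_isomorphic B B (F \<circ>\<^sub>F G) id_func"
        by (rule D.hull_unique[folded B_def hD_def, OF B.abelian_axioms FG exact_id[OF B.preadditive_axioms]])
      with GF GL F(1) show ?thesis unfolding is_equivalence_def by blast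
    qed
    ultimately show ?thesis unfolding qc qf by blast
  qed
  moreover have "\<exists>E. exact_functor A B E \<and> nat_isomorphic C B (E \<circ>\<^sub>F hC) (hD \<circ>\<^sub>F P)"
    using C.hull_extension[OF B.abelian_axioms hDP] unfolding A_def hC_def by blast
  ultimately show ?thesis unfolding Let_def S_def defs by blast
qed

end
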